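(* Let $\Omega\subset\mathbb R^3$ be a bounded Lipschitz domain with connected complement $\mathbb R^3\setminus\overline\Omega$ and $\mathbf 0\in\partial\Omega$, and let $h,M>0$ be such that $(B_h\times(-M,M))\cap\Omega=S_h\times(-M,M)$. Assume the Lamé constant $\lambda\ne0$. Let $\omega\in\mathbb R_+$ and let $\mathbf v,\mathbf w\in H^1(\Omega)^3$ satisfy $$\mathcal L\mathbf v+\omega^2\mathbf v=\mathbf 0\ \text{in }\Omega,\qquad \mathcal L\mathbf w+\omega^2(1+V)\mathbf w=\mathbf 0\ \text{in }\Omega,\qquad \mathbf w=\mathbf v,\ \ T_\nu\mathbf v=T_\nu\mathbf w\ \text{on }\Gamma,$$ where $\Gamma\subset\partial\Omega$ is an open subset containing $\Gamma_h^\pm\times(-M,M)$. Let $q:=1+V$ and suppose that for some $\alpha\in(0,1)$, $q\mathbf w\in C^\alpha(\overline{S_h}\times[-M,M])^3$ and $\mathbf v-\mathbf w\in C^{1,\alpha}(\overline{S_h}\times[-M,M])^3$. Assume: (a) for given constants $\gamma,\beta_1,\beta_2$ with $\gamma>\max\{\beta_1,\beta_2\}>0$ there is a sequence of Herglotz functions $\mathbf v_j$, $j=1,2,\dots$, with kernels $\mathbf g_{jp},\mathbf g_{js}$ such that for all $j$ $$\|\mathbf v-\mathbf v_j\|_{H^1(S_h\times(-M,M))^3}\le j^{-\gamma},\quad\|\mathbf g_{jp}\|_{L^2(\mathbb S^2)^3}\le j^{\beta_1},\quad\|\mathbf g_{js}\|_{L^2(\mathbb S^2)^3}\le j^{\beta_2};$$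 (b) $-\pi<\theta_m<\theta_M<\pi$ and $\theta_M-\theta_m\neq\pi$. Then for every edge point $(\mathbf 0,x_3^c)$ with $x_3^c\in(-M,M)$, and with $\mathcal R$ the dimension reduction operator centred at $x_3^c$ (for any admissible $L$ and $\phi$ as in the context), $$\lim_{\rho\to+0}\frac{1}{m(B(\mathbf 0,\rho)\cap P(\Omega))}\int_{B(\mathbf 0,\rho)\cap P(\Omega)}\mathcal R(V\mathbf w)(\mathbf x')\,\mathrm d\mathbf x'=\mathbf 0,$$ where $B(\mathbf 0,\rho)\subset\mathbb R^2$ is the disk of radius $\rho$ centred at $\mathbf 0$, $m(\cdot)$ is Lebesgue measure on $\mathbb R^2$ and $P(\Omega)$ is the projection of $\Omega$ to $\mathbb R^2$, $(\mathbf x',x_3)\mapsto\mathbf x'$.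
   Context: Real constants $\lambda,\mu$ satisfy $\mu>0$ and $3\lambda+2\mu>0$. The Lamé operator is $\mathcal L\mathbf u=\mu\Delta\mathbf u+(\lambda+\mu)\nabla(\nabla\cdot\mathbf u)$. $V\in L^\infty(\Omega)$ is real-valued and nontrivial. $\mathbf v,\mathbf w$ are $\mathbb C^3$-valued; equations hold in the distributional sense and boundary values in the trace sense. With $\nu$ the outward unit normal, $T_\nu\mathbf v=2\mu\,\partial_\nu\mathbf v+\lambda\nu(\nabla\cdot\mathbf v)+\mu\,\nu\times(\nabla\times\mathbf v)$. Write $\mathbf x=(\mathbf x',x_3)$, $\mathbf x'\in\mathbb R^2$. In $\mathbb R^2$: $W=\{\mathbf x'\ne\mathbf 0:\theta_m<\arg(x_1+\mathrm ix_2)<\theta_M\}$, $\Gamma^-=\{\mathbf x'\ne\mathbf 0:\arg(x_1+\mathrm ix_2)=\theta_m\}$, $\Gamma^+=\{\mathbf x'\ne\mathbf 0:\arg(x_1+\mathrm ix_2)=\theta_M\}$, $B_h$ is the open disk of radius $h$ centred at $\mathbf 0\in\mathbb R^2$, $S_h=W\cap B_h$, $\Gamma_h^\pm=\Gamma^\pm\cap B_h$. Set $k_p=\omega/\sqrt{\lambda+2\mu}$, $k_s=\omega/\sqrt\mu$. The elastic Herglotz wave function with kernels $\mathbf g_{jp},\mathbf g_{js}\in L^2(\mathbb S^2)^3$ is $$\mathbf v_j(\mathbf x)=\int_{\mathbb S^2}\{e^{\mathrm ik_p\mathbf x\cdot\mathbf d}\mathbf g_{jp}(\mathbf d)+e^{\mathrm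 ik_s\mathbf x\cdot\mathbf d}\mathbf g_{js}(\mathbf d)\}\,\mathrm d\sigma(\mathbf d).$$ Dimension reduction operator: for $x_3^c\in(-M,M)$, $L>0$ small enough that $(x_3^c-L,x_3^c+L)\subset(-M,M)$, and a nonnegative $\phi\in C_0^\infty((x_3^c-L,x_3^c+L))$ with $\phi\not\equiv0$, set $\mathcal R(\mathbf g)(\mathbf x')=\int_{x_3^c-L}^{x_3^c+L}\phi(x_3)\mathbf g(\mathbf x',x_3)\,\mathrm dx_3$ for $\mathbf x'\in S_h$. In the claim $V\mathbf w$ is understood as extended by zero outside $\Omega$. *)

theory Defs
  imports "HOL-Analysis.Analysis"
begin

section \<open>Smooth functions\<close>

definition dir_deriv :: "'a::real_normed_vector \<Rightarrow> ('a \<Rightarrow> 'b::real_normed_vector) \<Rightarrow> 'a \<Rightarrow> 'b"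
  where "dir_deriv b f x = frechet_derivative f (at x) b"

abbreviation pderiv_at :: "'n::finite \<Rightarrow> (real^'n \<Rightarrow> 'b::real_normed_vector) \<Rightarrow> real^'n \<Rightarrow> 'b"
  where "pderiv_at j \<equiv> dir_deriv (axis j 1)"

definition smooth :: "('a::real_normed_vector \<Rightarrow> 'b::real_normed_vector) \<Rightarrow> bool"
  where "smooth f \<longleftrightarrow> (\<forall>bs x. foldr dir_deriv bs f differentiable (at x))"

definition test_fun :: "'a::real_normed_vector set \<Rightarrow> ('a \<Rightarrow> real) \<Rightarrow> bool"
  where "test_fun S \<phi> \<longleftrightarrow>
    smooth \<phi> \<and> compact (closure {x. \<phi> x \<noteq> 0}) \<and> closure {x. \<phi> x \<noteq> 0} \<subseteq> S"

section \<open>Surface measure: the two-dimensional Hausdorff measure on three-space\<close>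

definition hausdorff2_delta :: "real \<Rightarrow> (real^3) set \<Rightarrow> ennreal"
  where "hausdorff2_delta \<delta> A =
    (INF U \<in> {U :: nat \<Rightarrow> (real^3) set. A \<subseteq> (\<Union>n. U n) \<and> (\<forall>n. bounded (U n) \<and> diameter (U n) \<le> \<delta>)}.
      \<Sum>n. ennreal (pi * (diameter (U n) / 2)^2))"

definition hausdorff2 :: "(real^3) set \<Rightarrow> ennreal"
  where "hausdorff2 A = (SUP \<delta> \<in> {0<..}. hausdorff2_delta \<delta> A)"

definition surface_measure :: "(real^3) measure"
  where "surface_measure = measure_of UNIV (sets borel) hausdorff2"

lemma hausdorff2_delta_le:
  assumes "A \<subseteq> (\<Union>n. U n)" "\<And>n. bounded (U n)" "\<And>n. diameter (U n) \<le> \<delta>"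
  shows "hausdorff2_delta \<delta> A \<le> (\<Sum>n. ennreal (pi * (diameter (U n) / 2)^2))"
  unfolding hausdorff2_delta_def using assms by (intro INF_lower) auto

lemma hausdorff2_delta_mono:
  assumes "\<epsilon> \<le> \<delta>" "A \<subseteq> B"
  shows "hausdorff2_delta \<delta> A \<le> hausdorff2_delta \<epsilon> B"
  unfolding hausdorff2_delta_def using assms
  by (intro INF_superset_mono) (auto intro: order_trans)

lemma hausdorff2_mono: "A \<subseteq> B \<Longrightarrow> hausdorff2 A \<le> hausdorff2 B"
  unfolding hausdorff2_def by (intro SUP_mono) (auto intro: hausdorff2_delta_mono)

lemma hausdorff2_empty: "hausdorff2 {} = 0"
proof -
  have "hausdorff2_delta \<delta> {} \<le> 0" if "\<delta> > 0" for \<delta>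
    using hausdorff2_delta_le[of "{}" "\<lambda>_. {}" \<delta>] that by simp
  then show ?thesis unfolding hausdorff2_def by (auto intro!: antisym SUP_least)
qed

lemma hausdorff2_delta_subadditive:
  "hausdorff2_delta \<delta> (\<Union>i::nat. A i) \<le> (\<Sum>i. hausdorff2_delta \<delta> (A i))"
proof (rule ennreal_le_epsilon)
  fix e :: real assume fin: "(\<Sum>i. hausdorff2_delta \<delta> (A i)) < top" and e: "0 < e"
  let ?c = "\<lambda>U :: (real^3) set. ennreal (pi * (diameter U / 2)^2)"
  have "\<exists>U. A i \<subseteq> (\<Union>n. U n) \<and> (\<forall>n. bounded (U n) \<and> diameter (U n) \<le> \<delta>) \<and>
      (\<Sum>n. ?c (U n)) \<le> hausdorff2_delta \<delta> (A i) + ennreal (e * (1/2)^Suc i)" for i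
  proof -
    have "hausdorff2_delta \<delta> (A i) < top"
      using fin by (rule ennreal_suminf_lessD)
    then have "hausdorff2_delta \<delta> (A i) < hausdorff2_delta \<delta> (A i) + ennreal (e * (1/2)^Suc i)"
      using e ennreal_add_left_cancel_less[of "hausdorff2_delta \<delta> (A i)" 0] by simp
    then show ?thesis
      by (subst (asm) hausdorff2_delta_def) (auto simp: INF_less_iff intro: less_imp_le)
  qed
  then obtain U where U: "\<And>i. A i \<subseteq> (\<Union>n. U i n)" "\<And>i n. bounded (U i n)"
    "\<And>i n. diameter (U i n) \<le> \<delta>"
    "\<And>i. (\<Sum>n. ?c (U i n)) \<le> hausdorff2_delta \<delta> (A i) + ennreal (e * (1/2)^Suc i)"
    by metis
  define W where "W k = (case prod_decode k of (i, n) \<Rightarrow> U i n)" for k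
  have "hausdorff2_delta \<delta> (\<Union>i. A i) \<le> (\<Sum>k. ?c (W k))"
  proof (rule hausdorff2_delta_le)
    show "(\<Union>i. A i) \<subseteq> (\<Union>k. W k)"
    proof
      fix x assume "x \<in> (\<Union>i. A i)"
      then obtain i n where "x \<in> U i n" using U(1) by blast
      then have "x \<in> W (prod_encode (i, n))" by (simp add: W_def)
      then show "x \<in> (\<Union>k. W k)" by blast
    qed
  qed (auto simp: W_def U split: prod.splits)
  also have "\<dots> = (\<Sum>k. case_prod (\<lambda>i n. ?c (U i n)) (prod_decode k))"
    by (intro suminf_cong) (simp add: W_def split: prod.splits)
  also have "\<dots> = (\<Sum>i. \<Sum>n. ?c (U i n))"
    by (rule suminf_ennreal_2dimen[unfolded comp_def]) simp
  also have "\<dots> \<le> (\<Sum>i. hausdorff2_delta \<delta> (A i) + ennreal (e * (1/2)^Suc i))"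
    using U(4) by (intro suminf_le summableI) auto
  also have "\<dots> = (\<Sum>i. hausdorff2_delta \<delta> (A i)) + (\<Sum>i. ennreal (e * (1/2)^Suc i))"
    by (intro suminf_add[symmetric] summableI)
  also have "(\<Sum>i. ennreal (e * (1/2)^Suc i)) = ennreal e"
    using e sums_mult[OF power_half_series, of e] by (intro suminf_ennreal_eq) auto
  finally show "hausdorff2_delta \<delta> (\<Union>i. A i) \<le> (\<Sum>i. hausdorff2_delta \<delta> (A i)) + ennreal e" .
qed

lemma hausdorff2_subadditive: "hausdorff2 (\<Union>i::nat. A i) \<le> (\<Sum>i. hausdorff2 (A i))"
proof -
  have "hausdorff2_delta \<delta> (\<Union>i. A i) \<le> (\<Sum>i. hausdorff2 (A i))" if "\<delta> > 0" for \<delta>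
    using hausdorff2_delta_subadditive[of \<delta> A]
  proof (rule order_trans)
    show "(\<Sum>i. hausdorff2_delta \<delta> (A i)) \<le> (\<Sum>i. hausdorff2 (A i))"
      using that by (intro suminf_le summableI) (auto simp: hausdorff2_def intro: SUP_upper)
  qed
  then show ?thesis by (subst hausdorff2_def) (auto intro: SUP_least)
qed

lemma hausdorff2_Un: "hausdorff2 (A \<union> B) \<le> hausdorff2 A + hausdorff2 B"
proof -
  let ?F = "\<lambda>i::nat. if i = 0 then A else if i = 1 then B else {}"
  have "(\<Sum>i. hausdorff2 (?F i)) = (\<Sum>i<2. hausdorff2 (?F i))"
    by (rule suminf_finite) (auto simp: hausdorff2_empty)
  moreover have "(\<Union>i. ?F i) = A \<union> B" by (force split: if_splits)
  ultimately show ?thesis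
    using hausdorff2_subadditive[of ?F] by (simp add: numeral_2_eq_2)
qed

lemma hausdorff2_separated:
  assumes d: "0 < d" "\<And>x y. x \<in> A \<Longrightarrow> y \<in> B \<Longrightarrow> d \<le> dist x y"
  shows "hausdorff2 A + hausdorff2 B \<le> hausdorff2 (A \<union> B)"
proof -
  let ?c = "\<lambda>U :: (real^3) set. ennreal (pi * (diameter U / 2)^2)"
  have *: "hausdorff2_delta \<delta> A + hausdorff2_delta \<delta> B \<le> hausdorff2_delta \<delta> (A \<union> B)"
    if \<delta>: "0 < \<delta>" "\<delta> < d" for \<delta>
    unfolding hausdorff2_delta_def[of \<delta> "A \<union> B"]
  proof (intro INF_greatest, clarsimp)
    fix U :: "nat \<Rightarrow> (real^3) set"
    assume U: "A \<subseteq> (\<Union>n. U n)" "B \<subseteq> (\<Union>n. U n)" "\<forall>n. bounded (U n) \<and> diameter (U n) \<le> \<delta>"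
    define r where "r X n = (if U n \<inter> X = {} then {} else U n)" for X n
    have r: "hausdorff2_delta \<delta> X \<le> (\<Sum>n. ?c (r X n))" if "X \<subseteq> (\<Union>n. U n)" for X
      using that U(3) \<delta> by (intro hausdorff2_delta_le) (force simp: r_def)+
    have "?c (r A n) + ?c (r B n) \<le> ?c (U n)" for n
    proof (cases "U n \<inter> A = {} \<or> U n \<inter> B = {}")
      case True then show ?thesis by (auto simp: r_def)
    next
      case False
      then obtain x y where "x \<in> U n" "x \<in> A" "y \<in> U n" "y \<in> B" by auto
      then have "d \<le> diameter (U n)" "diameter (U n) \<le> \<delta>"
        using d(2)[of x y] diameter_bounded_bound[of "U n" x y] U(3) by (auto intro: order_trans)
      then show ?thesis using \<delta>(2) by simp
    qed
    then have "(\<Sum>n. ?c (r A n) + ?c (r B n)) \<le> (\<Sum>n. ?c (U n))"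
      by (intro suminf_le summableI)
    then have "(\<Sum>n. ?c (r A n)) + (\<Sum>n. ?c (r B n)) \<le> (\<Sum>n. ?c (U n))"
      by (simp add: suminf_add[OF summableI summableI])
    then show "hausdorff2_delta \<delta> A + hausdorff2_delta \<delta> B \<le> (\<Sum>n. ?c (U n))"
      using r[OF U(1)] r[OF U(2)] by (meson add_mono order_trans)
  qed
  have "hausdorff2_delta \<delta> A + hausdorff2_delta \<epsilon> B \<le> hausdorff2 (A \<union> B)"
    if "0 < \<delta>" "0 < \<epsilon>" for \<delta> \<epsilon>
  proof -
    define \<eta> where "\<eta> = min (min \<delta> \<epsilon>) (d / 2)"
    have \<eta>: "0 < \<eta>" "\<eta> < d" "\<eta> \<le> \<delta>" "\<eta> \<le> \<epsilon>" using that d(1) by (auto simp: \<eta>_def)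
    have "hausdorff2_delta \<delta> A + hausdorff2_delta \<epsilon> B \<le> hausdorff2_delta \<eta> A + hausdorff2_delta \<eta> B"
      using \<eta> by (intro add_mono hausdorff2_delta_mono) auto
    also have "\<dots> \<le> hausdorff2_delta \<eta> (A \<union> B)" using * \<eta> by blast
    also have "\<dots> \<le> hausdorff2 (A \<union> B)"
      unfolding hausdorff2_def using \<eta> by (intro SUP_upper) auto
    finally show ?thesis .
  qed
  then have "(SUP \<epsilon>\<in>{0<..}. SUP \<delta>\<in>{0<..}. hausdorff2_delta \<delta> A + hausdorff2_delta \<epsilon> B) \<le> hausdorff2 (A \<union> B)"
    by (intro SUP_least) auto
  moreover have "{0<..} \<noteq> ({} :: real set)" using greaterThan_non_empty by blast
  ultimately show ?thesis
    unfolding hausdorff2_def[of A] hausdorff2_def[of B]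
    by (simp add: ennreal_SUP_add_left ennreal_SUP_add_right)
qed

lemma hausdorff2_closed_measurable:
  assumes C: "closed C"
  shows "hausdorff2 (C \<inter> T) + hausdorff2 (T - C) = hausdorff2 T"
proof (rule antisym)
  show "hausdorff2 T \<le> hausdorff2 (C \<inter> T) + hausdorff2 (T - C)"
  proof -
    have "(C \<inter> T) \<union> (T - C) = T" by blast
    then show ?thesis using hausdorff2_Un[of "C \<inter> T" "T - C"] by simp
  qed
next
  show "hausdorff2 (C \<inter> T) + hausdorff2 (T - C) \<le> hausdorff2 T"
  proof (cases "C = {} \<or> hausdorff2 T = top")
    case True then show ?thesis by (auto simp: hausdorff2_empty)
  next
    case False
    then have ne: "C \<noteq> {}" and fin: "hausdorff2 T < top" by (auto simp: less_top)
    define S where "S n = {x \<in> T. 1 / (real n + 1) \<le> infdist x C}" for n :: nat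
    define R where "R n = S (Suc n) - S n" for n
    have S_mono: "S m \<subseteq> S n" if "m \<le> n" for m n
    proof -
      have "1 / (real n + 1) \<le> 1 / (real m + 1)" using that by (intro divide_left_mono) auto
      then show ?thesis by (auto simp: S_def)
    qed
    have sep: "hausdorff2 (S n) + hausdorff2 (R (Suc n)) \<le> hausdorff2 (S (Suc (Suc n)))" for n
    proof -
      have "hausdorff2 (S n) + hausdorff2 (R (Suc n)) \<le> hausdorff2 (S n \<union> R (Suc n))"
      proof (rule hausdorff2_separated)
        show "0 < 1 / (real n + 1) - 1 / (real n + 2)" using frac_less2[of 1 1 "real n + 1" "real n + 2"] by simp
        fix x y assume "x \<in> S n" "y \<in> R (Suc n)"
        then have "1 / (real n + 1) \<le> infdist x C" "infdist y C \<le> 1 / (real n + 2)"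
          by (auto simp: S_def R_def add.commute)
        then show "1 / (real n + 1) - 1 / (real n + 2) \<le> dist x y"
          using infdist_triangle[of x C y] by linarith
      qed
      also have "\<dots> \<le> hausdorff2 (S (Suc (Suc n)))"
        using S_mono[of n "Suc (Suc n)"] by (intro hausdorff2_mono) (auto simp: R_def)
      finally show ?thesis .
    qed
    have part: "(\<Sum>k<m. hausdorff2 (R (2 * k + q + 1))) \<le> hausdorff2 (S (2 * m + q))" for m q
    proof (induction m)
      case (Suc m)
      have "(\<Sum>k<Suc m. hausdorff2 (R (2 * k + q + 1))) \<le>
          hausdorff2 (S (2 * m + q)) + hausdorff2 (R (Suc (2 * m + q)))"
        using Suc by (auto intro: add_right_mono)
      also have "\<dots> \<le> hausdorff2 (S (2 * Suc m + q))" using sep[of "2 * m + q"] by simp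
      finally show ?case .
    qed simp
    have S_T: "hausdorff2 (S n) \<le> hausdorff2 T" for n
      by (rule hausdorff2_mono) (auto simp: S_def)
    define f where "f k = hausdorff2 (R (Suc k))" for k
    have "(\<Sum>k<m. f k) \<le> 2 * hausdorff2 T" for m
    proof -
      have "(\<Sum>k<m. f k) \<le> (\<Sum>k<2 * m. f k)" by (intro sum_mono2) auto
      also have "\<dots> = (\<Sum>k<m. f (2 * k)) + (\<Sum>k<m. f (2 * k + 1))"
        by (induction m) (auto simp: algebra_simps)
      also have "\<dots> \<le> hausdorff2 T + hausdorff2 T"
        using order_trans[OF part[of 0 m] S_T] order_trans[OF part[of 1 m] S_T]
        by (intro add_mono) (auto simp: f_def)
      finally show ?thesis by (simp add: mult_2)
    qed
    then have "(\<Sum>k. f k) \<le> 2 * hausdorff2 T" by (intro suminf_le_const summableI)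
    also have "\<dots> < top" using fin by (simp add: ennreal_mult_less_top)
    finally have f_fin: "(\<Sum>k. f k) < top" .
    define g where "g k = enn2real (f k)" for k
    have fg: "f k = ennreal (g k)" for k
      using ennreal_suminf_lessD[OF f_fin, of k] by (simp add: g_def)
    have g0: "0 \<le> g k" for k by (simp add: g_def)
    have summ: "summable g" using f_fin by (intro summable_suminf_not_top) (auto simp: g0 fg)
    have tail: "hausdorff2 (T - C) \<le> hausdorff2 (S (Suc n)) + ennreal (\<Sum>k. g (k + n))" for n
    proof -
      have "T - C \<subseteq> S (Suc n) \<union> (\<Union>k. R (Suc (k + n)))"
      proof
        fix x assume x: "x \<in> T - C"
        then have "0 < infdist x C"
          using ne C infdist_pos_not_in_closed by auto
        then obtain m where "1 / (real m + 1) < infdist x C"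
          using nat_approx_posE by (metis of_nat_Suc add.commute)
        then have m: "x \<in> S m" using x by (auto simp: S_def)
        show "x \<in> S (Suc n) \<union> (\<Union>k. R (Suc (k + n)))"
        proof (rule ccontr)
          assume no: "\<not> ?thesis"
          have "x \<notin> S (Suc (n + k))" for k
            using no by (induction k) (auto simp: R_def add.commute)
          then show False using m S_mono[of m "Suc (n + m)"] by auto
        qed
      qed
      then have "hausdorff2 (T - C) \<le> hausdorff2 (S (Suc n)) + hausdorff2 (\<Union>k. R (Suc (k + n)))"
        using hausdorff2_mono hausdorff2_Un order_trans by blast
      also have "\<dots> \<le> hausdorff2 (S (Suc n)) + (\<Sum>k. f (k + n))"
        unfolding f_def by (intro add_left_mono hausdorff2_subadditive)
      also have "(\<Sum>k. f (k + n)) = ennreal (\<Sum>k. g (k + n))"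
        unfolding fg using summ by (intro suminf_ennreal2) (auto simp: g0 summable_iff_shift)
      finally show ?thesis .
    qed
    have CS: "hausdorff2 (C \<inter> T) + hausdorff2 (S n) \<le> hausdorff2 T" for n
    proof -
      have "hausdorff2 (C \<inter> T) + hausdorff2 (S n) \<le> hausdorff2 ((C \<inter> T) \<union> S n)"
      proof (rule hausdorff2_separated)
        show "0 < 1 / (real n + 1)" by simp
        fix x y assume "x \<in> C \<inter> T" "y \<in> S n"
        then show "1 / (real n + 1) \<le> dist x y"
          using infdist_le[of x C y] by (auto simp: S_def dist_commute)
      qed
      also have "\<dots> \<le> hausdorff2 T" by (intro hausdorff2_mono) (auto simp: S_def)
      finally show ?thesis .
    qed
    show ?thesis
    proof (rule ennreal_le_epsilon)
      fix e :: real assume "0 < e"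
      then obtain n where "norm (\<Sum>k. g (k + n)) < e" using suminf_exist_split[OF _ summ] by blast
      then have n: "(\<Sum>k. g (k + n)) \<le> e" by simp
      have "hausdorff2 (C \<inter> T) + hausdorff2 (T - C) \<le>
          hausdorff2 (C \<inter> T) + (hausdorff2 (S (Suc n)) + ennreal (\<Sum>k. g (k + n)))"
        by (intro add_left_mono tail)
      also have "\<dots> \<le> hausdorff2 T + ennreal e"
        unfolding add.assoc[symmetric] using n by (intro add_mono CS ennreal_leI)
      finally show "hausdorff2 (C \<inter> T) + hausdorff2 (T - C) \<le> hausdorff2 T + ennreal e" .
    qed
  qed
qed

lemma sets_surface_measure [simp]: "sets surface_measure = sets borel"
  and space_surface_measure [simp]: "space surface_measure = UNIV"
  using sets.sigma_sets_eq[of "borel :: (real^3) measure"]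
  unfolding surface_measure_def by (simp_all add: sets_measure_of_conv space_measure_of_conv)

text \<open>Borel sets are measurable for the outer measure, so \<^const>\<open>surface_measure\<close> agrees with it.\<close>

lemma emeasure_surface_measure:
  assumes "A \<in> sets borel"
  shows "emeasure surface_measure A = hausdorff2 A"
proof -
  define L where "L = lambda_system UNIV (Pow UNIV) hausdorff2"
  have "outer_measure_space (Pow UNIV) hausdorff2"
    unfolding outer_measure_space_def positive_def increasing_def countably_subadditive_def
    using hausdorff2_empty hausdorff2_mono hausdorff2_subadditive by auto
  then have ms: "measure_space UNIV L hausdorff2"
    unfolding L_def using sigma_algebra.caratheodory_lemma[OF sigma_algebra_Pow] by blast
  then interpret L: sigma_algebra UNIV L by (simp add: measure_space_def)
  have "Collect closed \<subseteq> L"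
    using hausdorff2_closed_measurable
    by (auto simp: L_def lambda_system_def Compl_eq_Diff_UNIV[symmetric] Diff_eq Int_commute)
  then have "sigma_sets UNIV (Collect closed) \<subseteq> L" by (rule L.sigma_sets_subset)
  then have sub: "sets borel \<subseteq> L" by (simp add: borel_eq_closed)
  show ?thesis
  proof (rule emeasure_measure_of[OF surface_measure_def])
    show "positive (sets surface_measure) hausdorff2" by (simp add: positive_def hausdorff2_empty)
    have "countably_additive L hausdorff2" using ms by (simp add: measure_space_def)
    then show "countably_additive (sets surface_measure) hausdorff2"
      using sub unfolding countably_additive_def
      by (metis (no_types, lifting) sets_surface_measure subset_trans sub subsetD)
  qed (use assms in auto)
qed

section \<open>Function spaces\<close>

definition L2_on :: "'a measure \<Rightarrow> 'a set \<Rightarrow> ('a \<Rightarrow> 'b::euclidean_space) \<Rightarrow> bool"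
  where "L2_on M S f \<longleftrightarrow>
    set_borel_measurable M S f \<and> set_integrable M S (\<lambda>x. (norm (f x))^2)"

definition L2_norm :: "'a measure \<Rightarrow> 'a set \<Rightarrow> ('a \<Rightarrow> 'b::euclidean_space) \<Rightarrow> real"
  where "L2_norm M S f = sqrt (LINT x:S|M. (norm (f x))^2)"

definition Linfty_on :: "(real^3) set \<Rightarrow> (real^3 \<Rightarrow> real) \<Rightarrow> bool"
  where "Linfty_on S f \<longleftrightarrow>
    set_borel_measurable lebesgue S f \<and> (\<exists>C. AE x in lebesgue. x \<in> S \<longrightarrow> \<bar>f x\<bar> \<le> C)"

text \<open>Gradients follow the Jacobian convention: the entry \<open>G x $ i $ j\<close> is the \<open>j\<close>-th partial
  derivative of the \<open>i\<close>-th component.\<close>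

definition has_weak_grad :: "(real^3) set \<Rightarrow> (real^3 \<Rightarrow> complex^3) \<Rightarrow> (real^3 \<Rightarrow> complex^3^3) \<Rightarrow> bool"
  where "has_weak_grad S u G \<longleftrightarrow>
    (\<forall>\<phi> j. test_fun S \<phi> \<longrightarrow>
      (LINT x:S|lebesgue. pderiv_at j \<phi> x *\<^sub>R u x) = - (LINT x:S|lebesgue. \<phi> x *\<^sub>R column j (G x)))"

definition H1_on :: "(real^3) set \<Rightarrow> (real^3 \<Rightarrow> complex^3) \<Rightarrow> bool"
  where "H1_on S u \<longleftrightarrow> L2_on lebesgue S u \<and> (\<exists>G. L2_on lebesgue S G \<and> has_weak_grad S u G)"

text \<open>The choices below are unique almost everywhere, and only integrals of them are used.\<close>

definition weak_grad :: "(real^3) set \<Rightarrow> (real^3 \<Rightarrow> complex^3) \<Rightarrow> real^3 \<Rightarrow> complex^3^3"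
  where "weak_grad S u = (SOME G. L2_on lebesgue S G \<and> has_weak_grad S u G)"

definition H1_norm :: "(real^3) set \<Rightarrow> (real^3 \<Rightarrow> complex^3) \<Rightarrow> real"
  where "H1_norm S u = sqrt ((L2_norm lebesgue S u)^2 + (L2_norm lebesgue S (weak_grad S u))^2)"

definition holder_on :: "real \<Rightarrow> (real^3) set \<Rightarrow> (real^3 \<Rightarrow> 'b::real_normed_vector) \<Rightarrow> bool"
  where "holder_on \<alpha> K f \<longleftrightarrow> (\<exists>C. \<forall>x\<in>K. \<forall>y\<in>K. norm (f x - f y) \<le> C * norm (x - y) powr \<alpha>)"

definition complexify :: "real^'n \<Rightarrow> complex^'n"
  where "complexify x = (\<chi> i. complex_of_real (x $ i))"

text \<open>Membership of an almost-everywhere class, given on the interior of the compact set \<open>K\<close>, in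
  the Hoelder spaces of order \<open>(0,\<alpha>)\<close> and \<open>(1,\<alpha>)\<close> on \<open>K\<close>: a representative (for the latter,
  also its gradient) extends to \<open>K\<close> with the stated regularity.\<close>

definition C0_holder :: "real \<Rightarrow> (real^3) set \<Rightarrow> (real^3 \<Rightarrow> complex^3) \<Rightarrow> bool"
  where "C0_holder \<alpha> K f \<longleftrightarrow>
    (\<exists>F. holder_on \<alpha> K F \<and> (AE x in lebesgue. x \<in> interior K \<longrightarrow> F x = f x))"

definition C1_holder :: "real \<Rightarrow> (real^3) set \<Rightarrow> (real^3 \<Rightarrow> complex^3) \<Rightarrow> bool"
  where "C1_holder \<alpha> K f \<longleftrightarrow>
    (\<exists>F G. continuous_on K F \<and> holder_on \<alpha> K G \<and>
      (\<forall>x \<in> interior K. (F has_derivative (\<lambda>y. G x *v complexify y)) (at x)) \<and>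
      (AE x in lebesgue. x \<in> interior K \<longrightarrow> F x = f x))"

section \<open>Bounded Lipschitz domains and boundary traces\<close>

definition proj2 :: "real^3 \<Rightarrow> real^2"
  where "proj2 x = vector [x $ 1, x $ 2]"

definition join3 :: "real^2 \<Rightarrow> real \<Rightarrow> real^3"
  where "join3 x' t = vector [x' $ 1, x' $ 2, t]"

definition cyl :: "(real^2) set \<Rightarrow> real set \<Rightarrow> (real^3) set"
  where "cyl A I = {x. proj2 x \<in> A \<and> x $ 3 \<in> I}"

definition bounded_lipschitz_domain :: "(real^3) set \<Rightarrow> bool"
  where "bounded_lipschitz_domain \<Omega> \<longleftrightarrow>
    open \<Omega> \<and> connected \<Omega> \<and> \<Omega> \<noteq> {} \<and> bounded \<Omega> \<and>
    (\<forall>p \<in> frontier \<Omega>. \<exists>r>0. \<exists>Q \<gamma> C.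
      orthogonal_transformation Q \<and> C-lipschitz_on UNIV \<gamma> \<and>
      \<Omega> \<inter> ball p r = {x \<in> ball p r. \<gamma> (proj2 (Q (x - p))) < Q (x - p) $ 3})"

text \<open>The trace is the continuous extension of restriction to the boundary from smooth functions
  on the closure to the first-order Sobolev space, with values in the square-integrable functions
  on the boundary.\<close>

definition has_trace :: "(real^3) set \<Rightarrow> (real^3 \<Rightarrow> complex^3) \<Rightarrow> (real^3 \<Rightarrow> complex^3) \<Rightarrow> bool"
  where "has_trace \<Omega> u g \<longleftrightarrow>
    L2_on surface_measure (frontier \<Omega>) g \<and>
    (\<exists>us :: nat \<Rightarrow> real^3 \<Rightarrow> complex^3. (\<forall>n. smooth (us n)) \<and>
      (\<lambda>n. H1_norm \<Omega> (\<lambda>x. us n x - u x)) \<longlonglongrightarrow> 0 \<and>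
      (\<lambda>n. L2_norm surface_measure (frontier \<Omega>) (\<lambda>x. us n x - g x)) \<longlonglongrightarrow> 0)"

definition trace_eq_on ::
    "(real^3) set \<Rightarrow> (real^3) set \<Rightarrow> (real^3 \<Rightarrow> complex^3) \<Rightarrow> (real^3 \<Rightarrow> complex^3) \<Rightarrow> bool"
  where "trace_eq_on \<Omega> \<Gamma> u v \<longleftrightarrow>
    (\<exists>f g. has_trace \<Omega> u f \<and> has_trace \<Omega> v g \<and> (AE x in surface_measure. x \<in> \<Gamma> \<longrightarrow> f x = g x))"

section \<open>The Lame operator and the boundary traction\<close>

text \<open>\<open>has_lame lam \<mu> S u f\<close>: the \<open>i\<close>-th component of the Lame operator applied to \<open>u\<close>, that is
  \<open>\<mu> (\<Sum>j. \<partial>\<^sub>j \<partial>\<^sub>j u\<^sub>i) + (lam + \<mu>) (\<Sum>j. \<partial>\<^sub>i \<partial>\<^sub>j u\<^sub>j)\<close>, equals the \<open>i\<close>-th component of \<open>f\<close> as a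
  distribution on \<open>S\<close>.\<close>

definition has_lame :: "real \<Rightarrow> real \<Rightarrow> (real^3) set \<Rightarrow> (real^3 \<Rightarrow> complex^3) \<Rightarrow> (real^3 \<Rightarrow> complex^3) \<Rightarrow> bool"
  where "has_lame lam \<mu> S u f \<longleftrightarrow>
    (\<forall>\<phi>. test_fun S \<phi> \<longrightarrow>
      (LINT x:S|lebesgue.
         (\<mu> * (\<Sum>j\<in>UNIV. pderiv_at j (pderiv_at j \<phi>) x)) *\<^sub>R u x +
         (lam + \<mu>) *\<^sub>R (\<chi> i. \<Sum>j\<in>UNIV. pderiv_at i (pderiv_at j \<phi>) x *\<^sub>R u x $ j))
      = (LINT x:S|lebesgue. \<phi> x *\<^sub>R f x))"

definition lame :: "real \<Rightarrow> real \<Rightarrow> (real^3) set \<Rightarrow> (real^3 \<Rightarrow> complex^3) \<Rightarrow> real^3 \<Rightarrow> complex^3"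
  where "lame lam \<mu> S u = (SOME f. L2_on lebesgue S f \<and> has_lame lam \<mu> S u f)"

definition ccross3 :: "complex^3 \<Rightarrow> complex^3 \<Rightarrow> complex^3"
  where "ccross3 a b = vector [a$2 * b$3 - a$3 * b$2, a$3 * b$1 - a$1 * b$3, a$1 * b$2 - a$2 * b$1]"

definition curl_of :: "complex^3^3 \<Rightarrow> complex^3"
  where "curl_of G = vector [G$3$2 - G$2$3, G$1$3 - G$3$1, G$2$1 - G$1$2]"

text \<open>\<open>traction lam \<mu> \<nu> G\<close> is
  \<open>2 \<mu> \<partial>\<^sub>\<nu> u + lam \<nu> (div u) + \<mu> \<nu> \<times> (curl u)\<close> for a field \<open>u\<close> with gradient \<open>G\<close>.\<close>

definition traction :: "real \<Rightarrow> real \<Rightarrow> real^3 \<Rightarrow> complex^3^3 \<Rightarrow> complex^3"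
  where "traction lam \<mu> \<nu> G =
    (2 * \<mu>) *\<^sub>R (G *v complexify \<nu>) + lam *\<^sub>R (trace G *s complexify \<nu>) +
    \<mu> *\<^sub>R ccross3 (complexify \<nu>) (curl_of G)"

lemma traction_stress:
  "traction lam \<mu> \<nu> G = (\<Sum>k\<in>UNIV. \<nu> $ k *\<^sub>R traction lam \<mu> (axis k 1) G)"
  by (simp add: traction_def complexify_def ccross3_def curl_of_def vec_eq_iff forall_3 sum_3
      vector_def trace_def matrix_vector_mult_def axis_def
      scaleR_conv_of_real[where 'a=complex] algebra_simps)

text \<open>The gradient of a first-order Sobolev field has no pointwise boundary values, so the traction
  along the outward unit normal is the functional on the boundary given by Green's formula:
  for a field \<open>u\<close> that is smooth up to the boundary, the lemma above and the divergence theorem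
  turn the following integral into the surface integral of \<open>\<phi>\<close> times the classical traction,
  because the divergence of the stress (with columns \<open>traction lam \<mu> (axis k 1) (grad u)\<close>) is the
  Lame operator applied to \<open>u\<close>.
  The functional sees only the boundary values of \<open>\<phi>\<close>; equality on the relatively open part \<open>\<Gamma>\<close>
  is tested with \<open>\<phi>\<close> whose support meets the boundary inside \<open>\<Gamma>\<close>.\<close>

definition boundary_traction ::
    "real \<Rightarrow> real \<Rightarrow> (real^3) set \<Rightarrow> (real^3 \<Rightarrow> complex^3) \<Rightarrow> (real^3 \<Rightarrow> real) \<Rightarrow> complex^3"
  where "boundary_traction lam \<mu> \<Omega> u \<phi> =
    (LINT x:\<Omega>|lebesgue.
      (\<Sum>k\<in>UNIV. pderiv_at k \<phi> x *\<^sub>R traction lam \<mu> (axis k 1) (weak_grad \<Omega> u x)) +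
      \<phi> x *\<^sub>R lame lam \<mu> \<Omega> u x)"

definition traction_eq_on ::
    "real \<Rightarrow> real \<Rightarrow> (real^3) set \<Rightarrow> (real^3) set \<Rightarrow> (real^3 \<Rightarrow> complex^3) \<Rightarrow> (real^3 \<Rightarrow> complex^3) \<Rightarrow> bool"
  where "traction_eq_on lam \<mu> \<Omega> \<Gamma> u v \<longleftrightarrow>
    (\<forall>\<phi>. test_fun UNIV \<phi> \<and> closure {x. \<phi> x \<noteq> 0} \<inter> frontier \<Omega> \<subseteq> \<Gamma> \<longrightarrow>
      boundary_traction lam \<mu> \<Omega> u \<phi> = boundary_traction lam \<mu> \<Omega> v \<phi>)"

section \<open>The edge geometry\<close>

definition arg2 :: "real^2 \<Rightarrow> real"
  where "arg2 x' = Arg (Complex (x' $ 1) (x' $ 2))"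

definition wedge :: "real \<Rightarrow> real \<Rightarrow> (real^2) set"
  where "wedge \<theta>m \<theta>M = {x'. x' \<noteq> 0 \<and> \<theta>m < arg2 x' \<and> arg2 x' < \<theta>M}"

definition ray :: "real \<Rightarrow> (real^2) set"
  where "ray \<theta> = {x'. x' \<noteq> 0 \<and> arg2 x' = \<theta>}"

definition sector :: "real \<Rightarrow> real \<Rightarrow> real \<Rightarrow> (real^2) set"
  where "sector \<theta>m \<theta>M h = wedge \<theta>m \<theta>M \<inter> ball 0 h"

section \<open>Elastic Herglotz functions and the dimension reduction operator\<close>

definition herglotz ::
    "real \<Rightarrow> real \<Rightarrow> real \<Rightarrow> (real^3 \<Rightarrow> complex^3) \<Rightarrow> (real^3 \<Rightarrow> complex^3) \<Rightarrow> real^3 \<Rightarrow> complex^3"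
  where "herglotz lam \<mu> \<omega> gp gs x =
    (let kp = \<omega> / sqrt (lam + 2 * \<mu>); ks = \<omega> / sqrt \<mu> in
      LINT d:sphere 0 1|surface_measure.
        exp (\<i> * of_real (kp * (x \<bullet> d))) *s gp d + exp (\<i> * of_real (ks * (x \<bullet> d))) *s gs d)"

definition dim_reduction ::
    "real \<Rightarrow> real \<Rightarrow> (real \<Rightarrow> real) \<Rightarrow> (real^3 \<Rightarrow> complex^3) \<Rightarrow> real^2 \<Rightarrow> complex^3"
  where "dim_reduction c L \<phi> g x' = (LINT t:{c - L<..<c + L}|lebesgue. \<phi> t *\<^sub>R g (join3 x' t))"

definition zero_ext :: "'a set \<Rightarrow> ('a \<Rightarrow> 'b::zero) \<Rightarrow> 'a \<Rightarrow> 'b"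
  where "zero_ext S f x = (if x \<in> S then f x else 0)"

end

theory Submission
 imports Defs
begin

text \<open>
 Let \<open>u = v - w\<close>, so that the Lame operator maps \<open>u\<close> to \<open>\<omega>\<^sup>2 f\<close> with \<open>f = (1 + V) w - v\<close>. As the Cauchy data of
 \<open>u\<close> vanish on both faces, \<open>u\<close> and its gradient vanish at the edge, so \<open>u = O(r\<^bsup>1+\<alpha>\<^esup>)\<close> with \<open>r\<close> the distance
 to the edge, and the weak equation for \<open>u\<close> may be tested with functions that do not vanish on the faces.
 The test functions are a cutoff times \<open>\<zeta>\<^bsup>-3\<^esup>\<close> with \<open>\<zeta> = x\<^sub>1 + \<i> x\<^sub>2 + s e\<^bsup>\<i>\<theta>\<^esup>\<close>, where \<open>\<theta>\<close> is the angle of the bisector.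
 After multiplication by \<open>s\<close>, as \<open>s\<close> tends to \<open>0\<close>, the terms with \<open>u\<close> vanish if the equation is contracted with a
 vector orthogonal to the isotropic vector \<open>(1, \<i>, 0)\<close>, and the right-hand side tends to the contracted value of
 \<open>R f\<close> at the edge, times a factor that is nonzero because the opening angle is not \<open>\<pi>\<close>. That \<open>R v\<close> has such a
 value, in the sense of mean oscillation \<open>O(\<rho>\<^bsup>\<delta>\<^esup>)\<close> on sectors of radius \<open>\<rho>\<close>, is all that is used of the
 Herglotz approximation. Hence \<open>R f\<close> has value \<open>0\<close> at the edge, and so has \<open>R (V w)\<close>, since \<open>V w = f + u\<close>.
\<close>

section \<open>Smooth functions\<close>

text \<open>The exponent 3 comes from counting powers at the edge, which has codimension two. The
  integral of \<zeta>^(-3) over a sector grows like 1/s, so the factor s leaves a finite limit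
  concentrated at the edge. The Hessian of the kernel has size |\<zeta>|^(-5); since s and r are
  bounded by multiples of |\<zeta>|, the factor s and u = O(r^(1+\<alpha>)) only bring this to
  r^(\<alpha>-3), not integrable in the plane. The contraction removes exactly this Hessian; what is
  left carries a derivative of the cutoff and is dominated by r^(\<alpha>-2). The pole lies on the
  ray opposite to the bisector, off the closed wedge even if the wedge is not convex. The nonzero
  factor is a multiple of the sine of the opening angle. Two obstacles shape the rest. Weak
  gradients and Lame images are square-integrable choices, so statements about them are made after
  testing, and cutoffs carry them from interior test functions to those that reach the faces. And
  \<open>\<Gamma>\<close> may omit the edge, so the traction condition is first used with test
  functions vanishing near the edge; the decay of u then removes that cutoff.\<close>

lemma dir_deriv_eqI: "(f has_derivative f') (at x) ==> dir_deriv b f x = f' b"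
 unfolding dir_deriv_def using frechet_derivative_at by metis

text \<open>Lists of directions are handled here; the closure properties below mostly exhibit a set
  of differentiable functions that is stable under directional derivatives.\<close>

lemma smooth_coinduct:
 assumes "f \<in> F"
  and "!!g x. g \<in> F ==> g differentiable (at x)"
  and "!!g b. g \<in> F ==> dir_deriv b g \<in> F"
 shows "smooth f"
proof -
 have "foldr dir_deriv bs f \<in> F" for bs by (induction bs) (auto intro: assms)
 then show ?thesis unfolding smooth_def using assms(2) by blast
qed

lemma smooth_differentiable: "smooth f ==> f differentiable (at x)" unfolding smooth_def by (metis foldr.simps(1) id_apply)

lemma smooth_dir_deriv [intro]: "smooth f ==> smooth (dir_deriv b f)"
proof -
 assume f: "smooth f"
 have "foldr dir_deriv bs (dir_deriv b f) = foldr dir_deriv (bs @ [b]) f" for bs by simp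
 then show ?thesis using f unfolding smooth_def by metis
qed

lemma smooth_has_derivative:
 assumes "smooth f" shows "(f has_derivative (\<lambda>b. dir_deriv b f x)) (at x)"
proof -
 have "(f has_derivative frechet_derivative f (at x)) (at x)" using smooth_differentiable[OF assms] frechet_derivative_works by blast
 then show ?thesis by (simp add: dir_deriv_def)
qed

lemma smooth_continuous: "smooth f ==> continuous_on S f"
 by (intro continuous_at_imp_continuous_on ballI has_derivative_continuous[OF smooth_has_derivative])

lemma smooth_measurable: "smooth f ==> f \<in> borel_measurable borel" using smooth_continuous borel_measurable_continuous_onI by blast

lemma smooth_const [intro, simp]: "smooth (\<lambda>x. c)"
proof (rule smooth_coinduct[where F = "range (\<lambda>c x. c)"])
 fix g :: "'a => 'b" and b assume "g \<in> range (\<lambda>c x. c)"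
 then obtain c where "g = (\<lambda>x. c)" by auto
 then have "dir_deriv b g = (\<lambda>x. 0)" by (intro ext dir_deriv_eqI[THEN trans]) auto
 then show "dir_deriv b g \<in> range (\<lambda>c x. c)" by auto
qed auto

lemma smooth_affine:
 assumes "bounded_linear A" shows "smooth (\<lambda>x. A x + c)"
proof (rule smooth_coinduct[where F = "insert (\<lambda>x. A x + c) (Collect smooth)"])
 have D: "((\<lambda>x. A x + c) has_derivative A) (at x)" for x
  by (rule has_derivative_eq_rhs[OF has_derivative_add[OF bounded_linear_imp_has_derivative[OF assms] has_derivative_const]]) simp
 fix g :: "'a => 'b" and b x assume "g \<in> insert (\<lambda>x. A x + c) (Collect smooth)"
 then consider "g = (\<lambda>x. A x + c)" | "smooth g" by auto
 note cs = this
 show "g differentiable (at x)" using cs D smooth_differentiable by cases (auto simp: differentiable_def)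
 show "dir_deriv b g \<in> insert (\<lambda>x. A x + c) (Collect smooth)" using cs
 proof cases
  case 1
  then have "dir_deriv b g = (\<lambda>x. A b)" using dir_deriv_eqI[OF D] by auto
  then show ?thesis by auto
 qed auto
qed auto

lemma smooth_linear: "bounded_linear A ==> smooth A" using smooth_affine[of A 0] by simp

lemma smooth_ident [intro, simp]: "smooth (\<lambda>x. x)" using smooth_linear[OF bounded_linear_ident] .

lemma dir_deriv_add:
 "f differentiable (at x) ==> g differentiable (at x) ==>
  dir_deriv b (\<lambda>x. f x + g x) x = dir_deriv b f x + dir_deriv b g x" by (rule dir_deriv_eqI[OF has_derivative_add, THEN trans])
  (auto simp: dir_deriv_def frechet_derivative_works[symmetric])

lemma dir_deriv_bilinear:
 assumes "bounded_bilinear P" "f differentiable (at x)" "g differentiable (at x)"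
 shows "dir_deriv b (\<lambda>x. P (f x) (g x)) x = P (f x) (dir_deriv b g x) + P (dir_deriv b f x) (g x)"
proof -
 have "(f has_derivative frechet_derivative f (at x)) (at x)"
  "(g has_derivative frechet_derivative g (at x)) (at x)" using assms frechet_derivative_works by blast+
 from bounded_bilinear.FDERIV[OF assms(1) this]
 show ?thesis by (intro dir_deriv_eqI[THEN trans]) (auto simp: dir_deriv_def)
qed

lemma smooth_add [intro]:
 assumes "smooth f" "smooth g" shows "smooth (\<lambda>x. f x + g x)"
proof (rule smooth_coinduct[where F = "{\<lambda>x. f x + g x | f g. smooth f \<and> smooth g}"])
 fix h :: "'a => 'b" and b x assume "h \<in> {\<lambda>x. f x + g x | f g. smooth f \<and> smooth g}"
 then obtain f g where h: "h = (\<lambda>x. f x + g x)" "smooth f" "smooth g" by auto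
 show "h differentiable (at x)" unfolding h(1) by (intro differentiable_add smooth_differentiable h)
 have "dir_deriv b h = (\<lambda>x. dir_deriv b f x + dir_deriv b g x)" using h by (auto intro!: ext dir_deriv_add smooth_differentiable)
 then show "dir_deriv b h \<in> {\<lambda>x. f x + g x | f g. smooth f \<and> smooth g}" using h by blast
qed (use assms in blast)

text \<open>The product rule turns \<open>P f g\<close> into a sum of two terms of the same kind, so
  the stable set has to consist of finite sums.\<close>

inductive_set bil_span for P :: "'a::real_normed_vector => 'b::real_normed_vector => 'c::real_normed_vector" where
 base: "smooth f ==> smooth g ==> (\<lambda>x. P (f x) (g x)) \<in> bil_span P"
| add: "p \<in> bil_span P ==> q \<in> bil_span P ==> (\<lambda>x. p x + q x) \<in> bil_span P"

lemma smooth_bilinear: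
 fixes f :: "'d::real_normed_vector => 'a::real_normed_vector"
 assumes P: "bounded_bilinear P" and "smooth f" "smooth g"
 shows "smooth (\<lambda>x. P (f x) (g x))"
proof -
 have *: "(\<forall>x. h differentiable (at x)) \<and> (\<forall>b. dir_deriv b h \<in> bil_span P)" if "h \<in> bil_span P"
  for h :: "'d => 'c" using that
 proof induction
  case (base f g)
  have "(\<lambda>x. P (f x) (g x)) differentiable (at x)" for x
   using bounded_bilinear.FDERIV[OF P smooth_has_derivative[OF base(1)] smooth_has_derivative[OF base(2)], of x] by (auto simp: differentiable_def)
  moreover have "dir_deriv b (\<lambda>x. P (f x) (g x)) =
   (\<lambda>x. P (f x) (dir_deriv b g x) + P (dir_deriv b f x) (g x))" for b by (intro ext dir_deriv_bilinear P smooth_differentiable base)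
  ultimately show ?case using base by (auto intro!: bil_span.intros)
 next
  case (add p q)
  then have "dir_deriv b (\<lambda>x. p x + q x) = (\<lambda>x. dir_deriv b p x + dir_deriv b q x)" for b by (intro ext dir_deriv_add) auto
  then show ?case using add by (auto intro!: bil_span.intros)
 qed
 show ?thesis by (rule smooth_coinduct[where F = "bil_span P"]) (use * assms in \<open>auto intro: bil_span.intros\<close>)
qed

lemma smooth_mult [intro]: "smooth f ==> smooth g ==> smooth (\<lambda>x. f x * g x :: 'b::real_normed_algebra)"
 by (rule smooth_bilinear[OF bounded_bilinear_mult])

lemma smooth_scaleR [intro]: "smooth f ==> smooth g ==> smooth (\<lambda>x. f x *\<^sub>R g x)"
 by (rule smooth_bilinear[OF bounded_bilinear_scaleR])

lemma smooth_uminus [intro]: "smooth f ==> smooth (\<lambda>x. - f x)" using smooth_scaleR[OF smooth_const[of "-1"], of f] by simp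

lemma smooth_diff [intro]: "smooth f ==> smooth g ==> smooth (\<lambda>x. f x - g x)"
 using smooth_add[OF _ smooth_uminus, of f g] by simp

lemma smooth_sum [intro]: "(!!i. i \<in> I ==> smooth (f i)) ==> smooth (\<lambda>x. \<Sum>i\<in>I. f i x)"
 by (induction I rule: infinite_finite_induct) auto

lemma smooth_power [intro]: "smooth f ==> smooth (\<lambda>x. f x ^ n :: 'b::real_normed_algebra_1)" by (induction n) auto

text \<open>The chain rule brings out the components of the inner derivative as scalar factors,
  hence the smooth coefficient \<open>h\<close> in the generators. The Euclidean codomain of
  \<open>f\<close> keeps the sum over directions finite.\<close>

inductive_set comp_span for f :: "'a::real_normed_vector => 'b::euclidean_space" where
 base: "smooth h ==> smooth k ==> (\<lambda>x. h x *\<^sub>R k (f x)) \<in> comp_span f"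
| add: "p \<in> comp_span f ==> q \<in> comp_span f ==> (\<lambda>x. p x + q x) \<in> comp_span f"

lemma dir_deriv_compose:
 fixes f :: "'a::real_normed_vector => 'b::euclidean_space"
 assumes "smooth f" "smooth k"
 shows "dir_deriv b (\<lambda>x. k (f x)) x = (\<Sum>i\<in>Basis. (dir_deriv b f x \<bullet> i) *\<^sub>R dir_deriv i k (f x))"
proof -
 have lin: "linear (\<lambda>v. dir_deriv v k y)" for y using smooth_has_derivative[OF assms(2)] has_derivative_linear by blast
 have "((\<lambda>x. k (f x)) has_derivative (\<lambda>v. dir_deriv (dir_deriv v f x) k (f x))) (at x)"
  using diff_chain_at[OF smooth_has_derivative[OF assms(1)] smooth_has_derivative[OF assms(2)]] by (simp add: o_def)
 then have "dir_deriv b (\<lambda>x. k (f x)) x = dir_deriv (dir_deriv b f x) k (f x)" by (rule dir_deriv_eqI)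
 also have "\<dots> = dir_deriv (\<Sum>i\<in>Basis. (dir_deriv b f x \<bullet> i) *\<^sub>R i) k (f x)" by (simp add: euclidean_representation)
 also have "\<dots> = (\<Sum>i\<in>Basis. (dir_deriv b f x \<bullet> i) *\<^sub>R dir_deriv i k (f x))"
  by (simp add: linear_sum[OF lin] linear_scale[OF lin])
 finally show ?thesis .
qed

lemma smooth_compose:
 fixes f :: "'a::real_normed_vector => 'b::euclidean_space" and k :: "'b => 'c::real_normed_vector"
 assumes f: "smooth f" and "smooth k"
 shows "smooth (\<lambda>x. k (f x))"
proof -
 have zero: "(\<lambda>x. 0 :: 'c) \<in> comp_span f" using comp_span.base[of "\<lambda>x. 0" "\<lambda>x. 0 :: 'c" f] by simp
 have sum: "(\<lambda>x. \<Sum>i\<in>I. g i x) \<in> comp_span f" if "!!i. i \<in> I ==> g i \<in> comp_span f"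
  for I and g :: "'b => 'a => 'c" using that by (induction I rule: infinite_finite_induct) (auto intro: zero comp_span.add)
 have *: "(\<forall>x. p differentiable (at x)) \<and> (\<forall>b. dir_deriv b p \<in> comp_span f)" if "p \<in> comp_span f"
  for p :: "'a => 'c" using that
 proof induction
  case (base h k)
  have dk: "(\<lambda>x. k (f x)) differentiable (at x)" for x
   using diff_chain_at[OF smooth_has_derivative[OF f] smooth_has_derivative[OF base(2)], of x] by (auto simp: o_def differentiable_def)
  have "dir_deriv b (\<lambda>x. h x *\<^sub>R k (f x)) x =
    (\<Sum>i\<in>Basis. (h x * (dir_deriv b f x \<bullet> i)) *\<^sub>R dir_deriv i k (f x)) + dir_deriv b h x *\<^sub>R k (f x)" for b x
   using dir_deriv_bilinear[OF bounded_bilinear_scaleR smooth_differentiable[OF base(1)] dk]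
    dir_deriv_compose[OF f base(2)] by (simp add: scaleR_sum_right)
  then have "dir_deriv b (\<lambda>x. h x *\<^sub>R k (f x)) =
    (\<lambda>x. (\<Sum>i\<in>Basis. (h x * (dir_deriv b f x \<bullet> i)) *\<^sub>R dir_deriv i k (f x)) + dir_deriv b h x *\<^sub>R k (f x))" for b
   by auto
  moreover have "smooth (\<lambda>x. h x * (dir_deriv b f x \<bullet> i))" for b i
   by (intro smooth_mult base(1) smooth_bilinear[OF bounded_bilinear_inner] smooth_dir_deriv f smooth_const)
  ultimately have "dir_deriv b (\<lambda>x. h x *\<^sub>R k (f x)) \<in> comp_span f" for b
   using base by (auto intro!: comp_span.add sum comp_span.base)
  moreover have "(\<lambda>x. h x *\<^sub>R k (f x)) differentiable (at x)" for x by (intro differentiable_scaleR dk smooth_differentiable base)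
  ultimately show ?case by blast
 next
  case (add p q)
  then have "dir_deriv b (\<lambda>x. p x + q x) = (\<lambda>x. dir_deriv b p x + dir_deriv b q x)" for b by (intro ext dir_deriv_add) auto
  then show ?case using add by (auto intro!: comp_span.intros)
 qed
 show ?thesis by (rule smooth_coinduct[where F = "comp_span f"])
   (use * assms comp_span.base[of "\<lambda>x. 1" k f] in auto)
qed

text \<open>Differentiation raises the power of \<open>1 / f\<close> and otherwise only changes the
  smooth coefficient, so sums of such terms with arbitrary powers form a stable set.\<close>

inductive_set inv_span for f :: "'a::real_normed_vector => real" where
 base: "smooth h ==> (\<lambda>x. h x * inverse (f x) ^ n) \<in> inv_span f"
| add: "p \<in> inv_span f ==> q \<in> inv_span f ==> (\<lambda>x. p x + q x) \<in> inv_span f"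

lemma smooth_inverse:
 fixes f :: "'a::real_normed_vector => real"
 assumes f: "smooth f" and nz: "!!x. f x ~= 0"
 shows "smooth (\<lambda>x. inverse (f x))"
proof -
 have *: "(\<forall>x. p differentiable (at x)) \<and> (\<forall>b. dir_deriv b p \<in> inv_span f)" if "p \<in> inv_span f" for p using that
 proof induction
  case (base h n)
  have D: "((\<lambda>x. h x * inverse (f x) ^ n) has_derivative
    (\<lambda>b. dir_deriv b h x * inverse (f x) ^ n +
     (- (of_nat n) * h x * dir_deriv b f x) * inverse (f x) ^ Suc n)) (at x)" for x
  proof -
   have "((\<lambda>x. inverse (f x)) has_derivative (\<lambda>b. - (inverse (f x) * dir_deriv b f x * inverse (f x)))) (at x)"
    by (rule Deriv.has_derivative_inverse[OF nz smooth_has_derivative[OF f]])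
   from has_derivative_mult[OF smooth_has_derivative[OF base(1)] has_derivative_power[OF this]]
   show ?thesis by (rule has_derivative_eq_rhs) (cases n; auto simp: algebra_simps)
  qed
  define d where "d b = (\<lambda>x. dir_deriv b h x * inverse (f x) ^ n +
     (- (of_nat n) * h x * dir_deriv b f x) * inverse (f x) ^ Suc n)" for b
  have "dir_deriv b (\<lambda>x. h x * inverse (f x) ^ n) = d b" for b unfolding d_def by (intro ext dir_deriv_eqI[OF D])
  moreover have "d b \<in> inv_span f" for b unfolding d_def by (intro inv_span.intros smooth_dir_deriv base(1) smooth_mult smooth_const f)
  moreover have "(\<lambda>x. h x * inverse (f x) ^ n) differentiable (at x)" for x unfolding differentiable_def using D by blast
  ultimately show ?case by simp
 next
  case (add p q)
  then have "dir_deriv b (\<lambda>x. p x + q x) = (\<lambda>x. dir_deriv b p x + dir_deriv b q x)" for b by (intro ext dir_deriv_add) auto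
  then show ?case using add by (auto intro!: inv_span.intros)
 qed
 show ?thesis by (rule smooth_coinduct[where F = "inv_span f"])
   (use * assms inv_span.base[of "\<lambda>x. 1" f 1] in auto)
qed

section \<open>A smooth step function\<close>

definition flat :: "real poly => real => real"
 where "flat p t = (if t > 0 then poly p (1 / t) * exp (- (1 / t)) else 0)"

lemma poly_exp_tendsto_0: "((\<lambda>y. poly p y * exp (- y)) \<longlongrightarrow> (0::real)) at_top"
proof -
 have "((\<lambda>y. \<Sum>i\<le>degree p. coeff p i * (y ^ i / exp y)) \<longlongrightarrow> (\<Sum>i\<le>degree p. coeff p i * 0)) at_top"
  by (intro tendsto_intros tendsto_power_div_exp_0)
 then show ?thesis by (simp add: poly_altdef sum_distrib_right exp_minus divide_inverse mult.assoc)
qed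

text \<open>With y = 1/t the derivative of p(y) exp(-y) is y^2 (p - p')(y) exp(-y), so the family
  indexed by polynomials is stable under differentiation. Only t = 0 needs an argument on difference
  quotients.\<close>

lemma flat_has_derivative:
 "(flat p has_real_derivative flat (monom 1 2 * (p - pderiv p)) t) (at t)"
proof -
 consider "t > 0" | "t < 0" | "t = 0" by linarith
 then show ?thesis
 proof cases
  case 1
  have "((\<lambda>t. poly p (1 / t) * exp (- (1 / t))) has_real_derivative
    flat (monom 1 2 * (p - pderiv p)) t) (at t)" using 1 by (auto intro!: derivative_eq_intros simp: flat_def poly_monom power2_eq_square field_simps)
  moreover have "\<forall>\<^sub>F s in nhds t. poly p (1 / s) * exp (- (1 / s)) = flat p s"
   using eventually_nhds_in_open[of "{0<..}" t] 1 by (auto elim!: eventually_mono simp: flat_def)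
  ultimately show ?thesis using DERIV_cong_ev[OF refl _ refl] by fast
 next
  case 2
  have "\<forall>\<^sub>F s in nhds t. 0 = flat p s" using eventually_nhds_in_open[of "{..<0}" t] 2 by (auto elim!: eventually_mono simp: flat_def)
  moreover have "((\<lambda>t. 0) has_real_derivative flat (monom 1 2 * (p - pderiv p)) t) (at t)" using 2 by (simp add: flat_def)
  ultimately show ?thesis using DERIV_cong_ev[OF refl _ refl] by fast
 next
  case 3
  \<comment> \<open>With y = 1/h the quotient from the right is y p(y) exp(-y), that is, the same
    expression for the polynomial \<open>pCons 0 p\<close>.\<close>
  have "((\<lambda>h. flat p h / h) \<longlongrightarrow> 0) (at_right 0)"
  proof -
   have "((\<lambda>h. poly (pCons 0 p) (inverse h) * exp (- inverse h)) \<longlongrightarrow> 0) (at_right 0)"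
    by (rule filterlim_compose[OF poly_exp_tendsto_0 filterlim_inverse_at_top_right])
   then show ?thesis by (rule Lim_transform_eventually)
     (auto simp: eventually_at_right_field flat_def divide_inverse mult_ac intro!: exI[of _ 1])
  qed
  moreover have "((\<lambda>h. flat p h / h) \<longlongrightarrow> 0) (at_left 0)" by (rule Lim_transform_eventually[OF tendsto_const])
    (auto simp: eventually_at_left_field flat_def intro!: exI[of _ "-1"])
  ultimately have "((\<lambda>h. flat p h / h) \<longlongrightarrow> 0) (at 0)" by (simp add: filterlim_split_at)
  then show ?thesis using 3 by (simp add: DERIV_def flat_def)
 qed
qed

lemma smooth_flat: "smooth (flat p)"
proof (rule smooth_coinduct[where F = "range flat"])
 fix g :: "real => real" and b x assume "g \<in> range flat"
 then obtain p where g: "g = flat p" by auto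
 have D: "(g has_derivative (\<lambda>b. flat (monom 1 2 * (p - pderiv p)) x * b)) (at x)" for x
  using flat_has_derivative[of p x] g by (simp add: has_field_derivative_def)
 then show "g differentiable (at x)" by (auto simp: differentiable_def)
 have "dir_deriv b g = flat (smult b (monom 1 2 * (p - pderiv p)))" using dir_deriv_eqI[OF D] by (auto simp: fun_eq_iff flat_def)
 then show "dir_deriv b g \<in> range flat" by auto
qed auto

definition sstep :: "real => real"
 where "sstep t = flat 1 t * inverse (flat 1 t + flat 1 (1 - t))"

lemma sstep_denom_pos: "flat 1 t + flat 1 (1 - t) > 0" by (cases "t > 0"; cases "t < 1") (auto simp: flat_def intro: add_pos_pos)

lemma smooth_sstep: "smooth sstep"
proof -
 have "smooth (\<lambda>t. flat 1 (1 - t) :: real)" by (rule smooth_compose[OF _ smooth_flat]) auto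
 then have "smooth (\<lambda>t. flat 1 t * inverse (flat 1 t + flat 1 (1 - t)))"
  using sstep_denom_pos by (intro smooth_mult smooth_inverse smooth_add smooth_flat) (auto simp: less_imp_neq[symmetric] smooth_flat)
 then show ?thesis by (simp add: sstep_def[abs_def])
qed

lemma sstep_0: "t <= 0 ==> sstep t = 0" and sstep_1: "t >= 1 ==> sstep t = 1" by (auto simp: sstep_def flat_def)

lemma sstep_range: "0 <= sstep t" "sstep t <= 1"
proof -
 have "0 <= flat 1 t" "0 <= flat 1 (1 - t)" by (auto simp: flat_def)
 then show "0 <= sstep t" "sstep t <= 1" using sstep_denom_pos[of t] by (auto simp: sstep_def divide_inverse[symmetric])
qed

section \<open>Test functions\<close>

lemma test_funI:
 assumes "smooth \<phi>" "{x. \<phi> x ~= 0} \<subseteq> C" "compact C" "C \<subseteq> S"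
 shows "test_fun S \<phi>"
proof -
 have "closure {x. \<phi> x ~= 0} \<subseteq> C" using assms by (simp add: closure_minimal compact_imp_closed)
 then show ?thesis unfolding test_fun_def using assms compact_Int_closed[OF assms(3), of "closure {x. \<phi> x ~= 0}"]
  by (auto simp: Int_absorb1)
qed

lemma test_funD:
 assumes "test_fun S \<phi>"
 shows "smooth \<phi>" "compact (closure {x. \<phi> x ~= 0})" "closure {x. \<phi> x ~= 0} \<subseteq> S"
  "x \<notin> closure {x. \<phi> x ~= 0} ==> \<phi> x = 0" "x \<notin> S ==> \<phi> x = 0"
 using assms closure_subset[of "{x. \<phi> x ~= 0}"] unfolding test_fun_def by auto

lemma test_fun_mult:
 assumes "test_fun S \<phi>" "smooth \<eta>" shows "test_fun S (\<lambda>x. \<eta> x * \<phi> x)"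
proof (rule test_funI[where C = "closure {x. \<phi> x ~= 0}"])
 show "{x. \<eta> x * \<phi> x ~= 0} \<subseteq> closure {x. \<phi> x ~= 0}" using closure_subset[of "{x. \<phi> x ~= 0}"] by auto
qed (use assms test_funD(1-3)[OF assms(1)] in auto)

lemma test_fun_mono: "test_fun S \<phi> ==> S \<subseteq> T ==> test_fun T \<phi>" unfolding test_fun_def by auto

lemma dir_deriv_cong_open:
 assumes "open U" "x \<in> U" "!!y. y \<in> U ==> f y = g y"
 shows "dir_deriv b f x = dir_deriv b g x"
proof -
 have "(f has_derivative D) (at x) \<longleftrightarrow> (g has_derivative D) (at x)" for D
  using assms has_derivative_transform_within_open[of f D x UNIV U g]
   has_derivative_transform_within_open[of g D x UNIV U f] by auto
 then show ?thesis by (simp add: dir_deriv_def frechet_derivative_def)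
qed

lemma test_fun_deriv_0:
 assumes "test_fun S \<phi>" "x \<notin> closure {x. \<phi> x ~= 0}"
 shows "dir_deriv b \<phi> x = 0"
proof -
 have "dir_deriv b \<phi> x = dir_deriv b (\<lambda>x. 0) x"
 proof (rule dir_deriv_cong_open[where U = "- closure {x. \<phi> x ~= 0}"])
  fix y assume "y \<in> - closure {x. \<phi> x ~= 0}"
  then show "\<phi> y = 0" by (intro test_funD(4)[OF assms(1)]) blast
 qed (use assms(2) in auto)
 then show ?thesis using dir_deriv_eqI[OF has_derivative_const] by simp
qed

lemma test_fun_dir_deriv:
 assumes "test_fun S \<phi>" shows "test_fun S (dir_deriv b \<phi>)"
proof (rule test_funI[where C = "closure {x. \<phi> x ~= 0}"])
 show "{x. dir_deriv b \<phi> x ~= 0} \<subseteq> closure {x. \<phi> x ~= 0}" using test_fun_deriv_0[OF assms] by blast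
qed (use test_funD(1-3)[OF assms] in auto)

lemma test_fun_bounded:
 assumes "test_fun S \<phi>" obtains B where "B > 0" "!!x. \<bar>\<phi> x\<bar> <= B"
proof -
 have "compact (\<phi> ` closure {x. \<phi> x ~= 0})" by (intro compact_continuous_image smooth_continuous test_funD[OF assms])
 then obtain B where B: "\<forall>y \<in> \<phi> ` closure {x. \<phi> x ~= 0}. norm y <= B" using compact_imp_bounded bounded_iff by metis
 have "\<bar>\<phi> x\<bar> <= \<bar>B\<bar> + 1" for x
 proof (cases "x \<in> closure {x. \<phi> x ~= 0}")
  case True
  then have "norm (\<phi> x) <= B" using B by blast
  then show ?thesis by simp
 qed (use test_funD(4)[OF assms, of x] in simp)
 then show ?thesis using that[of "\<bar>B\<bar> + 1"] by auto
qed

lemma dir_deriv_linear_combo: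
 assumes "smooth f" shows "dir_deriv (a *\<^sub>R b + a' *\<^sub>R b') f x = a *\<^sub>R dir_deriv b f x + a' *\<^sub>R dir_deriv b' f x"
proof -
 have "linear (\<lambda>b. dir_deriv b f x)" by (rule has_derivative_linear[OF smooth_has_derivative[OF assms]])
 then show ?thesis using linear_add[of "\<lambda>b. dir_deriv b f x"] linear_scale[of "\<lambda>b. dir_deriv b f x"] by simp
qed

lemma dir_deriv_representation:
 fixes f :: "real^'n::finite => 'b::real_normed_vector"
 assumes "smooth f" shows "dir_deriv e f x = (\<Sum>j\<in>UNIV. (e $ j) *\<^sub>R pderiv_at j f x)"
proof -
 have lin: "linear (\<lambda>b. dir_deriv b f x)" by (rule has_derivative_linear[OF smooth_has_derivative[OF assms]])
 have "(\<Sum>j\<in>UNIV. (e $ j) *\<^sub>R axis j 1) = e" by (simp add: vec_eq_iff axis_def if_distrib cong: if_cong)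
 then have "dir_deriv e f x = dir_deriv (\<Sum>j\<in>UNIV. (e $ j) *\<^sub>R axis j 1) f x" by simp
 also have "\<dots> = (\<Sum>j\<in>UNIV. (e $ j) *\<^sub>R pderiv_at j f x)" by (simp add: linear_sum[OF lin] linear_scale[OF lin])
 finally show ?thesis .
qed

section \<open>Fubini theorem in the coordinates of the edge\<close>

lemma proj2_nth [simp]: "proj2 x $ 1 = x $ 1" "proj2 x $ 2 = x $ 2" by (simp_all add: proj2_def)

lemma join3_nth [simp]: "join3 y t $ 1 = y $ 1" "join3 y t $ 2 = y $ 2" "join3 y t $ 3 = t" by (simp_all add: join3_def)

lemma proj2_join3 [simp]: "proj2 (join3 y t) = y" by (simp add: vec_eq_iff forall_2)

lemma join3_proj2 [simp]: "join3 (proj2 x) (x $ 3) = x" by (simp add: vec_eq_iff forall_3)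

lemma linear_proj2: "linear proj2" by (rule linearI) (simp_all add: vec_eq_iff forall_2)

lemma bounded_linear_proj2: "bounded_linear proj2" using linear_proj2 linear_conv_bounded_linear by blast

lemma linear_join3: "linear (\<lambda>p. join3 (fst p) (snd p))" by (rule linearI) (simp_all add: vec_eq_iff forall_3)

lemma bounded_linear_join3: "bounded_linear (\<lambda>p. join3 (fst p) (snd p))" using linear_join3 linear_conv_bounded_linear by blast

lemma continuous_on_proj2 [continuous_intros]: "continuous_on S f ==> continuous_on S (\<lambda>x. proj2 (f x))"
 by (rule bounded_linear.continuous_on[OF bounded_linear_proj2])

lemma continuous_on_join3 [continuous_intros]:
 "continuous_on S f ==> continuous_on S g ==> continuous_on S (\<lambda>x. join3 (f x) (g x))"
 using bounded_linear.continuous_on[OF bounded_linear_join3, of S "\<lambda>x. (f x, g x)"] by (simp add: continuous_on_Pair)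

lemma box_pair: "box (a, b) (c, d) = box a c \<times> box b d" by (force simp: mem_box Basis_prod_def)

lemma prod_Basis_vec: "(\<Prod>b\<in>(Basis :: (real^'n) set). f b) = (\<Prod>i\<in>UNIV. f (axis i 1))"
 by (simp add: Basis_vec_def UNION_singleton_eq_range prod.reindex inj_on_def axis_eq_axis)

text \<open>A measure on three-space is Lebesgue measure as soon as it is so on boxes. This is what
  carries Fubini's theorem to the splitting into a planar point and the coordinate along the
  edge.\<close>

lemma lborel_join3:
 "distr lborel borel (\<lambda>p :: (real^2) \<times> real. join3 (fst p) (snd p)) = lborel"
proof (rule lborel_eqI[symmetric])
 have meas: "(\<lambda>p :: (real^2) \<times> real. join3 (fst p) (snd p)) \<in> borel_measurable borel"
  by (intro borel_measurable_continuous_onI continuous_intros)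
 fix l u :: "real^3" assume lu: "!!b. b \<in> Basis ==> l \<bullet> b <= u \<bullet> b"
 have "l $ i <= u $ i" for i using lu[of "axis i 1"] by (simp add: Basis_vec_def inner_axis) (metis (full_types) UNIV_I insertI1)
 then have le: "l $ 1 <= u $ 1" "l $ 2 <= u $ 2" "l $ 3 <= u $ 3" by auto
 have pre: "(\<lambda>p. join3 (fst p) (snd p)) -` box l u = box (proj2 l, l $ 3) (proj2 u, u $ 3)"
  by (auto simp: box_pair mem_box_cart forall_2 forall_3)
 have "emeasure (distr lborel borel (\<lambda>p :: (real^2) \<times> real. join3 (fst p) (snd p))) (box l u) =
   emeasure lborel (box (proj2 l, l $ 3) (proj2 u, u $ 3))" using meas by (simp add: emeasure_distr pre)
 also have "\<dots> = emeasure (lborel \<Otimes>\<^sub>M lborel) (box (proj2 l) (proj2 u) \<times> box (l $ 3) (u $ 3))"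
  by (simp add: lborel_prod box_pair)
 also have "\<dots> = emeasure lborel (box (proj2 l) (proj2 u)) * emeasure lborel (box (l $ 3) (u $ 3))"
  by (intro lborel.emeasure_pair_measure_Times) auto
 also have "\<dots> = ennreal ((u $ 1 - l $ 1) * (u $ 2 - l $ 2)) * ennreal (u $ 3 - l $ 3)"
 proof -
  have "proj2 l \<bullet> b <= proj2 u \<bullet> b" if "b \<in> Basis" for b using le that by (auto simp: Basis_vec_def inner_axis UNIV_2)
  then have "emeasure lborel (box (proj2 l) (proj2 u)) = ennreal (\<Prod>b\<in>Basis. (proj2 u - proj2 l) \<bullet> b)" by (intro emeasure_lborel_box)
  moreover have "(\<Prod>b\<in>Basis. (proj2 u - proj2 l) \<bullet> b) = (u $ 1 - l $ 1) * (u $ 2 - l $ 2)"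
   by (simp add: prod_Basis_vec UNIV_2 inner_axis)
  ultimately show ?thesis using le by (simp only: emeasure_lborel_Ioo box_real)
 qed
 also have "\<dots> = (\<Prod>b\<in>Basis. (u - l) \<bullet> b)"
 proof -
  have "(\<Prod>b\<in>Basis. (u - l) \<bullet> b) = ((u $ 1 - l $ 1) * (u $ 2 - l $ 2)) * (u $ 3 - l $ 3)"
   unfolding prod_Basis_vec UNIV_3 by (simp add: inner_axis)
  then show ?thesis using ennreal_mult''[of "u $ 3 - l $ 3" "(u $ 1 - l $ 1) * (u $ 2 - l $ 2)"] le by (simp only: diff_ge_0_iff_ge simp_thms)
 qed
 finally show "emeasure (distr lborel borel (\<lambda>p :: (real^2) \<times> real. join3 (fst p) (snd p))) (box l u) =
   ennreal (\<Prod>b\<in>Basis. (u - l) \<bullet> b)" .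
qed simp

definition rot2 :: "real => real => real => real^2"
 where "rot2 th X Y = vector [X * cos th - Y * sin th, X * sin th + Y * cos th]"

lemma rot2_nth [simp]: "rot2 th X Y $ 1 = X * cos th - Y * sin th"
 "rot2 th X Y $ 2 = X * sin th + Y * cos th" by (simp_all add: rot2_def)

lemma continuous_on_rot2 [continuous_intros]:
 assumes "continuous_on S f" "continuous_on S g" shows "continuous_on S (\<lambda>x. rot2 th (f x) (g x))"
proof -
 have "linear (\<lambda>p. rot2 th (fst p) (snd p))" by (rule linearI) (simp_all add: vec_eq_iff forall_2 algebra_simps)
 then have "bounded_linear (\<lambda>p. rot2 th (fst p) (snd p))" using linear_conv_bounded_linear by blast
 from bounded_linear.continuous_on[OF this continuous_on_Pair[OF assms]]
 show ?thesis by simp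
qed

text \<open>The angle 0 merely identifies \<open>real \<times> real\<close> with
  \<open>real^2\<close>; the genuine rotation is added afterwards as a map of \<open>real^2\<close>,
  where the determinant formula applies.\<close>

lemma lborel_rot2_0: "distr lborel borel (\<lambda>p. rot2 0 (fst p) (snd p)) = lborel"
proof (rule lborel_eqI[symmetric])
 have meas: "(\<lambda>p. rot2 0 (fst p) (snd p)) \<in> borel_measurable borel" by (intro borel_measurable_continuous_onI continuous_intros)
 fix l u :: "real^2" assume lu: "!!b. b \<in> Basis ==> l \<bullet> b <= u \<bullet> b"
 have "l $ i <= u $ i" for i using lu[of "axis i 1"] by (simp add: Basis_vec_def inner_axis) (metis (full_types) UNIV_I insertI1)
 then have le: "l $ 1 <= u $ 1" "l $ 2 <= u $ 2" by auto
 have pre: "(\<lambda>p. rot2 0 (fst p) (snd p)) -` box l u = box (l $ 1, l $ 2) (u $ 1, u $ 2)"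
  by (auto simp: box_pair mem_box_cart forall_2 box_real)
 have "emeasure (distr lborel borel (\<lambda>p. rot2 0 (fst p) (snd p))) (box l u) =
   emeasure lborel (box (l $ 1, l $ 2) (u $ 1, u $ 2))" using meas by (simp add: emeasure_distr pre)
 also have "\<dots> = emeasure (lborel \<Otimes>\<^sub>M lborel) (box (l $ 1) (u $ 1) \<times> box (l $ 2) (u $ 2))"
  by (simp add: lborel_prod box_pair)
 also have "\<dots> = emeasure lborel (box (l $ 1) (u $ 1)) * emeasure lborel (box (l $ 2) (u $ 2))"
  by (intro lborel.emeasure_pair_measure_Times) auto
 also have "\<dots> = (\<Prod>b\<in>Basis. (u - l) \<bullet> b)"
  using le by (simp add: prod_Basis_vec UNIV_2 inner_axis ennreal_mult[symmetric] mult.assoc)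
 finally show "emeasure (distr lborel borel (\<lambda>p. rot2 0 (fst p) (snd p))) (box l u) =
   ennreal (\<Prod>b\<in>Basis. (u - l) \<bullet> b)" .
qed simp

text \<open>The determinant formula concerns images, whereas \<open>distr\<close> measures
  preimages; the rotation by the opposite angle turns one into the other.\<close>

lemma lborel_rotation:
 "distr lborel borel (\<lambda>x :: real^2. rot2 th (x $ 1) (x $ 2)) = lborel"
proof (rule lborel_eqI[symmetric])
 let ?R = "\<lambda>th. \<lambda>x :: real^2. rot2 th (x $ 1) (x $ 2)"
 have meas: "?R th \<in> borel_measurable borel" by (intro borel_measurable_continuous_onI continuous_intros)
 have lin: "linear (?R th)" for th by (rule linearI) (simp_all add: vec_eq_iff forall_2 algebra_simps)
 have "det (matrix (?R th)) = 1" for th by (simp add: det_2 matrix_def axis_def power2_eq_square[symmetric])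
 then have det: "measure lebesgue (?R th ` S) = measure lebesgue S"
  "?R th ` S \<in> lmeasurable" if "S \<in> lmeasurable" for S th
  using measure_linear_image[OF lin that] measurable_linear_image[OF lin that] by auto
 fix l u :: "real^2" assume lu: "!!b. b \<in> Basis ==> l \<bullet> b <= u \<bullet> b"
 have inv1: "?R (- th) (?R th x) = x" and inv2: "?R th (?R (- th) x) = x" for x
 proof -
  have key: "cos th * (cos th * a) + sin th * (sin th * a) = a" for a
  proof -
   have "cos th * (cos th * a) + sin th * (sin th * a) = (cos th * cos th + sin th * sin th) * a"
    by (simp only: distrib_right mult.assoc)
   then show ?thesis by (simp add: sin_cos_squared_add3)
  qed
  show "?R (- th) (?R th x) = x" "?R th (?R (- th) x) = x"
   by (simp_all add: vec_eq_iff forall_2 algebra_simps) (simp_all add: key)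
 qed
 have pre: "?R th -` box l u = ?R (- th) ` box l u"
 proof safe
  fix x assume "?R th x \<in> box l u"
  then show "x \<in> ?R (- th) ` box l u" using inv1[of x] by (intro image_eqI[of _ _ "?R th x"]) simp_all
 next
  fix x assume "x \<in> box l u"
  then show "?R (- th) x \<in> ?R th -` box l u" using inv2[of x] by simp
 qed
 have op: "open (?R th -` box l u)" by (intro open_vimage) (auto intro!: continuous_intros)
 have "emeasure (distr lborel borel (?R th)) (box l u) = emeasure lborel (?R th -` box l u)" using meas by (simp add: emeasure_distr)
 also have "\<dots> = emeasure lebesgue (?R th -` box l u)" using op by simp
 also have "\<dots> = ennreal (measure lebesgue (?R (- th) ` box l u))"
  using det(2)[of "box l u" "- th"] by (simp add: pre emeasure_eq_measure2 del: emeasure_completion)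
 also have "\<dots> = ennreal (measure lebesgue (box l u))" using det(1)[of "box l u" "- th"] by simp
 also have "\<dots> = (\<Prod>b\<in>Basis. (u - l) \<bullet> b)" using lu by (simp add: measure_lborel_box_eq)
 finally show "emeasure (distr lborel borel (?R th)) (box l u) = ennreal (\<Prod>b\<in>Basis. (u - l) \<bullet> b)" .
qed simp

lemma lborel_rot2: "distr lborel borel (\<lambda>p. rot2 th (fst p) (snd p)) = lborel"
proof -
 have m: "(\<lambda>x :: real^2. rot2 th (x $ 1) (x $ 2)) \<in> borel_measurable borel"
  "(\<lambda>p. rot2 0 (fst p) (snd p)) \<in> borel_measurable borel" by (intro borel_measurable_continuous_onI continuous_intros)+
 have "distr (distr lborel borel (\<lambda>p. rot2 0 (fst p) (snd p))) borel (\<lambda>x :: real^2. rot2 th (x $ 1) (x $ 2)) =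
  distr lborel borel (\<lambda>p. rot2 th (fst p) (snd p))" using m by (subst distr_distr) (auto simp: o_def)
 then show ?thesis by (simp add: lborel_rot2_0 lborel_rotation)
qed

text \<open>The nesting \<open>(X, Y, t)\<close> isolates the coordinate \<open>X\<close> along the
  bisector, in which \<open>wedge_divergence\<close> integrates. The map \<open>?g\<close> in the
  proof only reassociates the triple.\<close>

lemma lborel_rot3:
 "distr (lborel \<Otimes>\<^sub>M lborel) borel (\<lambda>(X, Y, t). join3 (rot2 th X Y) t) = (lborel :: (real^3) measure)"
proof -
 have mj: "(\<lambda>p :: (real^2) \<times> real. join3 (fst p) (snd p)) \<in> borel_measurable borel"
  by (intro borel_measurable_continuous_onI continuous_intros)
 have mr: "(\<lambda>p. rot2 th (fst p) (snd p)) \<in> borel_measurable borel" by (intro borel_measurable_continuous_onI continuous_intros)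
 let ?f = "\<lambda>q :: (real \<times> real) \<times> real. (rot2 th (fst (fst q)) (snd (fst q)), snd q)"
 let ?g = "\<lambda>q :: real \<times> real \<times> real. ((fst q, fst (snd q)), snd (snd q))"
 have mg: "?g \<in> borel_measurable borel" and mf: "?f \<in> borel_measurable borel" by (intro borel_measurable_continuous_onI continuous_intros)+
 have g: "distr lborel borel ?g = lborel"
 proof (rule lborel_eqI[symmetric])
  fix l u :: "(real \<times> real) \<times> real" assume lu: "!!b. b \<in> Basis ==> l \<bullet> b <= u \<bullet> b"
  obtain a b c a' b' c' where l: "l = ((a, b), c)" and u: "u = ((a', b'), c')" by (metis prod.exhaust)
  have le: "a <= a'" "b <= b'" "c <= c'"
   using lu[of "((1,0),0)"] lu[of "((0,1),0)"] lu[of "((0,0),1)"] by (auto simp: l u Basis_prod_def zero_prod_def)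
  have "?g -` box l u = box (a, b, c) (a', b', c')" by (auto simp: l u box_pair)
  then have "emeasure (distr lborel borel ?g) (box l u) = emeasure lborel (box (a, b, c) (a', b', c'))" using mg by (simp add: emeasure_distr)
  also have "\<dots> = ennreal (\<Prod>b\<in>Basis. (u - l) \<bullet> b)"
  proof -
   have "(\<Prod>b\<in>Basis. (u - l) \<bullet> b) = (\<Prod>i\<in>Basis. ((a', b', c') - (a, b, c)) \<bullet> i)"
    by (simp add: l u Basis_prod_def prod.union_disjoint prod.reindex inj_on_def
      image_Un image_image disjoint_iff)
   then show ?thesis using le by (subst emeasure_lborel_box) (auto simp: Basis_prod_def)
  qed
  finally show "emeasure (distr lborel borel ?g) (box l u) = ennreal (\<Prod>b\<in>Basis. (u - l) \<bullet> b)" .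
 qed simp
 have f: "distr lborel borel ?f = lborel"
 proof -
  have "distr (lborel \<Otimes>\<^sub>M lborel) (borel \<Otimes>\<^sub>M borel) (\<lambda>(x, y). (rot2 th (fst x) (snd x), y)) =
   distr lborel borel (\<lambda>p. rot2 th (fst p) (snd p)) \<Otimes>\<^sub>M distr lborel borel (\<lambda>y :: real. y)"
   by (subst pair_measure_distr[symmetric])
    (use mr in \<open>auto simp: lborel_rot2 distr_id2 intro: sigma_finite_lborel\<close>)
  then show ?thesis by (simp add: lborel_rot2 lborel_prod distr_id2 borel_prod case_prod_beta')
 qed
 let ?j = "\<lambda>p :: (real^2) \<times> real. join3 (fst p) (snd p)"
 have "lborel = distr (distr (distr lborel borel ?g) borel ?f) borel ?j" unfolding g f lborel_join3 ..
 also have "distr (distr lborel borel ?g) borel ?f = distr lborel borel (?f \<circ> ?g)" using mf mg by (intro distr_distr) simp_all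
 also have "distr (distr lborel borel (?f \<circ> ?g)) borel ?j = distr lborel borel (?j \<circ> (?f \<circ> ?g))"
  using mj mf mg by (intro distr_distr measurable_comp[of _ _ borel]) simp_all
 finally show ?thesis by (simp add: o_def case_prod_beta' lborel_prod)
qed

text \<open>Sections of a Lebesgue measurable function need not be measurable, so Fubini's theorem
  is applied to a Borel function that agrees with it almost everywhere.\<close>

lemma borel_representative:
 fixes f :: "'a::euclidean_space => 'b::euclidean_space"
 assumes "f \<in> borel_measurable lebesgue"
 obtains f' where "f' \<in> borel_measurable borel" "AE x in lborel. f x = f' x"
proof -
 have "\<exists>g. g \<in> borel_measurable lborel \<and> (AE x in lborel. f x \<bullet> b = g x)" for b
  using completion_ex_borel_measurable_real[of "\<lambda>x. f x \<bullet> b" lborel] assms by auto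
 then obtain g where g: "!!b. g b \<in> borel_measurable lborel" "!!b. AE x in lborel. f x \<bullet> b = g b x" by metis
 define f' where "f' x = (\<Sum>b\<in>Basis. g b x *\<^sub>R b)" for x
 have "f' \<in> borel_measurable borel" unfolding f'_def using g(1) by measurable
 moreover have "AE x in lborel. \<forall>b\<in>Basis. f x \<bullet> b = g b x" using g(2) by (intro AE_finite_allI) auto
 then have "AE x in lborel. f x = f' x"
 proof eventually_elim
  case (elim x)
  then have "f' x = (\<Sum>b\<in>Basis. (f x \<bullet> b) *\<^sub>R b)" unfolding f'_def by (intro sum.cong) auto
  then show ?case by (simp add: euclidean_representation)
 qed
 ultimately show ?thesis using that by blast
qed

lemma fubini_join3:
 fixes f :: "real^3 => 'b::euclidean_space"
 assumes f: "integrable lebesgue f"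
 shows "AE y in lebesgue. integrable lebesgue (\<lambda>t. f (join3 y t))"
  and "integrable lebesgue (\<lambda>y. LINT t|lebesgue. f (join3 y t))"
  and "(LINT x|lebesgue. f x) = (LINT y|lebesgue. LINT t|lebesgue. f (join3 y t))"
proof -
 have mj: "(\<lambda>p :: (real^2) \<times> real. join3 (fst p) (snd p)) \<in> borel_measurable borel"
  by (intro borel_measurable_continuous_onI continuous_intros)
 obtain f' where f': "f' \<in> borel_measurable borel" "AE x in lborel. f x = f' x"
  using borel_representative[OF borel_measurable_integrable[OF f]] by blast
 then have ae: "AE x in lebesgue. f x = f' x" by (simp add: AE_completion)
 have fl: "f' \<in> borel_measurable lebesgue" using f' by (simp add: measurable_completion)
 have f'i: "integrable lborel f'" using f ae f' fl integrable_cong_AE[of f lebesgue f'] by (simp add: integrable_completion)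
 let ?F = "\<lambda>p :: (real^2) \<times> real. f' (join3 (fst p) (snd p))"
 have Fi: "integrable (lborel \<Otimes>\<^sub>M lborel) ?F"
  using f'i mj f'(1) integrable_distr_eq[of "\<lambda>p :: (real^2) \<times> real. join3 (fst p) (snd p)" lborel borel f']
  by (simp add: lborel_join3 lborel_prod)
 \<comment> \<open>The set of disagreement is enlarged to a Borel null set, because
   \<open>lborel_join3\<close> controls preimages of Borel sets.\<close>
 have "AE p in lborel. f (join3 (fst p) (snd p)) = f' (join3 (fst p :: real^2) (snd p))"
 proof -
  from f'(2) obtain N where N: "N \<in> null_sets lborel" "{x. f x ~= f' x} \<subseteq> N" by (auto simp: eventually_ae_filter)
  then have "AE x in distr lborel borel (\<lambda>p :: (real^2) \<times> real. join3 (fst p) (snd p)). x \<notin> N"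
   by (simp add: lborel_join3 AE_not_in)
  then have "AE p in lborel. join3 (fst p :: real^2) (snd p) \<notin> N" using N mj by (subst (asm) AE_distr_iff) (auto simp: null_sets_def)
  then show ?thesis by eventually_elim (use N in auto)
 qed
 then have "AE y in lborel. AE t in lborel. f (join3 y t) = f' (join3 y t)" unfolding lborel_prod[symmetric] by (drule_tac lborel_pair.AE_pair) simp
 then have ae2: "AE y in lebesgue. AE t in lebesgue. f (join3 y t) = f' (join3 y t)" by (simp add: AE_completion_iff)
 have ae3: "AE y in lebesgue. integrable lborel (\<lambda>t. f' (join3 y t))" using lborel_pair.AE_integrable_fst'[OF Fi] by (simp add: AE_completion)
 have mt: "(\<lambda>t. f' (join3 y t)) \<in> borel_measurable borel" for y
  by (rule measurable_compose[OF _ f'(1)]) (intro borel_measurable_continuous_onI continuous_intros)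
 have int_iff: "integrable lebesgue (\<lambda>t. f (join3 y t)) \<longleftrightarrow> integrable lborel (\<lambda>t. f' (join3 y t))"
  "(LINT t|lebesgue. f (join3 y t)) = (LINT t|lborel. f' (join3 y t))"
  if a: "AE t in lebesgue. f (join3 y t) = f' (join3 y t)" for y
 proof -
  have m: "(\<lambda>t. f (join3 y t)) \<in> borel_measurable lebesgue" "(\<lambda>t. f' (join3 y t)) \<in> borel_measurable lebesgue"
  proof -
   show 1: "(\<lambda>t. f' (join3 y t)) \<in> borel_measurable lebesgue" using mt by (simp add: measurable_completion)
   show "(\<lambda>t. f (join3 y t)) \<in> borel_measurable lebesgue"
    by (rule borel_measurable_AE[OF 1]) (use a in \<open>auto elim: eventually_mono\<close>)
  qed
  show "integrable lebesgue (\<lambda>t. f (join3 y t)) \<longleftrightarrow> integrable lborel (\<lambda>t. f' (join3 y t))"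
   using integrable_cong_AE[OF m a] mt by (simp add: integrable_completion)
  show "(LINT t|lebesgue. f (join3 y t)) = (LINT t|lborel. f' (join3 y t))" using integral_cong_AE[OF m a] mt by (simp add: integral_completion)
 qed
 show "AE y in lebesgue. integrable lebesgue (\<lambda>t. f (join3 y t))" using ae2 ae3 by eventually_elim (simp add: int_iff)
 have Gi: "integrable lborel (\<lambda>y. LINT t|lborel. f' (join3 y t))" using lborel_pair.integrable_fst'[OF Fi] by simp
 then have Gi': "integrable lebesgue (\<lambda>y. LINT t|lborel. f' (join3 y t))" by (simp add: integrable_completion)
 have aeG: "AE y in lebesgue. (LINT t|lborel. f' (join3 y t)) = (LINT t|lebesgue. f (join3 y t))" using ae2 by eventually_elim (simp add: int_iff)
 have mG: "(\<lambda>y. LINT t|lebesgue. f (join3 y t)) \<in> borel_measurable lebesgue"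
  by (rule borel_measurable_AE[OF borel_measurable_integrable[OF Gi'] aeG])
 show "integrable lebesgue (\<lambda>y. LINT t|lebesgue. f (join3 y t))"
  using integrable_cong_AE[OF borel_measurable_integrable[OF Gi'] mG aeG] Gi' by simp
 have "(LINT x|lebesgue. f x) = (LINT x|lborel. f' x)" using integral_cong_AE[OF _ fl ae] f f' by (simp add: integral_completion)
 also have "\<dots> = (LINT p|(lborel \<Otimes>\<^sub>M lborel). ?F p)"
  using integral_distr[of "\<lambda>p :: (real^2) \<times> real. join3 (fst p) (snd p)" lborel borel f'] mj f'(1)
  by (simp add: lborel_join3 lborel_prod)
 also have "\<dots> = (LINT y|lborel. LINT t|lborel. f' (join3 y t))" using lborel_pair.integral_fst'[OF Fi] by simp
 also have "\<dots> = (LINT y|lebesgue. LINT t|lborel. f' (join3 y t))" using Gi by (simp add: integral_completion)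
 also have "\<dots> = (LINT y|lebesgue. LINT t|lebesgue. f (join3 y t))" using integral_cong_AE[OF borel_measurable_integrable[OF Gi'] mG aeG] .
 finally show "(LINT x|lebesgue. f x) = (LINT y|lebesgue. LINT t|lebesgue. f (join3 y t))" .
qed

section \<open>Hausdorff measure of Lipschitz boundaries\<close>

lemma norm_le_sum2: "norm (x :: real^2) <= \<bar>x $ 1\<bar> + \<bar>x $ 2\<bar>" using norm_le_l1_cart[of x] by (simp add: sum_2)

lemma norm_le_sum3: "norm (x :: real^3) <= \<bar>x $ 1\<bar> + \<bar>x $ 2\<bar> + \<bar>x $ 3\<bar>"
 using norm_le_l1_cart[of x] by (simp add: sum_3)

lemma unit_subinterval_ex:
 assumes "0 <= s" "s <= real N" "N >= 1" shows "\<exists>i<N. real i <= s \<and> s <= real i + 1"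
proof (cases "s = real N")
 case True
 then show ?thesis using assms by (intro exI[of _ "N - 1"]) (auto simp: of_nat_diff)
next
 case False
 then have "s < real N" using assms by auto
 moreover have "real (nat \<lfloor>s\<rfloor>) = of_int \<lfloor>s\<rfloor>" using assms(1) by simp
 moreover have "of_int \<lfloor>s\<rfloor> <= s" "s < of_int \<lfloor>s\<rfloor> + 1" by linarith+
 ultimately have "real (nat \<lfloor>s\<rfloor>) < real N" "real (nat \<lfloor>s\<rfloor>) <= s" "s <= real (nat \<lfloor>s\<rfloor>) + 1"
  by linarith+
 then show ?thesis unfolding of_nat_less_iff by blast
qed

text \<open>Cutting the square into N^2 squares of side d = 2a/N gives pieces whose images have
  diameter at most 2 C d. Their total weight N^2 pi (C d)^2 = 4 pi C^2 a^2 does not depend on N,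
  while the diameters become arbitrarily small.\<close>

lemma hausdorff2_lipschitz_image_finite:
 fixes f :: "real^2 => real^3"
 assumes a: "a > 0" and C: "C >= 0"
  and lip: "!!x y. dist (f x) (f y) <= C * dist x y"
 shows "hausdorff2 (f ` {x. \<bar>x $ 1\<bar> <= a \<and> \<bar>x $ 2\<bar> <= a}) < top"
proof -
 let ?S = "{x :: real^2. \<bar>x $ 1\<bar> <= a \<and> \<bar>x $ 2\<bar> <= a}"
 have "hausdorff2_delta de (f ` ?S) <= ennreal (4 * pi * C\<^sup>2 * a\<^sup>2)" if de: "de > 0" for de
 proof -
  obtain N :: nat where "4 * C * a / de < real N" using reals_Archimedean2 by blast
  moreover have "0 <= 4 * C * a / de" using a C de by simp
  ultimately have N: "4 * C * a / de < real N" "real N > 0" by linarith+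
  then have N1: "N >= 1" by simp
  define d where "d = 2 * a / real N"
  have d: "d > 0" using a N by (simp add: d_def)
  have Cd: "2 * C * d <= de" using N de by (simp add: d_def field_simps)
  define Q where "Q i j = {x :: real^2. - a + d * real i <= x $ 1 \<and> x $ 1 <= - a + d * (real i + 1) \<and>
   - a + d * real j <= x $ 2 \<and> x $ 2 <= - a + d * (real j + 1)}" for i j :: nat
  define U where "U k = (if k < N * N then f ` Q (k div N) (k mod N) else {})" for k
  have Qd: "dist x y <= 2 * d" if "x \<in> Q i j" "y \<in> Q i j" for x y i j
  proof -
   have "norm (x - y) <= \<bar>x $ 1 - y $ 1\<bar> + \<bar>x $ 2 - y $ 2\<bar>" using norm_le_sum2[of "x - y"] by simp
   also have "\<dots> <= d + d" using that by (intro add_mono) (auto simp: Q_def abs_le_iff algebra_simps)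
   finally show ?thesis by (simp add: dist_norm)
  qed
  have Ud: "dist x y <= 2 * C * d" if "x \<in> U k" "y \<in> U k" for x y k
  proof -
   from that obtain p q where pq: "x = f p" "y = f q" "p \<in> Q (k div N) (k mod N)" "q \<in> Q (k div N) (k mod N)"
    by (auto simp: U_def split: if_splits)
   have "dist (f p) (f q) <= C * (2 * d)" by (rule order_trans[OF lip mult_left_mono[OF Qd[OF pq(3,4)] C]])
   then show ?thesis using pq by (simp add: mult.assoc mult.left_commute)
  qed
  have Ub: "bounded (U k)" for k unfolding bounded_any_center[of _ "SOME x. x \<in> U k"] by (metis Ud someI)
  have Udiam: "diameter (U k) <= 2 * C * d" for k using Ud[of _ k] C d by (intro diameter_le) (auto simp: dist_norm)
  have cover: "f ` ?S \<subseteq> (\<Union>k. U k)"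
  proof (safe)
   fix x :: "real^2" assume x: "\<bar>x $ 1\<bar> <= a" "\<bar>x $ 2\<bar> <= a"
   have "\<exists>i<N. real i <= (s + a) / d \<and> (s + a) / d <= real i + 1" if "\<bar>s\<bar> <= a" for s
   proof (rule unit_subinterval_ex)
    show "(s + a) / d <= real N" using that a N by (simp add: d_def field_simps)
   qed (use that d N1 in auto)
   then obtain i j where ij: "i < N" "j < N" "real i <= (x $ 1 + a) / d" "(x $ 1 + a) / d <= real i + 1"
    "real j <= (x $ 2 + a) / d" "(x $ 2 + a) / d <= real j + 1" using x by metis
   have "x \<in> Q i j" using ij d by (auto simp: Q_def field_simps)
   moreover have "i * N + j < N * N"
   proof -
    have "i * N + j < Suc i * N" using ij by simp
    also have "\<dots> <= N * N" using ij by (intro mult_right_mono) auto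
    finally show ?thesis .
   qed
   moreover have "(i * N + j) div N = i" "(i * N + j) mod N = j" using ij by auto
   ultimately have "f x \<in> U (i * N + j)" by (auto simp: U_def)
   then show "f x \<in> (\<Union>k. U k)" by blast
  qed
  have "hausdorff2_delta de (f ` ?S) <= (\<Sum>k. ennreal (pi * (diameter (U k) / 2)^2))"
   using cover Ub order_trans[OF Udiam Cd] by (intro hausdorff2_delta_le) auto
  also have "\<dots> = (\<Sum>k<N * N. ennreal (pi * (diameter (U k) / 2)^2))" by (intro suminf_finite) (auto simp: U_def)
  also have "\<dots> <= (\<Sum>k<N * N. ennreal (pi * (C * d)^2))"
  proof (intro sum_mono ennreal_leI mult_left_mono power_mono)
   fix k show "diameter (U k) / 2 <= C * d" using Udiam[of k] by simp
   show "0 <= diameter (U k) / 2" using diameter_ge_0[OF Ub[of k]] by simp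
  qed auto
  also have "\<dots> = ennreal (real (N * N) * (pi * (C * d)^2))" by (simp add: ennreal_of_nat_eq_real_of_nat ennreal_mult)
  also have "real (N * N) * (pi * (C * d)^2) = 4 * pi * C\<^sup>2 * a\<^sup>2" using N by (simp add: d_def power2_eq_square field_simps)
  finally show ?thesis .
 qed
 then have "hausdorff2 (f ` ?S) <= ennreal (4 * pi * C\<^sup>2 * a\<^sup>2)" unfolding hausdorff2_def by (intro SUP_least) auto
 then show ?thesis using le_less_trans ennreal_less_top by blast
qed

text \<open>The preimage of a covering set of diameter d lies in a disk of radius d, and pi d^2 is
  four times the weight pi (d/2)^2. The constant 4 is crude, but only its finiteness
  matters.\<close>

lemma area_le_hausdorff2:
 fixes gr :: "real \<times> real => real^3"
 assumes exp: "!!p q. dist p q <= dist (gr p) (gr q)"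
 assumes meas: "gr \<in> borel_measurable borel" and E: "E \<in> sets borel"
 shows "emeasure lborel (gr -` E) <= 4 * hausdorff2 E"
proof -
 have mE: "gr -` E \<in> sets borel" using measurable_sets[OF meas E] by simp
 have "ennreal (1/4) * emeasure lborel (gr -` E) <= hausdorff2_delta 1 E" unfolding hausdorff2_delta_def
 proof (intro INF_greatest)
  fix U :: "nat => (real^3) set"
  assume "U \<in> {U. E \<subseteq> (\<Union>n. U n) \<and> (\<forall>n. bounded (U n) \<and> diameter (U n) <= 1)}"
  then have U: "E \<subseteq> (\<Union>n. U n)" "\<forall>n. bounded (U n) \<and> diameter (U n) <= 1" by auto
  define C where "C n = (if gr -` U n = {} then {} else cball (SOME p. gr p \<in> U n) (diameter (U n)))" for n
  have sub: "gr -` U n \<subseteq> C n" for n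
  proof
   fix p assume p: "p \<in> gr -` U n"
   let ?a = "SOME p. gr p \<in> U n"
   have a: "gr ?a \<in> U n" using p someI[of "\<lambda>p. gr p \<in> U n" p] by auto
   have "dist ?a p <= dist (gr ?a) (gr p)" by (rule exp)
   also have "\<dots> <= diameter (U n)" using a p U(2) by (intro diameter_bounded_bound) auto
   finally show "p \<in> C n" using p by (auto simp: C_def)
  qed
  have C: "C n \<in> sets lborel" "emeasure lborel (C n) <= ennreal 4 * ennreal (pi * (diameter (U n) / 2)^2)" for n
  proof -
   show "C n \<in> sets lborel" by (simp add: C_def)
   have d0: "0 <= diameter (U n)" using U(2) diameter_ge_0 by blast
   have "ennreal 4 * ennreal (pi * (diameter (U n) / 2)^2) = ennreal (4 * (pi * (diameter (U n) / 2)^2))" by (rule ennreal_mult[symmetric]) auto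
   also have "4 * (pi * (diameter (U n) / 2)^2) = pi * (diameter (U n))^2" by (simp add: power_divide)
   finally show "emeasure lborel (C n) <= ennreal 4 * ennreal (pi * (diameter (U n) / 2)^2)"
    using d0 by (simp only:) (simp add: C_def emeasure_cball unit_ball_vol_2 power2_eq_square)
  qed
  have "emeasure lborel (gr -` E) <= emeasure lborel (\<Union>n. C n)" using U(1) sub C(1) by (intro emeasure_mono) blast+
  also have "\<dots> <= (\<Sum>n. emeasure lborel (C n))" using C(1) by (intro emeasure_subadditive_countably) auto
  also have "\<dots> <= (\<Sum>n. ennreal 4 * ennreal (pi * (diameter (U n) / 2)^2))" using C(2) by (intro suminf_le summableI) auto
  also have "\<dots> = ennreal 4 * (\<Sum>n. ennreal (pi * (diameter (U n) / 2)^2))" by simp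
  finally have "ennreal (1/4) * emeasure lborel (gr -` E) <=
    ennreal (1/4) * (ennreal 4 * (\<Sum>n. ennreal (pi * (diameter (U n) / 2)^2)))" by (intro mult_left_mono) auto
  also have "\<dots> = (\<Sum>n. ennreal (pi * (diameter (U n) / 2)^2))" by (simp only: mult.assoc[symmetric] ennreal_mult[symmetric]) simp
  finally show "ennreal (1/4) * emeasure lborel (gr -` E) <= (\<Sum>n. ennreal (pi * (diameter (U n) / 2)^2))" .
 qed
 also have "\<dots> <= hausdorff2 E" unfolding hausdorff2_def by (intro SUP_upper) auto
 finally have "ennreal 4 * (ennreal (1/4) * emeasure lborel (gr -` E)) <= ennreal 4 * hausdorff2 E" by (intro mult_left_mono) auto
 then show ?thesis by (simp only: mult.assoc[symmetric] ennreal_mult[symmetric]) simp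
qed

text \<open>Lets smallness of boundary values with respect to the surface measure control integrals
  over the plane that parametrises the faces.\<close>

lemma nn_integral_graph_le:
 fixes gr :: "real \<times> real => real^3"
 assumes exp: "!!p q. dist p q <= dist (gr p) (gr q)"
 assumes meas: "gr \<in> borel_measurable borel" and F: "F \<in> borel_measurable borel"
 shows "(\<integral>\<^sup>+p. F (gr p) \<partial>lborel) <= 4 * (\<integral>\<^sup>+x. F x \<partial>surface_measure)"
proof -
 have "distr lborel surface_measure gr <= scale_measure 4 surface_measure" using area_le_hausdorff2[OF exp meas] meas
  by (subst le_measure) (auto simp: emeasure_distr emeasure_surface_measure cong: measurable_cong_sets)
 then have "nn_integral (distr lborel surface_measure gr) F <= nn_integral (scale_measure 4 surface_measure) F"
  by (intro nn_integral_mono_measure) auto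
 moreover have "nn_integral (distr lborel surface_measure gr) F = (\<integral>\<^sup>+p. F (gr p) \<partial>lborel)"
  using meas F by (intro nn_integral_distr) (auto cong: measurable_cong_sets)
 moreover have "nn_integral (scale_measure 4 surface_measure) F = 4 * (\<integral>\<^sup>+x. F x \<partial>surface_measure)"
  using F by (intro nn_integral_scale_measure) (auto cong: measurable_cong_sets)
 ultimately show ?thesis by simp
qed

text \<open>Locally the frontier lies in the graph of the Lipschitz function, a Lipschitz image of a
  square, and finitely many such pieces cover the compact frontier. Finiteness is what turns L2
  bounds on the frontier into L1 bounds.\<close>

lemma emeasure_frontier_lipschitz_domain:
 assumes "bounded_lipschitz_domain Om"
 shows "emeasure surface_measure (frontier Om) < top"
proof -
 have Om: "open Om" "bounded Om" and loc: "!!p. p \<in> frontier Om ==> \<exists>r>0. \<exists>Q \<gamma> C.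
   orthogonal_transformation Q \<and> C-lipschitz_on UNIV \<gamma> \<and>
   Om \<inter> ball p r = {x \<in> ball p r. \<gamma> (proj2 (Q (x - p))) < Q (x - p) $ 3}"
  using assms unfolding bounded_lipschitz_domain_def by blast+
 have fin: "\<exists>r>0. hausdorff2 (frontier Om \<inter> ball p r) < top" if p: "p \<in> frontier Om" for p
 proof -
  obtain r Q \<gamma> C where r: "r > 0" and Q: "orthogonal_transformation Q" and \<gamma>: "C-lipschitz_on UNIV \<gamma>"
   and eq: "Om \<inter> ball p r = {x \<in> ball p r. \<gamma> (proj2 (Q (x - p))) < Q (x - p) $ 3}" using loc[OF p] by blast
  have linQ: "linear Q" using Q by (rule orthogonal_transformation_linear)
  have cont\<gamma>: "continuous_on UNIV \<gamma>" using \<gamma> by (rule lipschitz_on_continuous_on)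
  have contQ: "continuous_on UNIV (\<lambda>x. Q (x - p))"
   using linear_continuous_on_compose[OF _ linQ, of UNIV "\<lambda>x. x - p"] by (simp add: continuous_on_diff)
  have cont2: "continuous_on UNIV (\<lambda>x. \<gamma> (proj2 (Q (x - p))))"
   by (rule continuous_on_compose2[OF cont\<gamma>]) (auto intro!: continuous_intros contQ)
  obtain Q' where Q': "!!x. Q (Q' x) = x" "!!x. Q' (Q x) = x" "orthogonal_transformation Q'"
   using orthogonal_transformation_bij[OF Q] orthogonal_transformation_inv[OF Q] by (metis bij_inv_eq_iff)
  have C: "C >= 0" using \<gamma> lipschitz_on_nonneg by blast
  define f where "f y = p + Q' (join3 y (\<gamma> y))" for y
  have nQ': "norm (Q' x) = norm x" for x using Q'(3) by (simp add: orthogonal_transformation)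
  have lip: "dist (f x) (f y) <= (2 + C) * dist x y" for x y
  proof -
   have "f x - f y = Q' (join3 (x - y) (\<gamma> x - \<gamma> y))" unfolding f_def add_diff_cancel_left
    by (subst linear_diff[OF orthogonal_transformation_linear[OF Q'(3)], symmetric])
     (rule arg_cong[where f = Q'], simp add: vec_eq_iff forall_3)
   then have "dist (f x) (f y) = norm (join3 (x - y) (\<gamma> x - \<gamma> y))" by (simp add: dist_norm nQ')
   also have "\<dots> <= \<bar>(x - y) $ 1\<bar> + \<bar>(x - y) $ 2\<bar> + \<bar>\<gamma> x - \<gamma> y\<bar>"
    using norm_le_sum3[of "join3 (x - y) (\<gamma> x - \<gamma> y)"] by simp
   also have "\<dots> <= norm (x - y) + norm (x - y) + C * norm (x - y)"
    using component_le_norm_cart[of "x - y"] lipschitz_onD[OF \<gamma>, of x y] by (intro add_mono) (auto simp: dist_norm)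
   finally show ?thesis by (simp add: dist_norm algebra_simps)
  qed
  have "frontier Om \<inter> ball p r \<subseteq> f ` {y. \<bar>y $ 1\<bar> <= r \<and> \<bar>y $ 2\<bar> <= r}"
  proof
   fix x assume x: "x \<in> frontier Om \<inter> ball p r"
   then have xn: "x \<notin> Om" and xc: "x \<in> closure Om" using Om(1) by (auto simp: frontier_def interior_open)
   have "\<not> \<gamma> (proj2 (Q (x - p))) < Q (x - p) $ 3" using xn x eq by blast
   \<comment> \<open>A point strictly below the graph has a neighbourhood disjoint from
     \<open>Om\<close>, so it is not in the closure.\<close>
   moreover have "\<not> \<gamma> (proj2 (Q (x - p))) > Q (x - p) $ 3"
   proof
    assume g: "\<gamma> (proj2 (Q (x - p))) > Q (x - p) $ 3"
    let ?V = "{x. Q (x - p) $ 3 < \<gamma> (proj2 (Q (x - p)))} \<inter> ball p r"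
    have "open ?V" by (intro open_Int open_ball open_Collect_less cont2 continuous_intros contQ)
    moreover have "x \<in> ?V" using g x by auto
    moreover have "?V \<inter> Om = {}"
    proof (rule equals0I)
     fix y assume "y \<in> ?V \<inter> Om"
     then have "y \<in> Om \<inter> ball p r" "Q (y - p) $ 3 < \<gamma> (proj2 (Q (y - p)))" by auto
     then show False unfolding eq by auto
    qed
    ultimately show False using xc open_Int_closure_eq_empty by blast
   qed
   ultimately have e: "\<gamma> (proj2 (Q (x - p))) = Q (x - p) $ 3" by linarith
   let ?y = "proj2 (Q (x - p))"
   have "x = f ?y" unfolding f_def e by (simp add: Q'(2))
   moreover have "\<bar>?y $ 1\<bar> <= r \<and> \<bar>?y $ 2\<bar> <= r"
   proof -
    have "norm (Q (x - p)) = norm (x - p)" using Q by (simp add: orthogonal_transformation)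
    then have "norm (Q (x - p)) <= r" using x by (simp add: dist_norm norm_minus_commute)
    then show ?thesis using component_le_norm_cart[of "Q (x - p)" 1] component_le_norm_cart[of "Q (x - p)" 2] by auto
   qed
   ultimately show "x \<in> f ` {y. \<bar>y $ 1\<bar> <= r \<and> \<bar>y $ 2\<bar> <= r}" by (intro image_eqI[of _ f ?y]) auto
  qed
  then have "hausdorff2 (frontier Om \<inter> ball p r) <= hausdorff2 (f ` {y. \<bar>y $ 1\<bar> <= r \<and> \<bar>y $ 2\<bar> <= r})"
   by (rule hausdorff2_mono)
  also have "\<dots> < top" using C by (intro hausdorff2_lipschitz_image_finite[OF r _ lip]) auto
  finally show ?thesis using r by blast
 qed
 then obtain r where r: "!!p. p \<in> frontier Om ==> r p > 0"
   "!!p. p \<in> frontier Om ==> hausdorff2 (frontier Om \<inter> ball p (r p)) < top" by metis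
 have "compact (frontier Om)" using Om(2) by (simp add: compact_frontier_bounded)
 then obtain D where D: "D \<subseteq> frontier Om" "finite D" "frontier Om \<subseteq> (\<Union>p\<in>D. ball p (r p))"
  using r(1) by (elim compactE_image[of _ "frontier Om" "\<lambda>p. ball p (r p)"]) force+
 have m: "frontier Om \<inter> ball p (r p) \<in> sets borel" for p by (intro sets.Int) auto
 have "emeasure surface_measure (frontier Om) <= emeasure surface_measure (\<Union>p\<in>D. frontier Om \<inter> ball p (r p))"
  using D m by (intro emeasure_mono) (auto intro!: sets.finite_UN)
 also have "\<dots> <= (\<Sum>p\<in>D. emeasure surface_measure (frontier Om \<inter> ball p (r p)))"
  using D m by (intro emeasure_subadditive_finite) auto
 also have "\<dots> < top" using D r(2) m by (intro ennreal_sum_less_top[THEN iffD2]) (auto simp: emeasure_surface_measure)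
 finally show ?thesis .
qed

text \<open>The sphere is covered by spherical coordinates on a square; the half-side 10 is a round
  number above 2 pi, so the square contains full periods of both angles.\<close>

lemma emeasure_sphere: "emeasure surface_measure (sphere (0::real^3) 1) < top"
proof -
 define f :: "real^2 => real^3" where
  "f y = vector [cos (y $ 1) * cos (y $ 2), cos (y $ 1) * sin (y $ 2), sin (y $ 1)]" for y
 have c: "\<bar>cos a - cos b\<bar> <= \<bar>a - b\<bar>" and s: "\<bar>sin a - sin b\<bar> <= \<bar>a - b\<bar>" for a b :: real
 proof -
  have "norm (cos a - cos b) <= 1 * norm (a - b)"
   by (rule field_differentiable_bound[of UNIV _ "\<lambda>x. - sin x"]) (auto intro!: derivative_eq_intros)
  then show "\<bar>cos a - cos b\<bar> <= \<bar>a - b\<bar>" by simp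
  have "norm (sin a - sin b) <= 1 * norm (a - b)"
   by (rule field_differentiable_bound[of UNIV _ "\<lambda>x. cos x"]) (auto intro!: derivative_eq_intros)
  then show "\<bar>sin a - sin b\<bar> <= \<bar>a - b\<bar>" by simp
 qed
 have pr: "\<bar>u * v - u' * v'\<bar> <= \<bar>u - u'\<bar> + \<bar>v - v'\<bar>" if "\<bar>v\<bar> <= 1" "\<bar>u'\<bar> <= 1" for u v u' v' :: real
 proof -
  have "u * v - u' * v' = (u - u') * v + u' * (v - v')" by (simp add: algebra_simps)
  also have "\<bar>\<dots>\<bar> <= \<bar>u - u'\<bar> * \<bar>v\<bar> + \<bar>u'\<bar> * \<bar>v - v'\<bar>" by (metis abs_mult abs_triangle_ineq)
  also have "\<dots> <= \<bar>u - u'\<bar> * 1 + 1 * \<bar>v - v'\<bar>" using that by (intro add_mono mult_mono) auto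
  finally show ?thesis by simp
 qed
 have lip: "dist (f x) (f y) <= 5 * dist x y" for x y
 proof -
  have "dist (f x) (f y) <= \<bar>(f x - f y) $ 1\<bar> + \<bar>(f x - f y) $ 2\<bar> + \<bar>(f x - f y) $ 3\<bar>"
   using norm_le_sum3 by (simp only: dist_norm)
  also have "\<dots> <= (\<bar>x $ 1 - y $ 1\<bar> + \<bar>x $ 2 - y $ 2\<bar>) + (\<bar>x $ 1 - y $ 1\<bar> + \<bar>x $ 2 - y $ 2\<bar>) + \<bar>x $ 1 - y $ 1\<bar>"
   unfolding f_def vector_minus_component vector_3 by (intro add_mono order_trans[OF pr] c s) auto
  also have "\<dots> <= 5 * dist x y" using component_le_norm_cart[of "x - y" 1] component_le_norm_cart[of "x - y" 2] by (simp add: dist_norm)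
  finally show ?thesis .
 qed
 have "sphere 0 1 \<subseteq> f ` {y. \<bar>y $ 1\<bar> <= 10 \<and> \<bar>y $ 2\<bar> <= 10}"
 proof
  fix x :: "real^3" assume "x \<in> sphere 0 1"
  then have n: "(x $ 1)\<^sup>2 + (x $ 2)\<^sup>2 + (x $ 3)\<^sup>2 = 1" by (simp add: norm_eq_1 inner_vec_def sum_3 power2_eq_square)
  define rh where "rh = sqrt ((x $ 1)\<^sup>2 + (x $ 2)\<^sup>2)"
  have rh: "rh\<^sup>2 = (x $ 1)\<^sup>2 + (x $ 2)\<^sup>2" "rh >= 0" by (auto simp: rh_def)
  then obtain a where a: "0 <= a" "a < 2 * pi" "rh = cos a" "x $ 3 = sin a" using sincos_total_2pi[of rh "x $ 3"] n by metis
  obtain b where b: "0 <= b" "b < 2 * pi" "x $ 1 = rh * cos b" "x $ 2 = rh * sin b"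
  proof (cases "rh = 0")
   case True
   then have "x $ 1 = 0" "x $ 2 = 0" using rh(1) by (auto simp: sum_power2_eq_zero_iff)
   then show ?thesis using that[of 0] True by simp
  next
   case False
   then have "(x $ 1 / rh)\<^sup>2 + (x $ 2 / rh)\<^sup>2 = 1"
    using rh(1) by (simp only: power_divide add_divide_distrib[symmetric] rh(1)[symmetric]) simp
   then obtain b where "0 <= b" "b < 2 * pi" "x $ 1 / rh = cos b" "x $ 2 / rh = sin b" using sincos_total_2pi by metis
   then show ?thesis using that[of b] False by (simp add: field_simps)
  qed
  have "2 * pi < 10" using pi_less_4 by simp
  then show "x \<in> f ` {y. \<bar>y $ 1\<bar> <= 10 \<and> \<bar>y $ 2\<bar> <= 10}"
   using a b by (intro image_eqI[of _ f "vector [a, b]"]) (auto simp: f_def vec_eq_iff forall_3 vector_2)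
 qed
 then have "hausdorff2 (sphere 0 1) <= hausdorff2 (f ` {y. \<bar>y $ 1\<bar> <= 10 \<and> \<bar>y $ 2\<bar> <= 10})"
  by (rule hausdorff2_mono)
 also have "\<dots> < top" by (intro hausdorff2_lipschitz_image_finite[OF _ _ lip]) auto
 finally show ?thesis by (simp add: emeasure_surface_measure)
qed

section \<open>The wedge\<close>

text \<open>\<open>cX\<close> and \<open>cY\<close> are the coordinates in the orthonormal frame
  whose first vector points along the bisector of angle \<open>th\<close>.\<close>

definition cX :: "real => real^2 => real" where "cX th x = x $ 1 * cos th + x $ 2 * sin th"
definition cY :: "real => real^2 => real" where "cY th x = x $ 2 * cos th - x $ 1 * sin th"

text \<open>The wedge with bisector of angle \<open>th\<close> and half-opening \<open>be\<close> is the positivity set of this function,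
 also when it is not convex.\<close>

definition ell :: "real => real => real^2 => real"
 where "ell th be x = cX th x * sin be - \<bar>cY th x\<bar> * cos be"

lemma cos_sin_mult: "cos th * (cos th * a) + sin th * (sin th * a) = (a :: real)"
proof -
 have "cos th * (cos th * a) + sin th * (sin th * a) = (cos th * cos th + sin th * sin th) * a"
  by (simp only: distrib_right mult.assoc)
 then show ?thesis by (simp add: sin_cos_squared_add3)
qed

lemma cX_rot2 [simp]: "cX th (rot2 th X Y) = X" and cY_rot2 [simp]: "cY th (rot2 th X Y) = Y"
 using cos_sin_mult[of th X] cos_sin_mult[of th Y] by (simp_all add: cX_def cY_def algebra_simps)

lemma rot2_cX_cY [simp]: "rot2 th (cX th x) (cY th x) = x" using cos_sin_mult[of th "x $ 1"] cos_sin_mult[of th "x $ 2"]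
 by (simp add: cX_def cY_def vec_eq_iff forall_2 algebra_simps)

lemma norm_sq_vec2: "(norm (x :: real^2))\<^sup>2 = (x $ 1)\<^sup>2 + (x $ 2)\<^sup>2"
 by (simp only: power2_norm_eq_inner) (simp add: inner_vec_def sum_2 power2_eq_square)

lemma norm_rot2: "(norm (rot2 th X Y))\<^sup>2 = X\<^sup>2 + Y\<^sup>2"
 using cos_sin_mult[of th "X * X"] cos_sin_mult[of th "Y * Y"] unfolding norm_sq_vec2 by (simp add: power2_eq_square algebra_simps)

lemma norm_cX_cY: "(norm x)\<^sup>2 = (cX th x)\<^sup>2 + (cY th x)\<^sup>2"
 using norm_rot2[of th "cX th x" "cY th x"] by simp

lemma abs_cX_le: "\<bar>cX th x\<bar> <= norm x" and abs_cY_le: "\<bar>cY th x\<bar> <= norm x"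
 using norm_cX_cY[of x th] abs_le_square_iff[of "cX th x" "norm x"] abs_le_square_iff[of "cY th x" "norm x"] by simp_all

lemma cX_add: "cX th (x + y) = cX th x + cX th y" and cY_add: "cY th (x + y) = cY th x + cY th y"
 and cX_scaleR: "cX th (r *\<^sub>R x) = r * cX th x" and cY_scaleR: "cY th (r *\<^sub>R x) = r * cY th x"
 by (simp_all add: cX_def cY_def algebra_simps)

lemma bounded_linear_cX: "bounded_linear (cX th)" and bounded_linear_cY: "bounded_linear (cY th)"
proof -
 have "linear (cX th)" "linear (cY th)" by (auto intro!: linearI simp: cX_add cY_add cX_scaleR cY_scaleR)
 then show "bounded_linear (cX th)" "bounded_linear (cY th)" using linear_conv_bounded_linear by auto
qed

lemmas continuous_on_cX [continuous_intros] = bounded_linear.continuous_on[OF bounded_linear_cX]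
lemmas continuous_on_cY [continuous_intros] = bounded_linear.continuous_on[OF bounded_linear_cY]

lemma continuous_on_ell [continuous_intros]: "continuous_on S f ==> continuous_on S (\<lambda>x. ell th be (f x))"
 unfolding ell_def by (intro continuous_intros)

definition e2 :: "real => real^2" where "e2 th = rot2 th 1 0"

lemma cX_e2 [simp]: "cX th (e2 th) = 1" and cY_e2 [simp]: "cY th (e2 th) = 0" by (simp_all add: e2_def)

lemma norm_e2 [simp]: "norm (e2 th) = 1"
 using norm_cX_cY[of "e2 th" th] by (simp add: power2_eq_1_iff) (metis abs_norm_cancel abs_minus_cancel abs_one)

lemma ell_add_e2: "ell th be (x + s *\<^sub>R e2 th) = ell th be x + s * sin be"
 by (simp add: ell_def cX_add cY_add cX_scaleR cY_scaleR algebra_simps)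

lemma ell_scaleR: "r >= 0 ==> ell th be (r *\<^sub>R x) = r * ell th be x"
 by (simp add: ell_def cX_scaleR cY_scaleR abs_mult algebra_simps)

lemma ell_0 [simp]: "ell th be 0 = 0" using ell_scaleR[of 0 th be 0] by simp

lemma ell_le: "ell th be x <= 2 * norm x"
proof -
 have "cX th x * sin be <= \<bar>cX th x\<bar> * 1"
  by (metis abs_ge_self abs_mult abs_sin_le_one mult_left_mono abs_ge_zero order_trans)
 moreover have "- \<bar>cY th x\<bar> * cos be <= \<bar>cY th x\<bar> * 1"
  using cos_ge_minus_one[of be] mult_left_mono[of "- cos be" 1 "\<bar>cY th x\<bar>"] by simp
 ultimately show ?thesis using abs_cX_le[of th x] abs_cY_le[of th x] by (simp add: ell_def)
qed

text \<open>A point of the closed wedge makes an angle of at most \<open>be\<close> with the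
  bisector. The bound keeps the pole of the later kernel away from the wedge, also for obtuse
  \<open>be\<close>.\<close>

lemma cX_lower_bound:
 assumes "ell th be x >= 0" "0 < be" "be < pi"
 shows "cX th x >= - \<bar>cos be\<bar> * norm x"
proof (cases "cX th x >= 0")
 case True
 have "- \<bar>cos be\<bar> * norm x <= 0" by simp
 then show ?thesis using True by linarith
next
 case False
 have s: "sin be > 0" using assms by (simp add: sin_gt_zero)
 have "\<bar>cX th x\<bar> * sin be <= - \<bar>cY th x\<bar> * cos be" using assms(1) False by (simp add: ell_def)
 also have "\<dots> <= \<bar>cY th x\<bar> * \<bar>cos be\<bar>"
  using mult_left_mono[of "- cos be" "\<bar>cos be\<bar>" "\<bar>cY th x\<bar>"] by simp
 finally have "(\<bar>cX th x\<bar> * sin be)\<^sup>2 <= (\<bar>cY th x\<bar> * \<bar>cos be\<bar>)\<^sup>2"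
  using s by (intro power_mono) auto
 then have "(cX th x)\<^sup>2 * (1 - (cos be)\<^sup>2) <= (cY th x)\<^sup>2 * (cos be)\<^sup>2"
  by (simp add: power_mult_distrib sin_squared_eq)
 then have "(cX th x)\<^sup>2 <= ((cX th x)\<^sup>2 + (cY th x)\<^sup>2) * (cos be)\<^sup>2" by (simp add: algebra_simps)
 then have "(cX th x)\<^sup>2 <= (\<bar>cos be\<bar> * norm x)\<^sup>2"
  by (simp add: norm_cX_cY[of x th] power_mult_distrib mult.commute)
 then have "\<bar>cX th x\<bar> <= \<bar>\<bar>cos be\<bar> * norm x\<bar>" by (simp only: abs_le_square_iff)
 then show ?thesis by simp
qed

lemma arg2_polar:
 fixes x :: "real^2"
 defines "th \<equiv> arg2 x"
 shows "x $ 1 = norm x * cos th" "x $ 2 = norm x * sin th" "- pi < th" "th <= pi"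
proof -
 let ?z = "Complex (x $ 1) (x $ 2)"
 have n: "cmod ?z = norm x" by (simp add: cmod_def norm_vec_def L2_set_def sum_2)
 have "?z = rcis (cmod ?z) (Arg ?z)" by (simp add: rcis_cmod_Arg)
 then have "Re ?z = Re (rcis (norm x) th)" "Im ?z = Im (rcis (norm x) th)" by (auto simp: n th_def arg2_def)
 then show "x $ 1 = norm x * cos th" "x $ 2 = norm x * sin th" by simp_all
 show "- pi < th" "th <= pi" using Arg_bounded[of ?z] by (auto simp: th_def arg2_def)
qed

text \<open>With \<open>de\<close> the angular deviation from the bisector, \<open>ell\<close> is
  the norm times sin (be - |de|). Since \<open>arg2\<close> is a principal value, the deviation is
  not reduced modulo 2 pi; for |de| > pi the point lies beyond the cut, outside the wedge.\<close>

lemma ell_arg2: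
 assumes ang: "- pi < \<theta>m" "\<theta>m < \<theta>M" "\<theta>M < pi"
 defines "th \<equiv> (\<theta>m + \<theta>M) / 2" and "be \<equiv> (\<theta>M - \<theta>m) / 2"
 assumes x: "x ~= 0"
 defines "de \<equiv> arg2 x - th"
 shows "\<bar>de\<bar> <= pi \<and> ell th be x = norm x * sin (be - \<bar>de\<bar>) \<or> \<bar>de\<bar> > pi \<and> ell th be x < 0"
proof -
 \<comment> \<open>The last bound says that both bounding angles stay strictly inside (-pi, pi), off
   the cut of \<open>Arg\<close>.\<close>
 have b: "0 < be" "be < pi" "be + \<bar>th\<bar> < pi" using ang by (auto simp: be_def th_def abs_if field_simps)
 have X: "cX th x = norm x * cos de" unfolding cX_def de_def cos_diff by (simp add: arg2_polar(1,2)[of x] algebra_simps)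
 have Y: "cY th x = norm x * sin de" unfolding cY_def de_def sin_diff by (simp add: arg2_polar(1,2)[of x] algebra_simps)
 have l: "ell th be x = norm x * (cos \<bar>de\<bar> * sin be - \<bar>sin de\<bar> * cos be)"
  by (simp add: ell_def X Y abs_mult algebra_simps)
 have d: "\<bar>de\<bar> <= pi + \<bar>th\<bar>" using arg2_polar(3,4)[of x] by (auto simp: de_def)
 show ?thesis
 proof (cases "\<bar>de\<bar> <= pi")
  case True
  have "\<bar>sin de\<bar> = sin \<bar>de\<bar>" using True sin_ge_zero[of "\<bar>de\<bar>"] by (cases "de >= 0") (auto)
  then show ?thesis using True l by (simp add: sin_diff algebra_simps)
 next
  case False
  have "sin \<bar>de\<bar> < 0" using False d b by (intro sin_lt_zero) auto
  then have "\<bar>sin de\<bar> = - sin \<bar>de\<bar>" by (cases "de >= 0") auto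
  then have "ell th be x = norm x * sin (be + \<bar>de\<bar>)" using l by (simp add: sin_add algebra_simps)
  moreover have "sin (be + \<bar>de\<bar>) < 0" using False d b by (intro sin_lt_zero) auto
  ultimately show ?thesis using False x by (simp add: mult_pos_neg)
 qed
qed

lemma wedge_eq_ell:
 assumes ang: "- pi < \<theta>m" "\<theta>m < \<theta>M" "\<theta>M < pi"
 shows "wedge \<theta>m \<theta>M = {x. ell ((\<theta>m + \<theta>M) / 2) ((\<theta>M - \<theta>m) / 2) x > 0}"
proof (rule set_eqI)
 fix x :: "real^2"
 define th be de where "th = (\<theta>m + \<theta>M) / 2" and "be = (\<theta>M - \<theta>m) / 2" and "de = arg2 x - th"
 have b: "0 < be" "be < pi" using ang by (auto simp: be_def)
 show "x \<in> wedge \<theta>m \<theta>M \<longleftrightarrow> x \<in> {x. ell ((\<theta>m + \<theta>M) / 2) ((\<theta>M - \<theta>m) / 2) x > 0}"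
 proof (cases "x = 0")
  case False
  have w: "x \<in> wedge \<theta>m \<theta>M \<longleftrightarrow> \<bar>de\<bar> < be"
   using False unfolding wedge_def de_def th_def be_def by (auto simp: abs_less_iff field_simps)
  consider "\<bar>de\<bar> <= pi" "ell th be x = norm x * sin (be - \<bar>de\<bar>)" | "\<bar>de\<bar> > pi" "ell th be x < 0"
   using ell_arg2[OF ang False] unfolding th_def be_def de_def by blast
  then show ?thesis
  proof cases
   case 1
   have "sin (be - \<bar>de\<bar>) > 0 \<longleftrightarrow> \<bar>de\<bar> < be"
   proof
    assume "\<bar>de\<bar> < be" then show "sin (be - \<bar>de\<bar>) > 0" using b by (intro sin_gt_zero) auto
   next
    assume s: "sin (be - \<bar>de\<bar>) > 0"
    show "\<bar>de\<bar> < be"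
    proof (rule ccontr)
     assume "\<not> \<bar>de\<bar> < be"
     then have "sin (\<bar>de\<bar> - be) >= 0" using 1 b by (intro sin_ge_zero) auto
     then show False using s sin_minus[of "be - \<bar>de\<bar>"] by simp
    qed
   qed
   then show ?thesis using w 1 False by (simp add: th_def be_def zero_less_mult_iff)
  next
   case 2
   then show ?thesis using w b by (simp add: th_def be_def)
  qed
 qed (simp add: wedge_def)
qed

lemma ell_0_imp_ray:
 assumes ang: "- pi < \<theta>m" "\<theta>m < \<theta>M" "\<theta>M < pi"
  and "x ~= 0" "ell ((\<theta>m + \<theta>M) / 2) ((\<theta>M - \<theta>m) / 2) x = 0"
 shows "x \<in> ray \<theta>m \<union> ray \<theta>M"
proof -
 define th be de where "th = (\<theta>m + \<theta>M) / 2" and "be = (\<theta>M - \<theta>m) / 2" and "de = arg2 x - th"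
 have b: "0 < be" "be < pi" using ang by (auto simp: be_def)
 have d: "\<bar>de\<bar> <= pi" "sin (be - \<bar>de\<bar>) = 0"
  using ell_arg2[OF ang assms(4)] assms(4,5) unfolding th_def be_def de_def by auto
 have "be - \<bar>de\<bar> = 0"
 proof (rule ccontr)
  assume "be - \<bar>de\<bar> ~= 0"
  then consider "be - \<bar>de\<bar> > 0" | "\<bar>de\<bar> - be > 0" by linarith
  then show False
  proof cases
   case 1 then have "sin (be - \<bar>de\<bar>) > 0" using b by (intro sin_gt_zero) auto
   then show False using d by simp
  next
   case 2 then have "sin (\<bar>de\<bar> - be) > 0" using b d by (intro sin_gt_zero) auto
   then show False using d sin_minus[of "be - \<bar>de\<bar>"] by simp
  qed
 qed
 then have "arg2 x = th + be \<or> arg2 x = th - be" by (auto simp: de_def abs_if split: if_splits)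
 then show ?thesis using assms(4) by (auto simp: ray_def th_def be_def field_simps)
qed

lemma open_cyl: "open A ==> open I ==> open (cyl A I)"
proof -
 assume "open A" "open I"
 then have "open (proj2 -` A \<inter> (\<lambda>x. x $ 3) -` I)" by (intro open_Int open_vimage) (auto intro!: continuous_intros)
 then show ?thesis by (simp add: cyl_def vimage_def Int_def)
qed

lemma closed_cyl: "closed A ==> closed I ==> closed (cyl A I)"
proof -
 assume "closed A" "closed I"
 then have "closed (proj2 -` A \<inter> (\<lambda>x. x $ 3) -` I)" by (intro closed_Int closed_vimage) (auto intro!: continuous_intros)
 then show ?thesis by (simp add: cyl_def vimage_def Int_def)
qed

lemma norm_le_proj2: "norm x <= norm (proj2 x) + \<bar>x $ 3\<bar>"
proof -
 have "x = join3 (proj2 x) 0 + join3 0 (x $ 3)" by (simp add: vec_eq_iff forall_3)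
 then have "norm x <= norm (join3 (proj2 x) 0) + norm (join3 0 (x $ 3))" by (metis norm_triangle_ineq)
 moreover have "norm (join3 y 0) = norm y" "norm (join3 0 t) = \<bar>t\<bar>" for y t by (simp_all add: norm_vec_def L2_set_def sum_3 sum_2)
 ultimately show ?thesis by simp
qed

lemma norm_proj2_le: "norm (proj2 x) <= norm x" by (simp add: norm_vec_def L2_set_def sum_3 sum_2)

lemma bounded_cyl: "bounded A ==> bounded I ==> bounded (cyl A I)"
proof -
 assume "bounded A" "bounded I"
 then obtain a b where "!!x. x \<in> A ==> norm x <= a" "!!x. x \<in> I ==> \<bar>x\<bar> <= b"
  by (auto simp: bounded_iff)
 then have "norm x <= a + b" if "x \<in> cyl A I" for x using norm_le_proj2[of x] that by (force simp: cyl_def)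
 then show ?thesis by (auto simp: bounded_iff)
qed

lemma compact_cyl: "compact A ==> compact I ==> compact (cyl A I)"
 by (simp add: compact_eq_bounded_closed closed_cyl bounded_cyl)

lemma cyl_mono: "A \<subseteq> B ==> I \<subseteq> J ==> cyl A I \<subseteq> cyl B J" by (auto simp: cyl_def)

section \<open>Analytic tools: mean value bound, Cauchy-Schwarz, dyadic integrability, divergence
  theorem on the wedge\<close>

lemma vector_mvt_bound:
 fixes f :: "real => 'a::real_normed_vector"
 assumes "a <= b" "continuous_on {a..b} f"
  and "!!x. a < x ==> x < b ==> (f has_vector_derivative f' x) (at x)"
  and "!!x. a < x ==> x < b ==> norm (f' x) <= B"
 shows "norm (f b - f a) <= B * (b - a)"
proof (cases "a = b")
 case False
 then have "norm (f b - f a) <= B * b - B * a" using assms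
  by (intro differentiable_bound_general[where f' = f' and \<phi>' = "\<lambda>x. B" and \<phi> = "\<lambda>x. B * x"])
   (auto intro!: continuous_intros derivative_eq_intros simp: has_real_derivative_iff_has_vector_derivative[symmetric])
 then show ?thesis by (simp add: algebra_simps)
qed simp

lemma L2_on_Cauchy_Schwarz:
 fixes f :: "'a => 'b::euclidean_space"
 assumes f: "L2_on N S f" and S: "S \<in> sets N" "emeasure N S < top"
 shows "set_integrable N S f"
  and "(LINT x:S|N. norm (f x)) <= sqrt (measure N S) * L2_norm N S f"
proof -
 let ?F = "\<lambda>x. indicator S x *\<^sub>R f x"
 have m: "?F \<in> borel_measurable N" using f by (simp add: L2_on_def set_borel_measurable_def)
 have sq: "(norm (?F x))\<^sup>2 = indicator S x *\<^sub>R (norm (f x))\<^sup>2" for x by (simp add: indicator_def)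
 have nF: "norm (?F x) = indicator S x *\<^sub>R norm (f x)" for x by (simp add: indicator_def)
 have i2: "integrable N (\<lambda>x. (norm (?F x))\<^sup>2)" using f unfolding L2_on_def set_integrable_def sq by simp
 have i1: "integrable N (indicator S :: 'a => real)" using S by simp
 have iF: "integrable N ?F"
 proof (rule Bochner_Integration.integrable_bound[OF Bochner_Integration.integrable_add[OF i1 i2] m])
  have "norm (?F x) <= norm (indicator S x + (norm (?F x))\<^sup>2)" for x
  proof (cases "x \<in> S")
   case True
   have "norm (f x) <= 1 + (norm (f x))\<^sup>2" using zero_le_power2[of "norm (f x) - 1"] norm_ge_zero[of "f x"]
    by (simp add: power2_diff) (smt (verit) zero_le_power2)
   then show ?thesis using True by simp
  qed simp
  then show "AE x in N. norm (?F x) <= norm (indicator S x + (norm (?F x))\<^sup>2)" by simp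
 qed
 then show "set_integrable N S f" by (simp add: set_integrable_def)
 define A where "A = (\<integral>x. norm (?F x) \<partial>N)"
 define B where "B = (\<integral>x. (norm (?F x))\<^sup>2 \<partial>N)"
 define m where "m = measure N S"
 have iN: "integrable N (\<lambda>x. norm (?F x))" by (rule integrable_norm[OF iF])
 \<comment> \<open>The square of \<open>s\<close> minus the norm integrates to a nonnegative
   quadratic polynomial in \<open>s\<close>, evaluated below at its minimum \<open>A / m\<close>.
   For m = 0 it is affine, and a suitable \<open>s\<close> would make it negative unless A =
   0.\<close>
 have quad: "0 <= s\<^sup>2 * m - 2 * s * A + B" for s
 proof -
  have "0 <= (\<integral>x. (s * indicator S x - norm (?F x))\<^sup>2 \<partial>N)" by simp
  also have "(\<lambda>x. (s * indicator S x - norm (?F x))\<^sup>2) =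
    (\<lambda>x. s\<^sup>2 * indicator S x - 2 * s * norm (?F x) + (norm (?F x))\<^sup>2)"
   by (auto simp: fun_eq_iff indicator_def power2_diff algebra_simps)
  also have "(\<integral>x. s\<^sup>2 * indicator S x - 2 * s * norm (?F x) + (norm (?F x))\<^sup>2 \<partial>N) = s\<^sup>2 * m - 2 * s * A + B"
   using i1 i2 iN S by (simp add: A_def B_def m_def)
  finally show ?thesis .
 qed
 have m0: "m >= 0" by (simp add: m_def)
 have A0: "A >= 0" by (simp add: A_def)
 have B0: "B >= 0" by (simp add: B_def)
 have "A\<^sup>2 <= m * B"
 proof (cases "m = 0")
  case True
  have "A = 0"
  proof (rule ccontr)
   assume "A ~= 0"
   then have "2 * ((B + 1) / A) * A = 2 * (B + 1)" by simp
   then show False using quad[of "(B + 1) / A"] True B0 by simp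
  qed
  then show ?thesis using True by simp
 next
  case False
  then have "0 <= (A / m)\<^sup>2 * m - 2 * (A / m) * A + B" by (intro quad)
  also have "\<dots> = B - A\<^sup>2 / m" using False by (simp add: power2_eq_square field_simps)
  finally show ?thesis using False m0 by (simp add: field_simps)
 qed
 then have "A <= sqrt (m * B)" by (rule real_le_rsqrt)
 also have "\<dots> = sqrt m * L2_norm N S f" unfolding L2_norm_def set_lebesgue_integral_def B_def sq by (simp add: real_sqrt_mult)
 finally show "(LINT x:S|N. norm (f x)) <= sqrt (measure N S) * L2_norm N S f" unfolding set_lebesgue_integral_def A_def m_def nF .
qed

text \<open>On the shell where r lies between h/2^(k+1) and h/2^k the weight 1/r^2 is at most 4 4^k
  / h^2, and the mass of \<open>g\<close> there is at most C (h/2^k)^(2+de). The products form a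
  geometric series of ratio 2^(-de). Used both for powers of the distance to the edge and for mean
  oscillations.\<close>

lemma dyadic_integrable:
 fixes g r :: "'a => real"
 assumes [measurable]: "g \<in> borel_measurable M" "r \<in> borel_measurable M" and sp: "space M = UNIV"
  and g0: "!!x. g x >= 0" and r0: "!!x. r x >= 0" and h: "h > 0" and de: "de > 0" and C: "C >= 0"
  and bnd: "!!rh. 0 < rh ==> rh <= h ==>
   (\<integral>\<^sup>+x. ennreal (g x) * indicator {x. r x < rh} x \<partial>M) <= ennreal (C * rh powr (2 + de))"
 shows "integrable M (\<lambda>x. indicator {x. r x < h} x * (g x / (r x)\<^sup>2))"
proof -
 have ms [measurable]: "{x. r x < rh} \<in> sets M" for rh using borel_measurable_less[of r M "\<lambda>_. rh"] by (simp add: sp)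
 define q where "q = 2 powr (- de)"
 have q: "0 < q" "q < 1" using de by (auto simp: q_def powr_less_one)
 have pw: "ennreal (g x / (r x)\<^sup>2) * indicator {x. r x < h} x <=
   (\<Sum>k. ennreal (4 * 4 ^ k / h\<^sup>2) * (ennreal (g x) * indicator {x. r x < h / 2 ^ k} x))" for x
 \<comment> \<open>At r x = 0 the quotient is 0 by the convention on division, so the points with r
   x = 0 contribute nothing.\<close>
 proof (cases "r x = 0 \<or> r x >= h")
  case True then show ?thesis by auto
 next
  case False
  then have rx: "0 < r x" "r x < h" using r0[of x] by auto
  have "\<exists>n. h / 2 ^ n <= r x"
  proof -
   obtain n :: nat where "h / r x < 2 ^ n" using real_arch_pow[of 2 "h / r x"] by auto
   then show ?thesis using rx by (intro exI[of _ n]) (simp add: field_simps)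
  qed
  define n where "n = (LEAST n. h / 2 ^ n <= r x)"
  have n: "h / 2 ^ n <= r x" unfolding n_def by (rule LeastI_ex) fact
  have "n ~= 0" using n rx by (intro notI) simp
  then obtain k where k: "n = Suc k" by (cases n) auto
  have "\<not> h / 2 ^ k <= r x" using not_less_Least[of k "\<lambda>n. h / 2 ^ n <= r x"] k by (simp add: n_def)
  then have k1: "r x < h / 2 ^ k" by simp
  have k2: "h <= 2 * 2 ^ k * r x" using n k by (simp add: field_simps)
  have "h\<^sup>2 <= (2 * 2 ^ k * r x)\<^sup>2" using k2 h by (intro power_mono) auto
  also have "\<dots> = 4 * 4 ^ k * (r x)\<^sup>2" by (simp add: power_mult_distrib power2_eq_square power_mult[symmetric] flip: power_mult_distrib)
  finally have "1 / (r x)\<^sup>2 <= 4 * 4 ^ k / h\<^sup>2" using rx h by (simp add: field_simps)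
  then have "g x / (r x)\<^sup>2 <= (4 * 4 ^ k / h\<^sup>2) * g x" using mult_right_mono[OF _ g0[of x]] by fastforce
  then have "ennreal (g x / (r x)\<^sup>2) <= ennreal (4 * 4 ^ k / h\<^sup>2) * ennreal (g x)"
   using g0[of x] by (simp add: ennreal_mult[symmetric] ennreal_leI)
  then have "ennreal (g x / (r x)\<^sup>2) * indicator {x. r x < h} x <=
    ennreal (4 * 4 ^ k / h\<^sup>2) * (ennreal (g x) * indicator {x. r x < h / 2 ^ k} x)" using k1 rx by simp
  also have "\<dots> <= (\<Sum>k. ennreal (4 * 4 ^ k / h\<^sup>2) * (ennreal (g x) * indicator {x. r x < h / 2 ^ k} x))"
   using sum_le_suminf[of "\<lambda>k. ennreal (4 * 4 ^ k / h\<^sup>2) * (ennreal (g x) * indicator {x. r x < h / 2 ^ k} x)" "{k}"] by simp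
  finally show ?thesis .
 qed
 have "(\<integral>\<^sup>+x. ennreal (g x / (r x)\<^sup>2) * indicator {x. r x < h} x \<partial>M) <=
   (\<integral>\<^sup>+x. (\<Sum>k. ennreal (4 * 4 ^ k / h\<^sup>2) * (ennreal (g x) * indicator {x. r x < h / 2 ^ k} x)) \<partial>M)"
  by (intro nn_integral_mono pw)
 also have "\<dots> = (\<Sum>k. ennreal (4 * 4 ^ k / h\<^sup>2) * (\<integral>\<^sup>+x. ennreal (g x) * indicator {x. r x < h / 2 ^ k} x \<partial>M))"
  by (subst nn_integral_suminf) (auto intro!: suminf_cong nn_integral_cmult)
 also have "\<dots> <= (\<Sum>k. ennreal ((4 * C * h powr de) * q ^ k))"
 proof (intro suminf_le summableI)
  fix k :: nat
  have "ennreal (4 * 4 ^ k / h\<^sup>2) * (\<integral>\<^sup>+x. ennreal (g x) * indicator {x. r x < h / 2 ^ k} x \<partial>M) <=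
    ennreal (4 * 4 ^ k / h\<^sup>2) * ennreal (C * (h / 2 ^ k) powr (2 + de))" using h by (intro mult_left_mono bnd) (auto simp: field_simps)
  also have "\<dots> = ennreal ((4 * 4 ^ k / h\<^sup>2) * (C * (h / 2 ^ k) powr (2 + de)))" using h C by (intro ennreal_mult[symmetric]) auto
  also have "(4 * 4 ^ k / h\<^sup>2) * (C * (h / 2 ^ k) powr (2 + de)) = (4 * C * h powr de) * q ^ k"
  proof -
   have "(h / 2 ^ k) powr (2 + de) = (h / 2 ^ k)\<^sup>2 * (h / 2 ^ k) powr de" using h by (simp add: powr_add powr_numeral)
   also have "(h / 2 ^ k) powr de = h powr de * q ^ k"
   proof -
    have "(2 ^ k) powr de = (2 powr de) ^ k" by (simp add: powr_realpow[symmetric] powr_powr mult.commute)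
    then show ?thesis using powr_divide[of h "2 ^ k" de] h by (simp add: q_def powr_minus power_inverse divide_inverse[of _ "(2 powr de) ^ k"])
   qed
   finally have e: "(h / 2 ^ k) powr (2 + de) = (h / 2 ^ k)\<^sup>2 * (h powr de * q ^ k)" .
   have "(2 ^ k)\<^sup>2 = (4 :: real) ^ k" by (simp add: power_mult[symmetric] mult.commute[of k] power_mult)
   then show ?thesis unfolding e using h by (simp add: power_divide)
  qed
  finally show "ennreal (4 * 4 ^ k / h\<^sup>2) * (\<integral>\<^sup>+x. ennreal (g x) * indicator {x. r x < h / 2 ^ k} x \<partial>M)
   <= ennreal ((4 * C * h powr de) * q ^ k)" .
 qed
 also have "\<dots> = ennreal (\<Sum>k. (4 * C * h powr de) * q ^ k)" using q C by (intro suminf_ennreal2 summable_mult summable_geometric) auto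
 also have "\<dots> < top" by simp
 finally have fin: "(\<integral>\<^sup>+x. ennreal (g x / (r x)\<^sup>2) * indicator {x. r x < h} x \<partial>M) < top" .
 show ?thesis
 proof (rule integrableI_bounded)
  have "ennreal (norm (indicator {x. r x < h} x * (g x / (r x)\<^sup>2))) =
    ennreal (g x / (r x)\<^sup>2) * indicator {x. r x < h} x" for x using g0[of x] by (simp add: indicator_def)
  then show "(\<integral>\<^sup>+x. ennreal (norm (indicator {x. r x < h} x * (g x / (r x)\<^sup>2))) \<partial>M) < \<infinity>" using fin by simp
 qed measurable
qed

text \<open>By translation invariance the difference quotients have integral 0, and they converge to
  the derivative with a common bound and a common bounded support.\<close>

lemma integral_dir_deriv_eq_0:
 fixes f :: "'a::euclidean_space => 'b::euclidean_space"
 assumes f: "smooth f" and R: "!!x. norm x >= R ==> f x = 0"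
 shows "integrable lborel (dir_deriv b f)" "(LINT x|lborel. dir_deriv b f x) = 0"
proof -
 \<comment> \<open>The shifts have length at most \<open>norm b\<close>, so the ball of radius R'
   contains the supports of all difference quotients.\<close>
 define R' where "R' = \<bar>R\<bar> + norm b + 1"
 have z: "dir_deriv b f x = 0" if "norm x > R" for x
 proof -
  have "dir_deriv b f x = dir_deriv b (\<lambda>x. 0) x"
   using that R by (intro dir_deriv_cong_open[where U = "{x. norm x > R}"]) (auto intro!: open_Collect_less continuous_intros)
  then show ?thesis using dir_deriv_eqI[OF has_derivative_const] by simp
 qed
 have "compact (dir_deriv b f ` cball 0 R')" by (intro compact_continuous_image smooth_continuous smooth_dir_deriv f) auto
 then obtain B where B: "!!x. x \<in> cball 0 R' ==> norm (dir_deriv b f x) <= B"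
  using compact_imp_bounded bounded_iff by (metis imageI)
 have B0: "B >= 0" using order_trans[OF norm_ge_zero B[of 0]] by (simp add: R'_def)
 have B': "norm (dir_deriv b f x) <= B" for x
 proof (cases "norm x > R")
  case False
  then have "norm x <= R'" using norm_ge_zero[of b] unfolding R'_def by linarith
  then show ?thesis by (intro B) simp
 qed (use z[of x] B0 in simp)
 define s where "s n x = real (Suc n) *\<^sub>R (f (x + (1 / real (Suc n)) *\<^sub>R b) - f x)" for n x
 have mf: "f \<in> borel_measurable borel" by (rule smooth_measurable[OF f])
 have ms: "s n \<in> borel_measurable borel" for n
  unfolding s_def by (intro borel_measurable_continuous_onI continuous_intros continuous_on_compose2[OF smooth_continuous[OF f, of UNIV]]) auto
 have D: "((\<lambda>\<tau>. f (x + \<tau> *\<^sub>R b)) has_vector_derivative dir_deriv b f (x + \<tau> *\<^sub>R b)) (at \<tau>)" for x \<tau>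
 proof -
  have "((\<lambda>\<tau>. x + \<tau> *\<^sub>R b) has_vector_derivative b) (at \<tau>)" by (auto intro!: derivative_eq_intros)
  from vector_derivative_diff_chain_within[OF this has_derivative_at_withinI[OF smooth_has_derivative[OF f]]]
  show ?thesis by (simp add: o_def)
 qed
 have sb: "norm (s n x) <= B" for n x
 proof -
  have "norm (f (x + (1 / real (Suc n)) *\<^sub>R b) - f (x + 0 *\<^sub>R b)) <= B * (1 / real (Suc n) - 0)"
   by (rule vector_mvt_bound[where f' = "\<lambda>\<tau>. dir_deriv b f (x + \<tau> *\<^sub>R b)"])
    (auto intro!: D B' continuous_intros continuous_on_compose2[OF smooth_continuous[OF f, of UNIV]])
  then have "real (Suc n) * norm (f (x + (1 / real (Suc n)) *\<^sub>R b) - f x) <= B" by (simp add: field_simps del: of_nat_Suc)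
  then show ?thesis by (simp add: s_def del: of_nat_Suc)
 qed
 have s0: "s n x = 0" if "norm x > R'" for n x
 proof -
  have "norm (x + (1 / real (Suc n)) *\<^sub>R b) >= norm x - norm ((1 / real (Suc n)) *\<^sub>R b)" by (metis norm_diff_ineq)
  moreover have "norm ((1 / real (Suc n)) *\<^sub>R b) <= norm b" using mult_left_mono[of 1 "1 + real n" "norm b"] by (simp add: divide_le_eq)
  ultimately have "f (x + (1 / real (Suc n)) *\<^sub>R b) = 0" "f x = 0" using that norm_ge_zero[of b] unfolding R'_def by (intro R; linarith)+
  then show ?thesis by (simp add: s_def)
 qed
 have lim: "(\<lambda>n. s n x) \<longlonglongrightarrow> dir_deriv b f x" for x
 proof -
  have seq: "filterlim (\<lambda>n. 1 / real (Suc n)) (at 0) sequentially"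
   using LIMSEQ_inverse_real_of_nat by (intro filterlim_atI) (auto simp: divide_inverse simp del: of_nat_Suc)
  have "(\<lambda>n. s n x \<bullet> i) \<longlonglongrightarrow> dir_deriv b f x \<bullet> i" for i
  proof -
   have "((\<lambda>\<tau>. f (x + \<tau> *\<^sub>R b) \<bullet> i) has_vector_derivative dir_deriv b f x \<bullet> i) (at 0)"
    using bounded_linear.has_vector_derivative[OF bounded_linear_inner_left D[of x 0]] by simp
   then have "((\<lambda>h. (f (x + h *\<^sub>R b) \<bullet> i - f x \<bullet> i) / h) \<longlongrightarrow> dir_deriv b f x \<bullet> i) (at 0)"
    by (simp add: has_real_derivative_iff_has_vector_derivative[symmetric] DERIV_def)
   from filterlim_compose[OF this seq]
   show ?thesis by (simp add: s_def inner_diff_left mult.commute del: of_nat_Suc)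
  qed
  then show ?thesis by (intro tendsto_componentwise_iff[THEN iffD2]) auto
 qed
 have w: "integrable lborel (\<lambda>x :: 'a. B * indicator (cball 0 R') x)"
  by (intro integrable_mult_right integrable_real_indicator) (auto simp: emeasure_lborel_cball_finite[unfolded infinity_ennreal_def])
 have bd: "AE x in lborel. norm (s n x) <= B * indicator (cball 0 R') x" for n
  using sb[of n] s0[of _ n] by (intro AE_I2) (auto simp: indicator_def)
 have md: "dir_deriv b f \<in> borel_measurable lborel" using smooth_measurable[OF smooth_dir_deriv[OF f]] by simp
 show int: "integrable lborel (dir_deriv b f)"
  using integrable_dominated_convergence[of "dir_deriv b f" lborel s "\<lambda>x. B * indicator (cball 0 R') x"] md ms w lim bd by simp
 have "(\<lambda>n. LINT x|lborel. s n x) \<longlonglongrightarrow> (LINT x|lborel. dir_deriv b f x)"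
  using integral_dominated_convergence[of "dir_deriv b f" lborel s "\<lambda>x. B * indicator (cball 0 R') x"] md ms w lim bd by simp
 moreover have "(LINT x|lborel. s n x) = 0" for n
 proof -
  have i: "integrable lborel f"
  proof -
   have "compact (f ` cball 0 R')" by (intro compact_continuous_image smooth_continuous f) auto
   then obtain B where B: "!!x. x \<in> cball 0 R' ==> norm (f x) <= B" using compact_imp_bounded bounded_iff by (metis imageI)
   have "integrable lborel (\<lambda>x :: 'a. B * indicator (cball 0 R') x)"
    by (intro integrable_mult_right integrable_real_indicator) (auto simp: emeasure_lborel_cball_finite[unfolded infinity_ennreal_def])
   then show ?thesis
   proof (rule Bochner_Integration.integrable_bound)
    have "norm (f x) <= norm (B * indicator (cball 0 R') x :: real)" for x
    proof (cases "norm x <= R'")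
     case False
     then have "R <= norm x" using norm_ge_zero[of b] unfolding R'_def by linarith
     then show ?thesis using R[of x] by simp
    qed (use B[of x] in simp)
    then show "AE x in lborel. norm (f x) <= norm (B * indicator (cball 0 R') x :: real)" by simp
   qed (use mf in simp)
  qed
  let ?c = "(1 / real (Suc n)) *\<^sub>R b"
  have m: "(+) ?c \<in> borel_measurable lborel" by simp
  have "integrable (distr lborel borel ((+) ?c)) f" "(LINT x|distr lborel borel ((+) ?c). f x) = (LINT x|lborel. f x)"
   using i by (simp_all add: lborel_distr_plus)
  then have "integrable lborel (\<lambda>x. f (?c + x))" "(LINT x|lborel. f (?c + x)) = (LINT x|lborel. f x)"
   using mf by (simp_all add: integrable_distr_eq integral_distr)
  then show ?thesis using i by (simp add: s_def add.commute)
 qed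
 ultimately show "(LINT x|lborel. dir_deriv b f x) = 0" by (simp add: LIMSEQ_const_iff)
qed

text \<open>The two faces of the edge form one graph over the plane orthogonal to the bisector.\<close>

definition face :: "real => real => real \<times> real => real^3"
 where "face th be p = join3 (rot2 th (\<bar>fst p\<bar> * cot be) (fst p)) (snd p)"

definition e3 :: "real => real^3" where "e3 th = join3 (e2 th) 0"

lemma ell_pos_iff: "0 < be ==> be < pi ==> ell th be (rot2 th X Y) > 0 \<longleftrightarrow> X > \<bar>Y\<bar> * cot be"
 and ell_nonneg_iff: "0 < be ==> be < pi ==> ell th be (rot2 th X Y) >= 0 \<longleftrightarrow> X >= \<bar>Y\<bar> * cot be"
 using sin_gt_zero[of be] by (auto simp: ell_def cot_def field_simps)

lemma continuous_on_face: "continuous_on S (face th be)" unfolding face_def by (intro continuous_intros)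

text \<open>For fixed (Y, t) the line in the direction of the bisector enters the wedge at X = |Y|
  cot be and never leaves it, so the fundamental theorem of calculus on each line yields the
  integral over the faces. The direction is transversal to both faces, so no normal vectors occur;
  for a non-convex wedge cot be is merely negative.\<close>

lemma wedge_divergence:
 fixes T :: "real^3 => 'b::euclidean_space"
 assumes be: "0 < be" "be < pi"
  and T: "continuous_on {x. ell th be (proj2 x) >= 0} T"
  and D: "!!x. ell th be (proj2 x) > 0 ==> (T has_derivative D x) (at x)"
  and T': "!!x. ell th be (proj2 x) > 0 ==> D x (e3 th) = T' x"
  and cT': "continuous_on {x. ell th be (proj2 x) > 0} T'"
  and B: "!!x. ell th be (proj2 x) > 0 ==> norm (T' x) <= B"
  and R: "!!x. norm x >= R ==> T x = 0" "!!x. norm x >= R ==> T' x = 0"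
 shows "set_integrable lborel {x. ell th be (proj2 x) > 0} T'"
  and "(LINT x:{x. ell th be (proj2 x) > 0}|lborel. T' x) = - (LINT p|lborel. T (face th be p))"
proof -
 let ?W = "{x. ell th be (proj2 x) > 0}"
 let ?H = "\<lambda>x. indicator ?W x *\<^sub>R T' x"
 have oW: "open ?W" by (intro open_Collect_less continuous_intros)
 have mH: "?H \<in> borel_measurable borel" using borel_measurable_continuous_on_indicator[OF _ cT'] oW by simp
 have B0: "\<bar>B\<bar> >= 0" by simp
 have iH: "integrable lborel ?H"
 proof (rule Bochner_Integration.integrable_bound)
  show "integrable lborel (\<lambda>x :: real^3. \<bar>B\<bar> * indicator (cball 0 R) x)"
   by (intro integrable_mult_right integrable_real_indicator) (auto simp: emeasure_lborel_cball_finite[unfolded infinity_ennreal_def])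
  have "norm (?H x) <= norm (\<bar>B\<bar> * indicator (cball 0 R) x :: real)" for x
   using B[of x] R(2)[of x] by (cases "norm x >= R") (auto simp: indicator_def)
  then show "AE x in lborel. norm (?H x) <= norm (\<bar>B\<bar> * indicator (cball 0 R) x :: real)" by simp
 qed (use mH in simp)
 then show "set_integrable lborel ?W T'" by (simp add: set_integrable_def)
 let ?c = "\<lambda>(X, Y, t). join3 (rot2 th X Y) t"
 have mc: "?c \<in> borel_measurable borel" unfolding case_prod_beta' by (intro borel_measurable_continuous_onI continuous_intros)
 have L: "distr lborel borel ?c = lborel" using lborel_rot3 by (simp add: lborel_prod)
 have mc': "?c \<in> lborel \<rightarrow>\<^sub>M borel" using mc by simp
 have "integrable lborel (\<lambda>q. ?H (?c q))" using iH integrable_distr_eq[OF mc' mH] unfolding L by blast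
 then have i2: "integrable (lborel \<Otimes>\<^sub>M lborel) (\<lambda>q. ?H (?c q))" unfolding lborel_prod .
 have "(LINT x|lborel. ?H x) = (LINT q|lborel. ?H (?c q))" using integral_distr[OF mc' mH] unfolding L .
 also have "\<dots> = (LINT q|(lborel \<Otimes>\<^sub>M lborel). ?H (?c q))" unfolding lborel_prod ..
 also have "\<dots> = (LINT p|lborel. LINT X|lborel. ?H (?c (X, p)))"
  using lborel_pair.integral_snd[of "\<lambda>X p. ?H (?c (X, p))"] i2 by (simp add: case_prod_beta')
 also have "(\<lambda>p. LINT X|lborel. ?H (?c (X, p))) = (\<lambda>p. - T (face th be p))"
 proof
  fix p :: "real \<times> real"
  show "(LINT X|lborel. ?H (?c (X, p))) = - T (face th be p)"
 proof -
  obtain Y t where p: "p = (Y, t)" by (cases p)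
  define \<gamma> where "\<gamma> = \<bar>Y\<bar> * cot be"
  \<comment> \<open>The upper end lies beyond the support of \<open>T\<close>, so only the boundary
    term on the face survives.\<close>
  define b where "b = max \<gamma> \<bar>R\<bar> + 1"
  define u where "u X = join3 (rot2 th X Y) t" for X
  have \<gamma>b: "\<gamma> < b" by (simp add: b_def)
  have cu: "continuous_on S u" for S unfolding u_def by (intro continuous_intros)
  have uW: "ell th be (proj2 (u X)) > 0 \<longleftrightarrow> X > \<gamma>" "ell th be (proj2 (u X)) >= 0 \<longleftrightarrow> X >= \<gamma>" for X
   using ell_pos_iff[OF be] ell_nonneg_iff[OF be] by (auto simp: u_def \<gamma>_def)
  have uR: "norm (u X) >= R" if "X >= b" for X
  proof -
   have "R <= X" using that by (simp add: b_def)
   also have "X <= norm (rot2 th X Y)" using abs_cX_le[of th "rot2 th X Y"] by simp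
   also have "\<dots> <= norm (u X)" using norm_proj2_le[of "u X"] by (simp add: u_def)
   finally show ?thesis .
  qed
  have du: "(u has_vector_derivative e3 th) (at X)" for X
  proof -
   have "u = (\<lambda>X. join3 (rot2 th 0 Y) t + X *\<^sub>R e3 th)"
    by (simp add: fun_eq_iff u_def vec_eq_iff forall_3 e3_def e2_def algebra_simps)
   then show ?thesis by (auto intro!: derivative_eq_intros)
  qed
  have dT: "((\<lambda>X. T (u X)) has_vector_derivative T' (u X)) (at X)" if "\<gamma> < X" for X
  proof -
   have "(T has_derivative D (u X)) (at (u X) within u ` UNIV)" by (rule has_derivative_at_withinI[OF D]) (use uW(1)[of X] that in blast)
   note vector_derivative_diff_chain_within[OF du this]
   moreover have "D (u X) (e3 th) = T' (u X)" using T'[of "u X"] uW(1)[of X] that by blast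
   ultimately show ?thesis by (simp add: o_def)
  qed
  have "((\<lambda>X. T' (u X)) has_integral T (u b) - T (u \<gamma>)) {\<gamma>..b}"
  proof (rule fundamental_theorem_of_calculus_interior)
   show "continuous_on {\<gamma>..b} (\<lambda>X. T (u X))" by (rule continuous_on_compose2[OF T cu]) (use uW(2) in force)
  qed (use \<gamma>b dT in auto)
  moreover have "T (u b) = 0" using uR[of b] R(1) by simp
  moreover have "u \<gamma> = face th be p" by (simp add: u_def \<gamma>_def p face_def)
  ultimately have "((\<lambda>X. T' (u X)) has_integral - T (face th be p)) {\<gamma>..b}" by simp
  then have hi: "((\<lambda>X. T' (u X)) has_integral - T (face th be p)) {\<gamma><..<b}"
   using has_integral_open_interval[of "\<lambda>X. T' (u X)" _ \<gamma> b] by (simp add: box_real)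
  have si: "set_integrable lborel {\<gamma><..<b} (\<lambda>X. T' (u X))" unfolding set_integrable_def
  proof (rule Bochner_Integration.integrable_bound)
   show "integrable lborel (\<lambda>X. \<bar>B\<bar> * indicator {\<gamma><..<b} X)" using \<gamma>b by simp
   show "(\<lambda>X. indicat_real {\<gamma><..<b} X *\<^sub>R T' (u X)) \<in> borel_measurable lborel"
    using borel_measurable_continuous_on_indicator[of "{\<gamma><..<b}" "\<lambda>X. T' (u X)"]
     continuous_on_compose2[OF cT' cu, of "{\<gamma><..<b}"] uW(1) by force
   have "norm (indicat_real {\<gamma><..<b} X *\<^sub>R T' (u X)) <= norm (\<bar>B\<bar> * indicator {\<gamma><..<b} X)" for X
    using B[of "u X"] uW(1)[of X] by (cases "X \<in> {\<gamma><..<b}") auto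
   then show "AE X in lborel. norm (indicat_real {\<gamma><..<b} X *\<^sub>R T' (u X)) <= norm (\<bar>B\<bar> * indicator {\<gamma><..<b} X)"
    by simp
  qed
  have "?H (?c (X, p)) = indicator {\<gamma><..<b} X *\<^sub>R T' (u X)" for X
   using uW(1)[of X] uR[of X] R(2)[of "u X"] by (cases "X >= b") (auto simp: p indicator_def u_def[symmetric])
  then have "(LINT X|lborel. ?H (?c (X, p))) = (LINT X:{\<gamma><..<b}|lborel. T' (u X))" by (simp add: set_lebesgue_integral_def)
  also have "\<dots> = - T (face th be p)" using set_borel_integral_eq_integral(2)[OF si] integral_unique[OF hi] by simp
  finally show ?thesis .
  qed
 qed
 finally show "(LINT x:?W|lborel. T' x) = - (LINT p|lborel. T (face th be p))" by (simp add: set_lebesgue_integral_def)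
qed

section \<open>Integration by parts up to the faces\<close>

text \<open>A point outside \<open>U\<close> has a neighbourhood on which the product vanishes
  identically, so the behaviour of \<open>f\<close> there is irrelevant.\<close>

lemma continuous_on_bump:
 fixes ps :: "'a::metric_space => real" and f :: "'a => 'b::real_normed_vector"
 assumes ps: "continuous_on UNIV ps" "closure {x. ps x ~= 0} \<subseteq> U" "open U" and f: "continuous_on (S \<inter> U) f"
 shows "continuous_on S (\<lambda>x. ps x *\<^sub>R f x)" unfolding continuous_on_eq_continuous_within
proof
 fix x assume x: "x \<in> S"
 show "continuous (at x within S) (\<lambda>x. ps x *\<^sub>R f x)"
 proof (cases "x \<in> U")
  case True
  have "continuous (at x within S \<inter> U) (\<lambda>x. ps x *\<^sub>R f x)"
   using continuous_on_scaleR[OF continuous_on_subset[OF ps(1)] f] x True by (simp add: continuous_on_eq_continuous_within)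
  moreover have "at x within S \<inter> U = at x within S" using True ps(3) by (intro at_within_nhd[of x U]) auto
  ultimately show ?thesis by simp
 next
  case False
  then have xn: "x \<in> - closure {x. ps x ~= 0}" using ps(2) by auto
  have z: "ps y = 0" if "y \<in> - closure {x. ps x ~= 0}" for y using that closure_subset[of "{x. ps x ~= 0}"] by blast
  have "\<forall>\<^sub>F y in at x within S. 0 = ps y *\<^sub>R f y" unfolding eventually_at_topological
  proof (intro exI[of _ "- closure {x. ps x ~= 0}"] conjI ballI impI)
   fix y assume "y \<in> - closure {x. ps x ~= 0}"
   from z[OF this] show "0 = ps y *\<^sub>R f y" by simp
  qed (use xn in auto)
  then have "((\<lambda>y. ps y *\<^sub>R f y) \<longlongrightarrow> 0) (at x within S)" by (rule Lim_transform_eventually[OF tendsto_const])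
  then show ?thesis using z[OF xn] by (simp add: continuous_within)
 qed
qed

lemma smooth_inner: "smooth (\<lambda>x :: 'a::euclidean_space. (x - a) \<bullet> (x - a))"
 by (intro smooth_bilinear[OF bounded_bilinear_inner] smooth_diff smooth_ident smooth_const)

text \<open>Equal to 1 up to the distance r / sqrt 2 from the centre and to 0 from the distance r
  on; the squared distance keeps it smooth at the centre.\<close>

definition bump :: "'a::euclidean_space => real => 'a => real"
 where "bump a r x = 1 - sstep (2 / r\<^sup>2 * ((x - a) \<bullet> (x - a)) - 1)"

lemma bump:
 assumes r: "r > 0"
 shows "smooth (bump a r)" "bump a r x >= 0" "bump a r x <= 1" "bump a r a = 1"
  "bump a r x ~= 0 ==> norm (x - a) < r"
proof -
 have "smooth (\<lambda>x. 2 / r\<^sup>2 * ((x - a) \<bullet> (x - a)) - 1 :: real)" by (intro smooth_diff smooth_mult smooth_const smooth_inner)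
 from smooth_compose[OF this smooth_sstep]
 show "smooth (bump a r)" unfolding bump_def[abs_def] by (intro smooth_diff smooth_const)
 show "bump a r x >= 0" "bump a r x <= 1" using sstep_range by (auto simp: bump_def)
 show "bump a r a = 1" by (simp add: bump_def sstep_0)
 assume nz: "bump a r x ~= 0"
 show "norm (x - a) < r"
 proof (rule ccontr)
  assume "\<not> norm (x - a) < r"
  then have "r\<^sup>2 <= (norm (x - a))\<^sup>2" using r by (intro power_mono) auto
  then have "2 / r\<^sup>2 * ((x - a) \<bullet> (x - a)) - 1 >= 1" using r by (simp add: power2_norm_eq_inner[symmetric] field_simps)
  then show False using nz by (simp add: bump_def sstep_1)
 qed
qed

lemma test_fun_bump:
 assumes "cball a r \<subseteq> U" "r > 0" shows "test_fun U (bump a r)"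
proof (rule test_funI[where C = "cball a r"])
 show "{x. bump a r x ~= 0} \<subseteq> cball a r" using bump(5)[OF assms(2)] by (fastforce simp: dist_norm norm_minus_commute)
qed (use bump(1)[OF assms(2)] assms(1) in auto)

section \<open>Cutoffs that vanish near the faces\<close>

definition sabs :: "real => real"
 where "sabs t = t * (2 * sstep ((t + 1) / 2) - 1)"

lemma smooth_sabs: "smooth sabs"
proof -
 have "smooth (\<lambda>t :: real. (1/2) * t + (1/2))" by (intro smooth_add smooth_mult smooth_const smooth_ident)
 then have "smooth (\<lambda>t :: real. (t + 1) / 2)" by (simp add: add_divide_distrib)
 from smooth_compose[OF this smooth_sstep]
 show ?thesis unfolding sabs_def[abs_def] by (intro smooth_mult smooth_diff smooth_const smooth_ident)
qed

lemma sabs_eq: "t >= 1 ==> sabs t = t" "t <= - 1 ==> sabs t = - t" by (auto simp: sabs_def sstep_0 sstep_1)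

lemma sabs_abs: "\<bar>sabs t - \<bar>t\<bar>\<bar> <= 2"
proof (cases "\<bar>t\<bar> >= 1")
 case True
 then show ?thesis using sabs_eq[of t] by (cases "t >= 0") auto
next
 case False
 have "\<bar>2 * sstep ((t + 1) / 2) - 1\<bar> <= 1" using sstep_range[of "(t + 1) / 2"] by auto
 then have "\<bar>sabs t\<bar> <= 1" using False by (simp add: sabs_def abs_mult mult_le_one)
 then show ?thesis using False by linarith
qed

lemma deriv_bounded_if_bounded_outside:
 fixes k :: "real => real"
 assumes k: "smooth k" and out: "!!t. \<bar>t\<bar> > a ==> \<bar>dir_deriv 1 k t\<bar> <= 1"
 obtains L where "L >= 0" "!!t. \<bar>dir_deriv 1 k t\<bar> <= L"
proof -
 have "compact (dir_deriv 1 k ` {-a..a})" by (intro compact_continuous_image smooth_continuous smooth_dir_deriv k) auto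
 then obtain B where B: "!!t. t \<in> {-a..a} ==> norm (dir_deriv 1 k t) <= B"
  using compact_imp_bounded bounded_iff by (metis imageI)
 have "\<bar>dir_deriv 1 k t\<bar> <= \<bar>B\<bar> + 1" for t
 proof (cases "\<bar>t\<bar> > a")
  case True then show ?thesis using out[of t] by linarith
 next
  case False
  then have "t \<in> {-a..a}" by auto
  from B[OF this] show ?thesis by simp
 qed
 then show ?thesis using that[of "\<bar>B\<bar> + 1"] by auto
qed

lemma sstep_deriv_bounded: obtains L where "L >= 0" "!!t. \<bar>dir_deriv 1 sstep t\<bar> <= L"
proof (rule deriv_bounded_if_bounded_outside[OF smooth_sstep, of 1])
 fix t :: real assume "\<bar>t\<bar> > 1"
 then consider "t > 1" | "t < 0" by linarith
 then have "dir_deriv 1 sstep t = 0"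
 proof cases
  case 1
  have "dir_deriv 1 sstep t = dir_deriv 1 (\<lambda>t. 1) t" using 1 by (intro dir_deriv_cong_open[where U = "{1<..}"]) (auto simp: sstep_1)
  then show ?thesis using dir_deriv_eqI[OF has_derivative_const] by simp
 next
  case 2
  have "dir_deriv 1 sstep t = dir_deriv 1 (\<lambda>t. 0) t" using 2 by (intro dir_deriv_cong_open[where U = "{..<0}"]) (auto simp: sstep_0)
  then show ?thesis using dir_deriv_eqI[OF has_derivative_const] by simp
 qed
 then show "\<bar>dir_deriv 1 sstep t\<bar> <= 1" by simp
qed (use that in auto)

lemma sabs_deriv_bounded: obtains L where "L >= 0" "!!t. \<bar>dir_deriv 1 sabs t\<bar> <= L"
proof (rule deriv_bounded_if_bounded_outside[OF smooth_sabs, of 1])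
 fix t :: real assume "\<bar>t\<bar> > 1"
 then consider "t > 1" | "t < -1" by linarith
 then show "\<bar>dir_deriv 1 sabs t\<bar> <= 1"
 proof cases
  case 1
  have "dir_deriv 1 sabs t = dir_deriv 1 (\<lambda>t. t) t" using 1 by (intro dir_deriv_cong_open[where U = "{1<..}"]) (auto simp: sabs_eq)
  also have "\<dots> = 1" by (rule dir_deriv_eqI[OF has_derivative_ident])
  finally show ?thesis by simp
 next
  case 2
  have "dir_deriv 1 sabs t = dir_deriv 1 (\<lambda>t. - t) t" using 2 by (intro dir_deriv_cong_open[where U = "{..<-1}"]) (auto simp: sabs_eq)
  also have "\<dots> = - 1" by (rule dir_deriv_eqI[OF has_derivative_minus[OF has_derivative_ident]])
  finally show ?thesis by simp
 qed
qed (use that in auto)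

text \<open>\<open>ell\<close> has a kink across the line of the bisector, so its absolute value is
  replaced by the smooth \<open>sabs\<close>, at the cost of an error of at most 2. The shift by 3
  absorbs this error: the cutoff is 0 for ell < 1 and 1 for ell >= 6.\<close>

definition pcut :: "real => real => real^2 => real"
 where "pcut th be x = sstep (cX th x * sin be - cos be * sabs (cY th x) - 3)"

lemma pcut_arg: "\<bar>cX th x * sin be - cos be * sabs (cY th x) - ell th be x\<bar> <= 2"
proof -
 have "cX th x * sin be - cos be * sabs (cY th x) - ell th be x = - (cos be * (sabs (cY th x) - \<bar>cY th x\<bar>))"
  by (simp add: ell_def algebra_simps)
 also have "\<bar>\<dots>\<bar> <= 1 * 2" unfolding abs_minus_cancel abs_mult by (intro mult_mono sabs_abs) auto
 finally show ?thesis by simp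
qed

lemma smooth_pcut_arg: "smooth (\<lambda>x. cX th x * sin be - cos be * sabs (cY th x) - 3)"
 by (intro smooth_diff smooth_mult smooth_const smooth_linear bounded_linear_cX
   smooth_compose[OF smooth_linear[OF bounded_linear_cY] smooth_sabs])

lemma smooth_pcut: "smooth (pcut th be)" unfolding pcut_def[abs_def] by (rule smooth_compose[OF smooth_pcut_arg smooth_sstep])

lemma pcut_range: "0 <= pcut th be x" "pcut th be x <= 1" using sstep_range by (auto simp: pcut_def)

lemma pcut_nz: "pcut th be x ~= 0 ==> ell th be x >= 1"
 using pcut_arg[of th x be] sstep_0[of "cX th x * sin be - cos be * sabs (cY th x) - 3"]
 unfolding pcut_def by (smt (verit))

lemma pcut_1: "ell th be x >= 6 ==> pcut th be x = 1"
 using pcut_arg[of th x be] sstep_1[of "cX th x * sin be - cos be * sabs (cY th x) - 3"]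
 unfolding pcut_def by (smt (verit))

lemma pcut_deriv_bounded: obtains L where "L >= 0" "!!b x. \<bar>dir_deriv b (pcut th be) x\<bar> <= L * norm b"
proof -
 obtain L1 where L1: "L1 >= 0" "!!t. \<bar>dir_deriv 1 sstep t\<bar> <= L1" by (rule sstep_deriv_bounded) blast
 obtain L2 where L2: "L2 >= 0" "!!t. \<bar>dir_deriv 1 sabs t\<bar> <= L2" by (rule sabs_deriv_bounded) blast
 let ?m = "\<lambda>x. cX th x * sin be - cos be * sabs (cY th x) - 3"
 have dm: "dir_deriv b ?m x = cX th b * sin be - cos be * (cY th b * dir_deriv 1 sabs (cY th x))" for b x
 proof (rule dir_deriv_eqI)
  have "((\<lambda>x. sabs (cY th x)) has_derivative (\<lambda>b. cY th b * dir_deriv 1 sabs (cY th x))) (at x)"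
  proof -
   have "((\<lambda>x. sabs (cY th x)) has_derivative (\<lambda>b. dir_deriv b (\<lambda>x. sabs (cY th x)) x)) (at x)"
    by (rule smooth_has_derivative[OF smooth_compose[OF smooth_linear[OF bounded_linear_cY] smooth_sabs]])
   then show ?thesis using dir_deriv_compose[OF smooth_linear[OF bounded_linear_cY] smooth_sabs]
     dir_deriv_eqI[OF bounded_linear_imp_has_derivative[OF bounded_linear_cY]] by simp
  qed
  then show "(?m has_derivative (\<lambda>b. cX th b * sin be - cos be * (cY th b * dir_deriv 1 sabs (cY th x)))) (at x)"
   by (auto intro!: derivative_eq_intros bounded_linear_imp_has_derivative[OF bounded_linear_cX])
 qed
 have "\<bar>dir_deriv b (pcut th be) x\<bar> <= (L1 * (1 + L2)) * norm b" for b x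
 proof -
  have "dir_deriv b (pcut th be) x = dir_deriv b ?m x * dir_deriv 1 sstep (?m x)"
   using dir_deriv_compose[OF smooth_pcut_arg smooth_sstep] by (simp add: pcut_def[abs_def])
  also have "\<bar>\<dots>\<bar> = \<bar>dir_deriv b ?m x\<bar> * \<bar>dir_deriv 1 sstep (?m x)\<bar>" by (rule abs_mult)
  also have "\<dots> <= ((1 + L2) * norm b) * L1"
  proof (intro mult_mono L1)
   have "\<bar>dir_deriv b ?m x\<bar> <= \<bar>cX th b\<bar> * \<bar>sin be\<bar> + \<bar>cos be\<bar> * (\<bar>cY th b\<bar> * \<bar>dir_deriv 1 sabs (cY th x)\<bar>)"
    unfolding dm by (metis abs_mult abs_triangle_ineq4)
   also have "\<dots> <= norm b * 1 + 1 * (norm b * L2)" by (intro add_mono mult_mono abs_cX_le abs_cY_le L2) auto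
   finally show "\<bar>dir_deriv b ?m x\<bar> <= (1 + L2) * norm b" by (simp add: algebra_simps)
  qed (use L2 in auto)
  finally show ?thesis by (simp add: algebra_simps)
 qed
 then show ?thesis using that[of "L1 * (1 + L2)"] L1 L2 by auto
qed

text \<open>As \<open>ell\<close> is homogeneous of degree 1, scaling squeezes the transition into
  1/(n+1) <= ell <= 6/(n+1), with gradients of order n + 1.\<close>

definition wcut :: "real => real => nat => real^3 => real"
 where "wcut th be n x = pcut th be (real (Suc n) *\<^sub>R proj2 x)"

lemma bounded_linear_scaled_proj2: "bounded_linear (\<lambda>x. r *\<^sub>R proj2 x)"
 by (rule bounded_linear_compose[OF bounded_linear_scaleR_right bounded_linear_proj2, unfolded o_def])

lemma smooth_wcut: "smooth (wcut th be n)" unfolding wcut_def[abs_def]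
 by (rule smooth_compose[OF smooth_linear[OF bounded_linear_scaled_proj2] smooth_pcut])

lemma wcut_range: "0 <= wcut th be n x" "wcut th be n x <= 1" using pcut_range by (auto simp: wcut_def)

lemma wcut_nz: "wcut th be n x ~= 0 ==> ell th be (proj2 x) >= 1 / real (Suc n)"
 using pcut_nz[of th be "real (Suc n) *\<^sub>R proj2 x"] by (simp add: wcut_def ell_scaleR field_simps del: of_nat_Suc)

lemma wcut_1: "ell th be (proj2 x) >= 6 / real (Suc n) ==> wcut th be n x = 1"
 using pcut_1[of th be "real (Suc n) *\<^sub>R proj2 x"] by (simp add: wcut_def ell_scaleR field_simps del: of_nat_Suc)

lemma wcut_deriv_0:
 assumes "ell th be (proj2 x) > 6 / real (Suc n)" shows "dir_deriv b (wcut th be n) x = 0"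
proof -
 have "dir_deriv b (wcut th be n) x = dir_deriv b (\<lambda>_. 1) x" using assms wcut_1
  by (intro dir_deriv_cong_open[where U = "{x. ell th be (proj2 x) > 6 / real (Suc n)}"])
   (auto intro!: open_Collect_less continuous_intros)
 then show ?thesis using dir_deriv_eqI[OF has_derivative_const] by simp
qed

lemma wcut_deriv_bounded:
 obtains L where "L >= 0" "!!n b x. \<bar>dir_deriv b (wcut th be n) x\<bar> <= L * real (Suc n) * norm b"
proof -
 obtain L where L: "L >= 0" "!!b x. \<bar>dir_deriv b (pcut th be) x\<bar> <= L * norm b" by (rule pcut_deriv_bounded) blast
 have "\<bar>dir_deriv b (wcut th be n) x\<bar> <= L * real (Suc n) * norm b" for n b x
 proof -
  have "((\<lambda>x. pcut th be (real (Suc n) *\<^sub>R proj2 x)) has_derivative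
   (\<lambda>b. dir_deriv (real (Suc n) *\<^sub>R proj2 b) (pcut th be) (real (Suc n) *\<^sub>R proj2 x))) (at x)"
   using diff_chain_at[OF bounded_linear_imp_has_derivative[OF bounded_linear_scaled_proj2] smooth_has_derivative[OF smooth_pcut]]
   by (simp add: o_def)
  then have "dir_deriv b (wcut th be n) x = dir_deriv (real (Suc n) *\<^sub>R proj2 b) (pcut th be) (real (Suc n) *\<^sub>R proj2 x)"
   unfolding wcut_def[abs_def] by (rule dir_deriv_eqI)
  then have "\<bar>dir_deriv b (wcut th be n) x\<bar> <= L * norm (real (Suc n) *\<^sub>R proj2 b)" by (simp only: L(2))
  also have "\<dots> = L * real (Suc n) * norm (proj2 b)" by (simp del: of_nat_Suc)
  also have "\<dots> <= L * real (Suc n) * norm b" using L(1) by (intro mult_left_mono norm_proj2_le) auto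
  finally show ?thesis .
 qed
 then show ?thesis using that L(1) by blast
qed

section \<open>The solid sector at the edge and its two faces\<close>

locale edge =
 fixes th be h M :: real
 assumes be: "0 < be" "be < pi" and cos_be: "cos be ~= 0" and h: "h > 0" and M: "M > 0"
begin

abbreviation "lev \<equiv> ell th be"
abbreviation "fac \<equiv> face th be"

text \<open>Test functions on \<open>Sol\<close> vanish near the faces, those on the full cylinder
  \<open>Cyl\<close> need not; passing from the former to the latter is the recurring task.\<close>

definition "Sect r = {x. lev x > 0 \<and> norm x < r}"
definition "Cyl r = cyl (ball 0 r) {-M<..<M}"
definition "Sol r = cyl (Sect r) {-M<..<M}"

abbreviation Sint :: "(real^3 => 'b::{banach, second_countable_topology}) => 'b" (binder "SINT " 10)
 where "Sint p \<equiv> set_lebesgue_integral lebesgue (Sol h) p"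
abbreviation "Sintegrable p \<equiv> set_integrable lebesgue (Sol h) p"

lemma sin_be: "sin be > 0" using be by (rule sin_gt_zero)

lemma open_Sect: "open (Sect r)" unfolding Sect_def by (intro open_Collect_conj open_Collect_less continuous_intros)

lemma open_Cyl: "open (Cyl r)" and open_Sol: "open (Sol r)" unfolding Cyl_def Sol_def by (intro open_cyl open_Sect; simp)+

lemma in_Cyl: "x \<in> Cyl r \<longleftrightarrow> norm (proj2 x) < r \<and> \<bar>x $ 3\<bar> < M" by (auto simp: Cyl_def cyl_def abs_less_iff)

lemma in_Sol: "x \<in> Sol r \<longleftrightarrow> lev (proj2 x) > 0 \<and> norm (proj2 x) < r \<and> \<bar>x $ 3\<bar> < M"
 by (auto simp: Sol_def Sect_def cyl_def abs_less_iff)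

lemma Sol_subset_Cyl: "Sol r \<subseteq> Cyl r" by (auto simp: in_Sol in_Cyl)

lemma bounded_Cyl: "bounded (Cyl r)" unfolding Cyl_def by (intro bounded_cyl) auto

lemma emeasure_Sol: "emeasure lebesgue (Sol r) < top"
proof -
 have "bounded (Sol r)" using bounded_Cyl bounded_subset Sol_subset_Cyl by blast
 then have "emeasure lborel (Sol r) < top" by (rule emeasure_bounded_finite[unfolded infinity_ennreal_def])
 then show "emeasure lebesgue (Sol r) < top" using open_Sol[of r] by simp
qed

lemma ell_face: "lev (proj2 (fac p)) = 0" using sin_be by (simp add: face_def ell_def cot_def)

lemma face_not_Sol: "fac p \<notin> Sol r" by (simp add: in_Sol ell_face)

lemma test_wcut:
 assumes "test_fun (Cyl r) ps" shows "test_fun (Sol r) (\<lambda>x. wcut th be n x * ps x)"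
proof (rule test_funI[where C = "closure {x. ps x ~= 0} \<inter> {x. lev (proj2 x) >= 1 / real (Suc n)}"])
 show "smooth (\<lambda>x. wcut th be n x * ps x)" by (intro smooth_mult smooth_wcut test_funD(1)[OF assms])
 show "{x. wcut th be n x * ps x ~= 0} \<subseteq> closure {x. ps x ~= 0} \<inter> {x. lev (proj2 x) >= 1 / real (Suc n)}"
  using closure_subset[of "{x. ps x ~= 0}"] wcut_nz[of th be n] by auto
 show "compact (closure {x. ps x ~= 0} \<inter> {x. lev (proj2 x) >= 1 / real (Suc n)})"
  by (intro compact_Int_closed test_funD(2)[OF assms] closed_Collect_le continuous_intros)
 show "closure {x. ps x ~= 0} \<inter> {x. lev (proj2 x) >= 1 / real (Suc n)} \<subseteq> Sol r"
 proof
  fix x assume x: "x \<in> closure {x. ps x ~= 0} \<inter> {x. lev (proj2 x) >= 1 / real (Suc n)}"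
  then have "x \<in> Cyl r" using test_funD(3)[OF assms] by blast
  moreover have "lev (proj2 x) > 0" using x by (auto intro: less_le_trans[of 0 "1 / real (Suc n)"])
  ultimately show "x \<in> Sol r" by (simp add: in_Sol in_Cyl)
 qed
qed

lemma wcut_tendsto: "lev (proj2 x) > 0 ==> \<forall>\<^sub>F n in sequentially. wcut th be n x = 1 \<and> dir_deriv b (wcut th be n) x = 0"
proof -
 assume l: "lev (proj2 x) > 0"
 have "(\<lambda>n. 6 * inverse (real (Suc n))) \<longlonglongrightarrow> 6 * 0" by (intro tendsto_intros LIMSEQ_inverse_real_of_nat)
 then have "\<forall>\<^sub>F n in sequentially. 6 * inverse (real (Suc n)) < lev (proj2 x)" using l by (intro order_tendstoD(2)) auto
 then show ?thesis by eventually_elim (use wcut_1 wcut_deriv_0 in \<open>auto simp: divide_inverse simp del: of_nat_Suc\<close>)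
qed

lemma integrable_test_mult:
 fixes p :: "real^3 => 'b::euclidean_space"
 assumes "set_integrable lebesgue A p" "test_fun U ps"
 shows "set_integrable lebesgue A (\<lambda>x. ps x *\<^sub>R p x)"
proof -
 obtain B where B: "B > 0" "!!x. \<bar>ps x\<bar> <= B" using test_fun_bounded[OF assms(2)] by blast
 have m: "ps \<in> borel_measurable lebesgue" using smooth_measurable[OF test_funD(1)[OF assms(2)]] by (simp add: measurable_completion)
 have i: "integrable lebesgue (\<lambda>x. indicator A x *\<^sub>R p x)" using assms(1) by (simp add: set_integrable_def)
 have "integrable lebesgue (\<lambda>x. ps x *\<^sub>R (indicator A x *\<^sub>R p x))"
 proof (rule Bochner_Integration.integrable_bound)
  show "integrable lebesgue (\<lambda>x. B *\<^sub>R norm (indicator A x *\<^sub>R p x))" using i by (intro integrable_scaleR_right integrable_norm)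
  show "(\<lambda>x. ps x *\<^sub>R indicator A x *\<^sub>R p x) \<in> borel_measurable lebesgue"
   using m borel_measurable_integrable[OF i] by (rule borel_measurable_scaleR)
  have "norm (ps x *\<^sub>R v) <= norm (B *\<^sub>R norm v)" for x and v :: 'b using B(1) mult_right_mono[OF B(2)[of x], of "norm v"] by simp
  then show "AE x in lebesgue. norm (ps x *\<^sub>R indicator A x *\<^sub>R p x) <= norm (B *\<^sub>R norm (indicator A x *\<^sub>R p x))"
   by (intro AE_I2)
 qed
 then show ?thesis by (simp add: set_integrable_def mult.commute)
qed

text \<open>Replaces the fundamental lemma of the calculus of variations: the cutoffs carry identities for
 test functions supported inside the domain over to test functions that do not vanish on the faces.\<close>

lemma test_extends_to_faces:
 fixes p :: "real^3 => 'b::euclidean_space"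
 assumes p: "set_integrable lebesgue (Sol r) p"
  and z: "!!\<phi>. test_fun (Sol r) \<phi> ==> (LINT x:Sol r|lebesgue. \<phi> x *\<^sub>R p x) = 0"
  and ps: "test_fun (Cyl r) ps"
 shows "(LINT x:Sol r|lebesgue. ps x *\<^sub>R p x) = 0"
proof -
 let ?I = "\<lambda>x. indicator (Sol r) x *\<^sub>R ps x *\<^sub>R p x"
 have i: "integrable lebesgue ?I" using integrable_test_mult[OF p ps] by (simp add: set_integrable_def)
 have "(\<lambda>n. LINT x|lebesgue. wcut th be n x *\<^sub>R ?I x) \<longlonglongrightarrow> (LINT x|lebesgue. ?I x)"
 proof (rule integral_dominated_convergence)
  show "integrable lebesgue (\<lambda>x. norm (?I x))" by (intro integrable_norm i)
  show "?I \<in> borel_measurable lebesgue" by (rule borel_measurable_integrable[OF i])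
  show "(\<lambda>x. wcut th be n x *\<^sub>R ?I x) \<in> borel_measurable lebesgue" for n
   by (rule borel_measurable_scaleR[OF _ borel_measurable_integrable[OF i]])
    (simp add: measurable_completion smooth_measurable[OF smooth_wcut])
  show "AE x in lebesgue. norm (wcut th be n x *\<^sub>R ?I x) <= norm (?I x)" for n
   using wcut_range[of th be n] by (intro AE_I2) (simp only: norm_scaleR[of "wcut th be n _"] abs_of_nonneg mult_left_le_one_le norm_ge_zero)
  show "AE x in lebesgue. (\<lambda>n. wcut th be n x *\<^sub>R ?I x) \<longlonglongrightarrow> ?I x"
  proof (intro AE_I2)
   fix x
   show "(\<lambda>n. wcut th be n x *\<^sub>R ?I x) \<longlonglongrightarrow> ?I x"
   proof (cases "x \<in> Sol r")
    case True
    then have "\<forall>\<^sub>F n in sequentially. ?I x = wcut th be n x *\<^sub>R ?I x"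
     using eventually_mono[OF wcut_tendsto[of x 0], of "\<lambda>n. ?I x = wcut th be n x *\<^sub>R ?I x"] by (simp add: in_Sol)
    then show ?thesis by (rule Lim_transform_eventually[OF tendsto_const])
   qed simp
  qed
 qed
 moreover have "(LINT x|lebesgue. wcut th be n x *\<^sub>R ?I x) = 0" for n using z[OF test_wcut[OF ps, of n]]
  by (simp add: set_lebesgue_integral_def mult.left_commute)
 ultimately show ?thesis by (simp add: LIMSEQ_const_iff set_lebesgue_integral_def)
qed

text \<open>A local form of \<open>wedge_divergence\<close>: the test function extends the product
  by zero, so \<open>f\<close> is needed only in the cylinder, up to the faces.\<close>

lemma face_integration_by_parts:
 fixes f :: "real^3 => 'b::euclidean_space"
 assumes ps: "test_fun (Cyl r) ps"
  and f: "continuous_on ({x. lev (proj2 x) >= 0} \<inter> Cyl r) f"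
  and D: "!!x. x \<in> Sol r ==> (f has_derivative D x) (at x)"
  and f': "!!x. x \<in> Sol r ==> D x (e3 th) = f' x" "continuous_on (Sol r) f'"
  and B: "!!x. x \<in> Sol r ==> norm (f x) <= B" "!!x. x \<in> Sol r ==> norm (f' x) <= B"
 shows "set_integrable lebesgue (Sol r) (\<lambda>x. dir_deriv (e3 th) ps x *\<^sub>R f x + ps x *\<^sub>R f' x)"
  and "(LINT x:Sol r|lebesgue. dir_deriv (e3 th) ps x *\<^sub>R f x + ps x *\<^sub>R f' x) =
   - (LINT p|lborel. ps (fac p) *\<^sub>R f (fac p))"
proof -
 let ?W = "{x. lev (proj2 x) > 0}"
 let ?dp = "dir_deriv (e3 th) ps"
 let ?T = "\<lambda>x. ps x *\<^sub>R f x"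
 define T' where "T' = (\<lambda>x. ?dp x *\<^sub>R f x + ps x *\<^sub>R f' x)"
 \<comment> \<open>Nothing is known about \<open>f\<close> outside the cylinder; there the product
   vanishes in a neighbourhood and has derivative 0.\<close>
 define DT where "DT x = (if x \<in> Cyl r then (\<lambda>b. ps x *\<^sub>R D x b + dir_deriv b ps x *\<^sub>R f x) else (\<lambda>b. 0))" for x
 have sm: "smooth ps" "smooth ?dp" using test_funD(1)[OF ps] by auto
 have dp: "test_fun (Cyl r) ?dp" by (rule test_fun_dir_deriv[OF ps])
 have WS: "x \<in> Sol r \<longleftrightarrow> x \<in> ?W \<and> x \<in> Cyl r" for x by (auto simp: in_Sol in_Cyl)
 have z: "ps x = 0" "?dp x = 0" if "x \<notin> Cyl r" for x using that test_funD(5)[OF ps] test_funD(5)[OF dp] by auto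
 obtain B1 where B1: "B1 > 0" "!!x. \<bar>ps x\<bar> <= B1" using test_fun_bounded[OF ps] by blast
 obtain B2 where B2: "B2 > 0" "!!x. \<bar>?dp x\<bar> <= B2" using test_fun_bounded[OF dp] by blast
 obtain R where R: "!!x. x \<in> Cyl r ==> norm x < R" using bounded_Cyl[of r] unfolding bounded_pos_less by blast
 have cont: "continuous_on {x. lev (proj2 x) >= 0} ?T"
  by (rule continuous_on_bump[OF smooth_continuous[OF sm(1)] test_funD(3)[OF ps] open_Cyl f])
 have Sc: "continuous_on (?W \<inter> Cyl r) f" by (rule continuous_on_subset[OF f]) auto
 have Sc': "continuous_on (?W \<inter> Cyl r) f'" by (rule continuous_on_subset[OF f'(2)]) (auto simp: WS)
 have cT': "continuous_on ?W T'" unfolding T'_def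
  by (intro continuous_on_add continuous_on_bump[where U = "Cyl r"] smooth_continuous open_Cyl sm test_funD(3)[OF dp] test_funD(3)[OF ps] Sc Sc')
 have der: "(?T has_derivative DT x) (at x)" if x: "lev (proj2 x) > 0" for x
 proof (cases "x \<in> Cyl r")
  case True
  then have "x \<in> Sol r" using x WS by auto
  from has_derivative_scaleR[OF smooth_has_derivative[OF sm(1)] D[OF this]]
  show ?thesis using True by (simp add: DT_def)
 next
  case False
  let ?N = "- closure {x. ps x ~= 0}"
  have "x \<in> ?N" using False test_funD(3)[OF ps] by blast
  moreover have "0 = ?T y" if "y \<in> ?N" for y using test_funD(4)[OF ps, of y] that by simp
  ultimately have "(?T has_derivative (\<lambda>b. 0)) (at x)"
   using has_derivative_transform_within_open[OF has_derivative_const[of 0 "at x"], of ?N ?T] by auto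
  then show ?thesis using False by (simp add: DT_def)
 qed
 have eqT': "DT x (e3 th) = T' x" if x: "lev (proj2 x) > 0" for x using f'(1)[of x] WS[of x] z[of x] x by (auto simp: DT_def T'_def)
 have bT': "norm (T' x) <= (B2 + B1) * \<bar>B\<bar>" if x: "lev (proj2 x) > 0" for x
 proof (cases "x \<in> Cyl r")
  case True
  then have xS: "x \<in> Sol r" using x WS by auto
  have "norm (T' x) <= \<bar>?dp x\<bar> * norm (f x) + \<bar>ps x\<bar> * norm (f' x)"
   unfolding T'_def by (metis norm_triangle_ineq norm_scaleR)
  also have "\<dots> <= B2 * \<bar>B\<bar> + B1 * \<bar>B\<bar>" using B[OF xS] B1(1) B2(1) by (intro add_mono mult_mono B1(2) B2(2)) auto
  finally show ?thesis by (simp add: algebra_simps)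
 next
  case False then show ?thesis using B1(1) B2(1) z[of x] by (simp add: T'_def)
 qed
 have out: "?T x = 0" "T' x = 0" if "norm x >= R" for x
 proof -
  have "x \<notin> Cyl r" using R[of x] that by force
  then show "?T x = 0" "T' x = 0" by (simp_all add: T'_def z)
 qed
 note wd = wedge_divergence[OF be cont der eqT' cT' bT' out]
 have eq: "indicator ?W x *\<^sub>R T' x = indicator (Sol r) x *\<^sub>R T' x" for x using z[of x] WS[of x] by (auto simp: indicator_def T'_def)
 have i: "integrable lborel (\<lambda>x. indicator (Sol r) x *\<^sub>R T' x)" using wd(1) by (simp add: set_integrable_def eq)
 then have il: "integrable lebesgue (\<lambda>x. indicator (Sol r) x *\<^sub>R T' x)" by (subst integrable_completion) auto
 then show "set_integrable lebesgue (Sol r) (\<lambda>x. ?dp x *\<^sub>R f x + ps x *\<^sub>R f' x)" by (simp add: set_integrable_def T'_def)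
 have "(LINT x:Sol r|lebesgue. T' x) = (LINT x|lborel. indicator (Sol r) x *\<^sub>R T' x)"
  unfolding set_lebesgue_integral_def using i by (intro integral_completion) auto
 also have "\<dots> = (LINT x:?W|lborel. T' x)" by (simp add: set_lebesgue_integral_def eq)
 also have "\<dots> = - (LINT p|lborel. ?T (fac p))" by (rule wd(2))
 finally show "(LINT x:Sol r|lebesgue. ?dp x *\<^sub>R f x + ps x *\<^sub>R f' x) = - (LINT p|lborel. ?T (fac p))" by (simp add: T'_def)
qed

end

lemma integrable_continuous_bounded_support:
 fixes g :: "'a::euclidean_space => 'b::euclidean_space"
 assumes "continuous_on UNIV g" "!!x. norm x > R ==> g x = 0" shows "integrable lborel g"
proof -
 have "integrable lborel (\<lambda>x. indicator (cball 0 R) x *\<^sub>R g x)"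
  by (intro borel_integrable_compact continuous_on_subset[OF assms(1)]) auto
 moreover have "(\<lambda>x. indicator (cball 0 R) x *\<^sub>R g x) = g" using assms(2) by (auto simp: fun_eq_iff indicator_def)
 ultimately show ?thesis by simp
qed

lemma norm_join3: "(norm (join3 y t))\<^sup>2 = (norm y)\<^sup>2 + t\<^sup>2"
 by (simp only: power2_norm_eq_inner) (simp add: inner_vec_def sum_2 sum_3 power2_eq_square)

lemma face_diff: "face th be p - face th be q =
  join3 (rot2 th (\<bar>fst p\<bar> * cot be - \<bar>fst q\<bar> * cot be) (fst p - fst q)) (snd p - snd q)"
 by (simp add: face_def vec_eq_iff forall_3 algebra_simps)

text \<open>Forgetting the coordinate along the bisector is a contraction inverse to
  \<open>face\<close>. This is the expansiveness that \<open>nn_integral_graph_le\<close> asks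
  for.\<close>

lemma face_expansive: "dist p q <= dist (face th be p) (face th be q)"
proof -
 have "(dist p q)\<^sup>2 = (fst p - fst q)\<^sup>2 + (snd p - snd q)\<^sup>2" by (simp add: dist_prod_def dist_real_def)
 also have "\<dots> <= (dist (face th be p) (face th be q))\<^sup>2"
  unfolding dist_norm face_diff norm_join3 norm_rot2 by simp
 finally show ?thesis by (rule power2_le_imp_le) simp
qed

lemma face_norm: "norm p <= norm (face th be p)"
proof -
 have "face th be (0, 0) = 0" by (simp add: face_def vec_eq_iff forall_3)
 then show ?thesis using face_expansive[of p "(0,0)" th be] by (simp add: dist_norm zero_prod_def[symmetric])
qed

lemma matrix_complexify_bound:
 obtains ka where "ka > 0" "!!(A :: complex^3^3) e. norm (A *v complexify e) <= ka * norm A * norm e"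
proof -
 have "bilinear (\<lambda>(A :: complex^3^3) e. A *v complexify e)" unfolding bilinear_def
  by (auto intro!: linearI simp: vec_eq_iff matrix_vector_mult_def complexify_def sum.distrib
    scaleR_conv_of_real[where 'a=complex] algebra_simps sum_distrib_left)
 from bilinear_bounded_pos[OF this] show ?thesis using that by (auto simp: mult_ac)
qed

lemma complexify_linear: "complexify (a *\<^sub>R x + b *\<^sub>R y) = a *\<^sub>R complexify x + b *\<^sub>R complexify y"
 by (simp add: complexify_def vec_eq_iff scaleR_conv_of_real[where 'a=complex])

lemma matrix_mult_scaleR: "A *v (a *\<^sub>R z) = a *\<^sub>R (A *v z)" for A :: "complex^'n^'m"
 by (simp add: vec_eq_iff matrix_vector_mult_def scaleR_conv_of_real[where 'a=complex] sum_distrib_left mult_ac)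

context edge
begin

text \<open>A small shift along the bisector moves a point of the closed wedge into the open
  one.\<close>

lemma closure_Sect:
 assumes "lev x >= 0" "norm x < r" shows "x \<in> closure (Sect r)" unfolding closure_approachable
proof (intro allI impI)
 fix e :: real assume e: "e > 0"
 define s where "s = min e (r - norm x) / 2"
 have s: "s > 0" "s < e" "s < r - norm x" using e assms by (auto simp: s_def min_def)
 have "norm (x + s *\<^sub>R e2 th) <= norm x + s" using norm_triangle_ineq[of x "s *\<^sub>R e2 th"] s by simp
 then have "x + s *\<^sub>R e2 th \<in> Sect r" using s assms sin_be by (simp add: Sect_def ell_add_e2 add_nonneg_pos)
 moreover have "dist (x + s *\<^sub>R e2 th) x < e" using s by (simp add: dist_norm)
 ultimately show "\<exists>y\<in>Sect r. dist y x < e" by blast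
qed

definition "Kcl = cyl (closure (Sect h)) {-M..M}"

lemma in_Kcl: "lev (proj2 x) >= 0 ==> x \<in> Cyl h ==> x \<in> Kcl"
 using closure_Sect[of "proj2 x" h] by (auto simp: Kcl_def cyl_def in_Cyl)

lemma Sol_subset_Kcl: "Sol h \<subseteq> Kcl" using in_Kcl by (auto simp: in_Sol in_Cyl)

lemma Sol_subset_interior: "Sol h \<subseteq> interior Kcl" using Sol_subset_Kcl open_Sol by (simp add: interior_maximal)

lemma compact_Kcl: "compact Kcl"
proof -
 have "bounded (Sect h)" unfolding Sect_def by (rule bounded_subset[of "ball 0 h"]) auto
 then show ?thesis unfolding Kcl_def by (intro compact_cyl) auto
qed

text \<open>The fundamental lemma of the calculus of variations on the faces, with a bump around a
  point where \<open>F\<close> does not vanish. The test functions avoid the plane of the bisector,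
  and with it the edge, where no trace condition is available; the edge itself is reached by
  continuity.\<close>

lemma vanish_on_faces:
 fixes F :: "real^3 => 'b::euclidean_space"
 assumes F: "continuous_on ({x. lev (proj2 x) >= 0} \<inter> Cyl r) F"
  and tst: "!!ps. test_fun (Cyl r \<inter> {x. cY th (proj2 x) ~= 0}) ps ==>
   (LINT p|lborel. ps (fac p) *\<^sub>R F (fac p)) = 0"
  and x: "lev (proj2 x) = 0" "x \<in> Cyl r"
 shows "F x = 0"
proof -
 let ?S = "{x. lev (proj2 x) >= 0} \<inter> Cyl r"
 have 1: "F x = 0" if x: "lev (proj2 x) = 0" "x \<in> Cyl r" "cY th (proj2 x) ~= 0" for x
 proof (rule ccontr)
  assume Fx: "F x ~= 0"
  define p0 where "p0 = (cY th (proj2 x), x $ 3)"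
  have "cX th (proj2 x) = \<bar>cY th (proj2 x)\<bar> * cot be" using x(1) sin_be by (simp add: ell_def cot_def field_simps)
  then have p0: "fac p0 = x" using rot2_cX_cY[of th "proj2 x"] by (simp add: p0_def face_def)
  have xS: "x \<in> ?S" using x by simp
  have "continuous (at x within ?S) (\<lambda>y. F y \<bullet> F x)"
   using continuous_on_inner[OF F continuous_on_const] xS by (simp add: continuous_on_eq_continuous_within)
  moreover have "F x \<bullet> F x > 0" using Fx by simp
  ultimately have "\<forall>\<^sub>F y in at x within ?S. F y \<bullet> F x > 0" unfolding continuous_within by (rule order_tendstoD(1))
  then obtain d where d: "d > 0" "!!y. y \<in> ?S ==> y ~= x ==> dist y x < d ==> F y \<bullet> F x > 0"
   unfolding eventually_at by blast
  have "open (Cyl r \<inter> {x. cY th (proj2 x) ~= 0})" by (intro open_Int open_Cyl open_Collect_neq continuous_intros)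
  then obtain d' where d': "d' > 0" "ball x d' \<subseteq> Cyl r \<inter> {x. cY th (proj2 x) ~= 0}" using x by (elim openE[of _ x]) auto
  define s where "s = min d d' / 2"
  have s: "s > 0" "s < d" "s < d'" using d d' by (auto simp: s_def)
  define ps where "ps = bump x s"
  have "cball x s \<subseteq> ball x d'" using s by auto
  then have t: "test_fun (Cyl r \<inter> {x. cY th (proj2 x) ~= 0}) ps" unfolding ps_def using d' s by (intro test_fun_bump) auto
  then have t': "test_fun (Cyl r) ps" by (rule test_fun_mono) auto
  define g where "g p = ps (fac p) *\<^sub>R F (fac p)" for p
  have gc: "continuous_on UNIV g" unfolding g_def[abs_def]
  proof (rule continuous_on_bump[where U = "fac -` Cyl r"])
   have cf: "continuous_on UNIV (fac)" by (rule continuous_on_face)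
   show "continuous_on UNIV (\<lambda>p. ps (fac p))" by (rule continuous_on_compose2[OF smooth_continuous[OF test_funD(1)[OF t]] cf]) auto
   show "open (fac -` Cyl r)" by (intro open_vimage open_Cyl cf)
   have "closure {p. ps (fac p) ~= 0} \<subseteq> fac -` closure {x. ps x ~= 0}"
    using closure_subset[of "{x. ps x ~= 0}"] by (intro closure_minimal closed_vimage cf closed_closure) auto
   then show "closure {p. ps (fac p) ~= 0} \<subseteq> fac -` Cyl r" using test_funD(3)[OF t'] by blast
   show "continuous_on (UNIV \<inter> fac -` Cyl r) (\<lambda>p. F (fac p))"
    by (rule continuous_on_compose2[OF F continuous_on_face]) (auto simp: ell_face)
  qed
  obtain R where R: "!!x. x \<in> Cyl r ==> norm x < R" using bounded_Cyl[of r] unfolding bounded_pos_less by blast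
  have gi: "integrable lborel g"
  proof (rule integrable_continuous_bounded_support[OF gc])
   fix p :: "real \<times> real" assume "norm p > R"
   then have "fac p \<notin> Cyl r" using R[of "fac p"] face_norm[of p th be] by force
   then show "g p = 0" using test_funD(5)[OF t'] by (simp add: g_def)
  qed
  \<comment> \<open>Pairing with the fixed vector \<open>F x\<close> makes the integrand scalar, and
    nonnegative because the bump is supported where \<open>F\<close> stays within a right angle of
    \<open>F x\<close>.\<close>
  have k0: "g p \<bullet> F x >= 0" for p
  proof (cases "ps (fac p) = 0")
   case False
   then have n: "norm (fac p - x) < s" using bump(5)[OF s(1)] by (simp add: ps_def)
   then have "fac p \<in> ball x d'" using s by (simp add: dist_norm norm_minus_commute)
   then have "fac p \<in> ?S" using d' by (auto simp: ell_face)
   then have "F (fac p) \<bullet> F x >= 0" using d(2)[of "fac p"] n s by (cases "fac p = x") (auto simp: dist_norm)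
   then have "ps (fac p) * (F (fac p) \<bullet> F x) >= 0" unfolding ps_def by (intro mult_nonneg_nonneg bump(2)[OF s(1)])
   then show ?thesis by (simp add: g_def)
  qed (simp add: g_def)
  have "(LINT p|lborel. g p \<bullet> F x) = (LINT p|lborel. g p) \<bullet> F x" using gi by simp
  also have "\<dots> = 0" using tst[OF t] by (simp add: g_def)
  finally have "AE p in lborel. g p \<bullet> F x = 0" using integral_nonneg_eq_0_iff_AE[of lborel "\<lambda>p. g p \<bullet> F x"] gi k0 by simp
  then have "AE p in lebesgue. p \<in> {p. g p \<bullet> F x = 0}" by (simp add: AE_completion)
  moreover have "closed {p. g p \<bullet> F x = 0}" by (intro closed_Collect_eq continuous_intros gc)
  ultimately have "p0 \<in> {p. g p \<bullet> F x = 0}" using mem_closed_if_AE_lebesgue by blast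
  moreover have "g p0 \<bullet> F x = F x \<bullet> F x" using bump(4)[OF s(1), of x] by (simp add: g_def p0 ps_def)
  ultimately show False using Fx by simp
 qed
 show ?thesis
 proof (cases "cY th (proj2 x) = 0")
  case False then show ?thesis using 1 x by blast
 next
  case True
  then have "cX th (proj2 x) = 0" using x(1) sin_be by (simp add: ell_def)
  then have "rot2 th 0 0 = proj2 x" using True rot2_cX_cY[of th "proj2 x"] by simp
  then have f0: "fac (0, x $ 3) = x" by (simp add: face_def)
  \<comment> \<open>Edge points are limits of points of the faces off the edge, where
    \<open>F\<close> is already known to vanish.\<close>
  let ?U = "{s :: real. fac (s, x $ 3) \<in> Cyl r}"
  have cf: "continuous_on A (\<lambda>s. fac (s, x $ 3))" for A
   by (rule continuous_on_compose2[OF continuous_on_face[of UNIV]]) (auto intro!: continuous_intros)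
  have oU: "open ?U" using open_vimage[OF open_Cyl[of r] cf] by (simp add: vimage_def)
  have zU: "0 \<in> ?U" using x f0 by simp
  have "continuous_on ?U (\<lambda>s. F (fac (s, x $ 3)))" by (rule continuous_on_compose2[OF F cf]) (auto simp: ell_face)
  then have "isCont (\<lambda>s. F (fac (s, x $ 3))) 0" using oU zU by (simp add: continuous_on_eq_continuous_at)
  then have l: "((\<lambda>s. F (fac (s, x $ 3))) \<longlongrightarrow> F x) (at 0)" using f0 by (simp add: isCont_def)
  have "\<forall>\<^sub>F s in at 0. s \<in> ?U" using oU zU by (rule eventually_at_in_open')
  then have "\<forall>\<^sub>F s in at 0. F (fac (s, x $ 3)) = 0" using eventually_neq_at_within[of 0 0 UNIV]
  proof eventually_elim
   case (elim s)
   then show ?case using 1[of "fac (s, x $ 3)"] by (simp add: ell_face) (simp add: face_def)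
  qed
  then have "((\<lambda>s. F (fac (s, x $ 3))) \<longlongrightarrow> 0) (at 0)" by (rule tendsto_eventually)
  then show ?thesis using l tendsto_unique[of "at (0::real)"] by fastforce
 qed
qed

lemma holder_continuous:
 assumes "holder_on \<alpha> K G" "\<alpha> > 0" shows "continuous_on K G" unfolding continuous_on_def
proof
 fix x assume x: "x \<in> K"
 obtain C where C: "!!x y. x \<in> K ==> y \<in> K ==> norm (G x - G y) <= C * norm (x - y) powr \<alpha>"
  using assms(1) unfolding holder_on_def by blast
 have "((\<lambda>y. norm (y - x)) \<longlongrightarrow> norm (x - x)) (at x within K)" by (intro tendsto_intros)
 then have "((\<lambda>y. norm (y - x) powr \<alpha>) \<longlongrightarrow> 0) (at x within K)"
  using tendsto_powr'[of "\<lambda>y. norm (y - x)" 0 "at x within K" "\<lambda>_. \<alpha>" \<alpha>] assms(2) by simp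
 from tendsto_mult_left[OF this, of C]
 have "((\<lambda>y. C * norm (y - x) powr \<alpha>) \<longlongrightarrow> 0) (at x within K)" by simp
 moreover have "\<forall>\<^sub>F y in at x within K. norm (G y - G x) <= C * norm (y - x) powr \<alpha>"
  unfolding eventually_at_filter using C x by (auto intro!: always_eventually)
 ultimately have "((\<lambda>y. G y - G x) \<longlongrightarrow> 0) (at x within K)" by (rule Lim_null_comparison[rotated])
 then show "(G \<longlongrightarrow> G x) (at x within K)" by (simp add: LIM_zero_iff)
qed

section \<open>Decay of the difference field at the edge\<close>

context
 fixes F :: "real^3 => complex^3" and G :: "real^3 => complex^3^3" and \<alpha> :: real
 assumes \<alpha>: "0 < \<alpha>" and F: "continuous_on Kcl F" and G: "holder_on \<alpha> Kcl G"
  and D: "!!x. x \<in> Sol h ==> (F has_derivative (\<lambda>y. G x *v complexify y)) (at x)"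
begin

lemma F_bounds:
 obtains C where "C >= 0" "!!x. x \<in> Kcl ==> norm (F x) <= C"
  "!!x e. x \<in> Kcl ==> norm (G x *v complexify e) <= C * norm e"
proof -
 obtain B1 where B1: "!!x. x \<in> Kcl ==> norm (F x) <= B1"
  using compact_imp_bounded[OF compact_continuous_image[OF F compact_Kcl]] unfolding bounded_iff by blast
 obtain B2 where B2: "!!x. x \<in> Kcl ==> norm (G x) <= B2"
  using compact_imp_bounded[OF compact_continuous_image[OF holder_continuous[OF G \<alpha>] compact_Kcl]] unfolding bounded_iff by blast
 obtain ka where ka: "ka > 0" "!!(A :: complex^3^3) e. norm (A *v complexify e) <= ka * norm A * norm e" using matrix_complexify_bound by blast
 have "norm (F x) <= \<bar>B1\<bar> + ka * \<bar>B2\<bar>" if "x \<in> Kcl" for x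
  using B1[OF that] mult_nonneg_nonneg[of ka "\<bar>B2\<bar>"] ka(1) by linarith
 moreover have "norm (G x *v complexify e) <= (\<bar>B1\<bar> + ka * \<bar>B2\<bar>) * norm e" if "x \<in> Kcl" for x e
 proof -
  have "norm (G x *v complexify e) <= ka * norm (G x) * norm e" by (rule ka(2))
  also have "\<dots> <= (\<bar>B1\<bar> + ka * \<bar>B2\<bar>) * norm e"
   using B2[OF that] ka(1) by (intro mult_right_mono) (auto intro!: add_increasing mult_left_mono)
  finally show ?thesis .
 qed
 ultimately show ?thesis using that[of "\<bar>B1\<bar> + ka * \<bar>B2\<bar>"] ka(1) by auto
qed

lemma path_derivative:
 assumes "x + \<tau> *\<^sub>R e \<in> Sol h"
 shows "((\<lambda>\<tau>. F (x + \<tau> *\<^sub>R e)) has_vector_derivative (G (x + \<tau> *\<^sub>R e) *v complexify e)) (at \<tau>)"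
proof -
 have "((\<lambda>\<tau>. x + \<tau> *\<^sub>R e) has_vector_derivative e) (at \<tau>)" by (auto intro!: derivative_eq_intros)
 from vector_derivative_diff_chain_within[OF this has_derivative_at_withinI[OF D[OF assms]]]
 show ?thesis by (simp add: o_def)
qed

context
 assumes face0: "!!x. lev (proj2 x) = 0 ==> x \<in> Cyl h ==> F x = 0"
begin

text \<open>Moving from x against the bisector, the boundary of the wedge is met after the length
  lev / sin be, where \<open>F\<close> vanishes; the mean value bound does the rest. This length is
  at most 2 |x'| / sin be, so the reduced radius keeps the whole segment inside the cylinder of
  radius h.\<close>

lemma F_le_ell:
 obtains C where "C >= 0" "!!x. x \<in> Sol (h / (1 + 2 / sin be)) ==> norm (F x) <= C * lev (proj2 x)"
proof -
 obtain C where C: "C >= 0" "!!x. x \<in> Kcl ==> norm (F x) <= C"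
  "!!x e. x \<in> Kcl ==> norm (G x *v complexify e) <= C * norm e" using F_bounds by blast
 have n3: "norm (e3 th) = 1"
  using norm_join3[of "e2 th" 0] unfolding e3_def[symmetric] by (simp add: power2_eq_1_iff) (use norm_ge_zero[of "e3 th"] in linarith)
 have "norm (F x) <= (C / sin be) * lev (proj2 x)" if x: "x \<in> Sol (h / (1 + 2 / sin be))" for x
 proof -
  have l: "lev (proj2 x) > 0" and nx: "norm (proj2 x) < h / (1 + 2 / sin be)" and x3: "\<bar>x $ 3\<bar> < M" using x by (auto simp: in_Sol)
  define L where "L = lev (proj2 x) / sin be"
  have L: "L > 0" using l sin_be by (simp add: L_def)
  have L2: "norm (proj2 x) + L < h"
  proof -
   have "norm (proj2 x) + L <= norm (proj2 x) + 2 * norm (proj2 x) / sin be"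
    using ell_le[of th be "proj2 x"] sin_be by (simp add: L_def divide_right_mono)
   also have "\<dots> = norm (proj2 x) * (1 + 2 / sin be)" by (simp add: algebra_simps)
   also have "\<dots> < h / (1 + 2 / sin be) * (1 + 2 / sin be)"
    using nx sin_be by (intro mult_strict_right_mono) (auto intro: add_pos_pos)
   also have "\<dots> = h"
   proof -
    have "1 + 2 / sin be > 0" using sin_be by (intro add_pos_pos) auto
    then show ?thesis by simp
   qed
   finally show ?thesis .
  qed
  define q where "q \<tau> = x + \<tau> *\<^sub>R (- e3 th)" for \<tau>
  have pq: "proj2 (q \<tau>) = proj2 x + (- \<tau>) *\<^sub>R e2 th" "q \<tau> $ 3 = x $ 3" for \<tau>
   by (simp_all add: q_def e3_def vec_eq_iff forall_2)
  have lq: "lev (proj2 (q \<tau>)) = (L - \<tau>) * sin be" for \<tau>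
   unfolding pq ell_add_e2 using sin_be by (simp add: L_def algebra_simps)
  have cq: "q \<tau> \<in> Cyl h" if "0 <= \<tau>" "\<tau> <= L" for \<tau>
  proof -
   have "norm (proj2 (q \<tau>)) <= norm (proj2 x) + \<tau>"
    using norm_triangle_ineq[of "proj2 x" "(- \<tau>) *\<^sub>R e2 th"] that unfolding pq by simp
   then show ?thesis using that L2 x3 by (simp add: in_Cyl pq)
  qed
  have qK: "q \<tau> \<in> Kcl" if "0 <= \<tau>" "\<tau> <= L" for \<tau> using that sin_be by (intro in_Kcl cq) (auto simp: lq)
  have qS: "q \<tau> \<in> Sol h" if "0 < \<tau>" "\<tau> < L" for \<tau> using cq[of \<tau>] that sin_be by (simp add: in_Sol in_Cyl lq)
  have "norm (F (q L) - F (q 0)) <= C * (L - 0)"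
  proof (rule vector_mvt_bound[where f' = "\<lambda>\<tau>. G (q \<tau>) *v complexify (- e3 th)"])
   show "continuous_on {0..L} (\<lambda>\<tau>. F (q \<tau>))"
   proof (rule continuous_on_compose2[OF F])
    show "continuous_on {0..L} q" unfolding q_def by (intro continuous_intros)
    show "q ` {0..L} \<subseteq> Kcl" using qK by auto
   qed
   show "((\<lambda>\<tau>. F (q \<tau>)) has_vector_derivative G (q \<tau>) *v complexify (- e3 th)) (at \<tau>)" if "0 < \<tau>" "\<tau> < L" for \<tau>
    using path_derivative[of x \<tau> "- e3 th"] qS[OF that] by (simp add: q_def)
   show "norm (G (q \<tau>) *v complexify (- e3 th)) <= C" if "0 < \<tau>" "\<tau> < L" for \<tau>
    using C(3)[OF qK, of \<tau> "- e3 th"] that n3 by simp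
  qed (use L in auto)
  moreover have "F (q L) = 0" using cq[of L] L by (intro face0) (auto simp: lq)
  moreover have "q 0 = x" by (simp add: q_def)
  ultimately show ?thesis by (simp add: L_def)
 qed
 then show ?thesis using that[of "C / sin be"] C(1) sin_be by auto
qed

text \<open>Along a segment of length rh parallel to a face, the increment of \<open>F\<close> is rh
  times the edge derivative up to O(rh^(1+\<alpha>)). Close to the face both end values are O(rh^2)
  by \<open>F_le_ell\<close>, so division by rh shows that the derivative along the face direction
  vanishes. The two face directions span the plane because the opening angle is not pi.\<close>

lemma G_edge_zero:
 assumes t: "\<bar>t\<bar> < M" shows "G (join3 0 t) *v complexify (join3 y 0) = 0"
proof -
 obtain CG where CG: "!!x y. x \<in> Kcl ==> y \<in> Kcl ==> norm (G x - G y) <= CG * norm (x - y) powr \<alpha>"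
  using G unfolding holder_on_def by blast
 obtain C where C: "C >= 0" "!!x. x \<in> Sol (h / (1 + 2 / sin be)) ==> norm (F x) <= C * lev (proj2 x)"
  by (rule F_le_ell) blast
 obtain ka where ka: "ka > 0" "!!(A :: complex^3^3) e. norm (A *v complexify e) <= ka * norm A * norm e" using matrix_complexify_bound by blast
 define h' where "h' = h / (1 + 2 / sin be)"
 have h': "h' > 0" "h' <= h"
 proof -
  have p: "1 + 2 / sin be > 1" using sin_be by simp
  then show "h' > 0" using h unfolding h'_def by (intro divide_pos_pos) linarith+
  have "h * 1 <= h * (1 + 2 / sin be)" using p h by (intro mult_left_mono) linarith+
  then show "h' <= h" unfolding h'_def using p pos_divide_le_eq[of "1 + 2 / sin be" h h] by linarith
 qed
 have K0: "join3 0 t \<in> Kcl" using t h by (intro in_Kcl) (auto simp: in_Cyl)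
 let ?G0 = "G (join3 0 t)"
 have ray: "?G0 *v complexify (join3 d 0) = 0" if d: "norm d = 1" "lev d = 0"
   "!!s \<tau>. \<tau> >= 0 ==> lev (s *\<^sub>R e2 th + \<tau> *\<^sub>R d) = s * sin be" for d
 proof -
  let ?d = "join3 d 0"
  have nd: "norm ?d = 1" using norm_join3[of d 0] d(1) by (simp add: power2_eq_1_iff) (use norm_ge_zero[of ?d] in linarith)
  have est: "norm (?G0 *v complexify ?d) <= 2 * C * rh + ka * \<bar>CG\<bar> * (2 * rh) powr \<alpha>"
   if rh: "0 < rh" "rh < 1" "2 * rh < h'" for rh
  proof -
   \<comment> \<open>The shift by rh^2 along the bisector keeps the segment in the open wedge, where
     \<open>F\<close> is differentiable, and is of lower order than rh.\<close>
   define a where "a = join3 (rh\<^sup>2 *\<^sub>R e2 th) t"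
   have r2: "rh\<^sup>2 <= rh" "rh\<^sup>2 > 0" using rh by (simp_all add: power2_eq_square mult_left_le)
   have pa: "proj2 (a + \<tau> *\<^sub>R ?d) = rh\<^sup>2 *\<^sub>R e2 th + \<tau> *\<^sub>R d" "(a + \<tau> *\<^sub>R ?d) $ 3 = t" for \<tau>
    by (simp_all add: a_def vec_eq_iff forall_2)
   have a3: "a $ 3 = t" by (simp add: a_def)
   have n: "norm (rh\<^sup>2 *\<^sub>R e2 th + \<tau> *\<^sub>R d) <= 2 * rh" if "0 <= \<tau>" "\<tau> <= rh" for \<tau>
    using norm_triangle_ineq[of "rh\<^sup>2 *\<^sub>R e2 th" "\<tau> *\<^sub>R d"] that d(1) r2 by simp
   have inS: "a + \<tau> *\<^sub>R ?d \<in> Sol h'" if "0 <= \<tau>" "\<tau> <= rh" for \<tau>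
    using n[OF that] that rh t r2 sin_be by (simp add: in_Sol pa a3 d(3))
   have inS': "a + \<tau> *\<^sub>R ?d \<in> Sol h" if "0 <= \<tau>" "\<tau> <= rh" for \<tau> using inS[OF that] h' by (simp add: in_Sol)
   have inK: "a + \<tau> *\<^sub>R ?d \<in> Kcl" if "0 <= \<tau>" "\<tau> <= rh" for \<tau> using inS'[OF that] Sol_subset_Kcl by blast
   have dist0: "norm (a + \<tau> *\<^sub>R ?d - join3 0 t) <= 2 * rh" if "0 <= \<tau>" "\<tau> <= rh" for \<tau>
   proof -
    have "a + \<tau> *\<^sub>R ?d - join3 0 t = join3 (rh\<^sup>2 *\<^sub>R e2 th + \<tau> *\<^sub>R d) 0"
     by (simp add: a_def vec_eq_iff forall_3)
    then have "norm (a + \<tau> *\<^sub>R ?d - join3 0 t) = norm (rh\<^sup>2 *\<^sub>R e2 th + \<tau> *\<^sub>R d)"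
     using norm_join3[of "rh\<^sup>2 *\<^sub>R e2 th + \<tau> *\<^sub>R d" 0] by (simp add: power2_eq_iff_nonneg)
    then show ?thesis using n[OF that] by simp
   qed
   let ?f = "\<lambda>\<tau>. F (a + \<tau> *\<^sub>R ?d) - \<tau> *\<^sub>R (?G0 *v complexify ?d)"
   have "norm (?f rh - ?f 0) <= (ka * (\<bar>CG\<bar> * (2 * rh) powr \<alpha>)) * (rh - 0)"
   proof (rule vector_mvt_bound[where f' = "\<lambda>\<tau>. G (a + \<tau> *\<^sub>R ?d) *v complexify ?d - ?G0 *v complexify ?d"])
    show "continuous_on {0..rh} ?f" by (intro continuous_intros continuous_on_compose2[OF F]) (auto simp: inK)
    fix \<tau> assume \<tau>: "0 < \<tau>" "\<tau> < rh"
    show "(?f has_vector_derivative G (a + \<tau> *\<^sub>R ?d) *v complexify ?d - ?G0 *v complexify ?d) (at \<tau>)"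
     using path_derivative[of a \<tau> ?d] inS'[of \<tau>] \<tau> by (auto intro!: derivative_eq_intros)
    have "norm ((G (a + \<tau> *\<^sub>R ?d) - ?G0) *v complexify ?d) <= ka * norm (G (a + \<tau> *\<^sub>R ?d) - ?G0) * norm ?d" by (rule ka(2))
    also have "\<dots> <= ka * (\<bar>CG\<bar> * (2 * rh) powr \<alpha>)"
    proof -
     have "norm (G (a + \<tau> *\<^sub>R ?d) - ?G0) <= CG * norm (a + \<tau> *\<^sub>R ?d - join3 0 t) powr \<alpha>"
      using \<tau> by (intro CG inK K0) auto
     also have "\<dots> <= \<bar>CG\<bar> * (2 * rh) powr \<alpha>" using dist0[of \<tau>] \<tau> \<alpha> by (intro mult_mono powr_mono2) auto
     finally show ?thesis using ka(1) nd by simp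
    qed
    finally show "norm (G (a + \<tau> *\<^sub>R ?d) *v complexify ?d - ?G0 *v complexify ?d) <= ka * (\<bar>CG\<bar> * (2 * rh) powr \<alpha>)"
     by (simp add: matrix_vector_mult_diff_rdistrib)
   qed (use rh in auto)
   moreover have "norm (F (a + \<tau> *\<^sub>R ?d)) <= C * rh\<^sup>2" if "0 <= \<tau>" "\<tau> <= rh" for \<tau>
   proof -
    have "norm (F (a + \<tau> *\<^sub>R ?d)) <= C * (rh\<^sup>2 * sin be)"
     using C(2)[of "a + \<tau> *\<^sub>R ?d"] inS[OF that] that by (simp add: h'_def pa d(3))
    also have "\<dots> <= C * (rh\<^sup>2 * 1)" using C(1) by (intro mult_left_mono) auto
    finally show ?thesis by simp
   qed
   from this[of 0] this[of rh] have "norm (F a) <= C * rh\<^sup>2" "norm (F (a + rh *\<^sub>R ?d)) <= C * rh\<^sup>2" using rh by auto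
   moreover have "norm (rh *\<^sub>R (?G0 *v complexify ?d)) <=
     norm (?f rh - ?f 0) + norm (F (a + rh *\<^sub>R ?d)) + norm (F a)"
    using norm_triangle_ineq4[of "F (a + rh *\<^sub>R ?d) - F a" "?f rh - ?f 0"] norm_triangle_ineq4[of "F (a + rh *\<^sub>R ?d)" "F a"] by simp
   ultimately have "rh * norm (?G0 *v complexify ?d) <=
     ka * (\<bar>CG\<bar> * (2 * rh) powr \<alpha>) * rh + C * rh\<^sup>2 + C * rh\<^sup>2" using rh by simp
   also have "\<dots> = rh * (2 * C * rh + ka * \<bar>CG\<bar> * (2 * rh) powr \<alpha>)" by (simp add: power2_eq_square algebra_simps)
   finally show ?thesis using rh(1) by simp
  qed
  have "((\<lambda>rh. 2 * C * rh + ka * \<bar>CG\<bar> * (2 * rh) powr \<alpha>) \<longlongrightarrow> 2 * C * 0 + ka * \<bar>CG\<bar> * 0) (at_right 0)"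
  proof (intro tendsto_intros)
   have "((\<lambda>rh. 2 * rh) \<longlongrightarrow> 2 * 0) (at_right (0::real))" by (intro tendsto_intros)
   then show "((\<lambda>rh. (2 * rh) powr \<alpha>) \<longlongrightarrow> 0) (at_right 0)"
    using tendsto_powr'[of "\<lambda>rh. 2 * rh" 0 "at_right 0" "\<lambda>_. \<alpha>" \<alpha>] \<alpha>
    using eventually_mono[OF eventually_at_right_less[of "0::real"], of "(\<le>) 0"] by simp
  qed
  moreover have "\<forall>\<^sub>F rh in at_right 0. norm (?G0 *v complexify ?d) <= 2 * C * rh + ka * \<bar>CG\<bar> * (2 * rh) powr \<alpha>"
   unfolding eventually_at_right_field using est h' by (intro exI[of _ "min 1 (h' / 2)"]) auto
  ultimately have "norm (?G0 *v complexify ?d) <= 0" by (intro tendsto_lowerbound[of _ _ "at_right (0::real)"]) auto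
  then show ?thesis by simp
 qed
 let ?d1 = "rot2 th (cos be) (sin be)" and ?d2 = "rot2 th (cos be) (- sin be)"
 have e: "s *\<^sub>R e2 th + \<tau> *\<^sub>R rot2 th X Y = rot2 th (\<tau> * X + s) (\<tau> * Y)" for s \<tau> X Y
  by (simp add: e2_def vec_eq_iff forall_2 algebra_simps)
 have 1: "?G0 *v complexify (join3 ?d1 0) = 0"
 proof (rule ray)
  show "norm ?d1 = 1" using norm_rot2[of th "cos be" "sin be"] by (simp add: power2_eq_1_iff) (use norm_ge_zero[of ?d1] in linarith)
  show "lev ?d1 = 0" using sin_be by (simp add: ell_def)
  show "lev (s *\<^sub>R e2 th + \<tau> *\<^sub>R ?d1) = s * sin be" if "\<tau> >= 0" for s \<tau>
   unfolding e using sin_be that by (simp add: ell_def abs_mult algebra_simps)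
 qed
 have 2: "?G0 *v complexify (join3 ?d2 0) = 0"
 proof (rule ray)
  show "norm ?d2 = 1" using norm_rot2[of th "cos be" "- sin be"] by (simp add: power2_eq_1_iff) (use norm_ge_zero[of ?d2] in linarith)
  show "lev ?d2 = 0" using sin_be by (simp add: ell_def)
  show "lev (s *\<^sub>R e2 th + \<tau> *\<^sub>R ?d2) = s * sin be" if "\<tau> >= 0" for s \<tau>
   unfolding e using sin_be that by (simp add: ell_def abs_mult algebra_simps)
 qed
 \<comment> \<open>Coefficients of \<open>y\<close> in the basis formed by the two face directions;
   the division by \<open>cos be\<close> excludes the flat opening angle.\<close>
 define a where "a = (cX th y / cos be + cY th y / sin be) / 2"
 define b where "b = (cX th y / cos be - cY th y / sin be) / 2"
 have "rot2 th ((a + b) * cos be) ((a - b) * sin be) = y"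
  using cos_be sin_be rot2_cX_cY[of th y] by (simp add: a_def b_def field_simps)
 moreover have "a *\<^sub>R join3 ?d1 0 + b *\<^sub>R join3 ?d2 0 = join3 (rot2 th ((a + b) * cos be) ((a - b) * sin be)) 0"
  by (simp add: vec_eq_iff forall_3 algebra_simps)
 ultimately have "join3 y 0 = a *\<^sub>R join3 ?d1 0 + b *\<^sub>R join3 ?d2 0" by simp
 then have "?G0 *v complexify (join3 y 0) =
   a *\<^sub>R (?G0 *v complexify (join3 ?d1 0)) + b *\<^sub>R (?G0 *v complexify (join3 ?d2 0))"
  by (simp only: complexify_linear matrix_vector_right_distrib matrix_mult_scaleR)
 then show ?thesis using 1 2 by simp
qed

text \<open>The segment from the edge point with the same third coordinate starts where both
  \<open>F\<close> and its planar derivative vanish. Hoelder continuity of \<open>G\<close> bounds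
  the derivative along the segment by a multiple of |x'|^\<alpha> times its length.\<close>

lemma F_le_powr:
 obtains C where "C >= 0" "!!x. x \<in> Sol h ==> norm (F x) <= C * norm (proj2 x) powr (1 + \<alpha>)"
proof -
 obtain CG where CG: "!!x y. x \<in> Kcl ==> y \<in> Kcl ==> norm (G x - G y) <= CG * norm (x - y) powr \<alpha>"
  using G unfolding holder_on_def by blast
 obtain ka where ka: "ka > 0" "!!(A :: complex^3^3) e. norm (A *v complexify e) <= ka * norm A * norm e" using matrix_complexify_bound by blast
 have "norm (F x) <= (ka * \<bar>CG\<bar>) * norm (proj2 x) powr (1 + \<alpha>)" if x: "x \<in> Sol h" for x
 proof -
  let ?y = "proj2 x" and ?t = "x $ 3"
  let ?e = "join3 ?y 0" and ?o = "join3 0 ?t"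
  have t: "\<bar>?t\<bar> < M" and ny: "norm ?y < h" and ly: "lev ?y > 0" using x by (auto simp: in_Sol)
  have q: "proj2 (?o + \<tau> *\<^sub>R ?e) = \<tau> *\<^sub>R ?y" "(?o + \<tau> *\<^sub>R ?e) $ 3 = ?t" for \<tau>
   by (simp_all add: vec_eq_iff forall_2)
  have nt: "norm (\<tau> *\<^sub>R ?y) <= norm ?y" if "0 <= \<tau>" "\<tau> <= 1" for \<tau> using that by (simp add: mult_left_le_one_le)
  have K: "?o + \<tau> *\<^sub>R ?e \<in> Kcl" if "0 <= \<tau>" "\<tau> <= 1" for \<tau>
   using nt[OF that] that t ny ly by (intro in_Kcl) (auto simp: in_Cyl q ell_scaleR)
  have S: "?o + \<tau> *\<^sub>R ?e \<in> Sol h" if "0 < \<tau>" "\<tau> <= 1" for \<tau>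
   using nt[of \<tau>] that t ny ly by (auto simp: in_Sol q ell_scaleR)
  have ne: "norm ?e = norm ?y" using norm_join3[of ?y 0] by (simp add: power2_eq_iff_nonneg)
  have "norm (F (?o + 1 *\<^sub>R ?e) - F (?o + 0 *\<^sub>R ?e)) <= (ka * \<bar>CG\<bar> * norm ?y powr (1 + \<alpha>)) * (1 - 0)"
  proof (rule vector_mvt_bound[where f' = "\<lambda>\<tau>. G (?o + \<tau> *\<^sub>R ?e) *v complexify ?e"])
   show "continuous_on {0..1} (\<lambda>\<tau>. F (?o + \<tau> *\<^sub>R ?e))"
    by (intro continuous_on_compose2[OF F] continuous_intros) (auto simp: K)
   fix \<tau> :: real assume \<tau>: "0 < \<tau>" "\<tau> < 1"
   show "((\<lambda>\<tau>. F (?o + \<tau> *\<^sub>R ?e)) has_vector_derivative G (?o + \<tau> *\<^sub>R ?e) *v complexify ?e) (at \<tau>)"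
    using \<tau> S by (intro path_derivative) auto
   have "G (?o + \<tau> *\<^sub>R ?e) *v complexify ?e = (G (?o + \<tau> *\<^sub>R ?e) - G ?o) *v complexify ?e"
    using G_edge_zero[OF t, of ?y] by (simp add: matrix_vector_mult_diff_rdistrib)
   also have "norm \<dots> <= ka * norm (G (?o + \<tau> *\<^sub>R ?e) - G ?o) * norm ?e" by (rule ka(2))
   also have "\<dots> <= ka * (\<bar>CG\<bar> * norm ?y powr \<alpha>) * norm ?y"
   proof -
    have "norm (G (?o + \<tau> *\<^sub>R ?e) - G ?o) <= CG * norm (?o + \<tau> *\<^sub>R ?e - ?o) powr \<alpha>"
     using K[of 0] K[of \<tau>] \<tau> by (intro CG) auto
    also have "\<dots> <= \<bar>CG\<bar> * norm ?y powr \<alpha>" using nt[of \<tau>] \<tau> \<alpha> ne by (intro mult_mono powr_mono2) auto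
    finally show ?thesis using ka(1) ne by (simp add: mult_right_mono)
   qed
   also have "\<dots> = ka * \<bar>CG\<bar> * norm ?y powr (1 + \<alpha>)" by (cases "?y = 0") (simp_all add: powr_add)
   finally show "norm (G (?o + \<tau> *\<^sub>R ?e) *v complexify ?e) <= ka * \<bar>CG\<bar> * norm ?y powr (1 + \<alpha>)" .
  qed auto
  moreover have "?o + 1 *\<^sub>R ?e = x" by (simp add: vec_eq_iff forall_3)
  moreover have "F ?o = 0" using t h by (intro face0) (auto simp: in_Cyl)
  ultimately show ?thesis by simp
 qed
 then show ?thesis using that[of "ka * \<bar>CG\<bar>"] ka(1) by auto
qed

end
end
end

section \<open>Traces and weak gradients\<close>

lemma L2_on_bounded:
 fixes f :: "'a => 'b::euclidean_space"
 assumes f: "f \<in> borel_measurable N" and S: "S \<in> sets N" "emeasure N S < top"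
  and B: "!!x. x \<in> S ==> norm (f x) <= B"
 shows "L2_on N S f"
proof -
 have m: "(\<lambda>x. indicator S x *\<^sub>R (norm (f x))\<^sup>2) \<in> borel_measurable N" using f S by measurable
 have "integrable N (\<lambda>x. indicator S x *\<^sub>R (norm (f x))\<^sup>2)"
 proof (rule Bochner_Integration.integrable_bound)
  show "integrable N (\<lambda>x. B\<^sup>2 * indicator S x)" using S by simp
  have "norm (indicator S x *\<^sub>R (norm (f x))\<^sup>2) <= norm (B\<^sup>2 * indicator S x)" for x
   using power_mono[OF B norm_ge_zero, of x 2] by (cases "x \<in> S") auto
  then show "AE x in N. norm (indicator S x *\<^sub>R (norm (f x))\<^sup>2) <= norm (B\<^sup>2 * indicator S x)" by simp
 qed (rule m)
 then show ?thesis using f S by (auto simp: L2_on_def set_borel_measurable_def set_integrable_def)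
qed

lemma norm_add_sq_le: "(norm (a + b))\<^sup>2 <= 2 * (norm a)\<^sup>2 + 2 * (norm b)\<^sup>2" for a b :: "'a::real_normed_vector"
proof -
 have "(norm (a + b))\<^sup>2 <= (norm a + norm b)\<^sup>2" by (intro power_mono norm_triangle_ineq) auto
 also have "\<dots> <= 2 * (norm a)\<^sup>2 + 2 * (norm b)\<^sup>2"
  using zero_le_power2[of "norm a - norm b"] by (simp add: power2_eq_square algebra_simps)
 finally show ?thesis .
qed

lemma L2_on_add:
 fixes f g :: "'a => 'b::euclidean_space"
 assumes f: "L2_on N S f" and g: "L2_on N S g" shows "L2_on N S (\<lambda>x. f x + g x)"
proof -
 have m: "(\<lambda>x. indicator S x *\<^sub>R (f x + g x)) \<in> borel_measurable N"
  using f g unfolding L2_on_def set_borel_measurable_def scaleR_add_right by (intro borel_measurable_add) auto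
 have e: "indicator S x *\<^sub>R (norm v)\<^sup>2 = (norm (indicator S x *\<^sub>R v))\<^sup>2" for v :: 'b and x by (simp add: indicator_def)
 have i: "integrable N (\<lambda>x. (norm (indicator S x *\<^sub>R (f x + g x)))\<^sup>2)"
 proof (rule Bochner_Integration.integrable_bound)
  show "integrable N (\<lambda>x. 2 * (indicator S x *\<^sub>R (norm (f x))\<^sup>2) + 2 * (indicator S x *\<^sub>R (norm (g x))\<^sup>2))"
   using f g unfolding L2_on_def set_integrable_def by (intro Bochner_Integration.integrable_add integrable_mult_right) auto
  show "(\<lambda>x. (norm (indicator S x *\<^sub>R (f x + g x)))\<^sup>2) \<in> borel_measurable N" using m by measurable
  have "norm ((norm (indicator S x *\<^sub>R (f x + g x)))\<^sup>2)
    <= norm (2 * (indicator S x *\<^sub>R (norm (f x))\<^sup>2) + 2 * (indicator S x *\<^sub>R (norm (g x))\<^sup>2))" for x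
   using norm_add_sq_le[of "f x" "g x"] by (cases "x \<in> S") auto
  then show "AE x in N. norm ((norm (indicator S x *\<^sub>R (f x + g x)))\<^sup>2)
    <= norm (2 * (indicator S x *\<^sub>R (norm (f x))\<^sup>2) + 2 * (indicator S x *\<^sub>R (norm (g x))\<^sup>2))" by simp
 qed
 show ?thesis unfolding L2_on_def set_borel_measurable_def set_integrable_def e by (rule conjI[OF m i])
qed

lemma L2_on_scaleR: "L2_on N S f ==> L2_on N S (\<lambda>x. c *\<^sub>R f x)" for f :: "'a => 'b::euclidean_space"
proof -
 assume f: "L2_on N S f"
 have a: "(\<lambda>x. indicator S x *\<^sub>R c *\<^sub>R f x) = (\<lambda>x. c *\<^sub>R (indicator S x *\<^sub>R f x))" by (simp add: mult.commute)
 have b: "(\<lambda>x. indicator S x *\<^sub>R (norm (c *\<^sub>R f x))\<^sup>2) = (\<lambda>x. c\<^sup>2 * (indicator S x *\<^sub>R (norm (f x))\<^sup>2))"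
  by (simp add: power_mult_distrib mult_ac)
 show ?thesis unfolding L2_on_def set_borel_measurable_def set_integrable_def a b
 proof (rule conjI)
  show "(\<lambda>x. c *\<^sub>R (indicator S x *\<^sub>R f x)) \<in> borel_measurable N" by (rule borel_measurable_scaleR[OF borel_measurable_const])
    (use f in \<open>simp add: L2_on_def set_borel_measurable_def\<close>)
  show "integrable N (\<lambda>x. c\<^sup>2 * (indicator S x *\<^sub>R (norm (f x))\<^sup>2))"
   by (rule integrable_mult_right) (use f in \<open>simp add: L2_on_def set_integrable_def\<close>)
 qed
qed

lemma L2_on_diff: "L2_on N S f ==> L2_on N S g ==> L2_on N S (\<lambda>x. f x - g x)"
 for f g :: "'a => 'b::euclidean_space" using L2_on_add[of N S f "\<lambda>x. (-1) *\<^sub>R g x"] L2_on_scaleR[of N S g "-1"] by simp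

lemma L2_on_uminus: "L2_on N S f ==> L2_on N S (\<lambda>x. - f x)" for f :: "'a => 'b::euclidean_space"
 using L2_on_scaleR[of N S f "-1"] by simp

lemma L2_on_mult_Linfty:
 fixes w :: "real^3 => 'b::euclidean_space"
 assumes V: "Linfty_on S V" and w: "L2_on lebesgue S w"
 shows "L2_on lebesgue S (\<lambda>x. V x *\<^sub>R w x)"
proof -
 obtain C where C: "AE x in lebesgue. x \<in> S \<longrightarrow> \<bar>V x\<bar> <= C" using V by (auto simp: Linfty_on_def)
 have mV: "(\<lambda>x. indicator S x * V x) \<in> borel_measurable lebesgue" using V by (simp add: Linfty_on_def set_borel_measurable_def)
 have mw: "(\<lambda>x. indicator S x *\<^sub>R w x) \<in> borel_measurable lebesgue" using w by (simp add: L2_on_def set_borel_measurable_def)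
 have e: "indicator S x *\<^sub>R V x *\<^sub>R w x = (indicator S x * V x) *\<^sub>R (indicator S x *\<^sub>R w x)" for x
  by (simp add: indicator_def)
 have m: "(\<lambda>x. indicator S x *\<^sub>R V x *\<^sub>R w x) \<in> borel_measurable lebesgue"
  unfolding e by (intro borel_measurable_scaleR mV mw)
 have e2: "indicator S x *\<^sub>R (norm (V x *\<^sub>R w x))\<^sup>2 = (norm (indicator S x *\<^sub>R V x *\<^sub>R w x))\<^sup>2" for x
  by (simp add: indicator_def)
 have i: "integrable lebesgue (\<lambda>x. (norm (indicator S x *\<^sub>R V x *\<^sub>R w x))\<^sup>2)"
 proof (rule Bochner_Integration.integrable_bound)
  show "integrable lebesgue (\<lambda>x. C\<^sup>2 * (indicator S x *\<^sub>R (norm (w x))\<^sup>2))"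
   using w unfolding L2_on_def set_integrable_def by (intro integrable_mult_right) auto
  show "(\<lambda>x. (norm (indicator S x *\<^sub>R V x *\<^sub>R w x))\<^sup>2) \<in> borel_measurable lebesgue" using m by measurable
  show "AE x in lebesgue. norm ((norm (indicator S x *\<^sub>R V x *\<^sub>R w x))\<^sup>2) <= norm (C\<^sup>2 * (indicator S x *\<^sub>R (norm (w x))\<^sup>2))"
   using C
  proof eventually_elim
   case (elim x)
   then show ?case using power_mono[of "\<bar>V x\<bar>" C 2] by (cases "x \<in> S") (auto simp: power_mult_distrib intro!: mult_right_mono)
  qed
 qed
 show ?thesis unfolding L2_on_def set_borel_measurable_def set_integrable_def e2 by (rule conjI[OF m i])
qed

lemma L2_norm_nonneg: "L2_norm N S f >= 0"
 unfolding L2_norm_def set_lebesgue_integral_def by (intro real_sqrt_ge_zero Bochner_Integration.integral_nonneg) simp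

lemma L2_norm_le_H1_norm: "L2_norm lebesgue S u <= H1_norm S u" "L2_norm lebesgue S (weak_grad S u) <= H1_norm S u"
 unfolding H1_norm_def by (intro real_le_rsqrt; simp add: L2_norm_nonneg)+

lemma set_integrable_bounded_linear:
 assumes "bounded_linear A" "set_integrable N S f" shows "set_integrable N S (\<lambda>x. A (f x))"
 using integrable_bounded_linear[OF assms(1) assms(2)[unfolded set_integrable_def]]
 by (simp add: set_integrable_def linear_scale[OF bounded_linear.linear[OF assms(1)]])

lemma set_integral_bounded_linear:
 fixes f :: "'a => 'b::{banach, second_countable_topology}" and A :: "'b => 'c::{banach, second_countable_topology}"
 assumes "bounded_linear A" "set_integrable N S f" shows "(LINT x:S|N. A (f x)) = A (LINT x:S|N. f x)"
 using integral_bounded_linear[OF assms(1) assms(2)[unfolded set_integrable_def]]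
 by (simp add: set_lebesgue_integral_def linear_scale[OF bounded_linear.linear[OF assms(1)]])

lemma set_integral_sum:
 fixes f :: "'i => 'a => 'b::{banach, second_countable_topology}"
 assumes "!!i. i \<in> I ==> set_integrable N S (f i)"
 shows "(LINT x:S|N. \<Sum>i\<in>I. f i x) = (\<Sum>i\<in>I. LINT x:S|N. f i x)" "set_integrable N S (\<lambda>x. \<Sum>i\<in>I. f i x)"
 using assms unfolding set_lebesgue_integral_def set_integrable_def scaleR_sum_right
 by (auto intro!: Bochner_Integration.integral_sum Bochner_Integration.integrable_sum)

lemma bounded_linear_column: "bounded_linear (\<lambda>G :: complex^'n^'m. column j G)"
proof -
 have "linear (\<lambda>G :: complex^'n^'m. column j G)" by (rule linearI) (simp_all add: column_def vec_eq_iff)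
 then show ?thesis using linear_conv_bounded_linear by blast
qed

lemma matrix_mult_complexify: "G *v complexify e = (\<Sum>j\<in>UNIV. (e $ j) *\<^sub>R column j G)"
 by (simp add: vec_eq_iff matrix_vector_mult_def complexify_def column_def scaleR_conv_of_real[where 'a=complex] mult.commute)

lemma bounded_linear_mult_complexify: "bounded_linear (\<lambda>G :: complex^'n^'m. G *v complexify e)" unfolding matrix_mult_complexify
 by (intro bounded_linear_sum bounded_linear_scaleR_const bounded_linear_column
   bounded_linear_compose[OF bounded_linear_scaleR_right bounded_linear_column, unfolded o_def])

lemma smooth_measurable_lebesgue: "smooth f ==> f \<in> borel_measurable lebesgue"
 by (simp add: measurable_completion smooth_measurable)

lemma smooth_bounded_on:
 fixes f :: "'a::euclidean_space => 'b::real_normed_vector"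
 assumes "smooth f" "bounded S" obtains B where "!!x. x \<in> S ==> norm (f x) <= B"
proof -
 have "compact (f ` closure S)" using assms by (intro compact_continuous_image smooth_continuous) auto
 then show ?thesis using that closure_subset[of S] compact_imp_bounded bounded_iff by (metis imageI subsetD)
qed

section \<open>Weak gradients and Green's formula on the domain near the edge\<close>

locale edge_domain = edge +
 fixes Om :: "(real^3) set"
 assumes lip: "bounded_lipschitz_domain Om" and Cyl_Int: "Cyl h \<inter> Om = Sol h"
begin

lemma Om: "open Om" "bounded Om" using lip by (auto simp: bounded_lipschitz_domain_def)

lemma sets_Om: "Om \<in> sets lebesgue" using Om(1) by simp

lemma emeasure_Om: "emeasure lebesgue Om < top"
proof -
 have "emeasure lborel Om < top" using Om(2) by (rule emeasure_bounded_finite[unfolded infinity_ennreal_def])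
 then show ?thesis using Om(1) by simp
qed

lemma Sol_subset_Om: "Sol h \<subseteq> Om" using Cyl_Int by auto

lemma test_fun_Om: "test_fun (Sol h) \<phi> ==> test_fun Om \<phi>" using test_fun_mono Sol_subset_Om by blast

lemma set_integrable_Sol:
 fixes p :: "real^3 => 'b::euclidean_space"
 shows "set_integrable lebesgue Om p ==> Sintegrable p"
 by (rule set_integrable_subset[of lebesgue Om p "Sol h"]) (use open_Sol[of h] Sol_subset_Om in auto)

lemma restrict_Sol: "(!!x. x \<notin> Cyl h ==> f x = 0) ==> (LINT x:Om|lebesgue. f x) = (SINT x. f x)"
 unfolding set_lebesgue_integral_def using Cyl_Int by (intro Bochner_Integration.integral_cong) (auto simp: indicator_def)

lemma L2_integrable: "L2_on lebesgue Om u ==> set_integrable lebesgue Om u" for u :: "real^3 => 'b::euclidean_space"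
 using L2_on_Cauchy_Schwarz(1) sets_Om emeasure_Om by blast

lemma H1_D:
 assumes "H1_on Om u"
 shows "L2_on lebesgue Om u" "L2_on lebesgue Om (weak_grad Om u)" "has_weak_grad Om u (weak_grad Om u)"
 using assms someI_ex[of "\<lambda>G. L2_on lebesgue Om G \<and> has_weak_grad Om u G"] unfolding H1_on_def weak_grad_def by auto

lemma weak_grad_dir:
 assumes u: "L2_on lebesgue Om u" and G: "L2_on lebesgue Om G" "has_weak_grad Om u G" and \<phi>: "test_fun Om \<phi>"
 shows "(LINT x:Om|lebesgue. dir_deriv e \<phi> x *\<^sub>R u x) = - (LINT x:Om|lebesgue. \<phi> x *\<^sub>R (G x *v complexify e))"
proof -
 have i: "set_integrable lebesgue Om (\<lambda>x. pderiv_at j \<phi> x *\<^sub>R u x)" for j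
  by (rule integrable_test_mult[OF L2_integrable[OF u] test_fun_dir_deriv[OF \<phi>]])
 have i': "set_integrable lebesgue Om (\<lambda>x. \<phi> x *\<^sub>R column j (G x))" for j
  by (rule integrable_test_mult[OF set_integrable_bounded_linear[OF bounded_linear_column L2_integrable[OF G(1)]] \<phi>])
 have "(LINT x:Om|lebesgue. dir_deriv e \<phi> x *\<^sub>R u x) =
   (LINT x:Om|lebesgue. \<Sum>j\<in>UNIV. (e $ j) *\<^sub>R (pderiv_at j \<phi> x *\<^sub>R u x))"
  by (simp add: dir_deriv_representation[OF test_funD(1)[OF \<phi>], of e] scaleR_sum_left)
 also have "\<dots> = (\<Sum>j\<in>UNIV. (e $ j) *\<^sub>R (LINT x:Om|lebesgue. pderiv_at j \<phi> x *\<^sub>R u x))"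
  using i by (subst set_integral_sum) (auto intro!: set_integrable_scaleR_right simp del: scaleR_scaleR)
 also have "\<dots> = - (\<Sum>j\<in>UNIV. (e $ j) *\<^sub>R (LINT x:Om|lebesgue. \<phi> x *\<^sub>R column j (G x)))"
  using G(2) \<phi> by (simp add: has_weak_grad_def sum_negf)
 also have "(\<Sum>j\<in>UNIV. (e $ j) *\<^sub>R (LINT x:Om|lebesgue. \<phi> x *\<^sub>R column j (G x))) =
   (LINT x:Om|lebesgue. \<Sum>j\<in>UNIV. (e $ j) *\<^sub>R (\<phi> x *\<^sub>R column j (G x)))"
  using i' by (subst set_integral_sum) (auto intro!: set_integrable_scaleR_right simp del: scaleR_scaleR)
 also have "\<dots> = (LINT x:Om|lebesgue. \<phi> x *\<^sub>R (G x *v complexify e))"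
  by (simp add: matrix_mult_complexify scaleR_sum_right mult.commute)
 finally show ?thesis .
qed

lemma weak_grad_dir_Sol:
 assumes u: "L2_on lebesgue Om u" and G: "L2_on lebesgue Om G" "has_weak_grad Om u G" and \<phi>: "test_fun (Sol h) \<phi>"
 shows "(SINT x. dir_deriv e \<phi> x *\<^sub>R u x) = - (SINT x. \<phi> x *\<^sub>R (G x *v complexify e))"
proof -
 have z: "\<phi> x = 0" "dir_deriv e \<phi> x = 0" if "x \<notin> Cyl h" for x
  using that Sol_subset_Cyl[of h] test_funD(5)[OF \<phi>, of x] test_funD(5)[OF test_fun_dir_deriv[OF \<phi>], of x e] by auto
 show ?thesis using weak_grad_dir[OF u G test_fun_Om[OF \<phi>], of e] restrict_Sol[of "\<lambda>x. dir_deriv e \<phi> x *\<^sub>R u x"]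
   restrict_Sol[of "\<lambda>x. \<phi> x *\<^sub>R (G x *v complexify e)"] z by simp
qed

definition smooth_grad :: "(real^3 => complex^3) => real^3 => complex^3^3"
 where "smooth_grad u x = (\<chi> i j. pderiv_at j u x $ i)"

lemma column_smooth_grad: "column j (smooth_grad u x) = pderiv_at j u x" by (simp add: smooth_grad_def column_def vec_eq_iff)

lemma smooth_L2: "smooth u ==> L2_on lebesgue Om u" for u :: "real^3 => 'b::euclidean_space"
 by (rule smooth_bounded_on[OF _ Om(2)], assumption)
  (rule L2_on_bounded[OF smooth_measurable_lebesgue sets_Om emeasure_Om])

lemma smooth_grad_smooth:
 assumes "smooth u" shows "smooth (smooth_grad u)"
proof -
 have l: "bounded_linear (\<lambda>c :: complex^3. \<chi> i k. if k = j then c $ i else 0)" for j :: 3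
 proof -
  have "linear (\<lambda>c :: complex^3. (\<chi> i k. if k = j then c $ i else 0) :: complex^3^3)" by (rule linearI) (simp_all add: vec_eq_iff)
  then show ?thesis using linear_conv_bounded_linear by blast
 qed
 have "smooth_grad u = (\<lambda>x. \<Sum>j\<in>UNIV. (\<chi> i k. if k = j then pderiv_at j u x $ i else 0))"
  by (simp add: fun_eq_iff smooth_grad_def vec_eq_iff)
 moreover have "smooth (\<lambda>x. (\<chi> i k. if k = j then pderiv_at j u x $ i else 0) :: complex^3^3)" for j
  by (rule smooth_compose[OF smooth_dir_deriv[OF assms] smooth_linear[OF l]])
 ultimately show ?thesis by auto
qed

text \<open>The product of the test function and the field is smooth on the whole space and vanishes
  outside \<open>Om\<close>, so its derivative has integral 0.\<close>

lemma smooth_weak_grad: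
 assumes u: "smooth u" shows "has_weak_grad Om u (smooth_grad u)" "L2_on lebesgue Om (smooth_grad u)"
proof -
 show "L2_on lebesgue Om (smooth_grad u)" by (rule smooth_L2[OF smooth_grad_smooth[OF u]])
 show "has_weak_grad Om u (smooth_grad u)" unfolding has_weak_grad_def column_smooth_grad
 proof (intro allI impI)
  fix \<phi> j assume \<phi>: "test_fun Om \<phi>"
  have dp: "test_fun Om (pderiv_at j \<phi>)" by (rule test_fun_dir_deriv[OF \<phi>])
  let ?d = "dir_deriv (axis j 1)"
  have i: "set_integrable lebesgue Om (\<lambda>x. ?d \<phi> x *\<^sub>R u x)" "set_integrable lebesgue Om (\<lambda>x. \<phi> x *\<^sub>R ?d u x)"
   by (rule integrable_test_mult[OF L2_integrable[OF smooth_L2[OF u]] dp])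
    (rule integrable_test_mult[OF L2_integrable[OF smooth_L2[OF smooth_dir_deriv[OF u]]] \<phi>])
  have sm: "smooth (\<lambda>x. \<phi> x *\<^sub>R u x)" using test_funD(1)[OF \<phi>] u by (rule smooth_scaleR)
  obtain R where R: "!!x. x \<in> Om ==> norm x < R" using Om(2) unfolding bounded_pos_less by blast
  have out: "\<phi> x *\<^sub>R u x = 0" if "norm x >= R" for x using test_funD(5)[OF \<phi>, of x] R[of x] that by force
  have eq: "?d (\<lambda>x. \<phi> x *\<^sub>R u x) x = ?d \<phi> x *\<^sub>R u x + \<phi> x *\<^sub>R ?d u x" for x
   using dir_deriv_bilinear[OF bounded_bilinear_scaleR smooth_differentiable[OF test_funD(1)[OF \<phi>]] smooth_differentiable[OF u]] by simp
  have "(LINT x:Om|lebesgue. ?d \<phi> x *\<^sub>R u x) + (LINT x:Om|lebesgue. \<phi> x *\<^sub>R ?d u x) =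
    (LINT x:Om|lebesgue. ?d (\<lambda>x. \<phi> x *\<^sub>R u x) x)" using i by (simp add: eq)
  also have "\<dots> = (LINT x|lebesgue. ?d (\<lambda>x. \<phi> x *\<^sub>R u x) x)" unfolding set_lebesgue_integral_def
  proof (rule Bochner_Integration.integral_cong)
   show "indicator Om x *\<^sub>R ?d (\<lambda>x. \<phi> x *\<^sub>R u x) x = ?d (\<lambda>x. \<phi> x *\<^sub>R u x) x" for x
    using test_funD(5)[OF \<phi>, of x] test_funD(5)[OF dp, of x] by (cases "x \<in> Om") (auto simp: eq)
  qed simp
  also have "\<dots> = (LINT x|lborel. ?d (\<lambda>x. \<phi> x *\<^sub>R u x) x)"
   using smooth_measurable[OF smooth_dir_deriv[OF sm]] by (intro integral_completion) simp
  also have "\<dots> = 0" by (rule integral_dir_deriv_eq_0(2)[OF sm out])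
  finally show "(LINT x:Om|lebesgue. ?d \<phi> x *\<^sub>R u x) = - (LINT x:Om|lebesgue. \<phi> x *\<^sub>R ?d u x)"
   by (simp add: eq_neg_iff_add_eq_0)
 qed
qed

lemma has_weak_grad_diff:
 assumes u: "L2_on lebesgue Om u" "L2_on lebesgue Om G" "has_weak_grad Om u G"
  and v: "L2_on lebesgue Om v" "L2_on lebesgue Om H" "has_weak_grad Om v H"
 shows "has_weak_grad Om (\<lambda>x. u x - v x) (\<lambda>x. G x - H x)" unfolding has_weak_grad_def
proof (intro allI impI)
 fix \<phi> j assume \<phi>: "test_fun Om \<phi>"
 note i = integrable_test_mult[OF L2_integrable test_fun_dir_deriv[OF \<phi>], of _ "axis j 1"]
 note i' = integrable_test_mult[OF set_integrable_bounded_linear[OF bounded_linear_column L2_integrable] \<phi>, of _ j]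
 have c: "column j (A - B) = column j A - column j B" for A B :: "complex^3^3" by (simp add: column_def vec_eq_iff)
 have "(LINT x:Om|lebesgue. pderiv_at j \<phi> x *\<^sub>R (u x - v x)) =
   (LINT x:Om|lebesgue. pderiv_at j \<phi> x *\<^sub>R u x) - (LINT x:Om|lebesgue. pderiv_at j \<phi> x *\<^sub>R v x)"
  unfolding scaleR_diff_right by (intro set_integral_diff i u v)
 also have "\<dots> = - ((LINT x:Om|lebesgue. \<phi> x *\<^sub>R column j (G x)) - (LINT x:Om|lebesgue. \<phi> x *\<^sub>R column j (H x)))"
  using u v \<phi> by (simp add: has_weak_grad_def)
 also have "\<dots> = - (LINT x:Om|lebesgue. \<phi> x *\<^sub>R column j (G x - H x))"
  unfolding c scaleR_diff_right by (subst set_integral_diff(2)[OF i' i'], intro u v, intro u v, simp)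
 finally show "(LINT x:Om|lebesgue. pderiv_at j \<phi> x *\<^sub>R (u x - v x)) = - (LINT x:Om|lebesgue. \<phi> x *\<^sub>R column j (G x - H x))" .
qed

text \<open>Testing on the solid sector is continuous for the L2 norm on the whole domain, the norm
  in which the approximations in the definition of a trace converge.\<close>

lemma test_integral_bound:
 assumes ps: "test_fun U ps"
 obtains C where "C >= 0" "!!p :: real^3 => 'b::euclidean_space. L2_on lebesgue Om p ==>
   norm (SINT x. ps x *\<^sub>R p x) <= C * L2_norm lebesgue Om p"
proof -
 obtain B where B: "B > 0" "!!x. \<bar>ps x\<bar> <= B" using test_fun_bounded[OF ps] by blast
 have "norm (SINT x. ps x *\<^sub>R p x) <= (B * sqrt (measure lebesgue Om)) * L2_norm lebesgue Om p"
  if p: "L2_on lebesgue Om p" for p :: "real^3 => 'b"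
 proof -
  have i: "set_integrable lebesgue Om p" by (rule L2_integrable[OF p])
  have j: "Sintegrable (\<lambda>x. ps x *\<^sub>R p x)" by (rule integrable_test_mult[OF set_integrable_Sol[OF i] ps])
  have "norm (SINT x. ps x *\<^sub>R p x) <= (LINT x|lebesgue. B * (indicator Om x *\<^sub>R norm (p x)))" unfolding set_lebesgue_integral_def
  proof (rule Bochner_Integration.integral_norm_bound_integral)
   show "integrable lebesgue (\<lambda>x. indicator (Sol h) x *\<^sub>R ps x *\<^sub>R p x)" using j by (simp add: set_integrable_def)
   show "integrable lebesgue (\<lambda>x. B * (indicator Om x *\<^sub>R norm (p x)))"
    using integrable_norm[OF i[unfolded set_integrable_def]] by (intro integrable_mult_right) simp
   fix x
   show "norm (indicator (Sol h) x *\<^sub>R ps x *\<^sub>R p x) <= B * (indicator Om x *\<^sub>R norm (p x))"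
    using mult_right_mono[OF B(2)[of x] norm_ge_zero[of "p x"]] Sol_subset_Om B(1) by (auto simp: indicator_def)
  qed
  also have "\<dots> = B * (LINT x:Om|lebesgue. norm (p x))" by (simp add: set_lebesgue_integral_def)
  also have "\<dots> <= B * (sqrt (measure lebesgue Om) * L2_norm lebesgue Om p)"
   using B(1) by (intro mult_left_mono L2_on_Cauchy_Schwarz(2)[OF p sets_Om emeasure_Om]) auto
  finally show ?thesis by simp
 qed
 then show ?thesis using that[of "B * sqrt (measure lebesgue Om)"] B(1) by auto
qed

lemma face_integral_smooth:
 fixes g :: "real^3 => 'b::euclidean_space"
 assumes "smooth g" "test_fun (Cyl h) ps"
 shows "(SINT x. dir_deriv (e3 th) ps x *\<^sub>R g x + ps x *\<^sub>R dir_deriv (e3 th) g x) =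
   - (LINT p|lborel. ps (fac p) *\<^sub>R g (fac p))"
proof -
 obtain B1 where B1: "!!x. x \<in> Cyl h ==> norm (g x) <= B1" using smooth_bounded_on[OF assms(1) bounded_Cyl] by blast
 obtain B2 where B2: "!!x. x \<in> Cyl h ==> norm (dir_deriv (e3 th) g x) <= B2"
  using smooth_bounded_on[OF smooth_dir_deriv[OF assms(1)] bounded_Cyl] by blast
 show ?thesis
 proof (rule face_integration_by_parts(2)[OF assms(2), where B = "max B1 B2"])
  show "(g has_derivative (\<lambda>b. dir_deriv b g x)) (at x)" for x by (rule smooth_has_derivative[OF assms(1)])
  show "norm (g x) <= max B1 B2" "norm (dir_deriv (e3 th) g x) <= max B1 B2" if "x \<in> Sol h" for x
   using B1[of x] B2[of x] Sol_subset_Cyl[of h] that by auto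
 qed (auto intro: smooth_continuous assms(1))
qed

text \<open>For the smooth approximations the face integral equals the volume expression by
  \<open>face_integral_smooth\<close>, and the volume expression is continuous in the H1 norm. Thus
  face integrals of approximating sequences are expressed by the limit field alone, whatever the
  sequence.\<close>

lemma trace_green:
 assumes u: "H1_on Om u" and us: "!!n. smooth (us n)" "(\<lambda>n. H1_norm Om (\<lambda>x. us n x - u x)) \<longlonglongrightarrow> 0"
  and ps: "test_fun (Cyl h) ps"
 shows "(\<lambda>n. - (LINT p|lborel. ps (fac p) *\<^sub>R us n (fac p))) \<longlonglongrightarrow>
  (SINT x. dir_deriv (e3 th) ps x *\<^sub>R u x + ps x *\<^sub>R (weak_grad Om u x *v complexify (e3 th)))"
proof -
 let ?e = "e3 th"
 let ?G = "weak_grad Om u"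
 define H where "H n = weak_grad Om (\<lambda>x. us n x - u x)" for n
 note uD = H1_D[OF u]
 have Ld: "L2_on lebesgue Om (\<lambda>x. us n x - u x)" for n by (intro L2_on_diff smooth_L2 us uD)
 have H1d: "H1_on Om (\<lambda>x. us n x - u x)" for n unfolding H1_on_def using Ld
   has_weak_grad_diff[OF smooth_L2[OF us(1)] smooth_weak_grad(2,1)[OF us(1)] uD] L2_on_diff[OF smooth_weak_grad(2)[OF us(1)] uD(2)] by blast
 note HD = H1_D[OF H1d, folded H_def]
 have dp: "test_fun (Cyl h) (dir_deriv ?e ps)" by (rule test_fun_dir_deriv[OF ps])
 obtain C1 where C1: "C1 >= 0" "!!p :: real^3 => complex^3. L2_on lebesgue Om p ==>
   norm (SINT x. dir_deriv ?e ps x *\<^sub>R p x) <= C1 * L2_norm lebesgue Om p" using test_integral_bound[OF dp] by blast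
 obtain C2 where C2: "C2 >= 0" "!!p :: real^3 => complex^3^3. L2_on lebesgue Om p ==>
   norm (SINT x. ps x *\<^sub>R p x) <= C2 * L2_norm lebesgue Om p" using test_integral_bound[OF ps] by blast
 let ?A = "\<lambda>G :: complex^3^3. G *v complexify ?e"
 obtain ka where ka: "ka > 0" "!!(A :: complex^3^3) e. norm (A *v complexify e) <= ka * norm A * norm e" using matrix_complexify_bound by blast
 note bl = bounded_linear_mult_complexify[of ?e]
 have Al: "?A (c *\<^sub>R g) = c *\<^sub>R ?A g" for c g by (rule linear_scale[OF bounded_linear.linear[OF bl]])
 have iS: "Sintegrable p" if "L2_on lebesgue Om p" for p :: "real^3 => 'q::euclidean_space"
  by (rule set_integrable_Sol[OF L2_integrable[OF that]])
 note it = integrable_test_mult[OF iS]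
 have su: "L2_on lebesgue Om (us n)" "L2_on lebesgue Om (dir_deriv ?e (us n))" for n by (intro smooth_L2 smooth_dir_deriv us)+
 have iG: "Sintegrable (\<lambda>x. ?A (?G x))" "Sintegrable (\<lambda>x. ?A (H n x))" for n by (intro set_integrable_bounded_linear[OF bl] iS uD HD)+
 \<comment> \<open>\<open>H n\<close> is a chosen weak gradient of \<open>us n - u\<close>, not the
   difference of given gradients. Both are weak gradients of the same field, so they agree after
   testing in the interior and hence up to the faces.\<close>
 have key: "(SINT x. ps x *\<^sub>R (dir_deriv ?e (us n) x - (?A (H n x) + ?A (?G x)))) = 0" for n
 proof (rule test_extends_to_faces[OF _ _ ps])
  show "Sintegrable (\<lambda>x. dir_deriv ?e (us n) x - (?A (H n x) + ?A (?G x)))" by (intro set_integral_diff(1) set_integral_add(1) iS su iG)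
  fix \<phi> assume \<phi>: "test_fun (Sol h) \<phi>"
  note i = integrable_test_mult[OF _ \<phi>] and i2 = integrable_test_mult[OF _ test_fun_dir_deriv[OF \<phi>]]
  have sg: "smooth_grad (us n) x *v complexify ?e = dir_deriv ?e (us n) x" for x
   unfolding matrix_mult_complexify column_smooth_grad by (rule dir_deriv_representation[OF us(1), symmetric])
  have "(SINT x. \<phi> x *\<^sub>R dir_deriv ?e (us n) x) = - (SINT x. dir_deriv ?e \<phi> x *\<^sub>R us n x)"
   using weak_grad_dir_Sol[OF su(1)[of n] smooth_weak_grad(2,1)[OF us(1)[of n]] \<phi>, where e = ?e] by (simp add: sg)
  also have "(SINT x. dir_deriv ?e \<phi> x *\<^sub>R us n x) =
    (SINT x. dir_deriv ?e \<phi> x *\<^sub>R (us n x - u x)) + (SINT x. dir_deriv ?e \<phi> x *\<^sub>R u x)"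
   using set_integral_add(2)[OF i2[OF iS[OF Ld[of n]], of ?e] i2[OF iS[OF uD(1)], of ?e]] by (simp add: algebra_simps)
  also have "\<dots> = - (SINT x. \<phi> x *\<^sub>R ?A (H n x)) - (SINT x. \<phi> x *\<^sub>R ?A (?G x))"
   using weak_grad_dir_Sol[OF HD(1)[of n] HD(2)[of n] HD(3)[of n] \<phi>, where e = ?e] weak_grad_dir_Sol[OF uD \<phi>, where e = ?e] by simp
  finally have e: "(SINT x. \<phi> x *\<^sub>R dir_deriv ?e (us n) x) =
    (SINT x. \<phi> x *\<^sub>R ?A (H n x)) + (SINT x. \<phi> x *\<^sub>R ?A (?G x))" by simp
  show "(SINT x. \<phi> x *\<^sub>R (dir_deriv ?e (us n) x - (?A (H n x) + ?A (?G x)))) = 0" unfolding scaleR_diff_right scaleR_add_right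
   by (subst set_integral_diff(2), rule i[OF iS[OF su(2)]], intro set_integral_add(1) i iG,
     subst set_integral_add(2)) (auto intro: i iG simp: e)
 qed
 have eqn: "- (LINT p|lborel. ps (fac p) *\<^sub>R us n (fac p)) =
   (SINT x. dir_deriv ?e ps x *\<^sub>R u x + ps x *\<^sub>R ?A (?G x)) +
   ((SINT x. dir_deriv ?e ps x *\<^sub>R (us n x - u x)) + ?A (SINT x. ps x *\<^sub>R H n x))" for n
 proof -
  have a: "(SINT x. ps x *\<^sub>R ?A (H n x)) = ?A (SINT x. ps x *\<^sub>R H n x)"
   using set_integral_bounded_linear[OF bl it[OF HD(2)[of n] ps]] by (simp add: Al)
  have b: "(SINT x. ps x *\<^sub>R dir_deriv ?e (us n) x) =
    (SINT x. ps x *\<^sub>R ?A (H n x)) + (SINT x. ps x *\<^sub>R ?A (?G x))"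
  proof -
   have "(SINT x. ps x *\<^sub>R (dir_deriv ?e (us n) x - (?A (H n x) + ?A (?G x)))) =
    (SINT x. ps x *\<^sub>R dir_deriv ?e (us n) x) -
    ((SINT x. ps x *\<^sub>R ?A (H n x)) + (SINT x. ps x *\<^sub>R ?A (?G x)))" unfolding scaleR_diff_right scaleR_add_right
    by (subst set_integral_diff(2), rule it[OF su(2) ps], intro set_integral_add(1) integrable_test_mult[OF _ ps] iG,
     subst set_integral_add(2)) (auto intro: integrable_test_mult[OF _ ps] iG)
   then show ?thesis using key[of n] by simp
  qed
  have c: "(SINT x. dir_deriv ?e ps x *\<^sub>R us n x) =
    (SINT x. dir_deriv ?e ps x *\<^sub>R (us n x - u x)) + (SINT x. dir_deriv ?e ps x *\<^sub>R u x)"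
   using set_integral_add(2)[OF it[OF Ld[of n] dp] it[OF uD(1) dp]] by (simp add: algebra_simps)
  have d: "(SINT x. dir_deriv ?e ps x *\<^sub>R u x + ps x *\<^sub>R ?A (?G x)) =
    (SINT x. dir_deriv ?e ps x *\<^sub>R u x) + (SINT x. ps x *\<^sub>R ?A (?G x))"
   by (intro set_integral_add(2) it[OF uD(1) dp] integrable_test_mult[OF iG(1) ps])
  have "- (LINT p|lborel. ps (fac p) *\<^sub>R us n (fac p)) =
    (SINT x. dir_deriv ?e ps x *\<^sub>R us n x + ps x *\<^sub>R dir_deriv ?e (us n) x)" using face_integral_smooth[OF us(1) ps] by simp
  also have "\<dots> = (SINT x. dir_deriv ?e ps x *\<^sub>R us n x) + (SINT x. ps x *\<^sub>R dir_deriv ?e (us n) x)"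
   by (intro set_integral_add(2) it[OF su(1) dp] it[OF su(2) ps])
  finally show ?thesis unfolding a[symmetric] b c d by simp
 qed
 have "(\<lambda>n. (SINT x. dir_deriv ?e ps x *\<^sub>R (us n x - u x)) + ?A (SINT x. ps x *\<^sub>R H n x)) \<longlonglongrightarrow> 0"
 proof (rule Lim_null_comparison)
  have "norm ((SINT x. dir_deriv ?e ps x *\<^sub>R (us n x - u x)) + ?A (SINT x. ps x *\<^sub>R H n x))
    <= (C1 + ka * C2 * norm ?e) * H1_norm Om (\<lambda>x. us n x - u x)" for n
  proof -
   let ?N = "H1_norm Om (\<lambda>x. us n x - u x)"
   have "norm (SINT x. dir_deriv ?e ps x *\<^sub>R (us n x - u x)) <= C1 * ?N"
    using C1(2)[OF Ld[of n]] mult_left_mono[OF L2_norm_le_H1_norm(1) C1(1), of Om "\<lambda>x. us n x - u x"] by simp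
   moreover have "norm (?A (SINT x. ps x *\<^sub>R H n x)) <= ka * (C2 * ?N) * norm ?e"
   proof -
    have "norm (SINT x. ps x *\<^sub>R H n x) <= C2 * ?N"
     using C2(2)[OF HD(2)[of n]] mult_left_mono[OF L2_norm_le_H1_norm(2) C2(1), of Om "\<lambda>x. us n x - u x"] by (simp add: H_def)
    then show ?thesis using ka(1) by (intro order_trans[OF ka(2)] mult_right_mono mult_left_mono) auto
   qed
   ultimately show ?thesis
    using norm_triangle_ineq[of "SINT x. dir_deriv ?e ps x *\<^sub>R (us n x - u x)" "?A (SINT x. ps x *\<^sub>R H n x)"]
    by (simp add: algebra_simps)
  qed
  then show "\<forall>\<^sub>F n in sequentially. norm ((SINT x. dir_deriv ?e ps x *\<^sub>R (us n x - u x)) + ?A (SINT x. ps x *\<^sub>R H n x))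
    <= (C1 + ka * C2 * norm ?e) * H1_norm Om (\<lambda>x. us n x - u x)" by simp
  show "(\<lambda>n. (C1 + ka * C2 * norm ?e) * H1_norm Om (\<lambda>x. us n x - u x)) \<longlonglongrightarrow> 0"
   using tendsto_mult_left[OF us(2), of "C1 + ka * C2 * norm ?e"] by simp
 qed
 from tendsto_add[OF tendsto_const this, of "SINT x. dir_deriv ?e ps x *\<^sub>R u x + ps x *\<^sub>R ?A (?G x)"]
 show ?thesis by (simp add: eqn)
qed

end

lemma smooth_gr_compose_integrable:
 fixes g :: "real^3 => 'b::euclidean_space"
 assumes "smooth g" "test_fun U ps" "bounded U"
 shows "integrable lborel (\<lambda>p. ps (face th be p) *\<^sub>R g (face th be p))"
proof -
 obtain R where R: "!!x. x \<in> U ==> norm x < R" using assms(3) unfolding bounded_pos_less by blast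
 show ?thesis
 proof (rule integrable_continuous_bounded_support)
  show "continuous_on UNIV (\<lambda>p. ps (face th be p) *\<^sub>R g (face th be p))"
   by (intro continuous_on_scaleR continuous_on_compose2[OF smooth_continuous[OF test_funD(1)[OF assms(2)]] continuous_on_face]
     continuous_on_compose2[OF smooth_continuous[OF assms(1)] continuous_on_face]) auto
  fix p :: "real \<times> real" assume "norm p > R"
  then have "face th be p \<notin> U" using R[of "face th be p"] face_norm[of p th be] by force
  then show "ps (face th be p) *\<^sub>R g (face th be p) = 0" using test_funD(5)[OF assms(2)] by simp
 qed
qed

lemma bounded_linear_traction: "bounded_linear (traction lam \<mu> \<nu>)"
proof -
 have "linear (traction lam \<mu> \<nu>)" by (rule linearI)
   (simp_all add: traction_def complexify_def ccross3_def curl_of_def vec_eq_iff forall_3 sum_3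
    vector_def trace_def matrix_vector_mult_def axis_def
    scaleR_conv_of_real[where 'a=complex] algebra_simps)
 then show ?thesis using linear_conv_bounded_linear by blast
qed

text \<open>These columns form the symmetric stress tensor: twice the normal derivative plus the
  cross product with the curl adds up to the gradient plus its transpose.\<close>

lemma traction_axis_nth:
 "traction lam \<mu> (axis k 1) G $ i =
  \<mu> *\<^sub>R (G $ i $ k) + \<mu> *\<^sub>R (G $ k $ i) + (if i = k then \<Sum>j\<in>UNIV. lam *\<^sub>R (G $ j $ j) else 0)"
 using exhaust_3[of i] exhaust_3[of k] by (auto simp: traction_def complexify_def ccross3_def curl_of_def sum_3 vector_def trace_def
   matrix_vector_mult_def axis_def scaleR_conv_of_real[where 'a=complex] algebra_simps)

lemma ennreal_le_mult_cancel: "ennreal a <= ennreal 4 * ennreal b ==> 0 <= b ==> a <= 4 * b"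
 by (metis ennreal_le_iff ennreal_mult mult_nonneg_nonneg zero_le_numeral)

section \<open>Boundary values of the difference of the two fields\<close>

locale edge_pair = edge_domain +
 fixes \<Gamma> :: "(real^3) set" and v w F :: "real^3 => complex^3" and G :: "real^3 => complex^3^3" and \<alpha> :: real
 assumes H1: "H1_on Om v" "H1_on Om w"
  and \<Gamma>: "\<Gamma> \<subseteq> frontier Om"
  and \<Gamma>_faces: "!!x. x \<in> Cyl h ==> lev (proj2 x) = 0 ==> proj2 x ~= 0 ==> x \<in> \<Gamma>"
  and traces: "trace_eq_on Om \<Gamma> w v"
  and \<alpha>: "0 < \<alpha>" and F_cont: "continuous_on Kcl F" and G_holder: "holder_on \<alpha> Kcl G"
  and F_der: "!!x. x \<in> Sol h ==> (F has_derivative (\<lambda>y. G x *v complexify y)) (at x)"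
  and F_eq: "AE x in lebesgue. x \<in> Sol h \<longrightarrow> F x = v x - w x"
begin

lemma F_bounded:
 "\<exists>C\<ge>0. (\<forall>x\<in>Kcl. norm (F x) <= C) \<and> (\<forall>x\<in>Kcl. \<forall>e. norm (G x *v complexify e) <= C * norm e)"
proof (rule F_bounds[OF \<alpha> F_cont G_holder])
 show "(F has_derivative (\<lambda>y. G x *v complexify y)) (at x)" if "x \<in> Sol h" for x by (rule F_der[OF that])
qed blast

text \<open>A weak gradient of v - w assembled from the two choices. Its relation to the continuous
  gradient \<open>G\<close> of the representative \<open>F\<close> is only used after
  testing.\<close>

definition "Gd x = weak_grad Om v x - weak_grad Om w x"

lemma L2_Gd: "L2_on lebesgue Om Gd" unfolding Gd_def[abs_def] by (intro L2_on_diff H1_D H1)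

lemma L2_u: "L2_on lebesgue Om (\<lambda>x. v x - w x)" by (intro L2_on_diff H1_D H1)

lemma weak_grad_u: "has_weak_grad Om (\<lambda>x. v x - w x) Gd" unfolding Gd_def[abs_def] by (intro has_weak_grad_diff H1_D H1)

lemma F_set_integrable: "Sintegrable F"
proof -
 obtain C where C: "!!x. x \<in> Kcl ==> norm (F x) <= C" using F_bounded by blast
 have m: "(\<lambda>x. indicator (Sol h) x *\<^sub>R F x) \<in> borel_measurable lebesgue"
  using borel_measurable_continuous_on_indicator[of "Sol h" F] open_Sol continuous_on_subset[OF F_cont Sol_subset_Kcl]
  by (simp add: measurable_completion)
 show ?thesis unfolding set_integrable_def
 proof (rule Bochner_Integration.integrable_bound[OF _ m])
  show "integrable lebesgue (\<lambda>x. C * indicator (Sol h) x)"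
   using emeasure_Sol[of h] open_Sol[of h] by (intro integrable_mult_right integrable_real_indicator) auto
  have "norm (indicator (Sol h) x *\<^sub>R F x) <= norm (C * indicator (Sol h) x)" for x
   using C[of x] Sol_subset_Kcl by (cases "x \<in> Sol h") auto
  then show "AE x in lebesgue. norm (indicator (Sol h) x *\<^sub>R F x) <= norm (C * indicator (Sol h) x)" by simp
 qed
qed

lemma u_set_integrable: "Sintegrable (\<lambda>x. v x - w x)" by (rule set_integrable_Sol[OF L2_integrable[OF L2_u]])

lemma Gd_set_integrable: "Sintegrable (\<lambda>x. Gd x *v complexify e)"
 by (rule set_integrable_bounded_linear[OF bounded_linear_mult_complexify set_integrable_Sol[OF L2_integrable[OF L2_Gd]]])

lemma u_eq_F:
 assumes ps: "test_fun U ps"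
 shows "(SINT x. ps x *\<^sub>R (v x - w x)) = (SINT x. ps x *\<^sub>R F x)"
proof -
 have "integrable lebesgue (\<lambda>x. indicator (Sol h) x *\<^sub>R ps x *\<^sub>R (v x - w x))"
  "integrable lebesgue (\<lambda>x. indicator (Sol h) x *\<^sub>R ps x *\<^sub>R F x)"
  using integrable_test_mult[OF u_set_integrable ps] integrable_test_mult[OF F_set_integrable ps] by (simp_all add: set_integrable_def)
 then show ?thesis unfolding set_lebesgue_integral_def
  by (intro integral_cong_AE borel_measurable_integrable) (use F_eq in \<open>auto elim!: eventually_mono simp: indicator_def\<close>)
qed

text \<open>By \<open>trace_green\<close> the expression is the limit of face integrals of
  differences of approximating smooth fields. On the faces off the edge both traces coincide almost
  everywhere, so these integrals are controlled by the L2 distances of the approximations to their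
  traces, which tend to 0.\<close>

lemma traces_cancel:
 assumes ps: "test_fun (Cyl h \<inter> {x. cY th (proj2 x) ~= 0}) ps"
 shows "(SINT x. dir_deriv (e3 th) ps x *\<^sub>R (v x - w x)) +
  (SINT x. ps x *\<^sub>R (Gd x *v complexify (e3 th))) = 0"
proof -
 let ?e = "e3 th" and ?S = surface_measure and ?fr = "frontier Om"
 have ps': "test_fun (Cyl h) ps" by (rule test_fun_mono[OF ps]) auto
 have dp: "test_fun (Cyl h) (dir_deriv ?e ps)" by (rule test_fun_dir_deriv[OF ps'])
 obtain f g where "has_trace Om w f" "has_trace Om v g" and fg: "AE x in ?S. x \<in> \<Gamma> \<longrightarrow> f x = g x"
  using traces unfolding trace_eq_on_def by blast
 then obtain us ws where f: "L2_on ?S ?fr f" and g: "L2_on ?S ?fr g"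
  and us: "!!n. smooth (us n)" "(\<lambda>n. H1_norm Om (\<lambda>x. us n x - v x)) \<longlonglongrightarrow> 0"
   "(\<lambda>n. L2_norm ?S ?fr (\<lambda>x. us n x - g x)) \<longlonglongrightarrow> 0"
  and ws: "!!n. smooth (ws n)" "(\<lambda>n. H1_norm Om (\<lambda>x. ws n x - w x)) \<longlonglongrightarrow> 0"
   "(\<lambda>n. L2_norm ?S ?fr (\<lambda>x. ws n x - f x)) \<longlonglongrightarrow> 0" unfolding has_trace_def by (metis (no_types, lifting))
 let ?I = "\<lambda>u. LINT p|lborel. ps (fac p) *\<^sub>R u (fac p)"
 note tv = trace_green[OF H1(1) us(1,2) ps'] and tw = trace_green[OF H1(2) ws(1,2) ps']
 have iS: "Sintegrable p" if "L2_on lebesgue Om p" for p :: "real^3 => 'q::euclidean_space"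
  by (rule set_integrable_Sol[OF L2_integrable[OF that]])
 note bl = bounded_linear_mult_complexify[of ?e]
 have ii: "Sintegrable (\<lambda>x. dir_deriv ?e ps x *\<^sub>R u x)"
  "Sintegrable (\<lambda>x. ps x *\<^sub>R (weak_grad Om u x *v complexify ?e))" if "H1_on Om u" for u
  by (intro integrable_test_mult[OF _ dp] integrable_test_mult[OF _ ps'] iS H1_D that set_integrable_bounded_linear[OF bl])+
 have lim: "(\<lambda>n. - (?I (us n) - ?I (ws n))) \<longlonglongrightarrow>
   (SINT x. dir_deriv ?e ps x *\<^sub>R (v x - w x)) + (SINT x. ps x *\<^sub>R (Gd x *v complexify ?e))"
 proof -
  have "(SINT x. dir_deriv ?e ps x *\<^sub>R v x + ps x *\<^sub>R (weak_grad Om v x *v complexify ?e)) -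
   (SINT x. dir_deriv ?e ps x *\<^sub>R w x + ps x *\<^sub>R (weak_grad Om w x *v complexify ?e)) =
   (SINT x. dir_deriv ?e ps x *\<^sub>R (v x - w x)) + (SINT x. ps x *\<^sub>R (Gd x *v complexify ?e))" using ii[OF H1(1)] ii[OF H1(2)]
   by (simp add: Gd_def matrix_vector_mult_diff_rdistrib scaleR_diff_right)
  then show ?thesis using tendsto_diff[OF tv tw] by (simp add: algebra_simps)
 qed
 obtain B where B: "B > 0" "!!x. \<bar>ps x\<bar> <= B" using test_fun_bounded[OF ps] by blast
 have fr: "?fr \<in> sets ?S" "emeasure ?S ?fr < top" using emeasure_frontier_lipschitz_domain[OF lip] by auto
 have bfr: "bounded ?fr" using compact_imp_bounded[OF compact_frontier_bounded[OF Om(2)]] .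
 define m where "m = sqrt (measure ?S ?fr)"
 \<comment> \<open>The part of the faces that the test function can see; removing the edge places it
   inside \<open>\<Gamma>\<close>.\<close>
 define Z where "Z = {x \<in> Cyl h. lev (proj2 x) = 0 \<and> cY th (proj2 x) ~= 0}"
 have Zb: "Z \<in> sets borel"
 proof -
  have "Z = Cyl h \<inter> {x. lev (proj2 x) = 0} \<inter> {x. cY th (proj2 x) ~= 0}" by (auto simp: Z_def)
  moreover have "closed {x. lev (proj2 x) = 0}" "open {x. cY th (proj2 x) ~= 0}"
   by (intro closed_Collect_eq open_Collect_neq continuous_intros)+
  ultimately show ?thesis using open_Cyl by (auto intro!: sets.Int)
 qed
 have Z\<Gamma>: "Z \<subseteq> \<Gamma>"
 proof
  fix x assume x: "x \<in> Z"
  moreover have "cY th 0 = 0" by (simp add: cY_def)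
  ultimately have "proj2 x ~= 0" by (auto simp: Z_def)
  then show "x \<in> \<Gamma>" using x by (intro \<Gamma>_faces) (auto simp: Z_def)
 qed
 \<comment> \<open>The factor 4 compares area in the parameter plane with surface measure,
   \<open>B\<close> bounds the test function and \<open>m\<close> comes from the Cauchy-Schwarz
   inequality on the frontier.\<close>
 have bound: "norm (?I (us n) - ?I (ws n)) <=
   4 * (B * (m * L2_norm ?S ?fr (\<lambda>x. us n x - g x) + m * L2_norm ?S ?fr (\<lambda>x. ws n x - f x)))" for n
 proof -
  define d where "d x = us n x - ws n x" for x
  have sd: "smooth d" unfolding d_def[abs_def] by (intro smooth_diff us ws)
  have sL2: "L2_on ?S ?fr u" if u: "smooth u" for u :: "real^3 => complex^3"
  proof -
   obtain Bu where "!!x. x \<in> ?fr ==> norm (u x) <= Bu" using smooth_bounded_on[OF u bfr] by blast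
   then show ?thesis using smooth_measurable[OF u] fr by (intro L2_on_bounded) (auto cong: measurable_cong_sets)
  qed
  have La: "L2_on ?S ?fr (\<lambda>x. us n x - g x)" and Lb: "L2_on ?S ?fr (\<lambda>x. ws n x - f x)" by (intro L2_on_diff sL2 us ws f g)+
  note CSa = L2_on_Cauchy_Schwarz[OF La fr] and CSb = L2_on_Cauchy_Schwarz[OF Lb fr]
  define Fq where "Fq x = ennreal (B * norm (d x)) * indicator Z x" for x
  have mFq: "Fq \<in> borel_measurable borel" unfolding Fq_def using smooth_measurable[OF sd] Zb by measurable
  let ?s = "\<lambda>x. B * (indicator ?fr x *\<^sub>R norm (us n x - g x) + indicator ?fr x *\<^sub>R norm (ws n x - f x))"
  have is1: "integrable ?S ?s" using integrable_norm[OF CSa(1)[unfolded set_integrable_def]] integrable_norm[OF CSb(1)[unfolded set_integrable_def]]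
   by (intro integrable_mult_right Bochner_Integration.integrable_add) simp_all
  have "?I (us n) - ?I (ws n) = ?I d"
   using smooth_gr_compose_integrable[OF us(1) ps' bounded_Cyl] smooth_gr_compose_integrable[OF ws(1) ps' bounded_Cyl]
   by (simp add: d_def scaleR_diff_right)
  then have "ennreal (norm (?I (us n) - ?I (ws n))) <= (\<integral>\<^sup>+p. ennreal (norm (ps (fac p) *\<^sub>R d (fac p))) \<partial>lborel)"
   using integral_norm_bound_ennreal[OF smooth_gr_compose_integrable[OF sd ps' bounded_Cyl]] by simp
  also have "\<dots> <= (\<integral>\<^sup>+p. Fq (fac p) \<partial>lborel)"
  proof (rule nn_integral_mono)
   fix p
   show "ennreal (norm (ps (fac p) *\<^sub>R d (fac p))) <= Fq (fac p)"
   proof (cases "ps (fac p) = 0")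
    case False
    then have "fac p \<in> Cyl h \<inter> {x. cY th (proj2 x) ~= 0}" using test_funD(5)[OF ps] by blast
    then have "fac p \<in> Z" by (simp add: Z_def ell_face)
    moreover have "\<bar>ps (fac p)\<bar> * norm (d (fac p)) <= B * norm (d (fac p))" by (intro mult_right_mono B(2)) auto
    ultimately show ?thesis by (simp add: Fq_def ennreal_leI)
   qed simp
  qed
  also have "\<dots> <= 4 * (\<integral>\<^sup>+x. Fq x \<partial>?S)" by (rule nn_integral_graph_le[OF face_expansive _ mFq])
    (intro borel_measurable_continuous_onI continuous_on_face)
  finally have e1: "ennreal (norm (?I (us n) - ?I (ws n))) <= 4 * (\<integral>\<^sup>+x. Fq x \<partial>?S)" .
  have "(\<integral>\<^sup>+x. Fq x \<partial>?S) <= (\<integral>\<^sup>+x. ennreal (?s x) \<partial>?S)"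
  proof (rule nn_integral_mono_AE)
   show "AE x in ?S. Fq x <= ennreal (?s x)" using fg
   proof eventually_elim
    case (elim x)
    show ?case
    proof (cases "x \<in> Z")
     case True
     then have x: "x \<in> \<Gamma>" "x \<in> ?fr" using Z\<Gamma> \<Gamma> by auto
     have "d x = (us n x - g x) - (ws n x - f x)" using elim x by (simp add: d_def)
     then have "norm (d x) <= norm (us n x - g x) + norm (ws n x - f x)" by (metis norm_triangle_ineq4)
     then show ?thesis using True x B(1) by (auto simp: Fq_def intro!: ennreal_leI mult_left_mono)
    qed (simp add: Fq_def)
   qed
  qed
  also have "(\<integral>\<^sup>+x. ennreal (?s x) \<partial>?S) = ennreal (LINT x|?S. ?s x)" using is1 B(1) by (intro nn_integral_eq_integral) auto
  also have "(LINT x|?S. ?s x) = B * ((LINT x:?fr|?S. norm (us n x - g x)) + (LINT x:?fr|?S. norm (ws n x - f x)))"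
   using integrable_norm[OF CSa(1)[unfolded set_integrable_def]] integrable_norm[OF CSb(1)[unfolded set_integrable_def]]
   by (simp add: set_lebesgue_integral_def)
  finally have e2: "(\<integral>\<^sup>+x. Fq x \<partial>?S) <= ennreal (B * ((LINT x:?fr|?S. norm (us n x - g x)) + (LINT x:?fr|?S. norm (ws n x - f x))))" .
  have nn: "0 <= B * ((LINT x:?fr|?S. norm (us n x - g x)) + (LINT x:?fr|?S. norm (ws n x - f x)))"
   using B(1) by (auto simp: set_lebesgue_integral_def intro!: mult_nonneg_nonneg add_nonneg_nonneg Bochner_Integration.integral_nonneg)
  have "ennreal (norm (?I (us n) - ?I (ws n))) <=
    ennreal 4 * ennreal (B * ((LINT x:?fr|?S. norm (us n x - g x)) + (LINT x:?fr|?S. norm (ws n x - f x))))"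
   using order_trans[OF e1 mult_left_mono[OF e2, of 4]] by simp
  then have "norm (?I (us n) - ?I (ws n)) <= 4 * (B * ((LINT x:?fr|?S. norm (us n x - g x)) + (LINT x:?fr|?S. norm (ws n x - f x))))"
   using nn by (rule ennreal_le_mult_cancel)
  also have "\<dots> <= 4 * (B * (m * L2_norm ?S ?fr (\<lambda>x. us n x - g x) + m * L2_norm ?S ?fr (\<lambda>x. ws n x - f x)))"
   using B(1) CSa(2) CSb(2) by (intro mult_left_mono add_mono) (auto simp: m_def)
  finally show ?thesis .
 qed
 have "(\<lambda>n. 4 * (B * (m * L2_norm ?S ?fr (\<lambda>x. us n x - g x) + m * L2_norm ?S ?fr (\<lambda>x. ws n x - f x)))) \<longlonglongrightarrow>
   4 * (B * (m * 0 + m * 0))" by (intro tendsto_intros us ws)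
 then have l0: "(\<lambda>n. 4 * (B * (m * L2_norm ?S ?fr (\<lambda>x. us n x - g x) + m * L2_norm ?S ?fr (\<lambda>x. ws n x - f x)))) \<longlonglongrightarrow> 0"
  by simp
 have "(\<lambda>n. ?I (us n) - ?I (ws n)) \<longlonglongrightarrow> 0" by (rule Lim_null_comparison[OF always_eventually[OF allI[OF bound]] l0])
 from tendsto_minus[OF this] show ?thesis using LIMSEQ_unique[OF lim] by simp
qed

text \<open>Integration by parts expresses the face integral of \<open>F\<close> by volume integrals
  of \<open>F\<close> and \<open>G\<close>. Replacing them by v - w and its weak gradient produces
  exactly the quantity that vanishes by \<open>traces_cancel\<close>, and
  \<open>vanish_on_faces\<close> concludes.\<close>

lemma F_face_zero: "lev (proj2 x) = 0 ==> x \<in> Cyl h ==> F x = 0"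
proof (rule vanish_on_faces)
 show cF: "continuous_on ({x. lev (proj2 x) >= 0} \<inter> Cyl h) F" by (rule continuous_on_subset[OF F_cont]) (auto intro: in_Kcl)
 let ?e = "e3 th"
 let ?g = "\<lambda>x. G x *v complexify ?e"
 obtain C where C: "C >= 0" "!!x. x \<in> Kcl ==> norm (F x) <= C"
   "!!x e. x \<in> Kcl ==> norm (G x *v complexify e) <= C * norm e" using F_bounded by blast
 have cg: "continuous_on (Sol h) ?g" by (rule bounded_linear.continuous_on[OF bounded_linear_mult_complexify
     continuous_on_subset[OF holder_continuous[OF G_holder \<alpha>] Sol_subset_Kcl]])
 have bF: "norm (F x) <= C + C * norm ?e" and bG: "norm (?g x) <= C + C * norm ?e" if "x \<in> Sol h" for x
 proof -
  have "x \<in> Kcl" using that Sol_subset_Kcl by blast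
  then show "norm (F x) <= C + C * norm ?e" "norm (?g x) <= C + C * norm ?e"
   using C(2)[of x] C(3)[of x ?e] C(1) mult_nonneg_nonneg[OF C(1) norm_ge_zero[of ?e]] by linarith+
 qed
 have parts: "Sintegrable (\<lambda>x. dir_deriv ?e ps x *\<^sub>R F x + ps x *\<^sub>R ?g x)"
  "(SINT x. dir_deriv ?e ps x *\<^sub>R F x + ps x *\<^sub>R ?g x) =
   - (LINT p|lborel. ps (fac p) *\<^sub>R F (fac p))" if "test_fun (Cyl h) ps" for ps
  by (rule face_integration_by_parts[OF that cF F_der refl cg bF bG]; assumption)+
 have ig: "Sintegrable ?g"
 proof -
  have m: "(\<lambda>x. indicator (Sol h) x *\<^sub>R ?g x) \<in> borel_measurable lebesgue"
   using borel_measurable_continuous_on_indicator[of "Sol h" ?g] open_Sol cg by (simp add: measurable_completion)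
  show ?thesis unfolding set_integrable_def
  proof (rule Bochner_Integration.integrable_bound[OF _ m])
   show "integrable lebesgue (\<lambda>x. (C * norm ?e) * indicator (Sol h) x)"
    using emeasure_Sol[of h] open_Sol[of h] by (intro integrable_mult_right integrable_real_indicator) auto
   have "norm (indicator (Sol h) x *\<^sub>R ?g x) <= norm ((C * norm ?e) * indicator (Sol h) x)" for x
    using C(3)[of x ?e] C(1) Sol_subset_Kcl by (cases "x \<in> Sol h") auto
   then show "AE x in lebesgue. norm (indicator (Sol h) x *\<^sub>R ?g x) <= norm ((C * norm ?e) * indicator (Sol h) x)" by simp
  qed
 qed
 note iGd = Gd_set_integrable[of ?e]
 have split: "(SINT x. dir_deriv ?e ps x *\<^sub>R F x + ps x *\<^sub>R ?g x) =
   (SINT x. dir_deriv ?e ps x *\<^sub>R F x) + (SINT x. ps x *\<^sub>R ?g x)"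
  if "test_fun (Cyl h) ps" for ps by (intro set_integral_add(2) integrable_test_mult[OF F_set_integrable test_fun_dir_deriv[OF that]]
    integrable_test_mult[OF ig that])
 \<comment> \<open>For interior test functions both gradients result from the same integral of
   \<open>F\<close> against a derivative; the cutoffs then extend the equality to the faces.\<close>
 have agree: "(SINT x. ps x *\<^sub>R ?g x) = (SINT x. ps x *\<^sub>R (Gd x *v complexify ?e))"
  if ps: "test_fun (Cyl h) ps" for ps
 proof -
  have d: "(SINT x. \<phi> x *\<^sub>R (?g x - Gd x *v complexify ?e)) =
    (SINT x. \<phi> x *\<^sub>R ?g x) - (SINT x. \<phi> x *\<^sub>R (Gd x *v complexify ?e))"
   if "test_fun U \<phi>" for \<phi> U unfolding scaleR_diff_right
   by (intro set_integral_diff(2) integrable_test_mult[OF ig that] integrable_test_mult[OF iGd that])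
  have "(SINT x. ps x *\<^sub>R (?g x - Gd x *v complexify ?e)) = 0"
  proof (rule test_extends_to_faces[OF _ _ ps])
   show "Sintegrable (\<lambda>x. ?g x - Gd x *v complexify ?e)" by (intro set_integral_diff(1) ig iGd)
   fix \<phi> assume \<phi>: "test_fun (Sol h) \<phi>"
   then have \<phi>': "test_fun (Cyl h) \<phi>" using test_fun_mono Sol_subset_Cyl by blast
   have "\<phi> (fac p) = 0" for p using test_funD(5)[OF \<phi>] face_not_Sol by blast
   then have "(SINT x. dir_deriv ?e \<phi> x *\<^sub>R F x) + (SINT x. \<phi> x *\<^sub>R ?g x) = 0"
    using parts(2)[OF \<phi>'] split[OF \<phi>'] by simp
   moreover have "(SINT x. dir_deriv ?e \<phi> x *\<^sub>R F x) = - (SINT x. \<phi> x *\<^sub>R (Gd x *v complexify ?e))"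
    using weak_grad_dir_Sol[OF L2_u L2_Gd weak_grad_u \<phi>, where e = ?e] u_eq_F[OF test_fun_dir_deriv[OF \<phi>], of ?e] by simp
   ultimately show "(SINT x. \<phi> x *\<^sub>R (?g x - Gd x *v complexify ?e)) = 0" unfolding d[OF \<phi>] by simp
  qed
  then show ?thesis unfolding d[OF ps] by simp
 qed
 fix ps assume ps: "test_fun (Cyl h \<inter> {x. cY th (proj2 x) ~= 0}) ps"
 then have ps': "test_fun (Cyl h) ps" by (rule test_fun_mono) auto
 show "(LINT p|lborel. ps (fac p) *\<^sub>R F (fac p)) = 0"
  using traces_cancel[OF ps] parts(2)[OF ps'] split[OF ps'] agree[OF ps'] u_eq_F[OF test_fun_dir_deriv[OF ps'], of ?e] by simp
qed

text \<open>The radius for which \<open>F_le_ell\<close> gives its bound; test functions are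
  confined to it in the identities for the weak equation.\<close>

definition "h1 = h / (1 + 2 / sin be)"

lemma h1: "0 < h1" "h1 <= h"
proof -
 have p: "1 + 2 / sin be > 1" using sin_be by simp
 then show "h1 > 0" using h unfolding h1_def by (intro divide_pos_pos) linarith+
 have "h * 1 <= h * (1 + 2 / sin be)" using p h by (intro mult_left_mono) linarith+
 then show "h1 <= h" unfolding h1_def using p pos_divide_le_eq[of "1 + 2 / sin be" h h] by linarith
qed

lemma Cyl_mono: "r <= s ==> Cyl r \<subseteq> Cyl s"
 by (auto simp: in_Cyl)

lemma F_ell: "\<exists>C\<ge>0. \<forall>x\<in>Sol h1. norm (F x) <= C * lev (proj2 x)"
proof (rule F_le_ell[OF \<alpha> F_cont G_holder, folded h1_def])
 show "(F has_derivative (\<lambda>y. G x *v complexify y)) (at x)" if "x \<in> Sol h" for x by (rule F_der[OF that])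
 show "F x = 0" if "lev (proj2 x) = 0" "x \<in> Cyl h" for x by (rule F_face_zero[OF that])
qed blast

lemma F_powr: "\<exists>C\<ge>0. \<forall>x\<in>Sol h. norm (F x) <= C * norm (proj2 x) powr (1 + \<alpha>)"
proof (rule F_le_powr[OF \<alpha> F_cont G_holder])
 show "(F has_derivative (\<lambda>y. G x *v complexify y)) (at x)" if "x \<in> Sol h" for x by (rule F_der[OF that])
 show "F x = 0" if "lev (proj2 x) = 0" "x \<in> Cyl h" for x by (rule F_face_zero[OF that])
qed blast

text \<open>Since \<^term>\<open>F\<close> vanishes on the faces, it is at most a multiple of \<^term>\<open>ell th be\<close> there, which compensates
 the growth of the gradients of the cutoffs.\<close>

lemma weak_integration_by_parts:
 assumes ps: "test_fun (Cyl h1) ps"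
 shows "(SINT x. dir_deriv e ps x *\<^sub>R F x) = - (SINT x. ps x *\<^sub>R (Gd x *v complexify e))"
proof -
 let ?g = "\<lambda>x. Gd x *v complexify e"
 have psh: "test_fun (Cyl h) ps" by (rule test_fun_mono[OF ps Cyl_mono[OF h1(2)]])
 obtain C where C: "C >= 0" "!!x. x \<in> Sol h1 ==> norm (F x) <= C * lev (proj2 x)" using F_ell by blast
 obtain L where L: "L >= 0" "!!n b x. \<bar>dir_deriv b (wcut th be n) x\<bar> <= L * real (Suc n) * norm b"
  by (rule wcut_deriv_bounded) blast
 let ?\<eta> = "wcut th be"
 let ?S = "indicat_real (Sol h)"
 let ?q = "\<lambda>x. ?S x *\<^sub>R (dir_deriv e ps x *\<^sub>R F x + ps x *\<^sub>R ?g x)"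
 let ?r = "\<lambda>n x. ?S x *\<^sub>R (?\<eta> n x *\<^sub>R (dir_deriv e ps x *\<^sub>R F x + ps x *\<^sub>R ?g x) + dir_deriv e (?\<eta> n) x *\<^sub>R (ps x *\<^sub>R F x))"
 note i1 = integrable_test_mult[OF F_set_integrable] and i2 = integrable_test_mult[OF Gd_set_integrable, of _ _ e]
 have iq: "integrable lebesgue ?q"
  using set_integral_add(1)[OF i1[OF test_fun_dir_deriv[OF ps], of e] i2[OF ps]] by (simp add: set_integrable_def)
 have ip: "integrable lebesgue (\<lambda>x. ?S x *\<^sub>R ps x *\<^sub>R F x)" using i1[OF ps] by (simp add: set_integrable_def)
 have mw: "?\<eta> n \<in> borel_measurable lebesgue" "dir_deriv e (?\<eta> n) \<in> borel_measurable lebesgue" for n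
  by (intro smooth_measurable_lebesgue smooth_wcut smooth_dir_deriv)+
 have req: "?r n x = ?\<eta> n x *\<^sub>R ?q x + dir_deriv e (?\<eta> n) x *\<^sub>R (?S x *\<^sub>R ps x *\<^sub>R F x)" for n x
  by (simp add: indicator_def)
 have zero: "(LINT x|lebesgue. ?r n x) = 0" for n
 proof -
  let ?\<phi> = "\<lambda>x. ?\<eta> n x * ps x"
  have \<phi>: "test_fun (Sol h) ?\<phi>" by (rule test_wcut[OF psh])
  have d: "dir_deriv e ?\<phi> x = ?\<eta> n x * dir_deriv e ps x + dir_deriv e (?\<eta> n) x * ps x" for x
   using dir_deriv_bilinear[OF bounded_bilinear_mult smooth_differentiable[OF smooth_wcut] smooth_differentiable[OF test_funD(1)[OF ps]]] .
  have "(SINT x. dir_deriv e ?\<phi> x *\<^sub>R F x) = - (SINT x. ?\<phi> x *\<^sub>R ?g x)"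
   using weak_grad_dir_Sol[OF L2_u L2_Gd weak_grad_u \<phi>, where e = e] u_eq_F[OF test_fun_dir_deriv[OF \<phi>], of e] by simp
  then have "(SINT x. dir_deriv e ?\<phi> x *\<^sub>R F x + ?\<phi> x *\<^sub>R ?g x) = 0"
   using set_integral_add(2)[OF i1[OF test_fun_dir_deriv[OF \<phi>], of e] i2[OF \<phi>]] by simp
  then show ?thesis unfolding set_lebesgue_integral_def d by (simp add: algebra_simps)
 qed
 have "(\<lambda>n. LINT x|lebesgue. ?r n x) \<longlonglongrightarrow> (LINT x|lebesgue. ?q x)"
 proof (rule integral_dominated_convergence)
  \<comment> \<open>The cutoff gradient is at most L (n+1) |e| and lives where lev <= 6/(n+1), while
    |F| <= C lev; the product is bounded by 6 L |e| C independently of n.\<close>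
  let ?w = "\<lambda>x. norm (?q x) + (6 * L * norm e * C) * norm (?S x * ps x)"
  show "integrable lebesgue ?w"
  proof -
   have "Sintegrable (\<lambda>x. ps x *\<^sub>R (1::real))" using emeasure_Sol[of h] open_Sol[of h]
    by (intro integrable_test_mult[OF _ ps]) (simp add: set_integrable_def)
   then have "integrable lebesgue (\<lambda>x. ?S x * ps x)" by (simp add: set_integrable_def)
   then show ?thesis by (intro Bochner_Integration.integrable_add integrable_norm integrable_mult_right iq)
  qed
  show "?q \<in> borel_measurable lebesgue" by (rule borel_measurable_integrable[OF iq])
  show "?r n \<in> borel_measurable lebesgue" for n unfolding req
   by (intro borel_measurable_add borel_measurable_scaleR[OF mw(1) borel_measurable_integrable[OF iq]]
     borel_measurable_scaleR[OF mw(2) borel_measurable_integrable[OF ip]])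
  show "AE x in lebesgue. norm (?r n x) <= ?w x" for n
  proof (intro AE_I2)
   fix x
   have "norm (dir_deriv e (?\<eta> n) x *\<^sub>R (?S x *\<^sub>R ps x *\<^sub>R F x)) <= (6 * L * norm e * C) * norm (?S x * ps x)"
   proof (cases "x \<in> Sol h \<and> ps x ~= 0 \<and> dir_deriv e (?\<eta> n) x ~= 0")
    case True
    then have "x \<in> Cyl h1" using test_funD(5)[OF ps] by blast
    then have xS: "x \<in> Sol h1" using True by (simp add: in_Sol in_Cyl)
    have l6: "lev (proj2 x) <= 6 / real (Suc n)" using True wcut_deriv_0 not_le by blast
    have "\<bar>dir_deriv e (?\<eta> n) x\<bar> * norm (F x) <= (L * real (Suc n) * norm e) * (C * (6 / real (Suc n)))"
     using C(1) L(1) by (intro mult_mono L(2) order_trans[OF C(2)[OF xS]] mult_left_mono l6) auto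
    also have "\<dots> = 6 * L * norm e * C" by (simp del: of_nat_Suc)
    finally have "\<bar>dir_deriv e (?\<eta> n) x\<bar> * norm (F x) * \<bar>ps x\<bar> <= 6 * L * norm e * C * \<bar>ps x\<bar>"
     by (rule mult_right_mono) simp
    then show ?thesis using True by (simp add: mult_ac abs_mult)
   next
    case False then show ?thesis using L(1) C(1) by (auto simp: indicator_def)
   qed
   moreover have "norm (?\<eta> n x *\<^sub>R ?q x) <= norm (?q x)"
    unfolding norm_scaleR[of "?\<eta> n x"] using wcut_range[of th be n x] by (intro mult_left_le_one_le) auto
   ultimately show "norm (?r n x) <= ?w x" unfolding req by (intro order_trans[OF norm_triangle_ineq] add_mono)
  qed
  show "AE x in lebesgue. (\<lambda>n. ?r n x) \<longlonglongrightarrow> ?q x"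
  proof (intro AE_I2)
   fix x
   show "(\<lambda>n. ?r n x) \<longlonglongrightarrow> ?q x"
   proof (cases "x \<in> Sol h")
    case True
    then have "\<forall>\<^sub>F n in sequentially. ?q x = ?r n x"
     using eventually_mono[OF wcut_tendsto[of x e], of "\<lambda>n. ?q x = ?r n x"] by (simp add: in_Sol)
    then show ?thesis by (rule Lim_transform_eventually[OF tendsto_const])
   qed simp
  qed
 qed
 then have "0 = (LINT x|lebesgue. ?q x)" by (simp only: zero LIMSEQ_const_iff)
 then show ?thesis using set_integral_add(2)[OF i1[OF test_fun_dir_deriv[OF ps], of e] i2[OF ps]]
  by (simp add: set_lebesgue_integral_def eq_neg_iff_add_eq_0)
qed

end

section \<open>The weak equation near the edge\<close>

lemma bounded_linear_nth: "bounded_linear (\<lambda>z :: complex^'n. z $ i)" by (rule bounded_linear_vec_nth)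

text \<open>Removes a neighbourhood of the edge. The traction condition is tested only with
  functions whose support meets the boundary inside \<open>\<Gamma>\<close>, and
  \<open>\<Gamma>\<close> need not contain edge points.\<close>

definition ecut :: "nat => real^3 => real"
 where "ecut n x = 1 - bump 0 1 (real (Suc n) *\<^sub>R proj2 x)"

lemma smooth_ecut: "smooth (ecut n)" unfolding ecut_def[abs_def]
 by (intro smooth_diff smooth_const smooth_compose[OF smooth_linear[OF bounded_linear_scaled_proj2] bump(1)]) simp

lemma ecut_range: "0 <= ecut n x" "ecut n x <= 1" using bump(2,3)[of 1 0 "real (Suc n) *\<^sub>R proj2 x"] by (auto simp: ecut_def)

lemma bump_center: "norm x <= 1 / 2 ==> bump 0 1 x = 1"
proof -
 assume "norm x <= 1 / 2"
 then have "(norm x)\<^sup>2 <= (1 / 2)\<^sup>2" by (intro power_mono) auto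
 then have "2 * (x \<bullet> x) - 1 <= 0" unfolding power2_norm_eq_inner by (simp add: power2_eq_square)
 then show ?thesis by (simp add: bump_def sstep_0)
qed

lemma ecut_nz: "ecut n x ~= 0 ==> norm (proj2 x) >= 1 / (2 * real (Suc n))"
proof (rule ccontr)
 assume a: "ecut n x ~= 0" "\<not> norm (proj2 x) >= 1 / (2 * real (Suc n))"
 then have "norm (real (Suc n) *\<^sub>R proj2 x) <= 1 / 2" by (simp add: field_simps del: of_nat_Suc)
 then show False using bump_center[of "real (Suc n) *\<^sub>R proj2 x"] a by (simp add: ecut_def del: of_nat_Suc)
qed

lemma ecut_outside:
 assumes "norm (proj2 x) > 1 / real (Suc n)"
 shows "ecut n x = 1" "dir_deriv b (ecut n) x = 0" "dir_deriv a (dir_deriv b (ecut n)) x = 0"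
proof -
 let ?U = "{x. norm (proj2 x) > 1 / real (Suc n)}"
 have oU: "open ?U" by (intro open_Collect_less continuous_intros)
 have 1: "ecut n x = 1" if "x \<in> ?U" for x using that bump(5)[of 1 0 "real (Suc n) *\<^sub>R proj2 x"]
  by (auto simp: ecut_def field_simps simp del: of_nat_Suc)
 have 2: "dir_deriv b (ecut n) x = 0" if x: "x \<in> ?U" for x b
 proof -
  have "dir_deriv b (ecut n) x = dir_deriv b (\<lambda>_. 1) x" by (rule dir_deriv_cong_open[OF oU x 1])
  then show ?thesis using dir_deriv_eqI[OF has_derivative_const] by simp
 qed
 have "dir_deriv a (dir_deriv b (ecut n)) x = dir_deriv a (\<lambda>_. 0) x" using assms by (intro dir_deriv_cong_open[OF oU _ 2]) auto
 then show "dir_deriv a (dir_deriv b (ecut n)) x = 0" using dir_deriv_eqI[OF has_derivative_const] by simp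
 show "ecut n x = 1" "dir_deriv b (ecut n) x = 0" using 1 2 assms by auto
qed

lemma ecut_deriv_bounded:
 obtains L where "L >= 0" "!!n x. \<bar>dir_deriv b (ecut n) x\<bar> <= L * real (Suc n)"
  "!!n x. \<bar>dir_deriv a (dir_deriv b (ecut n)) x\<bar> <= L * (real (Suc n))\<^sup>2"
proof -
 let ?k = "bump (0 :: real^2) 1"
 have t: "test_fun UNIV ?k" by (rule test_fun_bump) auto
 have sk: "smooth ?k" by (rule bump(1)) simp
 obtain L1 where L1: "L1 > 0" "!!y. \<bar>dir_deriv (proj2 b) ?k y\<bar> <= L1" using test_fun_bounded[OF test_fun_dir_deriv[OF t]] by blast
 obtain L2 where L2: "L2 > 0" "!!y. \<bar>dir_deriv (proj2 a) (dir_deriv (proj2 b) ?k) y\<bar> <= L2"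
  using test_fun_bounded[OF test_fun_dir_deriv[OF test_fun_dir_deriv[OF t]]] by blast
 have ch: "dir_deriv c (\<lambda>x. g (real (Suc n) *\<^sub>R proj2 x)) x = real (Suc n) * dir_deriv (proj2 c) g (real (Suc n) *\<^sub>R proj2 x)"
  if g: "smooth g" for g :: "real^2 => real" and c n x
 proof -
  have "((\<lambda>x. g (real (Suc n) *\<^sub>R proj2 x)) has_derivative
   (\<lambda>c. dir_deriv (real (Suc n) *\<^sub>R proj2 c) g (real (Suc n) *\<^sub>R proj2 x))) (at x)"
   using diff_chain_at[OF bounded_linear_imp_has_derivative[OF bounded_linear_scaled_proj2] smooth_has_derivative[OF g]] by (simp add: o_def)
  then have "dir_deriv c (\<lambda>x. g (real (Suc n) *\<^sub>R proj2 x)) x = dir_deriv (real (Suc n) *\<^sub>R proj2 c) g (real (Suc n) *\<^sub>R proj2 x)"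
   by (rule dir_deriv_eqI)
  also have "\<dots> = real (Suc n) * dir_deriv (proj2 c) g (real (Suc n) *\<^sub>R proj2 x)"
   using dir_deriv_linear_combo[OF g, of "real (Suc n)" "proj2 c" 0 0] by simp
  finally show ?thesis .
 qed
 have d1: "dir_deriv b (ecut n) = (\<lambda>x. - real (Suc n) * dir_deriv (proj2 b) ?k (real (Suc n) *\<^sub>R proj2 x))" for n
 proof
  fix x
  have sc: "smooth (\<lambda>x. ?k (real (Suc n) *\<^sub>R proj2 x))" by (rule smooth_compose[OF smooth_linear[OF bounded_linear_scaled_proj2] sk])
  have "dir_deriv b (ecut n) x = - dir_deriv b (\<lambda>x. ?k (real (Suc n) *\<^sub>R proj2 x)) x" unfolding ecut_def[abs_def]
   by (rule dir_deriv_eqI[OF has_derivative_diff[OF has_derivative_const smooth_has_derivative[OF sc]], THEN trans]) simp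
  then show "dir_deriv b (ecut n) x = - real (Suc n) * dir_deriv (proj2 b) ?k (real (Suc n) *\<^sub>R proj2 x)"
   using ch[OF sk] by (simp add: algebra_simps)
 qed
 have d2: "dir_deriv a (dir_deriv b (ecut n)) x = - (real (Suc n))\<^sup>2 * dir_deriv (proj2 a) (dir_deriv (proj2 b) ?k) (real (Suc n) *\<^sub>R proj2 x)" for n x
 proof -
  let ?g = "dir_deriv (proj2 b) ?k"
  have sg: "smooth ?g" by (rule smooth_dir_deriv[OF sk])
  have sc: "smooth (\<lambda>x. ?g (real (Suc n) *\<^sub>R proj2 x))" by (rule smooth_compose[OF smooth_linear[OF bounded_linear_scaled_proj2] sg])
  have "dir_deriv a (dir_deriv b (ecut n)) x = - real (Suc n) * dir_deriv a (\<lambda>x. ?g (real (Suc n) *\<^sub>R proj2 x)) x" unfolding d1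
   by (rule dir_deriv_eqI[OF has_derivative_mult_right[OF smooth_has_derivative[OF sc]], THEN trans]) simp
  then show ?thesis using ch[OF sg] by (simp add: power2_eq_square algebra_simps)
 qed
 show ?thesis
 proof (rule that[of "max L1 L2"])
  show "\<bar>dir_deriv b (ecut n) x\<bar> <= max L1 L2 * real (Suc n)" for n x
  proof -
   have "\<bar>dir_deriv b (ecut n) x\<bar> = \<bar>dir_deriv (proj2 b) ?k (real (Suc n) *\<^sub>R proj2 x)\<bar> * real (Suc n)"
    unfolding d1 by (simp add: abs_mult)
   also have "\<dots> <= max L1 L2 * real (Suc n)" using L1(2) by (intro mult_right_mono) (auto intro: max.coboundedI1)
   finally show ?thesis .
  qed
  show "\<bar>dir_deriv a (dir_deriv b (ecut n)) x\<bar> <= max L1 L2 * (real (Suc n))\<^sup>2" for n x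
  proof -
   have "\<bar>dir_deriv a (dir_deriv b (ecut n)) x\<bar> = \<bar>dir_deriv (proj2 a) (dir_deriv (proj2 b) ?k) (real (Suc n) *\<^sub>R proj2 x)\<bar> * (real (Suc n))\<^sup>2"
    unfolding d2 by (simp add: abs_mult)
   also have "\<dots> <= max L1 L2 * (real (Suc n))\<^sup>2" using L2(2) by (intro mult_right_mono) (auto intro: max.coboundedI2)
   finally show ?thesis .
  qed
 qed (use L1 in auto)
qed

lemma dir_deriv_mult:
 fixes f g :: "'a::real_normed_vector => 'b::real_normed_algebra"
 assumes "smooth f" "smooth g"
 shows "dir_deriv b (\<lambda>x. f x * g x) = (\<lambda>x. f x * dir_deriv b g x + dir_deriv b f x * g x)"
  and "dir_deriv a (dir_deriv b (\<lambda>x. f x * g x)) x =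
   f x * dir_deriv a (dir_deriv b g) x + dir_deriv a f x * dir_deriv b g x +
   dir_deriv b f x * dir_deriv a g x + dir_deriv a (dir_deriv b f) x * g x"
proof -
 have 1: "dir_deriv b (\<lambda>x. f x * g x) x = f x * dir_deriv b g x + dir_deriv b f x * g x"
  if "smooth f" "smooth g" for f g :: "'a => 'b" and b x by (intro dir_deriv_bilinear bounded_bilinear_mult smooth_differentiable that)
 then show eq: "dir_deriv b (\<lambda>x. f x * g x) = (\<lambda>x. f x * dir_deriv b g x + dir_deriv b f x * g x)" using assms by auto
 show "dir_deriv a (dir_deriv b (\<lambda>x. f x * g x)) x =
   f x * dir_deriv a (dir_deriv b g) x + dir_deriv a f x * dir_deriv b g x +
   dir_deriv b f x * dir_deriv a g x + dir_deriv a (dir_deriv b f) x * g x" unfolding eq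
  by (subst dir_deriv_add) (auto intro!: smooth_differentiable smooth_mult smooth_dir_deriv assms simp: 1 assms smooth_dir_deriv)
qed

text \<open>The \<open>i\<close>-th component of the Lame operator applied to \<open>\<phi>\<close> times the \<open>i\<close>-th unit vector, paired
 with \<open>u\<close>, with the derivatives ordered as the traction functional produces them.\<close>

definition lame_row :: "real => real => (real^3 => complex) => (real^3 => complex^3) => 3 => real^3 => complex"
 where "lame_row lam \<mu> \<phi> u i x =
  (\<Sum>k\<in>UNIV. of_real \<mu> * pderiv_at k (pderiv_at k \<phi>) x * u x $ i) +
  (\<Sum>k\<in>UNIV. of_real \<mu> * pderiv_at i (pderiv_at k \<phi>) x * u x $ k) +
  (\<Sum>k\<in>UNIV. of_real lam * pderiv_at k (pderiv_at i \<phi>) x * u x $ k)"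

lemma smooth_of_real: "smooth f ==> smooth (\<lambda>x. of_real (f x) :: complex)"
 using smooth_compose[OF _ smooth_linear[OF bounded_linear_of_real]] .

lemma dir_deriv_bounded_linear:
 assumes "bounded_linear A" "smooth f" shows "dir_deriv b (\<lambda>x. A (f x)) = (\<lambda>x. A (dir_deriv b f x))"
proof
 fix x
 show "dir_deriv b (\<lambda>x. A (f x)) x = A (dir_deriv b f x)"
  by (rule dir_deriv_eqI[OF bounded_linear.has_derivative[OF assms(1) smooth_has_derivative[OF assms(2)]]])
qed

context edge
begin

lemma emeasure_Cyl_le: assumes "rh > 0" shows "emeasure lebesgue (Cyl rh) <= ennreal (8 * M * rh\<^sup>2)"
proof -
 let ?B = "cbox (vector [-rh, -rh, -M]) (vector [rh, rh, M]) :: (real^3) set"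
 have sub: "Cyl rh \<subseteq> ?B"
 proof
  fix x assume "x \<in> Cyl rh"
  then have "norm (proj2 x) < rh" "\<bar>x $ 3\<bar> < M" by (auto simp: in_Cyl)
  then show "x \<in> ?B" using component_le_norm_cart[of "proj2 x" 1] component_le_norm_cart[of "proj2 x" 2] by (auto simp: mem_box_cart forall_3)
 qed
 have "emeasure lebesgue (Cyl rh) = emeasure lborel (Cyl rh)" using open_Cyl[of rh] by simp
 also have "\<dots> <= emeasure lborel ?B" using sub by (intro emeasure_mono) auto
 also have "\<dots> = ennreal (\<Prod>b\<in>Basis. (vector [rh, rh, M] - vector [-rh, -rh, -M] :: real^3) \<bullet> b)"
 proof (rule emeasure_lborel_cbox)
  fix b :: "real^3" assume "b \<in> Basis"
  then obtain i where "b = axis i 1" by (auto simp: Basis_vec_def)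
  then show "vector [-rh, -rh, -M] \<bullet> b <= vector [rh, rh, M] \<bullet> b" using assms M exhaust_3[of i] by (auto simp: inner_axis)
 qed
 also have "(\<Prod>b\<in>Basis. (vector [rh, rh, M] - vector [-rh, -rh, -M] :: real^3) \<bullet> b) = 8 * M * rh\<^sup>2"
  unfolding prod_Basis_vec UNIV_3 by (simp add: inner_axis power2_eq_square)
 finally show ?thesis .
qed

text \<open>The edge has codimension two: a cylinder of radius rh around it has volume O(rh^2), so
  every exponent above -2 is integrable.\<close>

lemma radial_integrable:
 assumes a: "a > 0"
 shows "integrable lebesgue (\<lambda>x. indicator (Cyl h) x * (norm (proj2 x) powr a / (norm (proj2 x))\<^sup>2))"
proof -
 let ?r = "\<lambda>x. norm (proj2 x)"
 let ?I = "indicat_real {x :: real^3. \<bar>x $ 3\<bar> < M}"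
 have mI: "{x :: real^3. \<bar>x $ 3\<bar> < M} \<in> sets borel" by (intro borel_open open_Collect_less continuous_intros)
 have mr: "?r \<in> borel_measurable borel" by (intro borel_measurable_continuous_onI continuous_intros)
 have mg: "(\<lambda>x. ?I x * ?r x powr a) \<in> borel_measurable borel" using mI mr by measurable
 have "integrable lebesgue (\<lambda>x. indicator {x. ?r x < h} x * (?I x * ?r x powr a / (?r x)\<^sup>2))"
 proof (rule dyadic_integrable[where de = a and C = "8 * M"])
  show "(\<lambda>x. ?I x * ?r x powr a) \<in> borel_measurable lebesgue" "?r \<in> borel_measurable lebesgue"
   using mg mr by (simp_all add: measurable_completion)
  fix rh :: real assume rh: "0 < rh" "rh <= h"
  have "(\<integral>\<^sup>+x. ennreal (?I x * ?r x powr a) * indicator {x. ?r x < rh} x \<partial>lebesgue) <=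
    (\<integral>\<^sup>+x. ennreal (rh powr a) * indicator (Cyl rh) x \<partial>lebesgue)"
   using a by (intro nn_integral_mono) (auto simp: indicator_def in_Cyl intro!: ennreal_leI powr_mono2)
  also have "\<dots> = ennreal (rh powr a) * emeasure lebesgue (Cyl rh)" using open_Cyl[of rh] by (intro nn_integral_cmult_indicator) auto
  also have "\<dots> <= ennreal (rh powr a) * ennreal (8 * M * rh\<^sup>2)" by (intro mult_left_mono emeasure_Cyl_le rh) auto
  also have "\<dots> = ennreal (8 * M * rh powr (2 + a))" using rh M by (simp add: ennreal_mult[symmetric] powr_add powr_numeral mult_ac)
  finally show "(\<integral>\<^sup>+x. ennreal (?I x * ?r x powr a) * indicator {x. ?r x < rh} x \<partial>lebesgue) <=
   ennreal (8 * M * rh powr (2 + a))" .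
 qed (use a h M in auto)
 moreover have "indicator {x. ?r x < h} x * (?I x * ?r x powr a / (?r x)\<^sup>2) = indicator (Cyl h) x * (?r x powr a / (?r x)\<^sup>2)" for x
  by (auto simp: indicator_def in_Cyl)
 ultimately show ?thesis by (simp only:)
qed

end

section \<open>The tested Lame equation up to the faces and across the edge\<close>

locale lame_pair = edge_pair +
 fixes lam \<mu> \<omega> :: real and V :: "real^3 => real"
 assumes V: "Linfty_on Om V"
  and eq_v: "has_lame lam \<mu> Om v (\<lambda>x. - (\<omega>^2 *\<^sub>R v x))"
  and eq_w: "has_lame lam \<mu> Om w (\<lambda>x. - ((\<omega>^2 * (1 + V x)) *\<^sub>R w x))"
  and traction: "traction_eq_on lam \<mu> Om \<Gamma> v w"
begin

definition "f x = (1 + V x) *\<^sub>R w x - v x"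

lemma L2_qw: "L2_on lebesgue Om (\<lambda>x. (1 + V x) *\<^sub>R w x)"
 using L2_on_add[OF H1_D(1)[OF H1(2)] L2_on_mult_Linfty[OF V H1_D(1)[OF H1(2)]]] by (simp add: algebra_simps)

lemma L2_f: "L2_on lebesgue Om f" unfolding f_def[abs_def] by (intro L2_on_diff L2_qw H1_D(1)[OF H1(1)])

text \<open>\<open>lame\<close> picks one square-integrable representative. Any other one agrees
  with it after testing in the interior, and by the cutoffs up to the faces, which lets the
  right-hand side of the equation take its place in the traction functional.\<close>

lemma lame_weak:
 assumes L2: "L2_on lebesgue Om g" and g: "has_lame lam \<mu> Om u g" and \<phi>: "test_fun (Cyl h) \<phi>"
 shows "L2_on lebesgue Om (lame lam \<mu> Om u)"
  and "(SINT x. \<phi> x *\<^sub>R lame lam \<mu> Om u x) = (SINT x. \<phi> x *\<^sub>R g x)"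
proof -
 have l: "L2_on lebesgue Om (lame lam \<mu> Om u) \<and> has_lame lam \<mu> Om u (lame lam \<mu> Om u)"
  unfolding lame_def by (rule someI[of _ g]) (use L2 g in blast)
 then show L: "L2_on lebesgue Om (lame lam \<mu> Om u)" by blast
 note i = set_integrable_Sol[OF L2_integrable[OF L]] set_integrable_Sol[OF L2_integrable[OF L2]]
 have d: "(SINT x. ps x *\<^sub>R (lame lam \<mu> Om u x - g x)) =
   (SINT x. ps x *\<^sub>R lame lam \<mu> Om u x) - (SINT x. ps x *\<^sub>R g x)"
  if "test_fun U ps" for ps U
  unfolding scaleR_diff_right by (intro set_integral_diff(2) integrable_test_mult[OF i(1) that] integrable_test_mult[OF i(2) that])
 have "(SINT x. \<phi> x *\<^sub>R (lame lam \<mu> Om u x - g x)) = 0"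
 proof (rule test_extends_to_faces[OF _ _ \<phi>])
  show "Sintegrable (\<lambda>x. lame lam \<mu> Om u x - g x)" by (intro set_integral_diff(1) i)
  fix ps assume ps: "test_fun (Sol h) ps"
  have z: "ps x = 0" if "x \<notin> Cyl h" for x using test_funD(5)[OF ps, of x] Sol_subset_Cyl[of h] that by blast
  have "(LINT x:Om|lebesgue. ps x *\<^sub>R lame lam \<mu> Om u x) = (LINT x:Om|lebesgue. ps x *\<^sub>R g x)"
   by (rule trans[OF l[THEN conjunct2, unfolded has_lame_def, rule_format, OF test_fun_Om[OF ps], symmetric]
      g[unfolded has_lame_def, rule_format, OF test_fun_Om[OF ps]]])
  then show "(SINT x. ps x *\<^sub>R (lame lam \<mu> Om u x - g x)) = 0"
   unfolding d[OF ps] by (subst (asm) (1 2) restrict_Sol) (simp_all add: z)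
 qed
 then show "(SINT x. \<phi> x *\<^sub>R lame lam \<mu> Om u x) = (SINT x. \<phi> x *\<^sub>R g x)" unfolding d[OF \<phi>] by simp
qed

definition "IF ps m = (SINT x. ps x *\<^sub>R (F x $ m))"
definition "IG ps m l = (SINT x. ps x *\<^sub>R (Gd x $ m $ l))"

lemma F_nth_integrable: "Sintegrable (\<lambda>x. F x $ m)" by (rule set_integrable_bounded_linear[OF bounded_linear_nth F_set_integrable])

lemma Gd_nth_integrable: "Sintegrable (\<lambda>x. Gd x $ m $ l)"
 using set_integrable_bounded_linear[OF bounded_linear_nth set_integrable_bounded_linear[OF bounded_linear_column[of l] set_integrable_Sol[OF L2_integrable[OF L2_Gd]]], of m]
 by (simp add: column_def)

lemma f_nth_integrable: "Sintegrable (\<lambda>x. f x $ m)"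
 by (rule set_integrable_bounded_linear[OF bounded_linear_nth set_integrable_Sol[OF L2_integrable[OF L2_f]]])

lemma IF_IG:
 assumes "test_fun (Cyl h1) ps" shows "IG ps m l = - IF (pderiv_at l ps) m"
proof -
 have c: "Gd x *v complexify (axis l 1) = column l (Gd x)" for x
  by (simp add: matrix_mult_complexify axis_def if_distrib[of "\<lambda>r. r *\<^sub>R _"] cong: if_cong)
 have "(SINT x. ps x *\<^sub>R (Gd x *v complexify (axis l 1))) $ m = IG ps m l"
  unfolding IG_def using set_integral_bounded_linear[OF bounded_linear_nth[of m] integrable_test_mult[OF Gd_set_integrable[of "axis l 1"] assms]]
  by (simp add: c) (simp add: column_def)
 moreover have "(SINT x. pderiv_at l ps x *\<^sub>R F x) $ m = IF (pderiv_at l ps) m"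
  unfolding IF_def using set_integral_bounded_linear[OF bounded_linear_nth[of m] integrable_test_mult[OF F_set_integrable test_fun_dir_deriv[OF assms, of "axis l 1"]]]
  by simp
 ultimately have "IF (pderiv_at l ps) m = - IG ps m l"
  using arg_cong[OF weak_integration_by_parts[OF assms, of "axis l 1"], of "\<lambda>z. z $ m"] by (simp only: vector_uminus_component)
 then show ?thesis by simp
qed

definition "row_int \<phi> i = (\<Sum>k\<in>UNIV. \<mu> *\<^sub>R IF (pderiv_at k (pderiv_at k \<phi>)) i) +
 (\<Sum>k\<in>UNIV. \<mu> *\<^sub>R IF (pderiv_at i (pderiv_at k \<phi>)) k) + (\<Sum>k\<in>UNIV. lam *\<^sub>R IF (pderiv_at k (pderiv_at i \<phi>)) k)"

text \<open>The traction is defined by Green's formula, so equal tractions are the weak equation for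
  v - w with one derivative already on the test function, valid up to the faces. A second
  integration by parts moves the other derivative over.\<close>

lemma lame_off_edge:
 assumes \<phi>: "test_fun (Cyl h1 \<inter> {x. proj2 x ~= 0}) \<phi>"
 shows "row_int \<phi> i = \<omega>\<^sup>2 *\<^sub>R (SINT x. \<phi> x *\<^sub>R (f x $ i))"
proof -
 have \<phi>1: "test_fun (Cyl h1) \<phi>" by (rule test_fun_mono[OF \<phi>]) auto
 have \<phi>h: "test_fun (Cyl h) \<phi>" by (rule test_fun_mono[OF \<phi>1 Cyl_mono[OF h1(2)]])
 have \<phi>U: "test_fun UNIV \<phi>" by (rule test_fun_mono[OF \<phi>]) auto
 note d\<phi> = test_fun_dir_deriv[OF \<phi>1]
 \<comment> \<open>Inside the cylinder the frontier of the domain lies in the zero set of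
   \<open>lev\<close>; off the edge that set consists of the faces, which belong to
   \<open>\<Gamma>\<close>.\<close>
 have "closure {x. \<phi> x ~= 0} \<inter> frontier Om \<subseteq> \<Gamma>"
 proof
  fix x assume x: "x \<in> closure {x. \<phi> x ~= 0} \<inter> frontier Om"
  then have xC: "x \<in> Cyl h" "proj2 x ~= 0" using test_funD(3)[OF \<phi>] Cyl_mono[OF h1(2)] by auto
  have "x \<notin> Om" "x \<in> closure Om" using x Om(1) by (auto simp: frontier_def interior_open)
  have "x \<notin> Sol h" using \<open>x \<notin> Om\<close> Cyl_Int by auto
  then have "lev (proj2 x) <= 0" using xC by (auto simp: in_Sol in_Cyl)
  moreover have "lev (proj2 x) >= 0"
  proof (rule ccontr)
   assume n: "\<not> lev (proj2 x) >= 0"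
   let ?U = "Cyl h \<inter> {x. lev (proj2 x) < 0}"
   have "open ?U" by (intro open_Int open_Cyl open_Collect_less continuous_intros)
   moreover have "?U \<inter> Om = {}"
   proof (rule equals0I)
    fix y assume y: "y \<in> ?U \<inter> Om"
    then have "y \<in> Sol h" using Cyl_Int by blast
    then show False using y by (simp add: in_Sol)
   qed
   ultimately have "?U \<inter> closure Om = {}" by (simp add: open_Int_closure_eq_empty)
   then show False using n xC \<open>x \<in> closure Om\<close> by auto
  qed
  ultimately show "x \<in> \<Gamma>" using \<Gamma>_faces[of x] xC by auto
 qed
 then have BT: "boundary_traction lam \<mu> Om v \<phi> = boundary_traction lam \<mu> Om w \<phi>"
  using traction \<phi>U unfolding traction_eq_on_def by blast
 let ?T = "\<lambda>k. traction lam \<mu> (axis k 1)"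
 let ?gv = "\<lambda>x. - (\<omega>^2 *\<^sub>R v x)" and ?gw = "\<lambda>x. - ((\<omega>^2 * (1 + V x)) *\<^sub>R w x)"
 have L2v: "L2_on lebesgue Om ?gv" by (intro L2_on_uminus L2_on_scaleR H1_D(1)[OF H1(1)])
 have L2w: "L2_on lebesgue Om ?gw" using L2_on_uminus[OF L2_on_scaleR[OF L2_qw, of "\<omega>\<^sup>2"]] by simp
 note lv = lame_weak[OF L2v eq_v \<phi>h] and lw = lame_weak[OF L2w eq_w \<phi>h]
 have z: "\<phi> x = 0" "pderiv_at k \<phi> x = 0" if "x \<notin> Cyl h" for x k
  using test_funD(5)[OF \<phi>h that] test_funD(5)[OF test_fun_dir_deriv[OF \<phi>h] that] by auto
 have iT: "Sintegrable (\<lambda>x. pderiv_at k \<phi> x *\<^sub>R ?T k (H x))" if "L2_on lebesgue Om H" for k H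
  by (rule integrable_test_mult[OF set_integrable_bounded_linear[OF bounded_linear_traction set_integrable_Sol[OF L2_integrable[OF that]]] d\<phi>])
 have iL: "Sintegrable (\<lambda>x. \<phi> x *\<^sub>R g x)" if "L2_on lebesgue Om g" for g :: "real^3 => complex^3"
  by (rule integrable_test_mult[OF set_integrable_Sol[OF L2_integrable[OF that]] \<phi>])
 have bt: "boundary_traction lam \<mu> Om u \<phi> =
   (SINT x. \<Sum>k\<in>UNIV. pderiv_at k \<phi> x *\<^sub>R ?T k (weak_grad Om u x)) + (SINT x. \<phi> x *\<^sub>R g x)"
  if u: "H1_on Om u" and L: "L2_on lebesgue Om (lame lam \<mu> Om u)"
   "(SINT x. \<phi> x *\<^sub>R lame lam \<mu> Om u x) = (SINT x. \<phi> x *\<^sub>R g x)" for u g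
 proof -
  have "boundary_traction lam \<mu> Om u \<phi> = (LINT x:Sol h|lebesgue.
    (\<Sum>k\<in>UNIV. pderiv_at k \<phi> x *\<^sub>R ?T k (weak_grad Om u x)) + \<phi> x *\<^sub>R lame lam \<mu> Om u x)"
   unfolding boundary_traction_def by (rule restrict_Sol) (simp add: z)
  also have "\<dots> = (SINT x. \<Sum>k\<in>UNIV. pderiv_at k \<phi> x *\<^sub>R ?T k (weak_grad Om u x)) +
    (SINT x. \<phi> x *\<^sub>R lame lam \<mu> Om u x)" by (intro set_integral_add(2) set_integral_sum(2) iT H1_D u iL L)
  finally show ?thesis using L(2) by simp
 qed
 have ts: "(SINT x. \<Sum>k\<in>UNIV. pderiv_at k \<phi> x *\<^sub>R ?T k (Gd x)) =
   (SINT x. \<Sum>k\<in>UNIV. pderiv_at k \<phi> x *\<^sub>R ?T k (weak_grad Om v x)) -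
   (SINT x. \<Sum>k\<in>UNIV. pderiv_at k \<phi> x *\<^sub>R ?T k (weak_grad Om w x))"
 proof -
  have "?T k (Gd x) = ?T k (weak_grad Om v x) - ?T k (weak_grad Om w x)" for k x
   unfolding Gd_def by (rule linear_diff[OF bounded_linear.linear[OF bounded_linear_traction]])
  then have "(\<Sum>k\<in>UNIV. pderiv_at k \<phi> x *\<^sub>R ?T k (Gd x)) =
   (\<Sum>k\<in>UNIV. pderiv_at k \<phi> x *\<^sub>R ?T k (weak_grad Om v x)) - (\<Sum>k\<in>UNIV. pderiv_at k \<phi> x *\<^sub>R ?T k (weak_grad Om w x))" for x
   by (simp add: scaleR_diff_right sum_subtractf)
  then show ?thesis by (simp only:) (intro set_integral_diff(2) set_integral_sum(2) iT H1_D H1)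
 qed
 have fs: "(SINT x. \<phi> x *\<^sub>R ?gv x) - (SINT x. \<phi> x *\<^sub>R ?gw x) = \<omega>\<^sup>2 *\<^sub>R (SINT x. \<phi> x *\<^sub>R f x)"
 proof -
  have "(SINT x. \<phi> x *\<^sub>R ?gv x) - (SINT x. \<phi> x *\<^sub>R ?gw x) =
    (SINT x. \<phi> x *\<^sub>R ?gv x - \<phi> x *\<^sub>R ?gw x)" by (intro set_integral_diff(2)[symmetric] iL L2v L2w)
  also have "(\<lambda>x. \<phi> x *\<^sub>R ?gv x - \<phi> x *\<^sub>R ?gw x) = (\<lambda>x. \<omega>\<^sup>2 *\<^sub>R (\<phi> x *\<^sub>R f x))"
   by (auto simp: fun_eq_iff f_def algebra_simps)
  finally show ?thesis by (simp only: set_integral_scaleR_right)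
 qed
 have sum0: "(SINT x. \<Sum>k\<in>UNIV. pderiv_at k \<phi> x *\<^sub>R ?T k (Gd x)) + \<omega>\<^sup>2 *\<^sub>R (SINT x. \<phi> x *\<^sub>R f x) = 0"
  unfolding ts fs[symmetric] using BT bt[OF H1(1) lv] bt[OF H1(2) lw] by (simp add: algebra_simps)
 have "(SINT x. \<Sum>k\<in>UNIV. pderiv_at k \<phi> x *\<^sub>R ?T k (Gd x)) $ i + \<omega>\<^sup>2 *\<^sub>R ((SINT x. \<phi> x *\<^sub>R f x) $ i) = 0"
  using arg_cong[OF sum0, of "\<lambda>z. z $ i"] by (simp only: vector_add_component vector_scaleR_component zero_index)
 moreover have "(SINT x. \<phi> x *\<^sub>R f x) $ i = (SINT x. \<phi> x *\<^sub>R (f x $ i))"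
  using set_integral_bounded_linear[OF bounded_linear_nth iL[OF L2_f], of i] by simp
 \<comment> \<open>In components, every entry of the gradient is tested with a derivative of the
   test function, and \<open>IF_IG\<close> integrates by parts once more. No face terms appear
   because \<open>F\<close> vanishes there.\<close>
 moreover have "(SINT x. \<Sum>k\<in>UNIV. pderiv_at k \<phi> x *\<^sub>R ?T k (Gd x)) $ i = - row_int \<phi> i"
 proof -
  have iG: "Sintegrable (\<lambda>x. c *\<^sub>R (pderiv_at k \<phi> x *\<^sub>R (Gd x $ m $ l)))" for c k m l
   by (intro set_integrable_scaleR_right integrable_test_mult[OF Gd_nth_integrable d\<phi>])
  have "(SINT x. \<Sum>k\<in>UNIV. pderiv_at k \<phi> x *\<^sub>R ?T k (Gd x)) $ i =
    (SINT x. \<Sum>k\<in>UNIV. (pderiv_at k \<phi> x *\<^sub>R ?T k (Gd x)) $ i)"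
  proof -
   have "Sintegrable (\<lambda>x. \<Sum>k\<in>UNIV. pderiv_at k \<phi> x *\<^sub>R ?T k (Gd x))" by (intro set_integral_sum(2) iT L2_Gd)
   from set_integral_bounded_linear[OF bounded_linear_nth[of i] this] show ?thesis by (simp only: sum_component)
  qed
  also have "\<dots> = (SINT x. \<Sum>k\<in>UNIV.
    \<mu> *\<^sub>R (pderiv_at k \<phi> x *\<^sub>R (Gd x $ i $ k)) + \<mu> *\<^sub>R (pderiv_at k \<phi> x *\<^sub>R (Gd x $ k $ i)) +
    (if i = k then \<Sum>j\<in>UNIV. lam *\<^sub>R (pderiv_at k \<phi> x *\<^sub>R (Gd x $ j $ j)) else 0))"
  proof -
   have pw: "(pderiv_at k \<phi> x *\<^sub>R ?T k (Gd x)) $ i =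
    \<mu> *\<^sub>R (pderiv_at k \<phi> x *\<^sub>R (Gd x $ i $ k)) + \<mu> *\<^sub>R (pderiv_at k \<phi> x *\<^sub>R (Gd x $ k $ i)) +
    (if i = k then \<Sum>j\<in>UNIV. lam *\<^sub>R (pderiv_at k \<phi> x *\<^sub>R (Gd x $ j $ j)) else 0)" for k x
    by (cases "i = k") (simp_all add: traction_axis_nth scaleR_add_right scaleR_sum_right mult.commute)
   show ?thesis unfolding pw ..
  qed
  also have "\<dots> = (\<Sum>k\<in>UNIV. \<mu> *\<^sub>R IG (pderiv_at k \<phi>) i k + \<mu> *\<^sub>R IG (pderiv_at k \<phi>) k i +
    (if i = k then \<Sum>j\<in>UNIV. lam *\<^sub>R IG (pderiv_at k \<phi>) j j else 0))"
  proof (subst set_integral_sum)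
   have s3: "Sintegrable (\<lambda>x. if i = k then \<Sum>j\<in>UNIV. lam *\<^sub>R (pderiv_at k \<phi> x *\<^sub>R (Gd x $ j $ j)) else 0)" for k
   proof (cases "i = k")
    case True
    then show ?thesis by (simp only: if_True simp_thms) (intro set_integral_sum(2) iG)
   next
    case False
    then show ?thesis by (simp add: set_integrable_def)
   qed
   show "Sintegrable (\<lambda>x.
    \<mu> *\<^sub>R (pderiv_at k \<phi> x *\<^sub>R (Gd x $ i $ k)) + \<mu> *\<^sub>R (pderiv_at k \<phi> x *\<^sub>R (Gd x $ k $ i)) +
    (if i = k then \<Sum>j\<in>UNIV. lam *\<^sub>R (pderiv_at k \<phi> x *\<^sub>R (Gd x $ j $ j)) else 0))" for k
    by (intro set_integral_add(1) iG s3)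
   show "(\<Sum>k\<in>UNIV. LINT x:Sol h|lebesgue.
    \<mu> *\<^sub>R (pderiv_at k \<phi> x *\<^sub>R (Gd x $ i $ k)) + \<mu> *\<^sub>R (pderiv_at k \<phi> x *\<^sub>R (Gd x $ k $ i)) +
    (if i = k then \<Sum>j\<in>UNIV. lam *\<^sub>R (pderiv_at k \<phi> x *\<^sub>R (Gd x $ j $ j)) else 0)) =
    (\<Sum>k\<in>UNIV. \<mu> *\<^sub>R IG (pderiv_at k \<phi>) i k + \<mu> *\<^sub>R IG (pderiv_at k \<phi>) k i +
    (if i = k then \<Sum>j\<in>UNIV. lam *\<^sub>R IG (pderiv_at k \<phi>) j j else 0))"
   proof (rule sum.cong[OF refl])
    fix k :: 3
    have e3: "(SINT x. if i = k then \<Sum>j\<in>UNIV. lam *\<^sub>R (pderiv_at k \<phi> x *\<^sub>R (Gd x $ j $ j)) else 0) =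
     (if i = k then \<Sum>j\<in>UNIV. lam *\<^sub>R IG (pderiv_at k \<phi>) j j else 0)"
    proof (cases "i = k")
     case True
     then show ?thesis by (simp only: if_True simp_thms) (subst set_integral_sum(1), rule iG, simp only: IG_def set_integral_scaleR_right)
    next
     case False then show ?thesis by (simp add: set_lebesgue_integral_def)
    qed
    show "(LINT x:Sol h|lebesgue.
     \<mu> *\<^sub>R (pderiv_at k \<phi> x *\<^sub>R (Gd x $ i $ k)) + \<mu> *\<^sub>R (pderiv_at k \<phi> x *\<^sub>R (Gd x $ k $ i)) +
     (if i = k then \<Sum>j\<in>UNIV. lam *\<^sub>R (pderiv_at k \<phi> x *\<^sub>R (Gd x $ j $ j)) else 0)) =
     \<mu> *\<^sub>R IG (pderiv_at k \<phi>) i k + \<mu> *\<^sub>R IG (pderiv_at k \<phi>) k i +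
     (if i = k then \<Sum>j\<in>UNIV. lam *\<^sub>R IG (pderiv_at k \<phi>) j j else 0)" unfolding e3[symmetric]
     by (subst set_integral_add(2)[OF set_integral_add(1)[OF iG iG] s3], subst set_integral_add(2)[OF iG iG])
      (simp only: set_integral_scaleR_right IG_def)
   qed
  qed
  also have "\<dots> = - row_int \<phi> i"
  proof -
   have d: "(\<Sum>k\<in>UNIV. if i = k then \<Sum>j\<in>UNIV. lam *\<^sub>R - IF (pderiv_at j (pderiv_at k \<phi>)) j else 0) =
     (\<Sum>j\<in>UNIV. lam *\<^sub>R - IF (pderiv_at j (pderiv_at i \<phi>)) j)" by simp
   show ?thesis unfolding IF_IG[OF d\<phi>] row_int_def sum.distrib d by (simp add: sum_negf)
  qed
  finally show ?thesis .
 qed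
 ultimately show ?thesis by simp
qed

end

context lame_pair
begin

lemma ecut_test:
 assumes \<phi>: "test_fun (Cyl h1) \<phi>"
 shows "test_fun (Cyl h1 \<inter> {x. proj2 x ~= 0}) (\<lambda>x. ecut n x * \<phi> x)"
proof (rule test_funI[where C = "closure {x. \<phi> x ~= 0} \<inter> {x. norm (proj2 x) >= 1 / (2 * real (Suc n))}"])
 show "smooth (\<lambda>x. ecut n x * \<phi> x)" by (intro smooth_mult smooth_ecut test_funD(1)[OF \<phi>])
 show "{x. ecut n x * \<phi> x ~= 0} \<subseteq> closure {x. \<phi> x ~= 0} \<inter> {x. norm (proj2 x) >= 1 / (2 * real (Suc n))}"
  using closure_subset[of "{x. \<phi> x ~= 0}"] ecut_nz[of n] by auto
 show "compact (closure {x. \<phi> x ~= 0} \<inter> {x. norm (proj2 x) >= 1 / (2 * real (Suc n))})"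
  by (intro compact_Int_closed test_funD(2)[OF \<phi>] closed_Collect_le continuous_intros)
 show "closure {x. \<phi> x ~= 0} \<inter> {x. norm (proj2 x) >= 1 / (2 * real (Suc n))} \<subseteq> Cyl h1 \<inter> {x. proj2 x ~= 0}"
 proof
  fix x assume x: "x \<in> closure {x. \<phi> x ~= 0} \<inter> {x. norm (proj2 x) >= 1 / (2 * real (Suc n))}"
  then have "0 < norm (proj2 x)" by (auto intro: less_le_trans[of 0 "1 / (2 * real (Suc n))"])
  then show "x \<in> Cyl h1 \<inter> {x. proj2 x ~= 0}" using x test_funD(3)[OF \<phi>] by auto
 qed
qed

lemma ecut_eventually:
 assumes "proj2 x ~= 0"
 shows "\<forall>\<^sub>F n in sequentially. 1 / real (Suc n) < norm (proj2 x)"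
proof -
 have "(\<lambda>n. inverse (real (Suc n))) \<longlonglongrightarrow> 0" by (rule LIMSEQ_inverse_real_of_nat)
 then have "\<forall>\<^sub>F n in sequentially. inverse (real (Suc n)) < norm (proj2 x)" using assms by (intro order_tendstoD(2)) auto
 then show ?thesis by (simp add: divide_inverse del: of_nat_Suc)
qed

text \<open>The derivatives of the edge cutoff are nonzero only where n + 1 <= 1/|x'|, so the second
  derivatives of the product are at most K/|x'|^2 uniformly in n. Against F = O(|x'|^(1+\<alpha>))
  this has an integrable majorant.\<close>

lemma IF_limit:
 assumes \<phi>: "test_fun (Cyl h1) \<phi>"
 shows "(\<lambda>n. IF (pderiv_at a (pderiv_at b (\<lambda>x. ecut n x * \<phi> x))) m) \<longlonglongrightarrow> IF (pderiv_at a (pderiv_at b \<phi>)) m"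
proof -
 obtain CF where CF: "CF >= 0" "!!x. x \<in> Sol h ==> norm (F x) <= CF * norm (proj2 x) powr (1 + \<alpha>)"
  using F_powr by blast
 note ta = test_fun_dir_deriv[OF \<phi>, of "axis a 1"] and tb = test_fun_dir_deriv[OF \<phi>, of "axis b 1"]
 note tab = test_fun_dir_deriv[OF tb, of "axis a 1"]
 obtain B0 B1 B2 B3 where B: "!!x. \<bar>\<phi> x\<bar> <= B0" "!!x. \<bar>pderiv_at a \<phi> x\<bar> <= B1" "!!x. \<bar>pderiv_at b \<phi> x\<bar> <= B2"
  "!!x. \<bar>pderiv_at a (pderiv_at b \<phi>) x\<bar> <= B3"
  using test_fun_bounded[OF \<phi>] test_fun_bounded[OF ta] test_fun_bounded[OF tb] test_fun_bounded[OF tab] by metis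
 have B0: "B0 >= 0" "B1 >= 0" "B2 >= 0" "B3 >= 0" using B[of 0] by auto
 obtain La where La: "La >= 0" "!!n x. \<bar>pderiv_at a (ecut n) x\<bar> <= La * real (Suc n)"
  by (rule ecut_deriv_bounded[of "axis a 1" "axis a 1"]) blast
 obtain Lb where Lb: "Lb >= 0" "!!n x. \<bar>pderiv_at b (ecut n) x\<bar> <= Lb * real (Suc n)"
  "!!n x. \<bar>pderiv_at a (pderiv_at b (ecut n)) x\<bar> <= Lb * (real (Suc n))\<^sup>2"
  by (rule ecut_deriv_bounded[of "axis b 1" "axis a 1"]) blast
 have s\<phi>: "smooth \<phi>" by (rule test_funD(1)[OF \<phi>])
 define K where "K = B3 * h\<^sup>2 + La * B2 * h + Lb * B1 * h + Lb * B0"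
 let ?r = "\<lambda>x. norm (proj2 x)"
 let ?dd = "\<lambda>n. pderiv_at a (pderiv_at b (\<lambda>x. ecut n x * \<phi> x))"
 have dd: "?dd n x = ecut n x * pderiv_at a (pderiv_at b \<phi>) x + pderiv_at a (ecut n) x * pderiv_at b \<phi> x +
   pderiv_at b (ecut n) x * pderiv_at a \<phi> x + pderiv_at a (pderiv_at b (ecut n)) x * \<phi> x" for n x
  by (rule dir_deriv_mult(2)[OF smooth_ecut s\<phi>])
 have ddb: "\<bar>?dd n x\<bar> <= K / (?r x)\<^sup>2" if x: "0 < ?r x" "?r x < h" for n x
 proof -
  let ?N = "real (Suc n)"
  \<comment> \<open>Either the scale of the cutoff is dominated by the inverse distance to the edge,
    or all its derivatives vanish at the point.\<close>
  have zero_or: "?N <= 1 / ?r x \<or> (pderiv_at a (ecut n) x = 0 \<and> pderiv_at b (ecut n) x = 0 \<and> pderiv_at a (pderiv_at b (ecut n)) x = 0)"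
   using ecut_outside[of n x] x by (cases "1 / ?N < ?r x") (auto simp: field_simps simp del: of_nat_Suc)
  have d1: "\<bar>pderiv_at a (ecut n) x\<bar> <= La * (1 / ?r x)" "\<bar>pderiv_at b (ecut n) x\<bar> <= Lb * (1 / ?r x)"
   "\<bar>pderiv_at a (pderiv_at b (ecut n)) x\<bar> <= Lb * (1 / ?r x)\<^sup>2"
  proof -
   have "\<bar>pderiv_at a (ecut n) x\<bar> <= La * (1 / ?r x) \<and> \<bar>pderiv_at b (ecut n) x\<bar> <= Lb * (1 / ?r x) \<and>
    \<bar>pderiv_at a (pderiv_at b (ecut n)) x\<bar> <= Lb * (1 / ?r x)\<^sup>2"
   proof (cases "?N <= 1 / ?r x")
    case True
    then show ?thesis using La Lb by (intro conjI order_trans[OF La(2)] order_trans[OF Lb(2)] order_trans[OF Lb(3)] mult_left_mono power_mono) auto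
   next
    case False
    then show ?thesis using zero_or La(1) Lb(1) x by simp
   qed
   then show "\<bar>pderiv_at a (ecut n) x\<bar> <= La * (1 / ?r x)" "\<bar>pderiv_at b (ecut n) x\<bar> <= Lb * (1 / ?r x)"
    "\<bar>pderiv_at a (pderiv_at b (ecut n)) x\<bar> <= Lb * (1 / ?r x)\<^sup>2" by auto
  qed
  have e: "\<bar>p + q + s + t\<bar> <= \<bar>p\<bar> + \<bar>q\<bar> + \<bar>s\<bar> + \<bar>t\<bar>" for p q s t :: real by linarith
  have "\<bar>?dd n x\<bar> <= \<bar>ecut n x\<bar> * \<bar>pderiv_at a (pderiv_at b \<phi>) x\<bar> + \<bar>pderiv_at a (ecut n) x\<bar> * \<bar>pderiv_at b \<phi> x\<bar> +
   \<bar>pderiv_at b (ecut n) x\<bar> * \<bar>pderiv_at a \<phi> x\<bar> + \<bar>pderiv_at a (pderiv_at b (ecut n)) x\<bar> * \<bar>\<phi> x\<bar>"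
   unfolding dd abs_mult[symmetric] by (rule e)
  also have "\<dots> <= 1 * B3 + (La * (1 / ?r x)) * B2 + (Lb * (1 / ?r x)) * B1 + (Lb * (1 / ?r x)\<^sup>2) * B0"
   using ecut_range[of n x] La(1) Lb(1) x by (intro add_mono mult_mono B d1) (auto simp: B0)
  also have "\<dots> <= K / (?r x)\<^sup>2"
  proof -
   have "(?r x)\<^sup>2 <= h\<^sup>2" using x by (intro power_mono) auto
   moreover have "0 < (?r x)\<^sup>2" using x by simp
   ultimately have "1 <= h\<^sup>2 / (?r x)\<^sup>2" by (simp only: le_divide_eq_1_pos)
   moreover have "1 / ?r x <= h / (?r x)\<^sup>2" using x by (simp add: power2_eq_square field_simps)
   ultimately have "1 * B3 + (La * (1 / ?r x)) * B2 + (Lb * (1 / ?r x)) * B1 + (Lb * (1 / ?r x)\<^sup>2) * B0 <=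
    (h\<^sup>2 / (?r x)\<^sup>2) * B3 + (La * (h / (?r x)\<^sup>2)) * B2 + (Lb * (h / (?r x)\<^sup>2)) * B1 + (Lb * (1 / ?r x)\<^sup>2) * B0"
    using La(1) Lb(1) B0 by (intro add_mono mult_right_mono mult_left_mono order_refl) auto
   also have "\<dots> = K / (?r x)\<^sup>2" by (simp add: K_def power_divide add_divide_distrib mult_ac)
   finally show ?thesis .
  qed
  finally show ?thesis .
 qed
 let ?w = "\<lambda>x. (K * CF) * (indicator (Cyl h) x * (?r x powr (1 + \<alpha>) / (?r x)\<^sup>2))"
 have K0: "K >= 0" unfolding K_def using B0 La(1) Lb(1) h by (intro add_nonneg_nonneg mult_nonneg_nonneg) auto
 have mm: "(\<lambda>x. indicator (Sol h) x *\<^sub>R (g x *\<^sub>R (F x $ m))) \<in> borel_measurable lebesgue" if "test_fun U g" for g U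
  using borel_measurable_integrable[OF integrable_test_mult[OF F_nth_integrable that, unfolded set_integrable_def]] .
 show ?thesis unfolding IF_def set_lebesgue_integral_def
 proof (rule integral_dominated_convergence[where w = ?w])
  show "(\<lambda>x. indicator (Sol h) x *\<^sub>R (pderiv_at a (pderiv_at b \<phi>) x *\<^sub>R (F x $ m))) \<in> borel_measurable lebesgue"
   by (rule mm[OF tab])
  show "(\<lambda>x. indicator (Sol h) x *\<^sub>R (?dd n x *\<^sub>R (F x $ m))) \<in> borel_measurable lebesgue" for n
   by (rule mm[OF test_fun_dir_deriv[OF test_fun_dir_deriv[OF ecut_test[OF \<phi>]]]])
  show "integrable lebesgue ?w" using \<alpha> by (intro integrable_mult_right radial_integrable) auto
  show "AE x in lebesgue. norm (indicator (Sol h) x *\<^sub>R (?dd n x *\<^sub>R (F x $ m))) <= ?w x" for n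
  proof (intro AE_I2)
   fix x
   show "norm (indicator (Sol h) x *\<^sub>R (?dd n x *\<^sub>R (F x $ m))) <= ?w x"
   proof (cases "x \<in> Sol h")
    case True
    then have r: "0 < ?r x" "?r x < h" "x \<in> Cyl h" by (auto simp: in_Sol in_Cyl)
    have "\<bar>?dd n x\<bar> * norm (F x $ m) <= (K / (?r x)\<^sup>2) * (CF * ?r x powr (1 + \<alpha>))"
     using K0 order_trans[OF Finite_Cartesian_Product.norm_nth_le CF(2)[OF True]] by (intro mult_mono ddb r) auto
    then show ?thesis using True r by (simp add: mult_ac)
   next
    case False
    then show ?thesis using K0 CF(1) by simp
   qed
  qed
  show "AE x in lebesgue. (\<lambda>n. indicator (Sol h) x *\<^sub>R (?dd n x *\<^sub>R (F x $ m))) \<longlonglongrightarrow>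
    indicator (Sol h) x *\<^sub>R (pderiv_at a (pderiv_at b \<phi>) x *\<^sub>R (F x $ m))"
  proof (intro AE_I2)
   fix x
   show "(\<lambda>n. indicator (Sol h) x *\<^sub>R (?dd n x *\<^sub>R (F x $ m))) \<longlonglongrightarrow>
    indicator (Sol h) x *\<^sub>R (pderiv_at a (pderiv_at b \<phi>) x *\<^sub>R (F x $ m))"
   proof (cases "x \<in> Sol h")
    case True
    then have "proj2 x ~= 0" by (auto simp: in_Sol)
    have "\<forall>\<^sub>F n in sequentially. indicator (Sol h) x *\<^sub>R (pderiv_at a (pderiv_at b \<phi>) x *\<^sub>R (F x $ m)) =
     indicator (Sol h) x *\<^sub>R (?dd n x *\<^sub>R (F x $ m))"
     using ecut_eventually[OF \<open>proj2 x ~= 0\<close>] by eventually_elim (simp add: dd ecut_outside del: of_nat_Suc)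
    then show ?thesis by (rule Lim_transform_eventually[OF tendsto_const])
   qed simp
  qed
 qed
qed

text \<open>Letting n tend to infinity in \<open>lame_off_edge\<close> for the test functions
  multiplied by \<open>ecut n\<close> admits test functions that do not vanish at the edge.\<close>

lemma lame_identity_real:
 assumes \<phi>: "test_fun (Cyl h1) \<phi>"
 shows "row_int \<phi> i = \<omega>\<^sup>2 *\<^sub>R (SINT x. \<phi> x *\<^sub>R (f x $ i))"
proof -
 let ?\<phi> = "\<lambda>n x. ecut n x * \<phi> x"
 have l1: "(\<lambda>n. row_int (?\<phi> n) i) \<longlonglongrightarrow> row_int \<phi> i"
  unfolding row_int_def by (intro tendsto_intros IF_limit \<phi>)
 have ig: "integrable lebesgue (\<lambda>x. indicator (Sol h) x *\<^sub>R (\<phi> x *\<^sub>R (f x $ i)))"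
  using integrable_test_mult[OF f_nth_integrable \<phi>] by (simp only: set_integrable_def)
 have "(\<lambda>n. SINT x. ?\<phi> n x *\<^sub>R (f x $ i)) \<longlonglongrightarrow> (SINT x. \<phi> x *\<^sub>R (f x $ i))"
  unfolding set_lebesgue_integral_def
 proof (rule integral_dominated_convergence)
  show "integrable lebesgue (\<lambda>x. norm (indicator (Sol h) x *\<^sub>R (\<phi> x *\<^sub>R (f x $ i))))" by (rule integrable_norm[OF ig])
  show "(\<lambda>x. indicator (Sol h) x *\<^sub>R (\<phi> x *\<^sub>R (f x $ i))) \<in> borel_measurable lebesgue" by (rule borel_measurable_integrable[OF ig])
  show "(\<lambda>x. indicator (Sol h) x *\<^sub>R (?\<phi> n x *\<^sub>R (f x $ i))) \<in> borel_measurable lebesgue" for n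
   using borel_measurable_integrable[OF integrable_test_mult[OF f_nth_integrable ecut_test[OF \<phi>], unfolded set_integrable_def]] .
  show "AE x in lebesgue. norm (indicator (Sol h) x *\<^sub>R (?\<phi> n x *\<^sub>R (f x $ i))) <= norm (indicator (Sol h) x *\<^sub>R (\<phi> x *\<^sub>R (f x $ i)))" for n
  proof (intro AE_I2)
   fix x
   have "\<bar>ecut n x * \<phi> x\<bar> <= \<bar>\<phi> x\<bar>" using ecut_range[of n x] by (simp add: abs_mult mult_left_le_one_le)
   then show "norm (indicator (Sol h) x *\<^sub>R (?\<phi> n x *\<^sub>R (f x $ i))) <= norm (indicator (Sol h) x *\<^sub>R (\<phi> x *\<^sub>R (f x $ i)))"
    unfolding norm_scaleR by (intro mult_left_mono mult_right_mono) auto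
  qed
  show "AE x in lebesgue. (\<lambda>n. indicator (Sol h) x *\<^sub>R (?\<phi> n x *\<^sub>R (f x $ i))) \<longlonglongrightarrow> indicator (Sol h) x *\<^sub>R (\<phi> x *\<^sub>R (f x $ i))"
  proof (intro AE_I2)
   fix x
   show "(\<lambda>n. indicator (Sol h) x *\<^sub>R (?\<phi> n x *\<^sub>R (f x $ i))) \<longlonglongrightarrow> indicator (Sol h) x *\<^sub>R (\<phi> x *\<^sub>R (f x $ i))"
   proof (cases "x \<in> Sol h")
    case True
    then have "proj2 x ~= 0" by (auto simp: in_Sol)
    have "\<forall>\<^sub>F n in sequentially. indicator (Sol h) x *\<^sub>R (\<phi> x *\<^sub>R (f x $ i)) =
     indicator (Sol h) x *\<^sub>R (?\<phi> n x *\<^sub>R (f x $ i))"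
     using ecut_eventually[OF \<open>proj2 x ~= 0\<close>] by eventually_elim (simp add: ecut_outside del: of_nat_Suc)
    then show ?thesis by (rule Lim_transform_eventually[OF tendsto_const])
   qed simp
  qed
 qed
 from tendsto_scaleR[OF tendsto_const this, of "\<omega>\<^sup>2"]
 have "(\<lambda>n. row_int (?\<phi> n) i) \<longlonglongrightarrow> \<omega>\<^sup>2 *\<^sub>R (SINT x. \<phi> x *\<^sub>R (f x $ i))"
  by (simp only: lame_off_edge[OF ecut_test[OF \<phi>]])
 from LIMSEQ_unique[OF l1 this] show ?thesis .
qed

lemma lame_identity:
 assumes s\<phi>: "smooth \<phi>" and re: "test_fun (Cyl h1) (\<lambda>x. Re (\<phi> x))" and im: "test_fun (Cyl h1) (\<lambda>x. Im (\<phi> x))"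
 shows "Sintegrable (lame_row lam \<mu> \<phi> F i)"
  and "(SINT x. lame_row lam \<mu> \<phi> F i x) = of_real (\<omega>\<^sup>2) * (SINT x. \<phi> x * f x $ i)"
proof -
 let ?a = "\<lambda>x. Re (\<phi> x)" and ?b = "\<lambda>x. Im (\<phi> x)"
 have cI: "Sintegrable (\<lambda>x. ps x * p x)"
  "(SINT x. ps x * p x) = (SINT x. Re (ps x) *\<^sub>R p x) + \<i> * (SINT x. Im (ps x) *\<^sub>R p x)"
  if p: "Sintegrable p" and t: "test_fun (Cyl h1) (\<lambda>x. Re (ps x))" "test_fun (Cyl h1) (\<lambda>x. Im (ps x))"
  for p ps :: "real^3 => complex"
 proof -
  have e: "ps x * p x = Re (ps x) *\<^sub>R p x + \<i> * (Im (ps x) *\<^sub>R p x)" for x by (simp add: complex_eq_iff algebra_simps)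
  note ir = integrable_test_mult[OF p t(1)] and ii = integrable_test_mult[OF p t(2)]
  have ii': "Sintegrable (\<lambda>x. \<i> * (Im (ps x) *\<^sub>R p x))" using set_integrable_bounded_linear[OF bounded_linear_mult_right ii] .
  show "Sintegrable (\<lambda>x. ps x * p x)" unfolding e by (rule set_integral_add(1)[OF ir ii'])
  show "(SINT x. ps x * p x) = (SINT x. Re (ps x) *\<^sub>R p x) + \<i> * (SINT x. Im (ps x) *\<^sub>R p x)"
   unfolding e set_integral_add(2)[OF ir ii'] set_integral_bounded_linear[OF bounded_linear_mult_right ii] ..
 qed
 have dr: "(\<lambda>x. Re (dir_deriv b ps x)) = dir_deriv b (\<lambda>x. Re (ps x))" "(\<lambda>x. Im (dir_deriv b ps x)) = dir_deriv b (\<lambda>x. Im (ps x))"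
  if "smooth ps" for ps :: "real^3 => complex" and b
  using dir_deriv_bounded_linear[OF bounded_linear_Re that] dir_deriv_bounded_linear[OF bounded_linear_Im that] by auto
 have dd: "(\<lambda>x. Re (pderiv_at k (pderiv_at l \<phi>) x)) = pderiv_at k (pderiv_at l ?a)"
  "(\<lambda>x. Im (pderiv_at k (pderiv_at l \<phi>) x)) = pderiv_at k (pderiv_at l ?b)" for k l
  using dr[OF smooth_dir_deriv[OF s\<phi>]] dr[OF s\<phi>] by auto
 have tdd: "test_fun (Cyl h1) (\<lambda>x. Re (pderiv_at k (pderiv_at l \<phi>) x))" "test_fun (Cyl h1) (\<lambda>x. Im (pderiv_at k (pderiv_at l \<phi>) x))" for k l
  unfolding dd by (intro test_fun_dir_deriv re im)+
 note iF = cI(1)[OF F_nth_integrable tdd]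
 have eF: "(SINT x. pderiv_at k (pderiv_at l \<phi>) x * F x $ m) =
   IF (pderiv_at k (pderiv_at l ?a)) m + \<i> * IF (pderiv_at k (pderiv_at l ?b)) m" for k l m unfolding cI(2)[OF F_nth_integrable tdd] IF_def
  using dd[of k l] by (simp add: fun_eq_iff)
 have icF: "Sintegrable (\<lambda>x. of_real c * pderiv_at k (pderiv_at l \<phi>) x * F x $ m)" for c k l m
  unfolding mult.assoc by (rule set_integrable_bounded_linear[OF bounded_linear_mult_right iF])
 have ecF: "(SINT x. of_real c * pderiv_at k (pderiv_at l \<phi>) x * F x $ m) =
   of_real c * (IF (pderiv_at k (pderiv_at l ?a)) m + \<i> * IF (pderiv_at k (pderiv_at l ?b)) m)" for c k l m
  unfolding mult.assoc set_integral_bounded_linear[OF bounded_linear_mult_right iF] eF ..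
 show "Sintegrable (lame_row lam \<mu> \<phi> F i)" unfolding lame_row_def[abs_def] by (intro set_integral_add(1) set_integral_sum(2) icF)
 have "(SINT x. lame_row lam \<mu> \<phi> F i x) = row_int ?a i + \<i> * row_int ?b i"
 proof -
  have "(SINT x. lame_row lam \<mu> \<phi> F i x) =
   (\<Sum>k\<in>UNIV. SINT x. of_real \<mu> * pderiv_at k (pderiv_at k \<phi>) x * F x $ i) +
   (\<Sum>k\<in>UNIV. SINT x. of_real \<mu> * pderiv_at i (pderiv_at k \<phi>) x * F x $ k) +
   (\<Sum>k\<in>UNIV. SINT x. of_real lam * pderiv_at k (pderiv_at i \<phi>) x * F x $ k)" unfolding lame_row_def
   by (subst set_integral_add(2), intro set_integral_add(1) set_integral_sum(2) icF, intro set_integral_sum(2) icF,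
     subst set_integral_add(2), intro set_integral_sum(2) icF, intro set_integral_sum(2) icF,
     subst (1 2 3) set_integral_sum(1)) (auto intro: icF)
  then show ?thesis unfolding ecF row_int_def by (simp add: sum.distrib sum_distrib_left algebra_simps scaleR_conv_of_real)
 qed
 also have "\<dots> = of_real (\<omega>\<^sup>2) * (SINT x. \<phi> x * f x $ i)"
  unfolding lame_identity_real[OF re] lame_identity_real[OF im] cI(2)[OF f_nth_integrable re im] by (simp add: scaleR_conv_of_real algebra_simps)
 finally show "(SINT x. lame_row lam \<mu> \<phi> F i x) = of_real (\<omega>\<^sup>2) * (SINT x. \<phi> x * f x $ i)" .
qed

end

section \<open>Blow-up at the edge\<close>

definition cplx :: "real^2 => complex" where "cplx y = Complex (y $ 1) (y $ 2)"

lemma norm_cplx: "norm (cplx y) = norm y"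
proof -
 have "(norm (cplx y))\<^sup>2 = (norm y)\<^sup>2" by (simp add: cplx_def norm_sq_vec2 cmod_power2)
 then show ?thesis by simp
qed

lemma bounded_linear_cplx: "bounded_linear cplx"
proof -
 have "linear cplx" by (intro linearI) (auto simp: cplx_def complex_eq_iff)
 then show ?thesis using linear_conv_bounded_linear by blast
qed

lemma cplx_rot2: "cplx (rot2 th X Y) = cis th * Complex X Y" by (simp add: cplx_def complex_eq_iff algebra_simps)

lemma cplx_e2: "cplx (e2 th) = cis th" by (simp add: e2_def cplx_rot2 complex_eq_iff)

text \<open>\<open>lame_row\<close> as an algebraic expression in the matrix of second derivatives,
  so that the leading part of this matrix can be split from the remainder.\<close>

definition lame_symbol :: "real => real => (3 => 3 => complex) => complex^3 => 3 => complex"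
 where "lame_symbol lam \<mu> D u i = (\<Sum>k\<in>UNIV. of_real \<mu> * D k k * u $ i) +
  (\<Sum>k\<in>UNIV. of_real \<mu> * D i k * u $ k) + (\<Sum>k\<in>UNIV. of_real lam * D k i * u $ k)"

lemma lame_row_symbol: "lame_row lam \<mu> \<phi> u i x = lame_symbol lam \<mu> (\<lambda>a b. pderiv_at a (pderiv_at b \<phi>) x) (u x) i"
 by (simp add: lame_row_def lame_symbol_def)

lemma lame_symbol_bound:
 assumes D: "!!a b. norm (D a b) <= B"
 shows "norm (lame_symbol lam \<mu> D u i) <= (6 * \<bar>\<mu>\<bar> + 3 * \<bar>lam\<bar>) * B * norm u"
proof -
 have B: "B >= 0" using order_trans[OF norm_ge_zero D] .
 have t: "norm (of_real c * D a b * u $ k) <= \<bar>c\<bar> * B * norm u" for c a b k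
  unfolding norm_mult by (intro mult_mono D Finite_Cartesian_Product.norm_nth_le) (auto simp: B)
 have s: "norm (\<Sum>k\<in>(UNIV::3 set). p k) <= 3 * q" if "!!k. norm (p k) <= q" for p :: "3 => complex" and q
  using sum_norm_le[of UNIV p "\<lambda>_. q"] that by simp
 have "norm (lame_symbol lam \<mu> D u i) <= 3 * (\<bar>\<mu>\<bar> * B * norm u) + 3 * (\<bar>\<mu>\<bar> * B * norm u) + 3 * (\<bar>lam\<bar> * B * norm u)"
  unfolding lame_symbol_def by (intro norm_triangle_mono s t)
 then show ?thesis by (simp add: algebra_simps)
qed

text \<open>The vector \<open>(1, \<i>, 0)\<close> is isotropic, so the leading part of the Lame operator applied to a
 function of \<open>x\<^sub>1 + \<i> x\<^sub>2\<close> is annihilated by contraction with any vector orthogonal to it.\<close>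

lemma lame_symbol_isotropic:
 assumes c: "c $ 1 + \<i> * c $ 2 = 0"
 shows "(\<Sum>i\<in>UNIV. c $ i * lame_symbol lam \<mu> (\<lambda>a b. q * cplx (proj2 (axis a 1)) * cplx (proj2 (axis b 1))) u i) = 0"
proof -
 have e: "cplx (proj2 (axis 1 1)) = 1" "cplx (proj2 (axis 2 1)) = \<i>" "cplx (proj2 (axis 3 1)) = 0"
  by (simp_all add: cplx_def complex_eq_iff axis_def)
 have c1: "c $ 1 = - (\<i> * c $ 2)" using c by (simp add: eq_neg_iff_add_eq_0)
 show ?thesis unfolding lame_symbol_def sum_3 e c1 by (simp add: algebra_simps)
qed

lemma lame_symbol_add: "lame_symbol lam \<mu> (\<lambda>a b. D a b + E a b) u i = lame_symbol lam \<mu> D u i + lame_symbol lam \<mu> E u i"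
 by (simp add: lame_symbol_def sum_3 algebra_simps)

section \<open>The kernel and its derivatives\<close>

context edge
begin

definition "kap = sqrt (1 - \<bar>cos be\<bar>)"

lemma kap: "0 < kap" "kap\<^sup>2 = 1 - \<bar>cos be\<bar>"
proof -
 have "0 < (sin be)\<^sup>2" using sin_be by simp
 then have "(cos be)\<^sup>2 < 1" using sin_cos_squared_add[of be] by linarith
 then have "\<bar>cos be\<bar> < 1" by (simp add: abs_square_less_1)
 then show "0 < kap" "kap\<^sup>2 = 1 - \<bar>cos be\<bar>" by (simp_all add: kap_def)
qed

definition "zt s y = cplx y + of_real s * cis th"

lemma zt_sq: "(norm (zt s y))\<^sup>2 = (norm y)\<^sup>2 + s\<^sup>2 + 2 * s * cX th y"
proof -
 have "(norm (zt s y))\<^sup>2 = (y $ 1 + s * cos th)\<^sup>2 + (y $ 2 + s * sin th)\<^sup>2" by (simp add: zt_def cplx_def cmod_power2)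
 also have "\<dots> = (y $ 1)\<^sup>2 + (y $ 2)\<^sup>2 + s\<^sup>2 + 2 * s * cX th y"
  using cos_sin_mult[of th "s * s"] by (simp add: cX_def power2_eq_square algebra_simps)
 finally show ?thesis by (simp add: norm_sq_vec2)
qed

text \<open>In the expansion \<open>zt_sq\<close> the mixed term is at least -2 s |cos be| |y|, and
  2 s |y| <= s^2 + |y|^2. What remains is the fraction 1 - |cos be| of |y|^2 + s^2, and this
  fraction is the square of \<open>kap\<close>.\<close>

lemma zt_lower:
 assumes "lev y >= 0" "s >= 0"
 shows "kap\<^sup>2 * s\<^sup>2 <= (norm (zt s y))\<^sup>2" "kap * norm y <= norm (zt s y)" "kap * s <= norm (zt s y)"
proof -
 let ?c = "\<bar>cos be\<bar>"
 have "2 * s * (- (?c * norm y)) <= 2 * s * cX th y" using cX_lower_bound[OF assms(1) be] assms(2) by (intro mult_left_mono) auto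
 moreover have "?c * (2 * s * norm y) <= ?c * (s\<^sup>2 + (norm y)\<^sup>2)" using sum_squares_bound[of s "norm y"] by (intro mult_left_mono) auto
 ultimately have "kap\<^sup>2 * ((norm y)\<^sup>2 + s\<^sup>2) <= (norm (zt s y))\<^sup>2" unfolding zt_sq kap(2) by (simp add: algebra_simps)
 moreover have "0 <= kap\<^sup>2 * s\<^sup>2" "0 <= kap\<^sup>2 * (norm y)\<^sup>2" by auto
 ultimately have 1: "(kap * s)\<^sup>2 <= (norm (zt s y))\<^sup>2" "(kap * norm y)\<^sup>2 <= (norm (zt s y))\<^sup>2"
  unfolding power_mult_distrib distrib_left by linarith+
 then show "kap\<^sup>2 * s\<^sup>2 <= (norm (zt s y))\<^sup>2" by (simp add: power_mult_distrib)
 show "kap * norm y <= norm (zt s y)" "kap * s <= norm (zt s y)" using 1 by (auto intro: power2_le_imp_le)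
qed

lemma zt_pos:
 assumes "lev y >= 0" "s > 0" shows "zt s y ~= 0" "norm (zt s y) > 0"
proof -
 have "0 < kap * s" using kap assms by simp
 then show "norm (zt s y) > 0" using zt_lower(3)[of y s] assms by linarith
 then show "zt s y ~= 0" by auto
qed

text \<open>A globally smooth function that equals \<open>1 / \<zeta>\<^sup>3\<close> on the wedge, where \<open>\<bar>\<zeta>\<bar> >= kap s\<close>.\<close>

definition "fden s y = (norm (zt s y))\<^sup>2 + kap\<^sup>2 * s\<^sup>2 * (1 - sstep (2 / (kap\<^sup>2 * s\<^sup>2) * (norm (zt s y))\<^sup>2 - 1))"
definition "psi s y = cnj (zt s y) ^ 3 * of_real (inverse (fden s y) ^ 3)"

lemma fden_pos:
 assumes "s > 0" shows "fden s y > 0"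
proof (cases "zt s y = 0")
 case True
 then show ?thesis using assms kap(1) by (simp add: fden_def sstep_0)
next
 case False
 then have "0 < (norm (zt s y))\<^sup>2" by simp
 moreover have "0 <= kap\<^sup>2 * s\<^sup>2 * (1 - sstep (2 / (kap\<^sup>2 * s\<^sup>2) * (norm (zt s y))\<^sup>2 - 1))"
  using sstep_range(2) by (intro mult_nonneg_nonneg) auto
 ultimately show ?thesis unfolding fden_def by linarith
qed

lemma smooth_zt: "smooth (zt s)" unfolding zt_def[abs_def] by (intro smooth_add smooth_linear[OF bounded_linear_cplx] smooth_const)

lemma smooth_psi:
 assumes s: "s > 0" shows "smooth (psi s)"
proof -
 have sq: "smooth (\<lambda>y. (norm (zt s y))\<^sup>2)"
  unfolding power2_norm_eq_inner by (rule smooth_bilinear[OF bounded_bilinear_inner smooth_zt smooth_zt])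
 have "smooth (\<lambda>y. 2 / (kap\<^sup>2 * s\<^sup>2) * (norm (zt s y))\<^sup>2 - 1)" by (intro smooth_diff smooth_mult smooth_const sq)
 from smooth_compose[OF this smooth_sstep]
 have "smooth (fden s)" unfolding fden_def[abs_def] by (intro smooth_add smooth_mult smooth_diff smooth_const sq)
 then have "smooth (\<lambda>y. inverse (fden s y))" using fden_pos[OF s] by (intro smooth_inverse) (auto simp: less_le)
 moreover have "smooth (\<lambda>y. cnj (zt s y))" by (rule smooth_compose[OF smooth_zt smooth_linear[OF bounded_linear_cnj]])
 ultimately show ?thesis unfolding psi_def[abs_def] by (intro smooth_mult smooth_power smooth_of_real)
qed

lemma psi_eq:
 assumes "lev y >= 0" "s > 0" shows "psi s y = inverse (zt s y) ^ 3"
proof -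
 note z = zt_pos[OF assms]
 have p: "0 < kap\<^sup>2 * s\<^sup>2" using kap(1) assms(2) by simp
 have "1 <= (norm (zt s y))\<^sup>2 / (kap\<^sup>2 * s\<^sup>2)" using zt_lower(1)[of y s] assms p by (simp add: pos_le_divide_eq)
 then have "2 / (kap\<^sup>2 * s\<^sup>2) * (norm (zt s y))\<^sup>2 - 1 >= 1" by simp
 then have "fden s y = (norm (zt s y))\<^sup>2" unfolding fden_def by (simp add: sstep_1)
 then have "psi s y = (cnj (zt s y) * of_real (inverse ((norm (zt s y))\<^sup>2))) ^ 3" by (simp add: psi_def power_mult_distrib)
 also have "cnj (zt s y) * of_real (inverse ((norm (zt s y))\<^sup>2)) = inverse (zt s y)"
 proof -
  have "zt s y * cnj (zt s y) = of_real ((norm (zt s y))\<^sup>2)" by (simp add: complex_norm_square[symmetric])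
  then show ?thesis using z by (simp add: field_simps)
 qed
 finally show ?thesis .
qed

text \<open>The function is holomorphic in x1 + i x2, so a derivative in direction b is the complex
  derivative times the complex number of b. This gives second derivatives the product form that
  \<open>lame_symbol_isotropic\<close> annihilates.\<close>

lemma zt_power_derivative:
 assumes "zt s (proj2 x) ~= 0"
 shows "((\<lambda>x. inverse (zt s (proj2 x)) ^ n) has_derivative
  (\<lambda>b. - of_nat n * inverse (zt s (proj2 x)) ^ Suc n * cplx (proj2 b))) (at x)"
proof -
 let ?z = "zt s (proj2 x)"
 have "((\<lambda>z. inverse z ^ n) has_field_derivative (- of_nat n * inverse ?z ^ Suc n)) (at ?z)"
  using DERIV_power[OF DERIV_inverse[OF assms], of n] by (cases n) (simp_all add: power2_eq_square algebra_simps)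
 then have 1: "((\<lambda>z. inverse z ^ n) has_derivative (\<lambda>b. - of_nat n * inverse ?z ^ Suc n * b)) (at ?z)"
  unfolding has_field_derivative_def .
 have "((\<lambda>x. zt s (proj2 x)) has_derivative (\<lambda>b. cplx (proj2 b) + 0)) (at x)" unfolding zt_def
  by (intro has_derivative_add has_derivative_const bounded_linear.has_derivative[OF bounded_linear_cplx]
    bounded_linear.has_derivative[OF bounded_linear_proj2] has_derivative_ident)
 from has_derivative_compose[OF this 1] show ?thesis by simp
qed

lemma psi_derivatives:
 assumes "lev (proj2 x) > 0" and s: "s > 0"
 shows "dir_deriv b (\<lambda>x. psi s (proj2 x)) x = - 3 * inverse (zt s (proj2 x)) ^ 4 * cplx (proj2 b)"
  and "dir_deriv a (dir_deriv b (\<lambda>x. psi s (proj2 x))) x =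
   12 * inverse (zt s (proj2 x)) ^ 5 * cplx (proj2 a) * cplx (proj2 b)"
proof -
 let ?U = "{x. lev (proj2 x) > 0}"
 have oU: "open ?U" by (intro open_Collect_less continuous_intros)
 have 1: "dir_deriv b (\<lambda>x. psi s (proj2 x)) x = - 3 * inverse (zt s (proj2 x)) ^ 4 * cplx (proj2 b)" if x: "x \<in> ?U" for x b
 proof -
  have "dir_deriv b (\<lambda>x. psi s (proj2 x)) x = dir_deriv b (\<lambda>x. inverse (zt s (proj2 x)) ^ 3) x"
   using psi_eq[OF less_imp_le s] by (intro dir_deriv_cong_open[OF oU x]) auto
  also have "\<dots> = - of_nat 3 * inverse (zt s (proj2 x)) ^ Suc 3 * cplx (proj2 b)"
   using x by (intro dir_deriv_eqI[OF zt_power_derivative] zt_pos(1) s) auto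
  finally show ?thesis by simp
 qed
 show "dir_deriv b (\<lambda>x. psi s (proj2 x)) x = - 3 * inverse (zt s (proj2 x)) ^ 4 * cplx (proj2 b)" using assms by (intro 1) simp
 have "dir_deriv a (dir_deriv b (\<lambda>x. psi s (proj2 x))) x =
   dir_deriv a (\<lambda>x. (- 3 * cplx (proj2 b)) * inverse (zt s (proj2 x)) ^ 4) x" using assms by (intro dir_deriv_cong_open[OF oU]) (auto simp: 1)
 also have "\<dots> = (- 3 * cplx (proj2 b)) * (- of_nat 4 * inverse (zt s (proj2 x)) ^ Suc 4 * cplx (proj2 a))"
  using assms by (intro dir_deriv_eqI[OF has_derivative_mult_right[OF zt_power_derivative]] zt_pos(1)) auto
 finally show "dir_deriv a (dir_deriv b (\<lambda>x. psi s (proj2 x))) x =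
   12 * inverse (zt s (proj2 x)) ^ 5 * cplx (proj2 a) * cplx (proj2 b)" by (simp add: mult_ac)
qed

lemma smooth_psi3: "s > 0 ==> smooth (\<lambda>x. psi s (proj2 x))"
 by (rule smooth_compose[OF smooth_linear[OF bounded_linear_proj2] smooth_psi])

lemma zt_upper: "s >= 0 ==> norm (zt s y) <= norm y + s"
 unfolding zt_def using norm_triangle_ineq[of "cplx y" "of_real s * cis th"] by (simp add: norm_cplx norm_mult)

lemma dir_deriv_of_real: "smooth A ==> dir_deriv b (\<lambda>x. of_real (A x) :: complex) = (\<lambda>x. of_real (dir_deriv b A x))"
 using dir_deriv_bounded_linear[OF bounded_linear_of_real[where 'a=complex]] by auto

text \<open>Only the term with both derivatives on the kernel has the order of the inverse fifth
  power, and the contraction kills it. The remaining terms have at least one derivative on the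
  smooth factor \<open>A\<close>; since the denominator is bounded, all of them are controlled by
  the inverse fourth power.\<close>

lemma lame_row_contracted_bound:
 assumes A: "test_fun U A" and c: "c $ 1 + \<i> * c $ 2 = 0"
 shows "\<exists>K\<ge>0. \<forall>s x u. 0 < s \<and> s <= 1 \<and> x \<in> Sol h \<longrightarrow>
  norm (\<Sum>i\<in>UNIV. c $ i * lame_row lam \<mu> (\<lambda>x. of_real (A x) * psi s (proj2 x)) u i x) <=
   K * inverse (norm (zt s (proj2 x))) ^ 4 * norm (u x)"
proof -
 note sA = test_funD(1)[OF A]
 have "\<exists>B>0. \<forall>x. \<bar>A x\<bar> <= B \<and> (\<forall>a. \<bar>pderiv_at a A x\<bar> <= B) \<and> (\<forall>a b. \<bar>pderiv_at a (pderiv_at b A) x\<bar> <= B)"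
 proof -
  obtain B0 where B0: "!!x. \<bar>A x\<bar> <= B0" using test_fun_bounded[OF A] by metis
  have "\<forall>a. \<exists>B. \<forall>x. \<bar>pderiv_at a A x\<bar> <= B" using test_fun_bounded[OF test_fun_dir_deriv[OF A]] by metis
  then obtain B1 where B1: "!!a x. \<bar>pderiv_at a A x\<bar> <= B1 a" by metis
  have "\<forall>a b. \<exists>B. \<forall>x. \<bar>pderiv_at a (pderiv_at b A) x\<bar> <= B"
   using test_fun_bounded[OF test_fun_dir_deriv[OF test_fun_dir_deriv[OF A]]] by metis
  then obtain B2 where B2: "!!a b x. \<bar>pderiv_at a (pderiv_at b A) x\<bar> <= B2 a b" by metis
  define B where "B = 1 + \<bar>B0\<bar> + (\<Sum>a\<in>UNIV. \<bar>B1 a\<bar>) + (\<Sum>a\<in>UNIV. \<Sum>b\<in>UNIV. \<bar>B2 a b\<bar>)"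
  have n: "0 <= (\<Sum>a\<in>UNIV. \<bar>B1 a\<bar>)" "0 <= (\<Sum>a\<in>UNIV. \<Sum>b\<in>UNIV. \<bar>B2 a b\<bar>)" by (auto intro!: sum_nonneg)
  have m1: "\<bar>B1 a\<bar> <= (\<Sum>a\<in>UNIV. \<bar>B1 a\<bar>)" for a by (rule member_le_sum) auto
  have m2: "\<bar>B2 a b\<bar> <= (\<Sum>a\<in>UNIV. \<Sum>b\<in>UNIV. \<bar>B2 a b\<bar>)" for a b
   by (rule order_trans[OF member_le_sum[of b UNIV "\<lambda>b. \<bar>B2 a b\<bar>"] member_le_sum[of a UNIV "\<lambda>a. \<Sum>b\<in>UNIV. \<bar>B2 a b\<bar>"]])
    (auto intro: sum_nonneg)
  show ?thesis
  proof (intro exI[of _ B] conjI allI)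
   show "B > 0" using n abs_ge_zero[of B0] unfolding B_def by linarith
   show "\<bar>A x\<bar> <= B" for x using B0[of x] n abs_ge_self[of B0] abs_ge_zero[of B0] unfolding B_def by linarith
   show "\<bar>pderiv_at a A x\<bar> <= B" for x a using B1[of a x] m1[of a] n abs_ge_self[of B0] abs_ge_zero[of B0] unfolding B_def by linarith
   show "\<bar>pderiv_at a (pderiv_at b A) x\<bar> <= B" for x a b using B2[of a b x] m2[of a b] n abs_ge_self[of B0] abs_ge_zero[of B0] unfolding B_def by linarith
  qed
 qed
 then obtain B where B: "B > 0" "!!x. \<bar>A x\<bar> <= B" "!!x a. \<bar>pderiv_at a A x\<bar> <= B" "!!a b x. \<bar>pderiv_at a (pderiv_at b A) x\<bar> <= B"
  by blast
 \<comment> \<open>Each of the two mixed terms contributes 3 B; the term with both derivatives on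
   \<open>A\<close> has the inverse third power, and h + 1 bounds the missing factor.\<close>
 define K1 where "K1 = 6 * B + B * (h + 1)"
 have K1: "K1 >= 0" using B(1) h by (simp add: K1_def)
 define K where "K = (\<Sum>i\<in>UNIV. norm (c $ i)) * ((6 * \<bar>\<mu>\<bar> + 3 * \<bar>lam\<bar>) * K1)"
 show ?thesis
 proof (intro exI[of _ K] conjI allI impI)
  show "K >= 0" unfolding K_def using K1 by (intro mult_nonneg_nonneg sum_nonneg) auto
  fix s :: real and x and u :: "real^3 => complex^3" assume sx: "0 < s \<and> s <= 1 \<and> x \<in> Sol h"
  then have s: "0 < s" "s <= 1" and x: "lev (proj2 x) > 0" "norm (proj2 x) < h" by (auto simp: in_Sol)
  let ?ps = "\<lambda>x. psi s (proj2 x)" and ?\<epsilon> = "\<lambda>a. cplx (proj2 (axis a 1))"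
  let ?z = "zt s (proj2 x)"
  let ?\<phi> = "\<lambda>x. of_real (A x) * ?ps x"
  let ?q = "of_real (A x) * (12 * inverse ?z ^ 5)"
  define E where "E a b = of_real (pderiv_at a A x) * (- 3 * inverse ?z ^ 4 * ?\<epsilon> b) +
   of_real (pderiv_at b A x) * (- 3 * inverse ?z ^ 4 * ?\<epsilon> a) + of_real (pderiv_at a (pderiv_at b A) x) * inverse ?z ^ 3" for a b
  have D: "pderiv_at a (pderiv_at b ?\<phi>) x = ?q * ?\<epsilon> a * ?\<epsilon> b + E a b" for a b
   unfolding dir_deriv_mult(2)[OF smooth_of_real[OF sA] smooth_psi3[OF s(1)]] dir_deriv_of_real[OF sA]
    dir_deriv_of_real[OF smooth_dir_deriv[OF sA]] psi_derivatives[OF x(1) s(1)] psi_eq[OF less_imp_le[OF x(1)] s(1)] E_def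
   by (simp add: algebra_simps)
  have zp: "norm ?z > 0" using zt_pos(2)[of "proj2 x" s] x s by simp
  have \<epsilon>: "norm (?\<epsilon> a) <= 1" for a unfolding norm_cplx using norm_proj2_le[of "axis a 1"] by simp
  have E: "norm (E a b) <= K1 * inverse (norm ?z) ^ 4" for a b
  proof -
   have t: "norm (of_real p * (- 3 * inverse ?z ^ 4 * ?\<epsilon> b)) <= 3 * B * inverse (norm ?z) ^ 4" if "\<bar>p\<bar> <= B" for p b
   proof -
    have "\<bar>p\<bar> * (3 * inverse (norm ?z) ^ 4 * norm (?\<epsilon> b)) <= B * (3 * inverse (norm ?z) ^ 4 * 1)"
     using that \<epsilon> B(1) by (intro mult_mono) auto
    then show ?thesis by (simp add: norm_mult norm_power norm_inverse mult_ac)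
   qed
   have t3: "norm (of_real (pderiv_at a (pderiv_at b A) x) * inverse ?z ^ 3) <= B * (h + 1) * inverse (norm ?z) ^ 4"
   proof -
    have "norm ?z <= h + 1" using zt_upper[of s "proj2 x"] x s by simp
    then have "inverse (norm ?z) ^ 4 * norm ?z <= inverse (norm ?z) ^ 4 * (h + 1)" by (intro mult_left_mono) auto
    moreover have "inverse (norm ?z) ^ 4 * norm ?z = inverse (norm ?z) ^ 3" using zp by (simp add: field_simps power_numeral_reduce)
    ultimately have "\<bar>pderiv_at a (pderiv_at b A) x\<bar> * inverse (norm ?z) ^ 3 <= B * (inverse (norm ?z) ^ 4 * (h + 1))"
     using B by (intro mult_mono) auto
    then show ?thesis by (simp add: norm_mult norm_power norm_inverse mult_ac)
   qed
   have "norm (E a b) <= 3 * B * inverse (norm ?z) ^ 4 + 3 * B * inverse (norm ?z) ^ 4 + B * (h + 1) * inverse (norm ?z) ^ 4"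
    unfolding E_def by (intro norm_triangle_mono t t3 B)
   then show ?thesis by (simp add: K1_def algebra_simps)
  qed
  have "(\<Sum>i\<in>UNIV. c $ i * lame_row lam \<mu> ?\<phi> u i x) = (\<Sum>i\<in>UNIV. c $ i * lame_symbol lam \<mu> E (u x) i)"
   unfolding lame_row_symbol D lame_symbol_add distrib_left sum.distrib lame_symbol_isotropic[OF c] by simp
  also have "norm \<dots> <= (\<Sum>i\<in>UNIV. norm (c $ i) * ((6 * \<bar>\<mu>\<bar> + 3 * \<bar>lam\<bar>) * (K1 * inverse (norm ?z) ^ 4) * norm (u x)))"
   by (rule sum_norm_le) (simp only: norm_mult, intro mult_left_mono lame_symbol_bound E norm_ge_zero)
  also have "\<dots> = K * inverse (norm ?z) ^ 4 * norm (u x)" by (simp add: K_def sum_distrib_right sum_distrib_left mult_ac)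
  finally show "norm (\<Sum>i\<in>UNIV. c $ i * lame_row lam \<mu> ?\<phi> u i x) <= K * inverse (norm ?z) ^ 4 * norm (u x)" .
 qed
qed

end

section \<open>The limit of the kernel integrals and its nonzero constant\<close>

lemma inverse_1_plus_square_integrable: "integrable lborel (\<lambda>Y :: real. indicator {0..} Y * inverse (1 + Y\<^sup>2))"
proof -
 have "(\<integral>\<^sup>+Y. ennreal (inverse (1 + Y\<^sup>2)) * indicator {0..} Y \<partial>lborel) = ennreal (pi / 2 - arctan 0)"
 proof (rule nn_integral_FTC_atLeast)
  show "DERIV arctan x :> inverse (1 + x\<^sup>2)" for x by (rule DERIV_arctan)
 qed (auto intro: tendsto_arctan_at_top)
 then have "(\<integral>\<^sup>+Y. ennreal (norm (indicator {0..} Y * inverse (1 + Y\<^sup>2) :: real)) \<partial>lborel) = ennreal (pi / 2 - arctan 0)"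
  by (subst (asm) nn_integral_cong[of _ _ "\<lambda>Y. ennreal (norm (indicator {0..} Y * inverse (1 + Y\<^sup>2) :: real))"])
   (auto simp: indicator_def)
 then show ?thesis by (intro integrableI_bounded) auto
qed

text \<open>The primitive \<open>- inverse a * inverse (1 + a * of_real Y)\<close> vanishes at
  infinity, and the two lower bounds give a majorant proportional to 1/(1 + Y^2).\<close>

lemma half_line_integral:
 fixes a :: complex
 assumes k: "k > 0" "!!Y. Y >= 0 ==> k <= norm (1 + a * of_real Y)" "!!Y. Y >= 0 ==> k * Y <= norm (1 + a * of_real Y)"
 shows "integrable lborel (\<lambda>Y. indicator {0..} Y *\<^sub>R inverse (1 + a * of_real Y) ^ 2)"
  and "(LINT Y|lborel. indicator {0..} Y *\<^sub>R inverse (1 + a * of_real Y) ^ 2) = inverse a"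
proof -
 let ?f = "\<lambda>Y. inverse (1 + a * of_real Y) ^ 2"
 have nz: "1 + a * of_real Y ~= 0" if "Y >= 0" for Y using k(1) k(2)[OF that] by auto
 have a: "a ~= 0"
 proof
  assume "a = 0"
  then show False using k(3)[of "2 / k"] k(1) by simp
 qed
 have cf: "continuous_on {0..} ?f" by (intro continuous_intros) (use nz in auto)
 have bnd: "norm (?f Y) <= 2 / k\<^sup>2 * inverse (1 + Y\<^sup>2)" if Y: "Y >= 0" for Y
 proof -
  let ?n = "norm (1 + a * of_real Y)"
  have "k\<^sup>2 <= ?n\<^sup>2" "(k * Y)\<^sup>2 <= ?n\<^sup>2" using k Y by (auto intro!: power_mono)
  then have "k\<^sup>2 * (1 + Y\<^sup>2) <= 2 * ?n\<^sup>2" by (simp add: power_mult_distrib algebra_simps)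
  then have "k\<^sup>2 * (1 + Y\<^sup>2) / 2 <= ?n\<^sup>2" by simp
  moreover have "0 < k\<^sup>2 * (1 + Y\<^sup>2) / 2" using k(1) by (intro divide_pos_pos mult_pos_pos add_pos_nonneg) auto
  ultimately have "inverse (?n\<^sup>2) <= inverse (k\<^sup>2 * (1 + Y\<^sup>2) / 2)" by (rule le_imp_inverse_le)
  also have "\<dots> = 2 / k\<^sup>2 * inverse (1 + Y\<^sup>2)" by (simp add: inverse_eq_divide)
  finally have "inverse (?n\<^sup>2) <= 2 / k\<^sup>2 * inverse (1 + Y\<^sup>2)" .
  then show ?thesis by (simp add: norm_power norm_inverse power_inverse)
 qed
 show i: "integrable lborel (\<lambda>Y. indicator {0..} Y *\<^sub>R ?f Y)"
 proof (rule Bochner_Integration.integrable_bound)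
  show "integrable lborel (\<lambda>Y. 2 / k\<^sup>2 * (indicator {0..} Y * inverse (1 + Y\<^sup>2)) :: real)"
   by (intro integrable_mult_right inverse_1_plus_square_integrable)
  show "(\<lambda>Y. indicator {0..} Y *\<^sub>R ?f Y) \<in> borel_measurable lborel" using borel_measurable_continuous_on_indicator[OF _ cf] by simp
  show "AE Y in lborel. norm (indicator {0..} Y *\<^sub>R ?f Y) <= norm (2 / k\<^sup>2 * (indicator {0..} Y * inverse (1 + Y\<^sup>2)) :: real)"
  proof (intro AE_I2)
   fix Y :: real
   show "norm (indicator {0..} Y *\<^sub>R ?f Y) <= norm (2 / k\<^sup>2 * (indicator {0..} Y * inverse (1 + Y\<^sup>2)) :: real)"
    using order_trans[OF bnd[of Y] abs_ge_self] by (cases "Y >= 0") auto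
  qed
 qed
 let ?F = "\<lambda>Y. - inverse a * inverse (1 + a * of_real Y)"
 have FTC: "(LINT Y|lborel. indicator {..y} Y *\<^sub>R (indicator {0..} Y *\<^sub>R ?f Y)) = ?F y + inverse a" if y: "y >= 0" for y
 proof -
  have "(LINT Y|lborel. indicator {..y} Y *\<^sub>R (indicator {0..} Y *\<^sub>R ?f Y)) = (LINT Y|lborel. indicator {0..y} Y *\<^sub>R ?f Y)"
   by (intro Bochner_Integration.integral_cong) (auto simp: indicator_def)
  also have "\<dots> = ?F y - ?F 0"
  proof (rule integral_FTC_atLeastAtMost[OF y])
   show "continuous_on {0..y} ?f" by (rule continuous_on_subset[OF cf]) auto
   fix x assume x: "0 <= x" "x <= y"
   have "((\<lambda>z. - inverse a * inverse (1 + a * z)) has_field_derivative ?f x) (at (of_real x))"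
    using nz[OF x(1)] a by (auto intro!: derivative_eq_intros simp: power2_eq_square)
   from has_vector_derivative_real_field[OF this]
   show "(?F has_vector_derivative ?f x) (at x within {0..y})" by simp
  qed
  finally show ?thesis by simp
 qed
 have "((\<lambda>y. ?F y + inverse a) \<longlongrightarrow> 0 + inverse a) at_top"
 proof (intro tendsto_add tendsto_const)
  show "(?F \<longlongrightarrow> 0) at_top"
  proof (rule Lim_null_comparison)
   show "\<forall>\<^sub>F y in at_top. norm (?F y) <= norm (inverse a) * inverse k * inverse y" using eventually_gt_at_top[of 0]
   proof eventually_elim
    case (elim y)
    then have "0 < k * y" using k(1) by simp
    then have "inverse (norm (1 + a * of_real y)) <= inverse (k * y)" using k(3)[of y] elim by (intro le_imp_inverse_le) auto
    then have "norm (inverse a) * inverse (norm (1 + a * of_real y)) <= norm (inverse a) * inverse (k * y)" by (intro mult_left_mono) auto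
    then show ?case by (simp add: norm_mult norm_inverse mult_ac)
   qed
   show "((\<lambda>y. norm (inverse a) * inverse k * inverse y) \<longlongrightarrow> 0) at_top"
    by (intro tendsto_mult_right_zero tendsto_inverse_0_at_top filterlim_ident)
  qed
 qed
 moreover have "((\<lambda>y. ?F y + inverse a) \<longlongrightarrow> (LINT Y|lborel. indicator {0..} Y *\<^sub>R ?f Y)) at_top"
  using tendsto_integral_at_top[OF _ i]
 proof (rule Lim_transform_eventually)
  show "\<forall>\<^sub>F y in at_top. (LINT Y|lborel. indicator {..y} Y *\<^sub>R (indicator {0..} Y *\<^sub>R ?f Y)) = ?F y + inverse a"
   using eventually_ge_at_top[of 0] by eventually_elim (rule FTC)
 qed simp
 ultimately show "(LINT Y|lborel. indicator {0..} Y *\<^sub>R ?f Y) = inverse a" using tendsto_unique[OF trivial_limit_at_top_linorder] by fastforce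
qed

lemma lborel_product_integral:
 fixes f :: "real => complex" and g :: "real => real"
 assumes i: "integrable lborel (\<lambda>p. g (snd p) *\<^sub>R f (fst p))" and g: "integrable lborel g"
 shows "(LINT p|lborel. g (snd p) *\<^sub>R f (fst p)) = (LINT t|lborel. g t) *\<^sub>R (LINT Y|lborel. f Y)"
proof -
 have "(LINT p|lborel. g (snd p) *\<^sub>R f (fst p)) = (LINT Y|lborel. (LINT t|lborel. g t *\<^sub>R f Y))"
  using lborel_pair.integral_fst'[of "\<lambda>p. g (snd p) *\<^sub>R f (fst p)"] i unfolding lborel_prod by simp
 also have "\<dots> = (LINT t|lborel. g t) *\<^sub>R (LINT Y|lborel. f Y)" using g by simp
 finally show ?thesis .
qed

context edge
begin

lemma zt_rot2: "zt s (rot2 th X Y) = cis th * Complex (X + s) Y" by (simp add: zt_def cplx_rot2 complex_eq_iff algebra_simps)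

lemma ell_rot2_face: "lev (rot2 th (\<bar>Y\<bar> * cot be) Y) = 0" using ell_face[of "(Y, 0)"] by (simp add: face_def)

lemma Complex_face_lower:
 "kap <= norm (Complex (\<bar>Y\<bar> * cot be + 1) Y)" "kap * \<bar>Y\<bar> <= norm (Complex (\<bar>Y\<bar> * cot be + 1) Y)"
proof -
 let ?y = "rot2 th (\<bar>Y\<bar> * cot be) Y"
 have n: "norm (Complex (\<bar>Y\<bar> * cot be + 1) Y) = norm (zt 1 ?y)" by (simp add: zt_rot2 norm_mult)
 show "kap <= norm (Complex (\<bar>Y\<bar> * cot be + 1) Y)" unfolding n using zt_lower(3)[of ?y 1] ell_rot2_face by simp
 have "kap * \<bar>Y\<bar> <= kap * norm ?y" using abs_cY_le[of th ?y] kap(1) by (intro mult_left_mono) auto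
 then show "kap * \<bar>Y\<bar> <= norm (Complex (\<bar>Y\<bar> * cot be + 1) Y)" unfolding n using zt_lower(2)[of ?y 1] ell_rot2_face by simp
qed

text \<open>This is the kernel at s = 1 on the faces, up to the rotation \<open>cis th\<close>. Each
  face is a half line, on which the denominator is 1 plus a multiple of the parameter, with slope
  cot be + i or, after reflection, cot be - i.\<close>

lemma face_profile_integral:
 shows "integrable lborel (\<lambda>Y. inverse (Complex (\<bar>Y\<bar> * cot be + 1) Y) ^ 2)"
  and "(LINT Y|lborel. inverse (Complex (\<bar>Y\<bar> * cot be + 1) Y) ^ 2) =
   inverse (Complex (cot be) 1) + inverse (Complex (cot be) (- 1))"
proof -
 let ?f = "\<lambda>a Y. indicator {0..} Y *\<^sub>R inverse (1 + a * complex_of_real Y) ^ 2"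
 let ?a = "Complex (cot be) 1" and ?b = "Complex (cot be) (- 1)"
 have ea: "1 + ?a * of_real Y = Complex (\<bar>Y\<bar> * cot be + 1) Y" and eb: "1 + ?b * of_real Y = Complex (\<bar>-Y\<bar> * cot be + 1) (-Y)"
  if "Y >= 0" for Y using that by (simp_all add: complex_eq_iff)
 have ka: "kap <= norm (1 + ?a * of_real Y)" "kap * Y <= norm (1 + ?a * of_real Y)"
  and kb: "kap <= norm (1 + ?b * of_real Y)" "kap * Y <= norm (1 + ?b * of_real Y)" if "Y >= 0" for Y
  unfolding ea[OF that] eb[OF that] using Complex_face_lower[of Y] Complex_face_lower[of "-Y"] that by auto
 note A = half_line_integral[OF kap(1) ka] and B = half_line_integral[OF kap(1) kb]
 have iB: "integrable lborel (\<lambda>Y. ?f ?b (- Y))" using lborel_integrable_real_affine[OF B(1), of "-1" 0] by simp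
 have eB: "(LINT Y|lborel. ?f ?b (- Y)) = inverse ?b" using lborel_integral_real_affine[of "-1" "?f ?b" 0] B(2) by simp
 have ae: "AE Y in lborel. ?f ?a Y + ?f ?b (- Y) = inverse (Complex (\<bar>Y\<bar> * cot be + 1) Y) ^ 2" using AE_lborel_singleton[of 0]
 proof eventually_elim
  case (elim Y)
  then show ?case using ea[of Y] eb[of "-Y"] by (cases "Y > 0") auto
 qed
 have m: "(\<lambda>Y. inverse (Complex (\<bar>Y\<bar> * cot be + 1) Y) ^ 2) \<in> borel_measurable lborel"
 proof -
  have "continuous_on UNIV (\<lambda>Y. inverse (Complex (\<bar>Y\<bar> * cot be + 1) Y) ^ 2)" unfolding Complex_eq
  proof (intro continuous_intros ballI)
   fix Y :: real
   show "complex_of_real (\<bar>Y\<bar> * cot be + 1) + \<i> * complex_of_real Y ~= 0"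
    using Complex_face_lower(1)[of Y] kap(1) unfolding Complex_eq by auto
  qed
  then show ?thesis using borel_measurable_continuous_onI by simp
 qed
 show "integrable lborel (\<lambda>Y. inverse (Complex (\<bar>Y\<bar> * cot be + 1) Y) ^ 2)"
  using integrable_cong_AE_imp[OF Bochner_Integration.integrable_add[OF A(1) iB] m] ae by (auto elim: eventually_mono)
 have "(LINT Y|lborel. inverse (Complex (\<bar>Y\<bar> * cot be + 1) Y) ^ 2) = (LINT Y|lborel. (?f ?a Y + ?f ?b (- Y)))"
  using ae borel_measurable_integrable[OF Bochner_Integration.integrable_add[OF A(1) iB]] m by (intro integral_cong_AE) (auto elim: eventually_mono)
 also have "\<dots> = inverse ?a + inverse ?b" by (rule trans[OF Bochner_Integration.integral_add[OF A(1) iB] arg_cong2[where f = "(+)", OF A(2) eB]])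
 finally show "(LINT Y|lborel. inverse (Complex (\<bar>Y\<bar> * cot be + 1) Y) ^ 2) = inverse ?a + inverse ?b" .
qed

text \<open>The faces are cones, so replacing Y by s Y turns s times the integral of the inverse
  square into an integral free of s, except that the cutoff is evaluated at a point tending to 0,
  where it equals 1.\<close>

lemma face_limit:
 fixes \<eta> :: "real^2 => real" and p3 :: "real => real"
 assumes \<eta>: "continuous_on UNIV \<eta>" "!!y. 0 <= \<eta> y" "!!y. \<eta> y <= 1" "!!y. \<eta> y ~= 0 ==> norm y < r" "\<eta> 0 = 1"
  and p3: "continuous_on UNIV p3" "!!t. p3 t ~= 0 ==> \<bar>t\<bar> < M"
  and s: "!!n. s n > 0" "s \<longlonglongrightarrow> 0"
 shows "(\<lambda>n. of_real (s n) * (LINT p|lborel. (\<eta> (proj2 (fac p)) * p3 (snd p)) *\<^sub>R inverse (zt (s n) (proj2 (fac p))) ^ 2))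
  \<longlonglongrightarrow> of_real (LINT t|lborel. p3 t) * (inverse (cis th) ^ 2 * (inverse (Complex (cot be) 1) + inverse (Complex (cot be) (- 1))))"
proof -
 let ?y = "\<lambda>Y. rot2 th (\<bar>Y\<bar> * cot be) Y"
 let ?p = "\<lambda>Y. inverse (Complex (\<bar>Y\<bar> * cot be + 1) Y) ^ 2"
 define k where "k s Y = \<eta> (?y Y) *\<^sub>R inverse (zt s (?y Y)) ^ 2" for s Y
 have cy: "continuous_on UNIV ?y" by (intro continuous_intros)
 have cz: "continuous_on UNIV (\<lambda>Y. zt s (?y Y))" for s by (rule continuous_on_compose2[OF smooth_continuous[OF smooth_zt] cy]) auto
 have ck: "continuous_on UNIV (k s)" if "s > 0" for s unfolding k_def using zt_pos(1)[of "?y Y" s for Y] ell_rot2_face that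
  by (intro continuous_on_scaleR continuous_on_power continuous_on_inverse cz
    continuous_on_compose2[OF \<eta>(1) cy]) auto
 have i3: "integrable lborel p3" by (rule integrable_continuous_bounded_support[OF p3(1), of M]) (use p3(2) in force)
 have kz: "k s Y = 0" if "\<bar>Y\<bar> >= r" for s Y
 proof -
  have "norm (?y Y) >= r" using abs_cY_le[of th "?y Y"] that by simp
  then have "\<eta> (?y Y) = 0" using \<eta>(4)[of "?y Y"] by auto
  then show ?thesis by (simp add: k_def)
 qed
 have prod: "(LINT p|lborel. (\<eta> (proj2 (fac p)) * p3 (snd p)) *\<^sub>R inverse (zt s (proj2 (fac p))) ^ 2) =
   (LINT t|lborel. p3 t) *\<^sub>R (LINT Y|lborel. k s Y)" if "s > 0" for s
 proof -
  have "integrable lborel (\<lambda>p. p3 (snd p) *\<^sub>R k s (fst p))"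
  proof (rule integrable_continuous_bounded_support[of _ "\<bar>r\<bar> + M"])
   show "continuous_on UNIV (\<lambda>p. p3 (snd p) *\<^sub>R k s (fst p))"
    by (intro continuous_on_scaleR continuous_on_compose2[OF p3(1)] continuous_on_compose2[OF ck[OF that]] continuous_intros) auto
   show "p3 (snd p) *\<^sub>R k s (fst p) = 0" if p: "norm p > \<bar>r\<bar> + M" for p
   proof -
    have "norm p <= \<bar>fst p\<bar> + \<bar>snd p\<bar>" using norm_Pair_le[of "fst p" "snd p"] by simp
    then have "\<bar>fst p\<bar> >= r \<or> \<not> \<bar>snd p\<bar> < M" using p by linarith
    then show ?thesis using kz[of "fst p" s] p3(2)[of "snd p"] by auto
   qed
  qed
  from lborel_product_integral[OF this i3] show ?thesis by (simp add: face_def k_def mult.commute)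
 qed
 have scale: "of_real s * (LINT Y|lborel. k s Y) = inverse (cis th) ^ 2 * (LINT Y|lborel. \<eta> (s *\<^sub>R ?y Y) *\<^sub>R ?p Y)" if s: "s > 0" for s
 proof -
  have e: "of_real s * (of_real s * k s (s * Y)) = inverse (cis th) ^ 2 * (\<eta> (s *\<^sub>R ?y Y) *\<^sub>R ?p Y)" for Y
  proof -
   have y: "?y (s * Y) = s *\<^sub>R ?y Y" using s by (simp add: vec_eq_iff forall_2 abs_mult algebra_simps)
   have z: "zt s (s *\<^sub>R ?y Y) = of_real s * (cis th * Complex (\<bar>Y\<bar> * cot be + 1) Y)"
    unfolding y[symmetric] zt_rot2 using s by (simp add: complex_eq_iff abs_mult algebra_simps)
   show ?thesis unfolding k_def y z using s by (simp add: scaleR_conv_of_real power2_eq_square field_simps)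
  qed
  have "(LINT Y|lborel. k s Y) = s *\<^sub>R (LINT Y|lborel. k s (s * Y))" using lborel_integral_real_affine[of s "k s" 0] s by simp
  then have "of_real s * (LINT Y|lborel. k s Y) = (LINT Y|lborel. of_real s * (of_real s * k s (s * Y)))" by (simp add: scaleR_conv_of_real)
  then show ?thesis unfolding e by (simp only: integral_mult_right_zero)
 qed
 have lim: "(\<lambda>n. LINT Y|lborel. \<eta> (s n *\<^sub>R ?y Y) *\<^sub>R ?p Y) \<longlonglongrightarrow> (LINT Y|lborel. ?p Y)"
 proof (rule integral_dominated_convergence)
  show "integrable lborel (\<lambda>Y. norm (?p Y))" by (rule integrable_norm[OF face_profile_integral(1)])
  show mp: "?p \<in> borel_measurable lborel" by (rule borel_measurable_integrable[OF face_profile_integral(1)])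
  show "(\<lambda>Y. \<eta> (s n *\<^sub>R ?y Y) *\<^sub>R ?p Y) \<in> borel_measurable lborel" for n
  proof -
   have "continuous_on UNIV (\<lambda>Y. \<eta> (s n *\<^sub>R ?y Y))" by (rule continuous_on_compose2[OF \<eta>(1)]) (auto intro!: continuous_intros)
   then show ?thesis using mp borel_measurable_continuous_onI by (intro borel_measurable_scaleR) auto
  qed
  show "AE Y in lborel. norm (\<eta> (s n *\<^sub>R ?y Y) *\<^sub>R ?p Y) <= norm (?p Y)" for n
   unfolding norm_scaleR using \<eta>(2,3) by (intro AE_I2 mult_left_le_one_le) auto
  show "AE Y in lborel. (\<lambda>n. \<eta> (s n *\<^sub>R ?y Y) *\<^sub>R ?p Y) \<longlonglongrightarrow> ?p Y"
  proof (intro AE_I2)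
   fix Y
   have "(\<lambda>n. s n *\<^sub>R ?y Y) \<longlonglongrightarrow> 0 *\<^sub>R ?y Y" by (intro tendsto_intros s)
   then have "(\<lambda>n. \<eta> (s n *\<^sub>R ?y Y)) \<longlonglongrightarrow> \<eta> (0 *\<^sub>R ?y Y)"
    using \<eta>(1) by (intro continuous_on_tendsto_compose[OF \<eta>(1)]) auto
   from tendsto_scaleR[OF this tendsto_const[of "?p Y"]]
   show "(\<lambda>n. \<eta> (s n *\<^sub>R ?y Y) *\<^sub>R ?p Y) \<longlonglongrightarrow> ?p Y" by (simp add: \<eta>(5))
  qed
 qed
 have "(\<lambda>n. of_real (LINT t|lborel. p3 t) * (inverse (cis th) ^ 2 * (LINT Y|lborel. \<eta> (s n *\<^sub>R ?y Y) *\<^sub>R ?p Y))) \<longlonglongrightarrow>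
  of_real (LINT t|lborel. p3 t) * (inverse (cis th) ^ 2 * (LINT Y|lborel. ?p Y))" by (intro tendsto_intros lim)
 then show ?thesis unfolding face_profile_integral(2) prod[OF s(1)] scale[OF s(1), symmetric] by (simp add: scaleR_conv_of_real mult_ac)
qed

end

lemma set_integrable_dominated:
 fixes g :: "'a => 'b::{banach, second_countable_topology}" and q :: "'a => 'c::{banach, second_countable_topology}"
 assumes g: "set_integrable N S g" and q: "(\<lambda>x. indicator S x *\<^sub>R q x) \<in> borel_measurable N"
  and B: "!!x. x \<in> S ==> norm (q x) <= B * norm (g x)"
 shows "set_integrable N S q" unfolding set_integrable_def
proof (rule Bochner_Integration.integrable_bound[OF _ q])
 show "integrable N (\<lambda>x. B *\<^sub>R norm (indicator S x *\<^sub>R g x))"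
  using g unfolding set_integrable_def by (intro integrable_scaleR_right integrable_norm)
 show "AE x in N. norm (indicator S x *\<^sub>R q x) <= norm (B *\<^sub>R norm (indicator S x *\<^sub>R g x))"
 proof (intro AE_I2)
  fix x show "norm (indicator S x *\<^sub>R q x) <= norm (B *\<^sub>R norm (indicator S x *\<^sub>R g x))"
   using order_trans[OF B[of x] abs_ge_self] by (cases "x \<in> S") (auto simp: abs_mult)
 qed
qed

context edge
begin

lemma cX_e2': "cplx (proj2 (e3 th)) = cis th" by (simp add: e3_def cplx_e2)

lemma continuous_on_zt: "continuous_on S (\<lambda>x. zt s (proj2 x))"
 by (rule continuous_on_compose2[OF smooth_continuous[OF smooth_zt]]) (auto intro!: continuous_intros)

lemma continuous_on_zt_power:
 assumes "s > 0" shows "continuous_on {x. lev (proj2 x) >= 0} (\<lambda>x. inverse (zt s (proj2 x)) ^ k)"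
 using zt_pos(1)[OF _ assms] by (intro continuous_intros continuous_on_zt) auto

text \<open>The factor \<open>s\<close> is paid for by one power of the kernel: s times the inverse
  third power is bounded by a multiple of 1/|y|^2, uniformly in s.\<close>

lemma zt_power_bounds:
 assumes "lev y >= 0" "s > 0"
 shows "norm (inverse (zt s y) ^ k) <= inverse (kap * s) ^ k"
  and "y ~= 0 ==> norm (inverse (zt s y) ^ k) <= inverse (kap * norm y) ^ k"
  and "y ~= 0 ==> norm (of_real s * inverse (zt s y) ^ Suc k) <= inverse kap * inverse (kap * norm y) ^ k"
proof -
 have 1: "inverse (norm (zt s y)) <= inverse (kap * s)" using zt_lower(3)[of y s] assms kap(1) by (intro le_imp_inverse_le) auto
 have 2: "inverse (norm (zt s y)) <= inverse (kap * norm y)" if "y ~= 0"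
  using zt_lower(2)[of y s] assms kap(1) that by (intro le_imp_inverse_le) auto
 show "norm (inverse (zt s y) ^ k) <= inverse (kap * s) ^ k" unfolding norm_power norm_inverse by (intro power_mono 1) simp
 show 3: "norm (inverse (zt s y) ^ k) <= inverse (kap * norm y) ^ k" if "y ~= 0"
  unfolding norm_power norm_inverse by (intro power_mono 2 that) simp
 assume y: "y ~= 0"
 have "norm (of_real s * inverse (zt s y) ^ Suc k) = (s * inverse (norm (zt s y))) * norm (inverse (zt s y) ^ k)"
  using assms by (simp add: norm_mult norm_inverse norm_power)
 also have "\<dots> <= (s * inverse (kap * s)) * inverse (kap * norm y) ^ k" using 1 3[OF y] assms kap(1) by (intro mult_mono mult_left_mono) auto
 also have "s * inverse (kap * s) = inverse kap" using assms by simp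
 finally show "norm (of_real s * inverse (zt s y) ^ Suc k) <= inverse kap * inverse (kap * norm y) ^ k" .
qed

lemma zt_power_measurable:
 assumes "s > 0" shows "(\<lambda>x. indicator (Sol h) x *\<^sub>R inverse (zt s (proj2 x)) ^ k) \<in> borel_measurable lebesgue"
proof -
 have "(\<lambda>x. indicator (Sol h) x *\<^sub>R inverse (zt s (proj2 x)) ^ k) \<in> borel_measurable borel"
  using open_Sol by (intro borel_measurable_continuous_on_indicator continuous_on_subset[OF continuous_on_zt_power[OF assms]])
   (auto simp: in_Sol)
 then show ?thesis by (simp add: measurable_completion)
qed

lemma set_integrable_zt_power_mult:
 assumes s: "s > 0" and g: "Sintegrable g"
 shows "Sintegrable (\<lambda>x. inverse (zt s (proj2 x)) ^ k * g x)"
proof (rule set_integrable_dominated[OF g, where B = "inverse (kap * s) ^ k"])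
 have "(\<lambda>x. (indicator (Sol h) x *\<^sub>R inverse (zt s (proj2 x)) ^ k) * (indicator (Sol h) x *\<^sub>R g x)) \<in> borel_measurable lebesgue"
  using g unfolding set_integrable_def by (intro borel_measurable_times zt_power_measurable s borel_measurable_integrable)
 then show "(\<lambda>x. indicator (Sol h) x *\<^sub>R (inverse (zt s (proj2 x)) ^ k * g x)) \<in> borel_measurable lebesgue"
  by (rule measurable_cong[THEN iffD1, rotated]) (simp add: indicator_def)
 show "norm (inverse (zt s (proj2 x)) ^ k * g x) <= inverse (kap * s) ^ k * norm (g x)" if "x \<in> Sol h" for x
  unfolding norm_mult using that s by (intro mult_right_mono zt_power_bounds) (auto simp: in_Sol)
qed

lemma set_integrable_const_Sol: "Sintegrable (\<lambda>x. c :: 'b::euclidean_space)"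
 unfolding set_integrable_def using emeasure_Sol[of h] open_Sol[of h]
 by (intro integrable_scaleR_left integrable_indicator) (auto simp: top.not_eq_extremum)

lemma set_integrable_zt_power: "s > 0 ==> Sintegrable (\<lambda>x. inverse (zt s (proj2 x)) ^ k)"
 using set_integrable_zt_power_mult[OF _ set_integrable_const_Sol[of 1]] by simp

lemma radial_dominated_limit:
 fixes g :: "nat => real^3 => complex"
 assumes m: "!!n. Sintegrable (g n)" and a: "a > 0"
  and b: "!!n x. x \<in> Sol h ==> norm (g n x) <= C * (norm (proj2 x) powr a / (norm (proj2 x))\<^sup>2)"
  and l: "!!x. x \<in> Sol h ==> (\<lambda>n. g n x) \<longlonglongrightarrow> 0"
 shows "(\<lambda>n. SINT x. g n x) \<longlonglongrightarrow> 0"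
proof -
 let ?w = "\<lambda>x. \<bar>C\<bar> * (indicator (Cyl h) x * (norm (proj2 x) powr a / (norm (proj2 x))\<^sup>2))"
 have "(\<lambda>n. LINT x|lebesgue. indicator (Sol h) x *\<^sub>R g n x) \<longlonglongrightarrow> (LINT x|(lebesgue :: (real^3) measure). 0 :: complex)"
 proof (rule integral_dominated_convergence[where w = ?w])
  show "integrable lebesgue ?w" by (intro integrable_mult_right radial_integrable a)
  show "(\<lambda>x. indicator (Sol h) x *\<^sub>R g n x) \<in> borel_measurable lebesgue" for n
   using m[of n] unfolding set_integrable_def by (rule borel_measurable_integrable)
  show "AE x in lebesgue. norm (indicator (Sol h) x *\<^sub>R g n x) <= ?w x" for n
  proof (intro AE_I2)
   fix x
   show "norm (indicator (Sol h) x *\<^sub>R g n x) <= ?w x"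
   proof (cases "x \<in> Sol h")
    case True
    have "norm (g n x) <= \<bar>C\<bar> * (norm (proj2 x) powr a / (norm (proj2 x))\<^sup>2)"
     by (rule order_trans[OF b[OF True]]) (intro mult_right_mono, auto)
    then show ?thesis using True Sol_subset_Cyl[of h] by auto
   qed simp
  qed
  show "AE x in lebesgue. (\<lambda>n. indicator (Sol h) x *\<^sub>R g n x) \<longlonglongrightarrow> 0"
  proof (intro AE_I2)
   fix x show "(\<lambda>n. indicator (Sol h) x *\<^sub>R g n x) \<longlonglongrightarrow> 0" using l[of x] by (cases "x \<in> Sol h") auto
  qed
 qed simp
 then show ?thesis by (simp add: set_lebesgue_integral_def)
qed

text \<open>Along the bisector the inverse square has derivative -2 \<open>cis th\<close> times the
  inverse cube. Integration by parts therefore leaves the face integral treated in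
  \<open>face_limit\<close> and a term with the derivative of the cutoff; after multiplication by s
  the latter is dominated by a multiple of 1/|y| and tends to 0.\<close>

lemma cone_limit:
 fixes \<eta> :: "real^2 => real" and p3 :: "real => real"
 assumes \<eta>: "continuous_on UNIV \<eta>" "!!y. 0 <= \<eta> y" "!!y. \<eta> y <= 1" "!!y. \<eta> y ~= 0 ==> norm y < r" "\<eta> 0 = 1"
  and p3: "continuous_on UNIV p3" "!!t. p3 t ~= 0 ==> \<bar>t\<bar> < M"
  and A: "test_fun (Cyl h) (\<lambda>x. \<eta> (proj2 x) * p3 (x $ 3))"
  and s: "!!n. s n > 0" "s \<longlonglongrightarrow> 0"
 shows "(\<lambda>n. of_real (s n) * (SINT x. (\<eta> (proj2 x) * p3 (x $ 3)) *\<^sub>R inverse (zt (s n) (proj2 x)) ^ 3))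
  \<longlonglongrightarrow> of_real (LINT t|lborel. p3 t) *
   (inverse (cis th) ^ 3 / 2 * (inverse (Complex (cot be) 1) + inverse (Complex (cot be) (- 1))))"
proof -
 define A where "A x = \<eta> (proj2 x) * p3 (x $ 3)" for x
 have tA: "test_fun (Cyl h) A" using A by (simp add: A_def[abs_def])
 let ?dA = "dir_deriv (e3 th) A"
 note tdA = test_fun_dir_deriv[OF tA, of "e3 th"]
 obtain B where B: "B > 0" "!!x. \<bar>?dA x\<bar> <= B" by (rule test_fun_bounded[OF tdA]) blast
 let ?v = "\<lambda>s k x. inverse (zt s (proj2 x)) ^ k"
 let ?I = "\<lambda>s. SINT x. A x *\<^sub>R ?v s 3 x"
 let ?J = "\<lambda>s. SINT x. ?dA x *\<^sub>R ?v s 2 x"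
 let ?E = "\<lambda>s. LINT p|lborel. A (fac p) *\<^sub>R ?v s 2 (fac p)"
 have parts: "2 * cis th * ?I s = ?J s + ?E s" if s: "s > 0" for s
 proof -
  let ?f' = "\<lambda>x. (- 2 * cis th) * ?v s 3 x"
  have i1: "Sintegrable (\<lambda>x. ?dA x *\<^sub>R ?v s 2 x)" by (rule integrable_test_mult[OF set_integrable_zt_power[OF s] tdA])
  have i2: "Sintegrable (\<lambda>x. A x *\<^sub>R ?v s 3 x)" by (rule integrable_test_mult[OF set_integrable_zt_power[OF s] tA])
  have e: "A x *\<^sub>R ?f' x = (- 2 * cis th) * (A x *\<^sub>R ?v s 3 x)" for x by simp
  have i3: "Sintegrable (\<lambda>x. A x *\<^sub>R ?f' x)" unfolding e by (rule set_integrable_bounded_linear[OF bounded_linear_mult_right i2])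
  have "(SINT x. ?dA x *\<^sub>R ?v s 2 x + A x *\<^sub>R ?f' x) = - ?E s"
  proof (rule face_integration_by_parts(2)[OF tA,
     where D = "\<lambda>x b. - of_nat 2 * inverse (zt s (proj2 x)) ^ Suc 2 * cplx (proj2 b)"
      and B = "inverse (kap * s) ^ 2 + 2 * inverse (kap * s) ^ 3"])
   have n: "0 <= inverse (kap * s) ^ k" for k using kap(1) s by simp
   show "continuous_on ({x. 0 <= lev (proj2 x)} \<inter> Cyl h) (?v s 2)" by (rule continuous_on_subset[OF continuous_on_zt_power[OF s]]) auto
   show "(?v s 2 has_derivative (\<lambda>b. - of_nat 2 * inverse (zt s (proj2 x)) ^ Suc 2 * cplx (proj2 b))) (at x)" if "x \<in> Sol h" for x
    using that s by (intro zt_power_derivative zt_pos(1)) (auto simp: in_Sol)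
   show "- of_nat 2 * inverse (zt s (proj2 x)) ^ Suc 2 * cplx (proj2 (e3 th)) = ?f' x" for x unfolding cX_e2' by (simp add: eval_nat_numeral)
   show "continuous_on (Sol h) ?f'"
    by (intro continuous_on_mult continuous_on_const continuous_on_subset[OF continuous_on_zt_power[OF s]]) (auto simp: in_Sol)
   fix x assume "x \<in> Sol h"
   then have l: "0 <= lev (proj2 x)" by (simp add: in_Sol)
   show "norm (?v s 2 x) <= inverse (kap * s) ^ 2 + 2 * inverse (kap * s) ^ 3" using zt_power_bounds(1)[OF l s, of 2] n[of 3] by linarith
   have "norm (?f' x) = 2 * norm (?v s 3 x)" by (simp add: norm_mult)
   then show "norm (?f' x) <= inverse (kap * s) ^ 2 + 2 * inverse (kap * s) ^ 3" using zt_power_bounds(1)[OF l s, of 3] n[of 2] by linarith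
  qed
  moreover have "(SINT x. ?dA x *\<^sub>R ?v s 2 x + A x *\<^sub>R ?f' x) = ?J s + (SINT x. A x *\<^sub>R ?f' x)"
   by (rule set_integral_add(2)[OF i1 i3])
  moreover have "(SINT x. A x *\<^sub>R ?f' x) = (- 2 * cis th) * ?I s"
   unfolding e by (rule set_integral_bounded_linear[OF bounded_linear_mult_right i2])
  ultimately show ?thesis by (simp add: algebra_simps add_eq_0_iff)
 qed
 have J: "(\<lambda>n. of_real (s n) * ?J (s n)) \<longlonglongrightarrow> 0"
 proof -
  let ?g = "\<lambda>n x. of_real (s n) * (?dA x *\<^sub>R ?v (s n) 2 x)"
  have i1: "Sintegrable (\<lambda>x. ?dA x *\<^sub>R ?v (s n) 2 x)" for n by (rule integrable_test_mult[OF set_integrable_zt_power[OF s(1)] tdA])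
  have e: "of_real (s n) * ?J (s n) = (SINT x. ?g n x)" for n by (rule set_integral_bounded_linear[OF bounded_linear_mult_right i1, symmetric])
  show ?thesis unfolding e
  proof (rule radial_dominated_limit[where a = 1 and C = "B * inverse kap ^ 2"])
   show "Sintegrable (?g n)" for n by (rule set_integrable_bounded_linear[OF bounded_linear_mult_right i1])
   fix x assume "x \<in> Sol h"
   then have l: "0 <= lev (proj2 x)" "proj2 x ~= 0" by (auto simp: in_Sol)
   show "norm (?g n x) <= B * inverse kap ^ 2 * (norm (proj2 x) powr 1 / (norm (proj2 x))\<^sup>2)" for n
   proof -
    have "norm (?g n x) = \<bar>?dA x\<bar> * norm (of_real (s n) * ?v (s n) (Suc 1) x)" by (simp add: norm_mult norm_power power2_eq_square)
    also have "\<dots> <= B * (inverse kap * inverse (kap * norm (proj2 x)) ^ 1)" using B l by (intro mult_mono zt_power_bounds(3) s) auto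
    also have "\<dots> = B * inverse kap ^ 2 * (norm (proj2 x) powr 1 / (norm (proj2 x))\<^sup>2)"
     using l kap(1) by (simp add: power2_eq_square field_simps)
    finally show ?thesis .
   qed
   show "(\<lambda>n. ?g n x) \<longlonglongrightarrow> 0"
   proof (rule Lim_null_comparison)
    show "\<forall>\<^sub>F n in sequentially. norm (?g n x) <= s n * (B * inverse (kap * norm (proj2 x)) ^ 2)"
    proof (intro always_eventually allI)
     fix n
     have "norm (?g n x) = s n * (\<bar>?dA x\<bar> * norm (?v (s n) 2 x))" using s(1)[of n] by (simp add: norm_mult)
     also have "\<dots> <= s n * (B * inverse (kap * norm (proj2 x)) ^ 2)"
      using B l s(1)[of n] by (intro mult_left_mono mult_mono zt_power_bounds(2)) auto
     finally show "norm (?g n x) <= s n * (B * inverse (kap * norm (proj2 x)) ^ 2)" .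
    qed
    show "(\<lambda>n. s n * (B * inverse (kap * norm (proj2 x)) ^ 2)) \<longlonglongrightarrow> 0" by (rule tendsto_mult_left_zero[OF s(2)])
   qed
  qed simp
 qed
 let ?L = "inverse (Complex (cot be) 1) + inverse (Complex (cot be) (- 1))"
 have E: "(\<lambda>n. of_real (s n) * ?E (s n)) \<longlonglongrightarrow> of_real (LINT t|lborel. p3 t) * (inverse (cis th) ^ 2 * ?L)"
  using face_limit[OF \<eta> p3 s] by (simp add: A_def face_def)
 have "(\<lambda>n. (inverse (cis th) / 2) * (of_real (s n) * ?J (s n) + of_real (s n) * ?E (s n))) \<longlonglongrightarrow>
   (inverse (cis th) / 2) * (0 + of_real (LINT t|lborel. p3 t) * (inverse (cis th) ^ 2 * ?L))" by (intro tendsto_intros J E)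
 moreover have "(inverse (cis th) / 2) * (of_real (s n) * ?J (s n) + of_real (s n) * ?E (s n)) = of_real (s n) * ?I (s n)" for n
 proof -
  have "(inverse (cis th) / 2) * (of_real (s n) * ?J (s n) + of_real (s n) * ?E (s n)) =
    (inverse (cis th) / 2) * (of_real (s n) * (2 * cis th * ?I (s n)))" unfolding parts[OF s(1)] by (simp add: distrib_left)
  also have "\<dots> = (inverse (cis th) * cis th) * (of_real (s n) * ?I (s n))" by (simp add: mult_ac)
  also have "inverse (cis th) * cis th = 1" by (rule left_inverse) (rule cis_neq_zero)
  finally show ?thesis by simp
 qed
 ultimately show ?thesis by (simp add: A_def[symmetric] power3_eq_cube power2_eq_square mult_ac)
qed

text \<open>The sum is 2 cot be / (cot be^2 + 1) = sin (2 be), the sine of the opening angle. For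
  the opening angle pi the contributions of the two faces would cancel.\<close>

lemma profile_constant_nz: "inverse (Complex (cot be) 1) + inverse (Complex (cot be) (- 1)) ~= 0"
proof -
 have c: "cot be ~= 0" using cos_be sin_be by (simp add: cot_def)
 have "inverse (Complex (cot be) 1) + inverse (Complex (cot be) (- 1)) = of_real (2 * cot be / ((cot be)\<^sup>2 + 1))"
  by (simp add: complex_eq_iff)
 moreover have "(cot be)\<^sup>2 + 1 ~= 0" by (metis add_pos_nonneg add.commute zero_le_power2 zero_less_one less_irrefl)
 ultimately show ?thesis using c by (simp only: of_real_eq_0_iff divide_eq_0_iff mult_eq_0_iff) simp
qed

text \<open>The dimension reduction operator with its window absorbed into the support of the
  weight; integration runs over the whole line.\<close>

definition Rop :: "(real => real) => (real^3 => 'b::euclidean_space) => real^2 => 'b"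
 where "Rop p3 p y = (LINT t|lebesgue. p3 t *\<^sub>R p (join3 y t))"

lemma test_fun_axis:
 assumes "test_fun {-M<..<M} p3"
 shows "smooth (\<lambda>x :: real^3. p3 (x $ 3))" "p3 t ~= 0 ==> \<bar>t\<bar> < M" "continuous_on UNIV p3"
proof -
 show "smooth (\<lambda>x :: real^3. p3 (x $ 3))" by (rule smooth_compose[OF smooth_linear[OF bounded_linear_vec_nth] test_funD(1)[OF assms]])
 show "\<bar>t\<bar> < M" if "p3 t ~= 0" using test_funD(5)[OF assms, of t] that by (cases "t \<in> {-M<..<M}") (auto simp: abs_less_iff)
 show "continuous_on UNIV p3" by (rule smooth_continuous[OF test_funD(1)[OF assms]])
qed

lemma Rop_section:
 assumes "test_fun {-M<..<M} p3"
 shows "indicator (Sol rh) (join3 y t) *\<^sub>R (p3 t *\<^sub>R p) = indicator (Sect rh) y *\<^sub>R (p3 t *\<^sub>R (p :: 'b::euclidean_space))"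
proof (cases "p3 t = 0")
 case False
 then have "join3 y t \<in> Sol rh \<longleftrightarrow> y \<in> Sect rh" using test_fun_axis(2)[OF assms] by (auto simp: in_Sol Sect_def)
 then show ?thesis by (simp add: indicator_def)
qed simp

lemma Rop_integrand:
 fixes p :: "real^3 => 'b::euclidean_space"
 assumes p: "set_integrable lebesgue (Sol rh) p" and p3: "test_fun {-M<..<M} p3"
 shows "integrable lebesgue (\<lambda>x. indicator (Sol rh) x *\<^sub>R (p3 (x $ 3) *\<^sub>R p x))"
proof -
 obtain B where B: "B > 0" "!!t. \<bar>p3 t\<bar> <= B" by (rule test_fun_bounded[OF p3]) blast
 have "set_integrable lebesgue (Sol rh) (\<lambda>x. p3 (x $ 3) *\<^sub>R p x)"
 proof (rule set_integrable_dominated[OF p, where B = B])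
  have "(\<lambda>x. p3 (x $ 3) *\<^sub>R (indicator (Sol rh) x *\<^sub>R p x)) \<in> borel_measurable lebesgue"
   using p unfolding set_integrable_def
   by (intro borel_measurable_scaleR smooth_measurable_lebesgue test_fun_axis[OF p3] borel_measurable_integrable)
  then show "(\<lambda>x. indicator (Sol rh) x *\<^sub>R (p3 (x $ 3) *\<^sub>R p x)) \<in> borel_measurable lebesgue" by (simp add: mult.commute)
 qed (use B in \<open>auto intro: mult_right_mono\<close>)
 then show ?thesis unfolding set_integrable_def .
qed

lemma Rop_sections:
 fixes p :: "real^3 => 'b::euclidean_space"
 assumes p: "Sintegrable p" and p3: "test_fun {-M<..<M} p3"
 shows "AE y in lebesgue. y \<in> Sect h \<longrightarrow> integrable lebesgue (\<lambda>t. p3 t *\<^sub>R p (join3 y t))"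
  and "integrable lebesgue (\<lambda>y. indicator (Sect h) y *\<^sub>R Rop p3 p y)"
  and "(\<lambda>y. indicator (Sect h) y *\<^sub>R (Rop p3 p y - ka)) \<in> borel_measurable lebesgue"
proof -
 note F = fubini_join3(1,2)[OF Rop_integrand[OF p p3], unfolded join3_nth Rop_section[OF p3]]
 show "AE y in lebesgue. y \<in> Sect h \<longrightarrow> integrable lebesgue (\<lambda>t. p3 t *\<^sub>R p (join3 y t))"
  using F(1) by eventually_elim auto
 show i: "integrable lebesgue (\<lambda>y. indicator (Sect h) y *\<^sub>R Rop p3 p y)" using F(2) by (simp only: Rop_def integral_scaleR_right)
 have "(\<lambda>y. indicator (Sect h) y *\<^sub>R ka) \<in> borel_measurable lebesgue"
  using open_Sect[of h] by (intro borel_measurable_scaleR borel_measurable_indicator) auto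
 with borel_measurable_integrable[OF i]
 show "(\<lambda>y. indicator (Sect h) y *\<^sub>R (Rop p3 p y - ka)) \<in> borel_measurable lebesgue"
  unfolding scaleR_diff_right by (rule borel_measurable_diff)
qed

text \<open>Kernel and planar cutoff do not depend on the third coordinate, so Fubini's theorem
  leaves a planar integral against the reduced field.\<close>

lemma section_integral:
 fixes g :: "real^3 => complex" and \<eta> :: "real^2 => real" and p3 :: "real => real"
 assumes i: "Sintegrable (\<lambda>x. (\<eta> (proj2 x) * p3 (x $ 3)) *\<^sub>R (inverse (zt s (proj2 x)) ^ 3 * g x))"
  and p3: "!!t. p3 t ~= 0 ==> \<bar>t\<bar> < M"
 defines "q \<equiv> \<lambda>y. indicator (Sect h) y *\<^sub>R (\<eta> y *\<^sub>R (inverse (zt s y) ^ 3 * (LINT t|lebesgue. p3 t *\<^sub>R g (join3 y t))))"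
 shows "integrable lebesgue q"
  and "(SINT x. (\<eta> (proj2 x) * p3 (x $ 3)) *\<^sub>R (inverse (zt s (proj2 x)) ^ 3 * g x)) = (LINT y|lebesgue. q y)"
proof -
 have e: "(LINT t|lebesgue. indicator (Sol h) (join3 y t) *\<^sub>R ((\<eta> (proj2 (join3 y t)) * p3 (join3 y t $ 3)) *\<^sub>R
   (inverse (zt s (proj2 (join3 y t))) ^ 3 * g (join3 y t)))) = q y" for y
 proof -
  have "indicator (Sol h) (join3 y t) *\<^sub>R ((\<eta> (proj2 (join3 y t)) * p3 (join3 y t $ 3)) *\<^sub>R
   (inverse (zt s (proj2 (join3 y t))) ^ 3 * g (join3 y t))) =
   indicator (Sect h) y *\<^sub>R (\<eta> y *\<^sub>R (inverse (zt s y) ^ 3 * (p3 t *\<^sub>R g (join3 y t))))" for t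
  proof (cases "p3 t = 0")
   case False
   then have "join3 y t \<in> Sol h \<longleftrightarrow> y \<in> Sect h" using p3[of t] by (auto simp: in_Sol Sect_def)
   then show ?thesis by (simp add: indicator_def)
  qed simp
  then show ?thesis by (simp only: q_def integral_scaleR_right integral_mult_right_zero)
 qed
 note F = fubini_join3[OF i[unfolded set_integrable_def]]
 show "integrable lebesgue q" using F(2) unfolding e .
 show "(SINT x. (\<eta> (proj2 x) * p3 (x $ 3)) *\<^sub>R (inverse (zt s (proj2 x)) ^ 3 * g x)) = (LINT y|lebesgue. q y)"
  unfolding set_lebesgue_integral_def using F(3) unfolding e .
qed

text \<open>Bilinear, without conjugation: isotropy of (1, i, 0) refers to this pairing.\<close>

definition "contr c z = (\<Sum>i\<in>UNIV. c $ i * z $ i)" for c z :: "complex^3"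

lemma bounded_linear_contr: "bounded_linear (contr c)" unfolding contr_def[abs_def]
 by (intro bounded_linear_sum bounded_linear_const_mult bounded_linear_nth)

text \<open>The contracted equation is tested with \<open>A\<close> times the kernel and multiplied
  by s = 1/(n+1). The left side tends to 0, and on the right the reduced field may be replaced by
  its edge value \<open>ka\<close>. This leaves \<open>contr c ka\<close> times the nonzero limit of
  \<open>cone_limit\<close>.\<close>

lemma edge_blowup:
 fixes F f :: "real^3 => complex^3" and p3 :: "real => real"
 assumes F: "!!x. x \<in> Sol h ==> norm (F x) <= CF * norm (proj2 x) powr (1 + \<alpha>)" and \<alpha>: "\<alpha> > 0"
  and r0: "0 < r0" "r0 <= h" and \<omega>: "\<omega> ~= 0"
  and f: "Sintegrable f"
  and row: "!!\<phi> i. smooth \<phi> ==> test_fun (Cyl r0) (\<lambda>x. Re (\<phi> x)) ==> test_fun (Cyl r0) (\<lambda>x. Im (\<phi> x)) ==>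
   Sintegrable (lame_row lam \<mu> \<phi> F i) \<and>
   (SINT x. lame_row lam \<mu> \<phi> F i x) = of_real (\<omega>\<^sup>2) * (SINT x. \<phi> x * f x $ i)"
  and p3: "test_fun {-M<..<M} p3" "(LINT t|lborel. p3 t) ~= 0"
  and avg: "!!rh. 0 < rh ==> rh <= h ==>
   (\<integral>\<^sup>+y. ennreal (norm (Rop p3 f y - ka)) * indicator (Sect rh) y \<partial>lebesgue) <= ennreal (C * rh powr (2 + de))"
  and C: "C >= 0" "de > 0"
  and c: "c $ 1 + \<i> * c $ 2 = 0"
 shows "contr c ka = 0"
proof -
 define \<eta> where "\<eta> = bump (0 :: real^2) (r0 / 2)"
 have r: "r0 / 2 > 0" using r0 by simp
 have \<eta>: "continuous_on UNIV \<eta>" "!!y. 0 <= \<eta> y" "!!y. \<eta> y <= 1" "!!y. \<eta> y ~= 0 ==> norm y < r0 / 2" "\<eta> 0 = 1"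
  using bump[OF r, of "0 :: real^2"] smooth_continuous unfolding \<eta>_def by auto
 note s3 = test_fun_axis(1)[OF p3(1)] and z3 = test_fun_axis(2)[OF p3(1)] and c3 = test_fun_axis(3)[OF p3(1)]
 \<comment> \<open>The product form with one factor per group of variables is what lets the test
   function pass through the dimension reduction.\<close>
 define A where "A x = \<eta> (proj2 x) * p3 (x $ 3)" for x
 have A: "test_fun (Cyl r0) A"
 proof (rule test_funI[where C = "cyl (cball 0 (r0 / 2)) (closure {t. p3 t ~= 0})"])
  show "smooth A" unfolding A_def[abs_def] \<eta>_def
   by (intro smooth_mult s3 smooth_compose[OF smooth_linear[OF bounded_linear_proj2] bump(1)[OF r]])
  show "{x. A x ~= 0} \<subseteq> cyl (cball 0 (r0 / 2)) (closure {t. p3 t ~= 0})"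
   using \<eta>(4) closure_subset[of "{t. p3 t ~= 0}"] by (force simp: A_def cyl_def)
  show "compact (cyl (cball 0 (r0 / 2)) (closure {t. p3 t ~= 0}))" by (intro compact_cyl compact_cball test_funD(2)[OF p3(1)])
  show "cyl (cball 0 (r0 / 2)) (closure {t. p3 t ~= 0}) \<subseteq> Cyl r0"
   unfolding Cyl_def using r0 by (intro cyl_mono test_funD(3)[OF p3(1)]) auto
 qed
 have Ah: "test_fun (Cyl h) A" by (rule test_fun_mono[OF A]) (use r0 in \<open>auto simp: in_Cyl\<close>)
 define s where "s n = inverse (real (Suc n))" for n
 have s: "!!n. s n > 0" "s \<longlonglongrightarrow> 0" "!!n. s n <= 1"
  using LIMSEQ_inverse_real_of_nat unfolding s_def by (auto simp: inverse_le_1_iff)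
 let ?v = "\<lambda>n k x. inverse (zt (s n) (proj2 x)) ^ k"
 let ?\<phi> = "\<lambda>n x. of_real (A x) * psi (s n) (proj2 x)"
 define g where "g x = contr c (f x)" for x
 have ig: "Sintegrable g" unfolding g_def[abs_def] by (rule set_integrable_bounded_linear[OF bounded_linear_contr f])
 have iAg: "Sintegrable (\<lambda>x. A x *\<^sub>R (?v n 3 x * u x))" if "Sintegrable u" for n u
  by (rule integrable_test_mult[OF set_integrable_zt_power_mult[OF s(1) that] A])
 let ?R = "\<lambda>n. SINT x. A x *\<^sub>R (?v n 3 x * g x)"
 obtain K where K: "K >= 0" "!!s x u. 0 < s ==> s <= 1 ==> x \<in> Sol h ==>
  norm (\<Sum>i\<in>UNIV. c $ i * lame_row lam \<mu> (\<lambda>x. of_real (A x) * psi s (proj2 x)) u i x) <=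
   K * inverse (norm (zt s (proj2 x))) ^ 4 * norm (u x)" using lame_row_contracted_bound[OF A c] by blast
 have rows: "Sintegrable (lame_row lam \<mu> (?\<phi> n) F i)"
  "(SINT x. lame_row lam \<mu> (?\<phi> n) F i x) = of_real (\<omega>\<^sup>2) * (SINT x. ?\<phi> n x * f x $ i)" for n i
 proof -
  have sp: "smooth (\<lambda>x. psi (s n) (proj2 x))" by (rule smooth_psi3[OF s(1)])
  have 1: "smooth (?\<phi> n)" by (intro smooth_mult smooth_of_real test_funD(1)[OF A] sp)
  have 2: "test_fun (Cyl r0) (\<lambda>x. Re (?\<phi> n x))"
   using test_fun_mult[OF A smooth_compose[OF sp smooth_linear[OF bounded_linear_Re]]] by (simp add: mult.commute)
  have 3: "test_fun (Cyl r0) (\<lambda>x. Im (?\<phi> n x))"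
   using test_fun_mult[OF A smooth_compose[OF sp smooth_linear[OF bounded_linear_Im]]] by (simp add: mult.commute)
  show "Sintegrable (lame_row lam \<mu> (?\<phi> n) F i)"
   "(SINT x. lame_row lam \<mu> (?\<phi> n) F i x) = of_real (\<omega>\<^sup>2) * (SINT x. ?\<phi> n x * f x $ i)" using row[OF 1 2 3] by auto
 qed
 let ?S = "\<lambda>n x. \<Sum>i\<in>UNIV. c $ i * lame_row lam \<mu> (?\<phi> n) F i x"
 have iS: "Sintegrable (?S n)" for n by (intro set_integral_sum(2) set_integrable_bounded_linear[OF bounded_linear_mult_right rows(1)])
 have SR: "(SINT x. ?S n x) = of_real (\<omega>\<^sup>2) * ?R n" for n
 proof -
  have psi: "(SINT x. ?\<phi> n x * f x $ i) = (SINT x. A x *\<^sub>R (?v n 3 x * f x $ i))" for i using psi_eq[OF less_imp_le s(1)]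
   by (intro set_lebesgue_integral_cong) (auto simp: in_Sol scaleR_conv_of_real open_Sol)
  have fi: "Sintegrable (\<lambda>x. f x $ i)" for i by (rule set_integrable_bounded_linear[OF bounded_linear_nth f])
  have "(SINT x. ?S n x) = (\<Sum>i\<in>UNIV. SINT x. c $ i * lame_row lam \<mu> (?\<phi> n) F i x)"
   by (intro set_integral_sum(1) set_integrable_bounded_linear[OF bounded_linear_mult_right rows(1)])
  also have "\<dots> = (\<Sum>i\<in>UNIV. c $ i * (of_real (\<omega>\<^sup>2) * (SINT x. A x *\<^sub>R (?v n 3 x * f x $ i))))"
   unfolding set_integral_bounded_linear[OF bounded_linear_mult_right rows(1)] rows(2) psi ..
  also have "\<dots> = of_real (\<omega>\<^sup>2) * (\<Sum>i\<in>UNIV. c $ i * (SINT x. A x *\<^sub>R (?v n 3 x * f x $ i)))"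
   by (simp add: sum_distrib_left mult_ac)
  also have "(\<Sum>i\<in>UNIV. c $ i * (SINT x. A x *\<^sub>R (?v n 3 x * f x $ i))) =
   (\<Sum>i\<in>UNIV. SINT x. c $ i * (A x *\<^sub>R (?v n 3 x * f x $ i)))"
   unfolding set_integral_bounded_linear[OF bounded_linear_mult_right iAg[OF fi]] ..
  also have "\<dots> = (SINT x. \<Sum>i\<in>UNIV. c $ i * (A x *\<^sub>R (?v n 3 x * f x $ i)))"
   by (intro set_integral_sum(1)[symmetric] set_integrable_bounded_linear[OF bounded_linear_mult_right iAg[OF fi]])
  also have "(\<lambda>x. \<Sum>i\<in>UNIV. c $ i * (A x *\<^sub>R (?v n 3 x * f x $ i))) = (\<lambda>x. A x *\<^sub>R (?v n 3 x * g x))"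
   by (simp add: fun_eq_iff g_def contr_def scaleR_conv_of_real sum_3 algebra_simps)
  finally show ?thesis .
 qed
 \<comment> \<open>The inverse fourth power times s is at most a multiple of 1/|x'|^3; with the
   decay of \<open>F\<close> the majorant is |x'|^(\<alpha>-2). Pointwise the kernel stays bounded
   while s tends to 0.\<close>
 have "(\<lambda>n. SINT x. of_real (s n) * ?S n x) \<longlonglongrightarrow> 0"
 proof (rule radial_dominated_limit[OF _ \<alpha>, where C = "K * inverse kap ^ 4 * CF"])
  show "Sintegrable (\<lambda>x. of_real (s n) * ?S n x)" for n by (rule set_integrable_bounded_linear[OF bounded_linear_mult_right iS])
  fix x assume x: "x \<in> Sol h"
  then have l: "0 <= lev (proj2 x)" "proj2 x ~= 0" by (auto simp: in_Sol)
  have rx: "norm (proj2 x) > 0" using l by simp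
  have b: "norm (of_real (s n) * ?S n x) <= K * norm (of_real (s n) * ?v n 4 x) * norm (F x)" for n
  proof -
   have "norm (of_real (s n) * ?S n x) <= s n * (K * inverse (norm (zt (s n) (proj2 x))) ^ 4 * norm (F x))"
    unfolding norm_mult using s(1)[of n] K(2)[OF s(1)[of n] s(3)[of n] x] by (intro mult_mono) auto
   then show ?thesis using s(1)[of n] by (simp add: norm_mult norm_power norm_inverse mult_ac)
  qed
  show "norm (of_real (s n) * ?S n x) <= K * inverse kap ^ 4 * CF * (norm (proj2 x) powr \<alpha> / (norm (proj2 x))\<^sup>2)" for n
  proof -
   have "K * norm (of_real (s n) * ?v n (Suc 3) x) * norm (F x) <=
    K * (inverse kap * inverse (kap * norm (proj2 x)) ^ 3) * (CF * norm (proj2 x) powr (1 + \<alpha>))"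
    using K(1) l kap(1) by (intro mult_mono mult_left_mono zt_power_bounds(3) s F x) auto
   also have "\<dots> = K * inverse kap ^ 4 * CF * (norm (proj2 x) powr \<alpha> / (norm (proj2 x))\<^sup>2)"
    using rx kap(1) by (simp add: powr_add field_simps eval_nat_numeral)
   finally show ?thesis using b[of n] by simp
  qed
  show "(\<lambda>n. of_real (s n) * ?S n x) \<longlonglongrightarrow> 0"
  proof (rule Lim_null_comparison)
   show "\<forall>\<^sub>F n in sequentially. norm (of_real (s n) * ?S n x) <= s n * (K * inverse (kap * norm (proj2 x)) ^ 4 * norm (F x))"
   proof (intro always_eventually allI)
    fix n
    have "K * norm (of_real (s n) * ?v n 4 x) * norm (F x) = s n * (K * norm (?v n 4 x) * norm (F x))" using s(1)[of n] by (simp add: norm_mult)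
    also have "\<dots> <= s n * (K * inverse (kap * norm (proj2 x)) ^ 4 * norm (F x))"
     using K(1) l s(1)[of n] by (intro mult_left_mono mult_right_mono zt_power_bounds(2)) auto
    finally show "norm (of_real (s n) * ?S n x) <= s n * (K * inverse (kap * norm (proj2 x)) ^ 4 * norm (F x))" using b[of n] by linarith
   qed
   show "(\<lambda>n. s n * (K * inverse (kap * norm (proj2 x)) ^ 4 * norm (F x))) \<longlonglongrightarrow> 0"
    by (rule tendsto_mult_left_zero[OF s(2)])
  qed
 qed
 then have "(\<lambda>n. of_real (s n) * (of_real (\<omega>\<^sup>2) * ?R n)) \<longlonglongrightarrow> 0"
  unfolding set_integral_bounded_linear[OF bounded_linear_mult_right iS] SR .
 from tendsto_mult_right_zero[OF this, of "inverse (of_real (\<omega>\<^sup>2))"]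
 have R0: "(\<lambda>n. of_real (s n) * ?R n) \<longlonglongrightarrow> 0" using \<omega> by (simp add: field_simps)
 define \<Phi> where "\<Phi> = (LINT t|lborel. p3 t)"
 define Rf where "Rf = Rop p3 f"
 define Rg where "Rg = Rop p3 g"
 have sect: "AE y in lebesgue. y \<in> Sect h \<longrightarrow> Rg y = contr c (Rf y)" using Rop_sections(1)[OF f p3(1)]
 proof eventually_elim
  case (elim y)
  show ?case
  proof
   assume "y \<in> Sect h"
   then have i: "integrable lebesgue (\<lambda>t. p3 t *\<^sub>R f (join3 y t))" using elim by simp
   have "contr c (Rf y) = (LINT t|lebesgue. contr c (p3 t *\<^sub>R f (join3 y t)))"
    unfolding Rf_def Rop_def by (rule integral_bounded_linear[OF bounded_linear_contr i, symmetric])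
   then show "Rg y = contr c (Rf y)" unfolding Rg_def Rop_def g_def by (simp add: linear_scale[OF bounded_linear.linear[OF bounded_linear_contr]])
  qed
 qed
 have mRf: "(\<lambda>y. indicator (Sect h) y *\<^sub>R (Rf y - ka)) \<in> borel_measurable lebesgue"
  unfolding Rf_def by (rule Rop_sections(3)[OF f p3(1)])
 let ?N = "\<lambda>y. norm (indicator (Sect h) y *\<^sub>R (Rf y - ka))"
 \<comment> \<open>The decay of the mean oscillation is exactly what makes the deviation from
   \<open>ka\<close> integrable against 1/|y|^2.\<close>
 have iN: "integrable lebesgue (\<lambda>y :: real^2. indicator {y. norm y < h} y * (?N y / (norm y)\<^sup>2))"
 proof (rule dyadic_integrable[OF _ _ _ _ _ h C(2,1)])
  show "?N \<in> borel_measurable lebesgue" using mRf by measurable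
  show "norm \<in> borel_measurable (lebesgue :: (real^2) measure)" by (simp add: measurable_completion)
  fix rh assume rh: "0 < rh" "rh <= h"
  have "(\<integral>\<^sup>+y. ennreal (?N y) * indicator {y. norm y < rh} y \<partial>lebesgue) =
    (\<integral>\<^sup>+y. ennreal (norm (Rf y - ka)) * indicator (Sect rh) y \<partial>lebesgue)"
   using rh by (intro nn_integral_cong) (auto simp: indicator_def Sect_def)
  then show "(\<integral>\<^sup>+y. ennreal (?N y) * indicator {y. norm y < rh} y \<partial>lebesgue) <= ennreal (C * rh powr (2 + de))"
   using avg[OF rh] unfolding Rf_def by simp
 qed auto
 obtain Nc where Nc: "Nc > 0" "!!z. norm (contr c z) <= Nc * norm z"
  using bounded_linear.pos_bounded[OF bounded_linear_contr[of c]] by (auto simp: mult.commute)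
 let ?iv = "\<lambda>n y. inverse (zt (s n) y) ^ 3"
 define q1 where "q1 n y = indicator (Sect h) y *\<^sub>R (\<eta> y *\<^sub>R (?iv n y * of_real \<Phi>))" for n y
 define qg where "qg n y = indicator (Sect h) y *\<^sub>R (\<eta> y *\<^sub>R (?iv n y * Rg y))" for n y
 let ?R1 = "\<lambda>n. SINT x. A x *\<^sub>R (?v n 3 x * 1)"
 have i1: "(LINT t|lebesgue. p3 t *\<^sub>R (1::complex)) = of_real \<Phi>"
 proof -
  have m: "p3 \<in> borel_measurable lborel" using smooth_measurable[OF test_funD(1)[OF p3(1)]] by simp
  have "integrable lborel p3" using p3(2) not_integrable_integral_eq by blast
  then show ?thesis using m by (simp add: \<Phi>_def integral_completion integrable_completion scaleR_conv_of_real)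
 qed
 have q1: "integrable lebesgue (q1 n)" "?R1 n = (LINT y|lebesgue. q1 n y)" for n
  using section_integral[where ?p3.0 = p3 and \<eta> = \<eta> and s = "s n" and g = "\<lambda>_. 1", OF iAg[OF set_integrable_const_Sol, unfolded A_def] z3]
  unfolding i1 q1_def A_def by simp_all
 have qg: "integrable lebesgue (qg n)" "?R n = (LINT y|lebesgue. qg n y)" for n
  using section_integral[where ?p3.0 = p3 and \<eta> = \<eta> and s = "s n", OF iAg[OF ig, unfolded A_def] z3]
  unfolding qg_def A_def Rg_def Rop_def by simp_all
 define kag where "kag = contr c ka"
 have \<Phi>: "\<Phi> ~= 0" using p3(2) by (simp add: \<Phi>_def)
 \<comment> \<open>The error made by replacing the contracted reduced field by the constant
   \<open>kag\<close>; \<open>s\<close> times the inverse cube is dominated by a multiple of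
   1/|y|^2, so \<open>iN\<close> supplies the majorant.\<close>
 define d where "d n y = of_real (s n) * (indicator (Sect h) y *\<^sub>R (\<eta> y *\<^sub>R (?iv n y * (Rg y - kag))))" for n y
 have d_eq: "d n = (\<lambda>y. of_real (s n) * (qg n y - kag / of_real \<Phi> * q1 n y))" for n
  using \<Phi> by (simp add: fun_eq_iff d_def qg_def q1_def scaleR_conv_of_real algebra_simps)
 have id: "integrable lebesgue (d n)" for n unfolding d_eq by (intro integrable_mult_right Bochner_Integration.integrable_diff qg q1)
 have dR: "(LINT y|lebesgue. d n y) = of_real (s n) * ?R n - kag / of_real \<Phi> * (of_real (s n) * ?R1 n)" for n
 proof -
  have "(LINT y|lebesgue. d n y) = of_real (s n) * ((LINT y|lebesgue. qg n y) - (LINT y|lebesgue. kag / of_real \<Phi> * q1 n y))"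
   unfolding d_eq integral_mult_right_zero
   by (subst Bochner_Integration.integral_diff[OF qg(1) integrable_mult_right[OF q1(1)]]) (simp only: integral_mult_right_zero)
  then show ?thesis unfolding integral_mult_right_zero qg(2) q1(2) by (simp add: algebra_simps)
 qed
 have bd: "AE y in lebesgue. \<forall>n. norm (d n y) <= (Nc * inverse kap ^ 3) * (indicator {y. norm y < h} y * (?N y / (norm y)\<^sup>2)) \<and>
   norm (d n y) <= s n * (inverse (kap * norm y) ^ 3 * norm (Rg y - kag))" using sect
 proof eventually_elim
  case (elim y)
  show ?case
  proof (intro allI)
   fix n
   show "norm (d n y) <= (Nc * inverse kap ^ 3) * (indicator {y. norm y < h} y * (?N y / (norm y)\<^sup>2)) \<and>
    norm (d n y) <= s n * (inverse (kap * norm y) ^ 3 * norm (Rg y - kag))"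
   proof (cases "y \<in> Sect h")
    case True
    then have l: "0 <= lev y" "y ~= 0" "norm y < h" by (auto simp: Sect_def)
    have ny: "norm y > 0" using l by simp
    have "norm (d n y) = \<eta> y * (norm (of_real (s n) * ?iv n y) * norm (Rg y - kag))"
     using True \<eta>(2)[of y] by (simp add: d_def norm_mult mult_ac)
    also have "\<dots> <= norm (of_real (s n) * ?iv n y) * norm (Rg y - kag)" using \<eta>(2,3)[of y] by (intro mult_left_le_one_le) auto
    finally have 1: "norm (d n y) <= norm (of_real (s n) * ?iv n y) * norm (Rg y - kag)" .
    have "norm (Rg y - kag) <= Nc * norm (Rf y - ka)"
     using elim True Nc(2)[of "Rf y - ka"] linear_diff[OF bounded_linear.linear[OF bounded_linear_contr[of c]], of "Rf y" ka] by (simp add: kag_def)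
    then have "norm (of_real (s n) * inverse (zt (s n) y) ^ Suc 2) * norm (Rg y - kag) <=
     (inverse kap * inverse (kap * norm y) ^ 2) * (Nc * norm (Rf y - ka))" using l kap(1) by (intro mult_mono zt_power_bounds(3) s) auto
    also have "\<dots> = (Nc * inverse kap ^ 3) * (indicator {y. norm y < h} y * (?N y / (norm y)\<^sup>2))"
     using True l ny kap(1) by (simp add: field_simps eval_nat_numeral)
    finally have 2: "norm (of_real (s n) * ?iv n y) * norm (Rg y - kag) <= (Nc * inverse kap ^ 3) * (indicator {y. norm y < h} y * (?N y / (norm y)\<^sup>2))"
     by simp
    have "norm (of_real (s n) * ?iv n y) * norm (Rg y - kag) = s n * (norm (?iv n y) * norm (Rg y - kag))" using s(1)[of n] by (simp add: norm_mult)
    also have "\<dots> <= s n * (inverse (kap * norm y) ^ 3 * norm (Rg y - kag))"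
     using l s(1)[of n] by (intro mult_left_mono mult_right_mono zt_power_bounds(2)) auto
    finally show ?thesis using 1 2 by linarith
   next
    case False
    then show ?thesis using s(1)[of n] kap(1) Nc(1) by (simp add: d_def)
   qed
  qed
 qed
 have "(\<lambda>n. LINT y|lebesgue. d n y) \<longlonglongrightarrow> (LINT y|(lebesgue :: (real^2) measure). 0 :: complex)"
 proof (rule integral_dominated_convergence)
  show "integrable lebesgue (\<lambda>y :: real^2. (Nc * inverse kap ^ 3) * (indicator {y. norm y < h} y * (?N y / (norm y)\<^sup>2)))"
   by (rule integrable_mult_right[OF iN])
  show "d n \<in> borel_measurable lebesgue" for n by (rule borel_measurable_integrable[OF id])
  show "AE y in lebesgue. norm (d n y) <= (Nc * inverse kap ^ 3) * (indicator {y. norm y < h} y * (?N y / (norm y)\<^sup>2))" for n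
   using bd by eventually_elim blast
  show "AE y in lebesgue. (\<lambda>n. d n y) \<longlonglongrightarrow> 0" using bd
  proof eventually_elim
   case (elim y)
   show ?case
   proof (rule Lim_null_comparison)
    show "\<forall>\<^sub>F n in sequentially. norm (d n y) <= s n * (inverse (kap * norm y) ^ 3 * norm (Rg y - kag))"
     using elim by (intro always_eventually allI) blast
    show "(\<lambda>n. s n * (inverse (kap * norm y) ^ 3 * norm (Rg y - kag))) \<longlonglongrightarrow> 0" by (rule tendsto_mult_left_zero[OF s(2)])
   qed
  qed
 qed simp
 then have D0: "(\<lambda>n. of_real (s n) * ?R n - kag / of_real \<Phi> * (of_real (s n) * ?R1 n)) \<longlonglongrightarrow> 0" unfolding dR by simp
 let ?L = "of_real \<Phi> * (inverse (cis th) ^ 3 / 2 * (inverse (Complex (cot be) 1) + inverse (Complex (cot be) (- 1))))"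
 have R1: "(\<lambda>n. of_real (s n) * ?R1 n) \<longlonglongrightarrow> ?L"
  unfolding A_def \<Phi>_def mult_1_right by (rule cone_limit[OF \<eta> c3 z3 Ah[unfolded A_def[abs_def]] s(1,2)])
 \<comment> \<open>The quotient by \<open>\<Phi>\<close> occurs because \<open>?R1\<close> is the
   test of the constant field 1, whose reduction is \<open>\<Phi>\<close> rather than 1.\<close>
 have "(\<lambda>n. kag / of_real \<Phi> * (of_real (s n) * ?R1 n)) \<longlonglongrightarrow> 0" using tendsto_diff[OF R0 D0] by simp
 moreover have "(\<lambda>n. kag / of_real \<Phi> * (of_real (s n) * ?R1 n)) \<longlonglongrightarrow> kag / of_real \<Phi> * ?L"
  by (intro tendsto_intros R1)
 ultimately have "kag / of_real \<Phi> * ?L = 0" by (rule LIMSEQ_unique[symmetric])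
 then show ?thesis using \<Phi> profile_constant_nz cis_neq_zero[of th] unfolding kag_def by simp
qed

end

section \<open>Mean oscillation of the reduced fields\<close>

lemma geometric_limit:
 fixes k :: "nat => 'b::banach"
 assumes k: "!!n. norm (k (Suc n) - k n) <= B * q ^ n" and q: "0 < q" "q < 1"
 shows "\<exists>l. \<forall>n. norm (k n - l) <= B / (1 - q) * q ^ n"
proof -
 have sq: "summable (\<lambda>i. B * q ^ (i + n))" for n using q by (intro summable_mult summable_ignore_initial_segment summable_geometric) auto
 have s: "summable (\<lambda>i. k (Suc i) - k i)" using k by (intro summable_comparison_test'[OF sq[of 0], of 0]) simp
 have "norm (k n - (k 0 + (\<Sum>i. k (Suc i) - k i))) <= B / (1 - q) * q ^ n" for n
 proof -
  have "(\<Sum>i. k (Suc i) - k i) = (\<Sum>i. k (Suc (i + n)) - k (i + n)) + (\<Sum>i<n. k (Suc i) - k i)"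
   using suminf_split_initial_segment[OF s, of n] by simp
  then have "norm (k n - (k 0 + (\<Sum>i. k (Suc i) - k i))) = norm (\<Sum>i. k (Suc (i + n)) - k (i + n))"
   by (simp add: sum_lessThan_telescope norm_minus_commute)
  also have "\<dots> <= (\<Sum>i. B * q ^ (i + n))" by (rule norm_suminf_le[OF k sq])
  also have "\<dots> = B / (1 - q) * q ^ n"
   using suminf_mult[OF summable_geometric[of q], of "B * q ^ n"] suminf_geometric[of q] q by (simp add: power_add mult_ac)
  finally show ?thesis .
 qed
 then show ?thesis by blast
qed

context edge
begin

text \<open>The lower bound comes from a disk around the bisector point at distance rh/2: there lev
  is rh sin be / 2, and moving by less than rh sin be / 4 lowers it by less than twice that
  amount.\<close>

lemma emeasure_Sect:
 assumes rh: "rh > 0"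
 shows "emeasure lebesgue (Sect rh) <= ennreal (pi * rh\<^sup>2)" "ennreal (pi * (sin be / 4)\<^sup>2 * rh\<^sup>2) <= emeasure lebesgue (Sect rh)"
proof -
 have e: "emeasure lebesgue (Sect rh) = emeasure lborel (Sect rh)" using open_Sect by simp
 have b: "emeasure lborel (ball (a :: real^2) r) = ennreal (pi * r\<^sup>2)" if "r >= 0" for a r
  using emeasure_ball[OF that, of a] by (simp add: unit_ball_vol_2)
 have "emeasure lborel (Sect rh) <= emeasure lborel (ball (0 :: real^2) rh)" by (intro emeasure_mono) (auto simp: Sect_def)
 then show "emeasure lebesgue (Sect rh) <= ennreal (pi * rh\<^sup>2)" using b[of rh 0] rh e by simp
 have "ball ((rh / 2) *\<^sub>R e2 th) (sin be / 4 * rh) \<subseteq> Sect rh"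
 proof
  fix y assume y: "y \<in> ball ((rh / 2) *\<^sub>R e2 th) (sin be / 4 * rh)"
  define x where "x = y - (rh / 2) *\<^sub>R e2 th"
  have x: "norm x < sin be / 4 * rh" using y by (simp add: x_def dist_norm norm_minus_commute)
  have yx: "y = x + (rh / 2) *\<^sub>R e2 th" by (simp add: x_def)
  have "\<bar>cX th x * sin be\<bar> <= norm x * 1" "\<bar>\<bar>cY th x\<bar> * cos be\<bar> <= norm x * 1"
   unfolding abs_mult by (intro mult_mono; simp add: abs_cX_le abs_cY_le)+
  then have "lev y > 0" using x unfolding yx ell_add_e2 by (simp add: ell_def) argo
  moreover have "norm y < rh"
  proof -
   have "sin be / 4 * rh <= 1 / 4 * rh" using rh sin_le_one[of be] by (intro mult_right_mono) auto
   with x have "norm x < 1 / 4 * rh" by (rule less_le_trans)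
   then show ?thesis using norm_triangle_ineq[of x "(rh / 2) *\<^sub>R e2 th"] rh unfolding yx by simp
  qed
  ultimately show "y \<in> Sect rh" by (simp add: Sect_def)
 qed
 then have "emeasure lborel (ball ((rh / 2) *\<^sub>R e2 th) (sin be / 4 * rh)) <= emeasure lborel (Sect rh)"
  using open_Sect by (intro emeasure_mono) auto
 then show "ennreal (pi * (sin be / 4)\<^sup>2 * rh\<^sup>2) <= emeasure lebesgue (Sect rh)"
  using b[of "sin be / 4 * rh" "(rh / 2) *\<^sub>R e2 th"] rh sin_be unfolding e mult.assoc power_mult_distrib[symmetric] by simp
qed

text \<open>Not normalised by the area, so decay of Hoelder type with exponent \<open>de\<close>
  appears as the power 2 + de. The extended nonnegative integral makes sense before integrability is
  known.\<close>

definition osc :: "(real^2 => 'b::euclidean_space) => 'b => real => ennreal"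
 where "osc g ka rh = (\<integral>\<^sup>+y. ennreal (norm (g y - ka)) * indicator (Sect rh) y \<partial>lebesgue)"

lemma osc_mono: "rh <= rh' ==> osc g ka rh <= osc g ka rh'"
 unfolding osc_def by (intro nn_integral_mono mult_left_mono) (auto simp: indicator_def Sect_def)

lemma osc_const: "(\<integral>\<^sup>+y. ennreal c * indicator (Sect rh) y \<partial>lebesgue) = ennreal c * emeasure lebesgue (Sect rh)"
 using open_Sect by (intro nn_integral_cmult_indicator) auto

lemma osc_measurable:
 assumes "(\<lambda>y. indicator (Sect h) y *\<^sub>R (g y - ka)) \<in> borel_measurable lebesgue" "rh <= h"
 shows "(\<lambda>y. ennreal (norm (g y - ka)) * indicator (Sect rh) y) \<in> borel_measurable lebesgue"
proof -
 have "(\<lambda>y. ennreal (norm (indicator (Sect h) y *\<^sub>R (g y - ka)))) \<in> borel_measurable lebesgue" using assms(1) by measurable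
 then have "(\<lambda>y. ennreal (norm (indicator (Sect h) y *\<^sub>R (g y - ka))) * indicator (Sect rh) y) \<in> borel_measurable lebesgue"
  using open_Sect[of rh] by (intro borel_measurable_times_ennreal borel_measurable_indicator) auto
 then show ?thesis by (rule measurable_cong[THEN iffD1, rotated]) (use assms(2) in \<open>auto simp: indicator_def Sect_def\<close>)
qed

lemma osc_triangle:
 assumes m: "!!ka. (\<lambda>y. indicator (Sect h) y *\<^sub>R (g y - ka)) \<in> borel_measurable lebesgue" and rh: "rh <= h"
 shows "ennreal (norm (ka - ka')) * emeasure lebesgue (Sect rh) <= osc g ka rh + osc g ka' rh"
  and "osc g ka rh <= osc g ka' rh + ennreal (norm (ka - ka')) * emeasure lebesgue (Sect rh)"
proof -
 have t: "ennreal (norm a) * i <= ennreal (norm b) * i + ennreal (norm c) * i" if "norm a <= norm b + norm c" for a b c :: 'a and i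
  unfolding distrib_right[symmetric] ennreal_plus[OF norm_ge_zero norm_ge_zero, symmetric] using that by (intro mult_right_mono ennreal_leI) auto
 have 1: "norm (ka - ka') <= norm (g y - ka) + norm (g y - ka')" "norm (g y - ka) <= norm (g y - ka') + norm (ka - ka')" for y
  using norm_triangle_ineq4[of "g y - ka'" "g y - ka"] norm_triangle_ineq4[of "g y - ka'" "ka - ka'"] by simp_all
 show "ennreal (norm (ka - ka')) * emeasure lebesgue (Sect rh) <= osc g ka rh + osc g ka' rh"
  unfolding osc_const[symmetric] osc_def nn_integral_add[OF osc_measurable[OF m rh] osc_measurable[OF m rh], symmetric]
  by (intro nn_integral_mono t 1)
 have mc: "(\<lambda>y. ennreal (norm (ka - ka')) * indicator (Sect rh) y) \<in> borel_measurable lebesgue"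
  using open_Sect[of rh] by (intro borel_measurable_times_ennreal borel_measurable_indicator) auto
 show "osc g ka rh <= osc g ka' rh + ennreal (norm (ka - ka')) * emeasure lebesgue (Sect rh)"
  unfolding osc_const[symmetric] osc_def nn_integral_add[OF osc_measurable[OF m rh] mc, symmetric] by (intro nn_integral_mono t 1)
qed

definition osc_decay :: "(real^2 => 'b::euclidean_space) => 'b => real => bool"
 where "osc_decay g ka de \<longleftrightarrow> (\<exists>C\<ge>0. \<forall>rh. 0 < rh \<and> rh <= h \<longrightarrow> osc g ka rh <= ennreal (C * rh powr (2 + de)))"

text \<open>As in Campanato's characterisation of Hoelder continuity, constants depending on the scale
 converge, with a rate, along dyadic scales.\<close>

lemma osc_decay_campanato:
 assumes m: "!!ka. (\<lambda>y. indicator (Sect h) y *\<^sub>R (g y - ka)) \<in> borel_measurable lebesgue"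
  and C: "C >= 0" and de: "de > 0"
  and ex: "!!rh. 0 < rh ==> rh <= h ==> \<exists>ka. osc g ka rh <= ennreal (C * rh powr (2 + de))"
 shows "\<exists>ka. osc_decay g ka de"
proof -
 define r where "r n = h / 2 ^ n" for n :: nat
 have r: "0 < r n" "r n <= h" "r n = 2 * r (Suc n)" for n using h by (auto simp: r_def field_simps)
 have "\<forall>n. \<exists>ka. osc g ka (r n) <= ennreal (C * r n powr (2 + de))" using ex r by blast
 then obtain k where k: "!!n. osc g (k n) (r n) <= ennreal (C * r n powr (2 + de))" by metis
 define a where "a = pi * (sin be / 4)\<^sup>2"
 have a: "a > 0" using sin_be by (simp add: a_def)
 define q where "q = 2 powr (- de)"
 have q: "0 < q" "q < 1" using de by (auto simp: q_def powr_less_one)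
 have rp: "r n powr de = h powr de * q ^ n" "r n powr (2 + de) = (r n)\<^sup>2 * r n powr de" for n
 proof -
  have "q ^ n = 2 powr (- de * real n)" unfolding q_def by (simp add: powr_realpow[symmetric] powr_powr)
  also have "\<dots> = inverse ((2 ^ n) powr de)" by (simp add: powr_realpow[symmetric] powr_powr powr_minus mult.commute)
  finally have "q ^ n = inverse ((2 ^ n) powr de)" .
  moreover have "r n powr de = h powr de / (2 ^ n) powr de" unfolding r_def by (rule powr_divide)
  ultimately show "r n powr de = h powr de * q ^ n" by (simp add: divide_inverse)
  show "r n powr (2 + de) = (r n)\<^sup>2 * r n powr de" using r(1)[of n] by (simp add: powr_add)
 qed
 define B where "B = 8 * C / a * h powr de"
 have "norm (k (Suc n) - k n) <= B * q ^ n" for n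
 proof -
  let ?c = "C * r n powr (2 + de)" and ?d = "norm (k (Suc n) - k n)"
  have c: "C * r (Suc n) powr (2 + de) <= ?c" using C de r[of n] r(1)[of "Suc n"] by (intro mult_left_mono powr_mono2) auto
  \<comment> \<open>Constants of consecutive scales are compared on the smaller sector, whose area
    is at least a times the square of its radius; the factor 8 is 2 from the triangle inequality
    times 4 from halving the radius.\<close>
  have "ennreal ?d * ennreal (a * (r (Suc n))\<^sup>2) <= ennreal ?d * emeasure lebesgue (Sect (r (Suc n)))"
   unfolding a_def by (intro mult_left_mono emeasure_Sect(2) r) auto
  also have "\<dots> <= osc g (k (Suc n)) (r (Suc n)) + osc g (k n) (r (Suc n))" by (rule osc_triangle(1)[OF m r(2)])
  also have "\<dots> <= ennreal ?c + ennreal ?c"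
   using r(1)[of "Suc n"] r(3)[of n] c by (intro add_mono order_trans[OF k ennreal_leI] order_trans[OF osc_mono k]) auto
  finally have "?d * (a * (r (Suc n))\<^sup>2) <= 2 * ?c"
   using C a by (simp add: ennreal_mult[symmetric] ennreal_plus[symmetric] del: ennreal_plus)
  then have "?d * (a * (r n)\<^sup>2) <= 8 * ?c" unfolding r(3)[of n] by (simp add: power_mult_distrib mult_ac)
  then have "?d <= 8 * ?c / (a * (r n)\<^sup>2)" using a r(1)[of n] by (subst pos_le_divide_eq) auto
  also have "\<dots> = B * q ^ n" using r(1)[of n] unfolding rp B_def by (simp add: field_simps)
  finally show ?thesis .
 qed
 from geometric_limit[OF this q] obtain l where l: "!!n. norm (k n - l) <= B / (1 - q) * q ^ n" by blast
 define C2 where "C2 = C + 8 * C / a / (1 - q) * pi"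
 have C2: "C2 >= 0" using C a q by (simp add: C2_def)
 have rn: "osc g l (r n) <= ennreal (C2 * r n powr (2 + de))" for n
 proof -
  have "osc g l (r n) <= osc g (k n) (r n) + ennreal (norm (l - k n)) * emeasure lebesgue (Sect (r n))" by (rule osc_triangle(2)[OF m r(2)])
  also have "\<dots> <= ennreal (C * r n powr (2 + de)) + ennreal (B / (1 - q) * q ^ n) * ennreal (pi * (r n)\<^sup>2)"
   using l[of n] by (intro add_mono k mult_mono ennreal_leI emeasure_Sect(1) r) (auto simp: norm_minus_commute)
  also have "\<dots> = ennreal (C * r n powr (2 + de) + B / (1 - q) * q ^ n * (pi * (r n)\<^sup>2))"
   using C a q by (simp add: ennreal_mult[symmetric] ennreal_plus[symmetric] B_def del: ennreal_plus)
  also have "C * r n powr (2 + de) + B / (1 - q) * q ^ n * (pi * (r n)\<^sup>2) = C2 * r n powr (2 + de)"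
   unfolding rp B_def C2_def by (simp add: algebra_simps)
  finally show ?thesis .
 qed
 show ?thesis unfolding osc_decay_def
 proof (intro exI conjI allI impI)
  show "0 <= C2 * 2 powr (2 + de)" using C2 by simp
  fix rh assume rh: "0 < rh \<and> rh <= h"
  \<comment> \<open>An arbitrary radius lies between two consecutive dyadic ones, which costs the
    factor 2^(2+de).\<close>
  have "\<exists>n. r n < rh" using real_arch_pow_inv[of "rh / h" "1 / 2"] rh h by (auto simp: r_def power_one_over field_simps)
  then obtain n where n: "r n < rh" "!!i. i < n ==> \<not> r i < rh" using exists_least_iff[of "\<lambda>n. r n < rh"] by blast
  then obtain i where i: "n = Suc i" using rh by (cases n) (auto simp: r_def)
  have "rh <= r i" "r i <= 2 * rh" using n(1) n(2)[of i] r(3)[of i] by (auto simp: i)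
  have "osc g l rh <= ennreal (C2 * r i powr (2 + de))" by (rule order_trans[OF osc_mono[OF \<open>rh <= r i\<close>] rn])
  also have "C2 * r i powr (2 + de) <= C2 * (2 * rh) powr (2 + de)"
   using C2 de r(1)[of i] \<open>r i <= 2 * rh\<close> by (intro mult_left_mono powr_mono2) auto
  then have "ennreal (C2 * r i powr (2 + de)) <= ennreal (C2 * 2 powr (2 + de) * rh powr (2 + de))"
   using rh by (intro ennreal_leI) (simp add: powr_mult)
  finally show "osc g l rh <= ennreal (C2 * 2 powr (2 + de) * rh powr (2 + de))" .
 qed
qed

lemma osc_decay_mono:
 assumes "osc_decay g ka de" "de' <= de" shows "osc_decay g ka de'"
proof -
 obtain C where C: "C >= 0" "!!rh. 0 < rh \<and> rh <= h ==> osc g ka rh <= ennreal (C * rh powr (2 + de))"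
  using assms(1) unfolding osc_decay_def by blast
 have "osc g ka rh <= ennreal (C * h powr (de - de') * rh powr (2 + de'))" if rh: "0 < rh \<and> rh <= h" for rh
 proof -
  have "rh powr (2 + de) = rh powr (de - de') * rh powr (2 + de')" by (simp add: powr_add[symmetric]) (simp add: add.commute)
  also have "\<dots> <= h powr (de - de') * rh powr (2 + de')" using rh assms(2) by (intro mult_right_mono powr_mono2) auto
  finally have "C * rh powr (2 + de) <= C * (h powr (de - de') * rh powr (2 + de'))" using C(1) by (rule mult_left_mono)
  then show ?thesis using order_trans[OF C(2)[OF rh] ennreal_leI] by (simp add: mult_ac)
 qed
 then show ?thesis unfolding osc_decay_def using C(1) by (intro exI[of _ "C * h powr (de - de')"]) auto
qed

text \<open>The sign \<open>s\<close> covers sums and differences at once.\<close>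

lemma osc_Rop_combine:
 fixes f g :: "real^3 => 'b::euclidean_space"
 assumes f: "Sintegrable f" and g: "Sintegrable g"
  and p3: "test_fun {-M<..<M} p3" and rh: "rh <= h" and s: "\<bar>s\<bar> = 1"
 shows "osc (Rop p3 (\<lambda>x. f x + s *\<^sub>R g x)) (ka + s *\<^sub>R ka') rh <= osc (Rop p3 f) ka rh + osc (Rop p3 g) ka' rh"
 unfolding osc_def nn_integral_add[OF osc_measurable[OF Rop_sections(3)[OF f p3] rh] osc_measurable[OF Rop_sections(3)[OF g p3] rh], symmetric]
proof (intro nn_integral_mono_AE)
 show "AE y in lebesgue. ennreal (norm (Rop p3 (\<lambda>x. f x + s *\<^sub>R g x) y - (ka + s *\<^sub>R ka'))) * indicator (Sect rh) y <=
  ennreal (norm (Rop p3 f y - ka)) * indicator (Sect rh) y + ennreal (norm (Rop p3 g y - ka')) * indicator (Sect rh) y"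
  using Rop_sections(1)[OF f p3] Rop_sections(1)[OF g p3]
 proof eventually_elim
  case (elim y)
  show ?case
  proof (cases "y \<in> Sect rh")
   case True
   then have y: "y \<in> Sect h" using rh by (auto simp: Sect_def)
   have "Rop p3 (\<lambda>x. f x + s *\<^sub>R g x) y = Rop p3 f y + s *\<^sub>R Rop p3 g y"
   proof -
    have e: "p3 t *\<^sub>R (f (join3 y t) + s *\<^sub>R g (join3 y t)) = p3 t *\<^sub>R f (join3 y t) + s *\<^sub>R (p3 t *\<^sub>R g (join3 y t))" for t
     by (simp add: scaleR_add_right mult.commute)
    show ?thesis unfolding Rop_def e integral_scaleR_right[symmetric]
     using elim y by (intro Bochner_Integration.integral_add integrable_scaleR_right) auto
   qed
   then have "Rop p3 (\<lambda>x. f x + s *\<^sub>R g x) y - (ka + s *\<^sub>R ka') = (Rop p3 f y - ka) + s *\<^sub>R (Rop p3 g y - ka')"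
    by (simp add: scaleR_diff_right)
   then have "norm (Rop p3 (\<lambda>x. f x + s *\<^sub>R g x) y - (ka + s *\<^sub>R ka')) <= norm (Rop p3 f y - ka) + norm (Rop p3 g y - ka')"
    using norm_triangle_ineq[of "Rop p3 f y - ka" "s *\<^sub>R (Rop p3 g y - ka')"] s by (simp only: norm_scaleR mult_1)
   then show ?thesis using True by (simp add: ennreal_plus[symmetric] ennreal_leI del: ennreal_plus)
  qed simp
 qed
qed

lemma osc_decay_combine:
 fixes f g :: "real^3 => 'b::euclidean_space"
 assumes f: "Sintegrable f" and g: "Sintegrable g"
  and p3: "test_fun {-M<..<M} p3" and s: "\<bar>s\<bar> = 1"
  and d: "osc_decay (Rop p3 f) ka de" "osc_decay (Rop p3 g) ka' de"
 shows "osc_decay (Rop p3 (\<lambda>x. f x + s *\<^sub>R g x)) (ka + s *\<^sub>R ka') de"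
proof -
 obtain C C' where C: "C >= 0" "!!rh. 0 < rh \<and> rh <= h ==> osc (Rop p3 f) ka rh <= ennreal (C * rh powr (2 + de))"
  "C' >= 0" "!!rh. 0 < rh \<and> rh <= h ==> osc (Rop p3 g) ka' rh <= ennreal (C' * rh powr (2 + de))"
  using d unfolding osc_decay_def by blast
 have "osc (Rop p3 (\<lambda>x. f x + s *\<^sub>R g x)) (ka + s *\<^sub>R ka') rh <= ennreal ((C + C') * rh powr (2 + de))" if rh: "0 < rh \<and> rh <= h" for rh
  using order_trans[OF osc_Rop_combine[OF f g p3 _ s] add_mono[OF C(2)[OF rh] C(4)[OF rh]]] rh C(1,3)
  by (simp add: ennreal_plus[symmetric] distrib_right del: ennreal_plus)
 then show ?thesis unfolding osc_decay_def using C(1,3) by (intro exI[of _ "C + C'"]) auto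
qed

text \<open>The comparison constant is the reduction of the edge values \<open>p0\<close>.
  Integration over |t| < M contributes 2 M B and the area of the sector pi rh^2.\<close>

lemma osc_Rop_pointwise:
 fixes p :: "real^3 => 'b::euclidean_space"
 assumes p: "Sintegrable p" and p3: "test_fun {-M<..<M} p3" "!!t. \<bar>p3 t\<bar> <= B" and L: "L >= 0" "a >= 0"
  and p0: "continuous_on {-M<..<M} p0"
  and b: "!!y t. y \<in> Sect h ==> \<bar>t\<bar> < M ==> norm (p (join3 y t) - p0 t) <= L * norm y powr a"
  and rh: "0 < rh" "rh <= h"
 shows "osc (Rop p3 p) (LINT t|lebesgue. p3 t *\<^sub>R p0 t) rh <= ennreal (2 * M * B * pi * L * rh powr (2 + a))"
proof -
 have B: "B >= 0" using p3(2)[of 0] by simp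
 have "continuous_on UNIV (\<lambda>t. p3 t *\<^sub>R p0 t)"
  by (rule continuous_on_bump[OF test_fun_axis(3)[OF p3(1)] test_funD(3)[OF p3(1)]]) (use p0 in auto)
 then have "integrable lborel (\<lambda>t. p3 t *\<^sub>R p0 t)"
  by (rule integrable_continuous_bounded_support[of _ M]) (use test_fun_axis(2)[OF p3(1)] in force)
 then have i0: "integrable lebesgue (\<lambda>t. p3 t *\<^sub>R p0 t)" by (simp add: integrable_completion)
 have iM: "integrable lebesgue (indicator {-M..M} :: real => real)" using M by (intro integrable_real_indicator) auto
 have "osc (Rop p3 p) (LINT t|lebesgue. p3 t *\<^sub>R p0 t) rh <= (\<integral>\<^sup>+y. ennreal (2 * M * B * L * rh powr a) * indicator (Sect rh) y \<partial>lebesgue)"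
  unfolding osc_def
 proof (intro nn_integral_mono_AE)
  show "AE y in lebesgue. ennreal (norm (Rop p3 p y - (LINT t|lebesgue. p3 t *\<^sub>R p0 t))) * indicator (Sect rh) y <=
   ennreal (2 * M * B * L * rh powr a) * indicator (Sect rh) y" using Rop_sections(1)[OF p p3(1)]
  proof eventually_elim
   case (elim y)
   show ?case
   proof (cases "y \<in> Sect rh")
    case True
    then have y: "y \<in> Sect h" "norm y <= rh" using rh by (auto simp: Sect_def)
    let ?d = "\<lambda>t. p3 t *\<^sub>R (p (join3 y t) - p0 t)"
    have ip: "integrable lebesgue (\<lambda>t. p3 t *\<^sub>R p (join3 y t))" using elim y by blast
    have "Rop p3 p y - (LINT t|lebesgue. p3 t *\<^sub>R p0 t) = (LINT t|lebesgue. ?d t)"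
     unfolding Rop_def scaleR_diff_right by (rule Bochner_Integration.integral_diff[OF ip i0, symmetric])
    also have "norm \<dots> <= (LINT t|lebesgue. B * (L * rh powr a) * indicator {-M..M} t)"
    proof (rule Bochner_Integration.integral_norm_bound_integral)
     show "integrable lebesgue ?d" unfolding scaleR_diff_right by (rule Bochner_Integration.integrable_diff[OF ip i0])
     show "integrable lebesgue (\<lambda>t. B * (L * rh powr a) * indicator {-M..M} t)" by (rule integrable_mult_right[OF iM])
     show "norm (?d t) <= B * (L * rh powr a) * indicator {-M..M} t" for t
     proof (cases "p3 t = 0")
      case True
      then show ?thesis using B L by simp
     next
      case False
      then have t: "\<bar>t\<bar> < M" by (rule test_fun_axis(2)[OF p3(1)])
      have "L * norm y powr a <= L * rh powr a" using y L by (intro mult_left_mono powr_mono2) auto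
      then have "\<bar>p3 t\<bar> * norm (p (join3 y t) - p0 t) <= B * (L * rh powr a)"
       using B order_trans[OF b[OF y(1) t]] by (intro mult_mono p3(2)) auto
      then show ?thesis using t by (simp add: abs_less_iff)
     qed
    qed
    also have "\<dots> = 2 * M * B * L * rh powr a" using M by (simp add: measure_completion)
    finally show ?thesis using True by (simp add: ennreal_leI)
   qed simp
  qed
 qed
 also have "\<dots> <= ennreal (2 * M * B * L * rh powr a) * ennreal (pi * rh\<^sup>2)"
  unfolding osc_const by (intro mult_left_mono emeasure_Sect rh) auto
 also have "\<dots> = ennreal (2 * M * B * pi * L * rh powr (2 + a))" using rh M B L by (simp add: ennreal_mult[symmetric] powr_add mult_ac)
 finally show ?thesis .
qed

text \<open>By Fubini's theorem the reduction is bounded from L1 of the solid sector to L1 of the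
  planar one. This handles errors that are small only in a mean sense.\<close>

lemma osc_Rop_L1:
 fixes p :: "real^3 => 'b::euclidean_space"
 assumes p: "set_integrable lebesgue (Sol rh) p" and p3: "test_fun {-M<..<M} p3" "!!t. \<bar>p3 t\<bar> <= B"
 shows "osc (Rop p3 p) 0 rh <= ennreal (B * (LINT x:Sol rh|lebesgue. norm (p x)))"
proof -
 let ?q = "\<lambda>x. indicator (Sol rh) x *\<^sub>R (p3 (x $ 3) *\<^sub>R p x)"
 let ?n = "\<lambda>y. LINT t|lebesgue. norm (indicator (Sect rh) y *\<^sub>R (p3 t *\<^sub>R p (join3 y t)))"
 have iq: "integrable lebesgue (\<lambda>x. norm (?q x))" by (rule integrable_norm[OF Rop_integrand[OF p p3(1)]])
 note F = fubini_join3(2,3)[OF iq, unfolded join3_nth Rop_section[OF p3(1)]]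
 have "osc (Rop p3 p) 0 rh <= (\<integral>\<^sup>+y. ennreal (?n y) \<partial>lebesgue)" unfolding osc_def Rop_def
 proof (intro nn_integral_mono)
  fix y
  show "ennreal (norm ((LINT t|lebesgue. p3 t *\<^sub>R p (join3 y t)) - 0)) * indicator (Sect rh) y <= ennreal (?n y)"
   using integral_norm_bound[of lebesgue "\<lambda>t. p3 t *\<^sub>R p (join3 y t)"] by (cases "y \<in> Sect rh") (auto intro: ennreal_leI)
 qed
 also have "\<dots> = ennreal (LINT y|lebesgue. ?n y)" by (intro nn_integral_eq_integral F(1) AE_I2 integral_nonneg_AE) auto
 also have "(LINT y|lebesgue. ?n y) = (LINT x|lebesgue. norm (?q x))" by (rule F(2)[symmetric])
 also have "ennreal \<dots> <= ennreal (LINT x|lebesgue. B * norm (indicator (Sol rh) x *\<^sub>R p x))"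
  using p p3(2) unfolding set_integrable_def
  by (intro ennreal_leI integral_mono iq integrable_mult_right integrable_norm) (auto simp: indicator_def intro: mult_right_mono)
 finally show ?thesis by (simp add: set_lebesgue_integral_def)
qed

end

section \<open>Lipschitz bound for Herglotz functions\<close>

lemma set_integral_norm_bound':
 fixes p :: "'a::euclidean_space => 'b::euclidean_space"
 assumes "set_integrable N S p" "set_integrable N S q" "!!x. x \<in> S ==> norm (p x) <= q x"
 shows "norm (LINT x:S|N. p x) <= (LINT x:S|N. q x :: real)" unfolding set_lebesgue_integral_def
 by (rule Bochner_Integration.integral_norm_bound_integral)
  (use assms in \<open>auto simp: set_integrable_def indicator_def\<close>)

lemma L2_on_subset:
 fixes f :: "'a => 'b::euclidean_space"
 assumes f: "L2_on N S f" and T: "T \<subseteq> S" "T \<in> sets N" and S: "S \<in> sets N"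
 shows "L2_on N T f" "L2_norm N T f <= L2_norm N S f"
proof -
 have "(\<lambda>x. indicator T x *\<^sub>R (indicator S x *\<^sub>R f x)) \<in> borel_measurable N"
  by (rule borel_measurable_scaleR[OF borel_measurable_indicator[OF T(2)]])
   (use f in \<open>simp add: L2_on_def set_borel_measurable_def\<close>)
 moreover have "(\<lambda>x. indicator T x *\<^sub>R (indicator S x *\<^sub>R f x)) = (\<lambda>x. indicator T x *\<^sub>R f x)"
  using T(1) by (auto simp: fun_eq_iff indicator_def)
 moreover have iT: "set_integrable N T (\<lambda>x. (norm (f x))\<^sup>2)"
  using f unfolding L2_on_def by (auto intro: set_integrable_subset[OF _ T(2,1)])
 ultimately show "L2_on N T f" by (simp add: L2_on_def set_borel_measurable_def)
 show "L2_norm N T f <= L2_norm N S f" unfolding L2_norm_def set_lebesgue_integral_def using f iT T(1) unfolding L2_on_def set_integrable_def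
  by (intro real_sqrt_le_mono integral_mono) (auto simp: indicator_def)
qed

lemma norm_vector_mult: "norm (c *s g) = norm c * norm g" for c :: complex and g :: "complex^3"
 unfolding norm_vec_def by (simp add: norm_mult L2_set_right_distrib)

lemma vector_mult_measurable:
 fixes g :: "'a => complex^3"
 assumes [measurable]: "e \<in> borel_measurable N" "g \<in> borel_measurable N" shows "(\<lambda>x. e x *s g x) \<in> borel_measurable N"
proof -
 have "linear (\<lambda>g :: complex^3. \<i> *s g)" by (intro linearI) (simp_all add: vec_eq_iff algebra_simps)
 then have l: "bounded_linear (\<lambda>g :: complex^3. \<i> *s g)" using linear_conv_bounded_linear by blast
 have [measurable]: "(\<lambda>x. \<i> *s g x) \<in> borel_measurable N"
  by (rule measurable_compose[OF assms(2) borel_measurable_continuous_onI[OF linear_continuous_on[OF l]]])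
 have e: "(\<lambda>x. e x *s g x) = (\<lambda>x. Re (e x) *\<^sub>R g x + Im (e x) *\<^sub>R (\<i> *s g x))"
  by (simp add: fun_eq_iff vec_eq_iff complex_eq_iff)
 show ?thesis unfolding e by measurable
qed

lemma norm_exp_diff_le: "norm (exp (\<i> * of_real a) - exp (\<i> * of_real b)) <= \<bar>a - b\<bar>"
proof -
 have "exp (\<i> * of_real a) - exp (\<i> * of_real b) = exp (\<i> * of_real b) * (exp (\<i> * of_real (a - b)) - 1)"
  by (simp add: algebra_simps exp_add[symmetric])
 then have "norm (exp (\<i> * of_real a) - exp (\<i> * of_real b)) = 2 * \<bar>sin ((a - b) / 2)\<bar>"
  by (simp only: norm_mult norm_exp_i_times dist_exp_i_1 mult_1)
 then show ?thesis using abs_sin_x_le_abs_x[of "(a - b) / 2"] by simp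
qed

text \<open>A plane wave with unit direction has its wave number as Lipschitz constant, and on the
  sphere, whose area is finite, the L1 norms of the kernels are bounded by their L2 norms.\<close>

lemma herglotz_lipschitz:
 assumes g: "L2_on surface_measure (sphere 0 1) gp" "L2_on surface_measure (sphere 0 1) gs"
  and B: "L2_norm surface_measure (sphere 0 1) gp <= b" "L2_norm surface_measure (sphere 0 1) gs <= b"
 shows "norm (herglotz lam \<mu> \<omega> gp gs x - herglotz lam \<mu> \<omega> gp gs y) <=
  (\<bar>\<omega> / sqrt (lam + 2 * \<mu>)\<bar> + \<bar>\<omega> / sqrt \<mu>\<bar>) * sqrt (measure surface_measure (sphere (0::real^3) 1)) * b * norm (x - y)"
proof -
 let ?S = "sphere (0::real^3) 1" and ?N = surface_measure
 let ?e = "\<lambda>k x d. exp (\<i> * of_real (k * (x \<bullet> d))) :: complex"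
 define kp ks where "kp = \<omega> / sqrt (lam + 2 * \<mu>)" and "ks = \<omega> / sqrt \<mu>"
 have S: "?S \<in> sets ?N" by simp
 note CS = L2_on_Cauchy_Schwarz[OF _ S emeasure_sphere]
 have i: "set_integrable ?N ?S (\<lambda>d. ?e k x d *s u d)" if u: "L2_on ?N ?S u" for k x and u :: "real^3 => complex^3"
 proof (rule set_integrable_dominated[OF CS(1)[OF u], where B = 1])
  have "(\<lambda>d. ?e k x d) \<in> borel_measurable borel" by (intro borel_measurable_continuous_onI continuous_intros)
  then have "(\<lambda>d. ?e k x d) \<in> borel_measurable ?N" by (simp cong: measurable_cong_sets)
  then have "(\<lambda>d. ?e k x d *s (indicator ?S d *\<^sub>R u d)) \<in> borel_measurable ?N"
   using u unfolding L2_on_def set_borel_measurable_def by (intro vector_mult_measurable) auto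
  moreover have "(\<lambda>d. ?e k x d *s (indicator ?S d *\<^sub>R u d)) = (\<lambda>d. indicator ?S d *\<^sub>R (?e k x d *s u d))"
   by (simp add: fun_eq_iff vec_eq_iff)
  ultimately show "(\<lambda>d. indicator ?S d *\<^sub>R (?e k x d *s u d)) \<in> borel_measurable ?N" by (simp only:)
 qed (simp add: norm_vector_mult)
 let ?I = "\<lambda>x d. ?e kp x d *s gp d + ?e ks x d *s gs d"
 let ?q = "\<lambda>d. (\<bar>kp\<bar> * norm (x - y)) * norm (gp d) + (\<bar>ks\<bar> * norm (x - y)) * norm (gs d)"
 have H: "herglotz lam \<mu> \<omega> gp gs x = (LINT d:?S|?N. ?I x d)" for x by (simp add: herglotz_def kp_def ks_def Let_def)
 have iI: "set_integrable ?N ?S (?I x)" for x by (intro set_integral_add(1) i g)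
 have n: "set_integrable ?N ?S (\<lambda>d. norm (u d))" if "L2_on ?N ?S u" for u :: "real^3 => complex^3"
  by (rule set_integrable_norm[OF CS(1)[OF that]])
 have iq: "set_integrable ?N ?S (\<lambda>d. c * norm (u d))" if "L2_on ?N ?S u" for c and u :: "real^3 => complex^3"
  using n[OF that] by simp
 have "norm (herglotz lam \<mu> \<omega> gp gs x - herglotz lam \<mu> \<omega> gp gs y) = norm (LINT d:?S|?N. ?I x d - ?I y d)"
  unfolding H set_integral_diff(2)[OF iI iI] ..
 also have "\<dots> <= (LINT d:?S|?N. ?q d)"
 proof (rule set_integral_norm_bound')
  show "set_integrable ?N ?S (\<lambda>d. ?I x d - ?I y d)" by (rule set_integral_diff(1)[OF iI iI])
  show "set_integrable ?N ?S ?q" by (intro set_integral_add(1) iq g)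
  fix d assume d: "d \<in> ?S"
  have k: "norm ((?e k x d - ?e k y d) *s u) <= (\<bar>k\<bar> * norm (x - y)) * norm u" for k and u :: "complex^3"
  proof -
   have "\<bar>k * (x \<bullet> d) - k * (y \<bullet> d)\<bar> = \<bar>k\<bar> * \<bar>(x - y) \<bullet> d\<bar>"
    by (simp add: inner_diff_left right_diff_distrib[symmetric] abs_mult)
   also have "\<dots> <= \<bar>k\<bar> * (norm (x - y) * 1)" using Cauchy_Schwarz_ineq2[of "x - y" d] d by (intro mult_left_mono) auto
   finally have "\<bar>k * (x \<bullet> d) - k * (y \<bullet> d)\<bar> <= \<bar>k\<bar> * norm (x - y)" by simp
   then have "norm (?e k x d - ?e k y d) <= \<bar>k\<bar> * norm (x - y)" by (rule order_trans[OF norm_exp_diff_le])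
   then show ?thesis unfolding norm_vector_mult by (intro mult_right_mono) auto
  qed
  have "?I x d - ?I y d = (?e kp x d - ?e kp y d) *s gp d + (?e ks x d - ?e ks y d) *s gs d" by (simp add: vec_eq_iff algebra_simps)
  then show "norm (?I x d - ?I y d) <= ?q d" by (simp only:) (intro norm_triangle_mono k)
 qed
 also have "\<dots> = (\<bar>kp\<bar> * norm (x - y)) * (LINT d:?S|?N. norm (gp d)) + (\<bar>ks\<bar> * norm (x - y)) * (LINT d:?S|?N. norm (gs d))"
  by (subst set_integral_add(2)[OF iq[OF g(1)] iq[OF g(2)]]) simp
 also have "\<dots> <= (\<bar>kp\<bar> * norm (x - y)) * (sqrt (measure ?N ?S) * b) + (\<bar>ks\<bar> * norm (x - y)) * (sqrt (measure ?N ?S) * b)"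
  by (intro add_mono mult_left_mono order_trans[OF CS(2)[OF g(1)]] order_trans[OF CS(2)[OF g(2)]] B) auto
 finally show ?thesis unfolding kp_def ks_def by (simp add: algebra_simps)
qed

section \<open>Complex conjugation, and the vanishing of the edge value\<close>

definition cnjv :: "complex^3 => complex^3" where "cnjv z = (\<chi> i. cnj (z $ i))"

lemma cnjv: "cnjv z $ i = cnj (z $ i)" "norm (cnjv z) = norm z" "cnjv (cnjv z) = z" "cnjv (a - b) = cnjv a - cnjv b"
 "bounded_linear cnjv"
proof -
 show "cnjv z $ i = cnj (z $ i)" "norm (cnjv z) = norm z" "cnjv (cnjv z) = z" "cnjv (a - b) = cnjv a - cnjv b"
  by (simp_all add: cnjv_def norm_vec_def vec_eq_iff)
 have "linear cnjv" by (intro linearI) (simp_all add: cnjv_def vec_eq_iff)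
 then show "bounded_linear cnjv" using linear_conv_bounded_linear by blast
qed

lemma cnj_dir_deriv: "smooth \<phi> ==> dir_deriv b (\<lambda>x. cnj (\<phi> x)) = (\<lambda>x. cnj (dir_deriv b \<phi> x))"
 by (rule dir_deriv_bounded_linear[OF bounded_linear_cnj])

text \<open>The Lame coefficients are real, so the equation for the conjugated field tested with a
  function is the conjugate of the original equation tested with the conjugate function.\<close>

lemma lame_row_cnj:
 assumes "smooth \<phi>" shows "lame_row lam \<mu> \<phi> (\<lambda>x. cnjv (F x)) i x = cnj (lame_row lam \<mu> (\<lambda>x. cnj (\<phi> x)) F i x)"
 unfolding lame_row_def cnj_dir_deriv[OF assms] cnj_dir_deriv[OF smooth_dir_deriv[OF assms]] by (simp add: cnjv)

context edge
begin

text \<open>Contraction with \<open>(1, \<i>, 0)\<close>, applied to the data and to their complex conjugates,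
 and with \<open>(0, 0, 1)\<close> yields all components of the mean value.\<close>

lemma edge_average_zero:
 fixes F f :: "real^3 => complex^3"
 assumes F: "!!x. x \<in> Sol h ==> norm (F x) <= CF * norm (proj2 x) powr (1 + \<alpha>)" and \<alpha>: "\<alpha> > 0"
  and r0: "0 < r0" "r0 <= h" and \<omega>: "\<omega> ~= 0"
  and f: "Sintegrable f"
  and row: "!!\<phi> i. smooth \<phi> ==> test_fun (Cyl r0) (\<lambda>x. Re (\<phi> x)) ==> test_fun (Cyl r0) (\<lambda>x. Im (\<phi> x)) ==>
   Sintegrable (lame_row lam \<mu> \<phi> F i) \<and>
   (SINT x. lame_row lam \<mu> \<phi> F i x) = of_real (\<omega>\<^sup>2) * (SINT x. \<phi> x * f x $ i)"
  and p3: "test_fun {-M<..<M} p3" "(LINT t|lborel. p3 t) ~= 0"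
  and avg: "osc_decay (Rop p3 f) ka de" and de: "de > 0"
 shows "ka = 0"
proof -
 obtain C where C: "C >= 0" "!!rh. 0 < rh ==> rh <= h ==> osc (Rop p3 f) ka rh <= ennreal (C * rh powr (2 + de))"
  using avg unfolding osc_decay_def by blast
 note blow = edge_blowup[OF F \<alpha> r0 \<omega> f row p3 C(2)[unfolded osc_def] C(1) de]
 let ?F = "\<lambda>x. cnjv (F x)" and ?f = "\<lambda>x. cnjv (f x)"
 have R: "Rop p3 ?f y = cnjv (Rop p3 f y)" for y
  using Bochner_Integration.integral_bounded_linear'[OF cnjv(5) cnjv(5), where M = lebesgue and f = "\<lambda>t. p3 t *\<^sub>R f (join3 y t)"]
  unfolding Rop_def by (simp add: cnjv(3) linear_scale[OF bounded_linear.linear[OF cnjv(5)]])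
 have bF: "norm (?F x) <= CF * norm (proj2 x) powr (1 + \<alpha>)" if "x \<in> Sol h" for x using F[OF that] by (simp add: cnjv)
 have bf: "Sintegrable ?f" by (rule set_integrable_bounded_linear[OF cnjv(5) f])
 have brow: "Sintegrable (lame_row lam \<mu> \<phi> ?F i) \<and>
   (SINT x. lame_row lam \<mu> \<phi> ?F i x) = of_real (\<omega>\<^sup>2) * (SINT x. \<phi> x * ?f x $ i)"
  if t: "smooth \<phi>" "test_fun (Cyl r0) (\<lambda>x. Re (\<phi> x))" "test_fun (Cyl r0) (\<lambda>x. Im (\<phi> x))" for \<phi> i
 proof -
  let ?c = "\<lambda>x. cnj (\<phi> x)"
  have "smooth ?c" by (rule smooth_compose[OF t(1) smooth_linear[OF bounded_linear_cnj]])
  moreover have "test_fun (Cyl r0) (\<lambda>x. Re (?c x))" "test_fun (Cyl r0) (\<lambda>x. Im (?c x))"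
   using t(2) test_fun_mult[OF t(3) smooth_const[of "-1"]] by simp_all
  ultimately have r: "Sintegrable (lame_row lam \<mu> ?c F i)"
   "(SINT x. lame_row lam \<mu> ?c F i x) = of_real (\<omega>\<^sup>2) * (SINT x. ?c x * f x $ i)" using row by blast+
  have e: "(SINT x. cnj (p x)) = cnj (SINT x. p x)" for p
   using Bochner_Integration.integral_bounded_linear'[OF bounded_linear_cnj bounded_linear_cnj, of lebesgue "\<lambda>x. indicator (Sol h) x *\<^sub>R p x"]
   by (simp add: set_lebesgue_integral_def)
  have "(SINT x. lame_row lam \<mu> \<phi> ?F i x) = cnj (of_real (\<omega>\<^sup>2) * (SINT x. ?c x * f x $ i))"
   unfolding lame_row_cnj[OF t(1)] e r(2) ..
  also have "\<dots> = of_real (\<omega>\<^sup>2) * (SINT x. \<phi> x * ?f x $ i)" using e[of "\<lambda>x. ?c x * f x $ i"] by (simp add: cnjv)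
  finally show ?thesis using set_integrable_bounded_linear[OF bounded_linear_cnj r(1)] unfolding lame_row_cnj[OF t(1), abs_def] by blast
 qed
 have bC: "(\<integral>\<^sup>+y. ennreal (norm (Rop p3 ?f y - cnjv ka)) * indicator (Sect rh) y \<partial>lebesgue) <= ennreal (C * rh powr (2 + de))"
  if "0 < rh" "rh <= h" for rh using C(2)[OF that] unfolding osc_def R cnjv(4)[symmetric] cnjv(2) .
 note bblow = edge_blowup[OF bF \<alpha> r0 \<omega> bf brow p3 bC C(1) de]
 let ?c = "vector [1, \<i>, 0] :: complex^3" and ?d = "vector [0, 0, 1] :: complex^3"
 have 1: "ka $ 1 + \<i> * ka $ 2 = 0" using blow[of ?c] by (simp add: contr_def sum_3)
 have 2: "ka $ 3 = 0" using blow[of ?d] by (simp add: contr_def sum_3)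
 \<comment> \<open>Conjugated back this reads ka1 - i ka2 = 0, which together with ka1 + i ka2 = 0
   removes both planar components.\<close>
 have "cnj (ka $ 1) + \<i> * cnj (ka $ 2) = 0" using bblow[of ?c] by (simp add: contr_def sum_3 cnjv)
 then have "cnj (cnj (ka $ 1) + \<i> * cnj (ka $ 2)) = 0" by simp
 then have "ka $ 1 = 0" "ka $ 2 = 0" using 1 by (auto simp: complex_eq_iff)
 then show ?thesis using 2 by (simp add: vec_eq_iff forall_3)
qed

text \<open>The number of the approximating function is coupled to the scale by \<open>j \<approx> (h / rh) powr (2 / (\<gamma> + b))\<close>,
 which balances the approximation error against the growth of the Lipschitz constants.\<close>

lemma osc_decay_approx:
 fixes v :: "real^3 => complex^3"
 assumes v: "L2_on lebesgue (Sol h) v" and p3: "test_fun {-M<..<M} p3" and b: "0 < b" "b < \<gamma>" and L: "L >= 0"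
  and lip: "!!j x y. j >= 1 ==> norm (vj j x - vj j y) <= L * real j powr b * norm (x - y)"
  and E: "!!j. j >= 1 ==> L2_norm lebesgue (Sol h) (\<lambda>x. v x - vj j x) <= real j powr (- \<gamma>)"
 shows "\<exists>ka. osc_decay (Rop p3 v) ka ((\<gamma> - b) / (\<gamma> + b))"
proof -
 \<comment> \<open>With j of size rh^(-\<tau>), the approximation error gives rh j^(-\<gamma>) and
   the Lipschitz bound j^b rh^3. Equality of the two exponents means that \<tau> \<gamma> = 1 + de
   and \<tau> b = 1 - de, and both bounds become rh^(2+de).\<close>
 define de \<tau> where "de = (\<gamma> - b) / (\<gamma> + b)" and "\<tau> = 2 / (\<gamma> + b)"
 have de: "de > 0" "\<tau> > 0" "\<tau> * \<gamma> = 1 + de" "\<tau> * b = 1 - de" using b by (auto simp: de_def \<tau>_def field_simps)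
 obtain B where B: "B > 0" "!!t. \<bar>p3 t\<bar> <= B" by (rule test_fun_bounded[OF p3]) blast
 have Sol: "Sol r \<in> sets lebesgue" "emeasure lebesgue (Sol r) < top" for r using open_Sol emeasure_Sol by auto
 note CS = L2_on_Cauchy_Schwarz[OF _ Sol]
 define C where "C = B * sqrt (8 * M) * h powr (- (1 + de)) + 2 * M * B * pi * L * 2 powr b * h powr (1 - de)"
 have C: "C >= 0" using B(1) M L by (simp add: C_def)
 have "\<exists>ka. osc_decay (Rop p3 v) ka de"
 proof (rule osc_decay_campanato[OF Rop_sections(3)[OF CS(1)[OF v] p3] C de(1)])
  fix rh assume rh: "0 < rh" "rh <= h"
  let ?t = "h / rh"
  \<comment> \<open>As rh <= h, the power is at least 1; rounding up therefore gives j >= 1 and at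
    most doubles it.\<close>
  define j where "j = nat \<lceil>?t powr \<tau>\<rceil>"
  have t1: "1 <= ?t powr \<tau>" using rh de(2) by (intro ge_one_powr_ge_zero) (auto simp: field_simps)
  have j: "?t powr \<tau> <= real j" "real j <= 2 * ?t powr \<tau>" "j >= 1" using t1 unfolding j_def by linarith+
  define d where "d x = v x - vj j x" for x
  have c: "continuous_on UNIV (vj j)"
   by (rule lipschitz_on_continuous_on[OF lipschitz_onI[of _ _ "L * real j powr b"]]) (use lip[OF j(3)] L in \<open>auto simp: dist_norm\<close>)
  have Lj: "L2_on lebesgue (Sol h) (vj j)"
  proof -
   obtain R where R: "!!x. x \<in> Cyl h ==> norm x <= R" using bounded_Cyl[of h] unfolding bounded_iff by blast
   have "vj j \<in> borel_measurable lebesgue" using borel_measurable_continuous_onI[OF c] by (simp add: measurable_completion)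
   moreover have "norm (vj j x) <= norm (vj j 0) + L * real j powr b * R" if "x \<in> Sol h" for x
   proof -
    have "L * real j powr b * norm x <= L * real j powr b * R" using R[of x] that Sol_subset_Cyl L by (intro mult_left_mono) auto
    then show ?thesis using lip[OF j(3), of x 0] norm_triangle_sub[of "vj j x" "vj j 0"] by simp
   qed
   ultimately show ?thesis by (intro L2_on_bounded[OF _ Sol]) auto
  qed
  have Ld: "L2_on lebesgue (Sol h) d" unfolding d_def[abs_def] by (rule L2_on_diff[OF v Lj])
  have sub: "Sol rh \<subseteq> Sol h" using rh by (auto simp: in_Sol)
  note Ldr = L2_on_subset[OF Ld sub Sol(1) Sol(1)]
  have "osc (Rop p3 d) 0 rh <= ennreal (B * (LINT x:Sol rh|lebesgue. norm (d x)))" by (rule osc_Rop_L1[OF CS(1)[OF Ldr(1)] p3 B(2)])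
  \<comment> \<open>The additional factor rh is the square root of the volume of the solid sector,
    from the Cauchy-Schwarz inequality.\<close>
  also have "B * (LINT x:Sol rh|lebesgue. norm (d x)) <= B * (sqrt (8 * M) * rh * real j powr (- \<gamma>))"
  proof -
   have "emeasure lebesgue (Sol rh) <= ennreal (8 * M * rh\<^sup>2)"
    using open_Cyl[of rh] by (intro order_trans[OF emeasure_mono[OF Sol_subset_Cyl] emeasure_Cyl_le[OF rh(1)]]) auto
   then have "measure lebesgue (Sol rh) <= 8 * M * rh\<^sup>2" using M by (simp add: measure_def enn2real_leI)
   then have "sqrt (measure lebesgue (Sol rh)) <= sqrt (8 * M) * rh"
    using real_sqrt_le_mono[of _ "8 * M * rh\<^sup>2"] rh by (simp add: real_sqrt_mult)
   then have "sqrt (measure lebesgue (Sol rh)) * L2_norm lebesgue (Sol rh) d <= sqrt (8 * M) * rh * real j powr (- \<gamma>)"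
    using order_trans[OF Ldr(2) E[OF j(3), folded d_def]] L2_norm_nonneg rh M by (intro mult_mono) auto
   then show ?thesis using order_trans[OF CS(2)[OF Ldr(1)]] B(1) by (intro mult_left_mono) auto
  qed
  also have "\<dots> <= B * sqrt (8 * M) * h powr (- (1 + de)) * rh powr (2 + de)"
  proof -
   have "real j powr (- \<gamma>) <= (?t powr \<tau>) powr (- \<gamma>)" using j(1) t1 b by (intro powr_mono2') auto
   also have "\<dots> = ?t powr (- (1 + de))" unfolding powr_powr using de(3) by simp
   also have "\<dots> = h powr (- (1 + de)) / rh powr (- (1 + de))" by (rule powr_divide)
   also have "\<dots> = h powr (- (1 + de)) * rh powr (1 + de)" unfolding powr_minus[of rh] by (simp add: divide_inverse)
   finally have "B * sqrt (8 * M) * (rh * real j powr (- \<gamma>)) <= B * sqrt (8 * M) * (rh * (h powr (- (1 + de)) * rh powr (1 + de)))"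
    using B(1) M rh(1) by (intro mult_left_mono) auto
   moreover have "rh powr (2 + de) = rh * rh powr (1 + de)" using rh(1) powr_add[of rh 1 "1 + de"] by simp
   ultimately show ?thesis by (simp add: mult_ac)
  qed
  finally have 1: "osc (Rop p3 d) 0 rh <= ennreal (B * sqrt (8 * M) * h powr (- (1 + de)) * rh powr (2 + de))" by (simp add: ennreal_leI)
  \<comment> \<open>The constant is the reduced edge value of the approximating function, which
    varies with the scale; this is why a Campanato argument has to produce one constant for all
    scales.\<close>
  let ?k = "LINT t|lebesgue. p3 t *\<^sub>R vj j (join3 0 t)"
  have "osc (Rop p3 (vj j)) ?k rh <= ennreal (2 * M * B * pi * (L * real j powr b) * rh powr (2 + 1))"
  proof (rule osc_Rop_pointwise[OF CS(1)[OF Lj] p3 B(2) _ _ _ _ rh])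
   show "continuous_on {-M<..<M} (\<lambda>t. vj j (join3 0 t))" by (rule continuous_on_compose2[OF c]) (auto intro!: continuous_intros)
   fix y t
   have "join3 y t - join3 0 t = join3 y 0" by (simp add: vec_eq_iff forall_3)
   moreover have "norm (join3 y 0) = norm y" using norm_join3[of y 0] by simp
   ultimately show "norm (vj j (join3 y t) - vj j (join3 0 t)) <= (L * real j powr b) * norm y powr 1"
    using lip[OF j(3), of "join3 y t" "join3 0 t"] by simp
  qed (use L in auto)
  also have "2 * M * B * pi * (L * real j powr b) * rh powr (2 + 1) <= 2 * M * B * pi * L * 2 powr b * h powr (1 - de) * rh powr (2 + de)"
  proof -
   have "real j powr b <= (2 * ?t powr \<tau>) powr b" using j(2) b by (intro powr_mono2) auto
   also have "\<dots> = 2 powr b * (h powr (1 - de) / rh powr (1 - de))" using de(4) by (simp add: powr_mult powr_powr powr_divide)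
   finally have "2 * M * B * pi * L * (real j powr b * rh powr 3) <=
     2 * M * B * pi * L * (2 powr b * (h powr (1 - de) / rh powr (1 - de)) * rh powr 3)" using B(1) M L by (intro mult_left_mono mult_right_mono) auto
   moreover have "rh powr 3 = rh powr (1 - de) * rh powr (2 + de)" by (simp add: powr_add[symmetric])
   moreover have "rh powr (1 - de) > 0" using rh(1) by simp
   ultimately show ?thesis by (simp add: mult_ac)
  qed
  finally have 2: "osc (Rop p3 (vj j)) ?k rh <= ennreal (2 * M * B * pi * L * 2 powr b * h powr (1 - de) * rh powr (2 + de))"
   by (simp add: ennreal_leI)
  have "osc (Rop p3 (\<lambda>x. d x + 1 *\<^sub>R vj j x)) (0 + 1 *\<^sub>R ?k) rh <= osc (Rop p3 d) 0 rh + osc (Rop p3 (vj j)) ?k rh"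
   by (rule osc_Rop_combine[OF CS(1)[OF Ld] CS(1)[OF Lj] p3 rh(2)]) simp
  also have "\<dots> <= ennreal (C * rh powr (2 + de))"
   using add_mono[OF 1 2] B(1) M L by (simp add: C_def distrib_right ennreal_plus[symmetric] del: ennreal_plus)
  finally show "\<exists>ka. osc (Rop p3 v) ka rh <= ennreal (C * rh powr (2 + de))" by (auto simp: d_def)
 qed
 then show ?thesis by (simp add: de_def)
qed

end

section \<open>Average of the reduced potential term\<close>

context edge
begin

text \<open>The difference vanishes almost everywhere, so the L1 bound gives its reduction
  oscillation 0. Fields known only up to null sets may thus be exchanged before the reduction along
  lines.\<close>

lemma osc_decay_cong:
 fixes f g :: "real^3 => 'b::euclidean_space"
 assumes f: "Sintegrable f" and g: "Sintegrable g"
  and p3: "test_fun {-M<..<M} p3" and e: "AE x in lebesgue. x \<in> Sol h \<longrightarrow> f x = g x"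
  and d: "osc_decay (Rop p3 g) ka de"
 shows "osc_decay (Rop p3 f) ka de"
proof -
 let ?d = "\<lambda>x. f x - g x"
 have i: "Sintegrable ?d" by (rule set_integral_diff(1)[OF f g])
 obtain B where B: "B > 0" "!!t. \<bar>p3 t\<bar> <= B" by (rule test_fun_bounded[OF p3]) blast
 have "osc (Rop p3 ?d) 0 rh <= ennreal (0 * rh powr (2 + de))" if rh: "0 < rh \<and> rh <= h" for rh
 proof -
  have s: "Sol rh \<subseteq> Sol h" using rh by (auto simp: in_Sol)
  have "osc (Rop p3 ?d) 0 rh <= ennreal (B * (LINT x:Sol rh|lebesgue. norm (?d x)))"
   using open_Sol by (intro osc_Rop_L1[OF set_integrable_subset[OF i _ s] p3 B(2)]) auto
  also have "(LINT x:Sol rh|lebesgue. norm (?d x)) = 0" unfolding set_lebesgue_integral_def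
   by (rule integral_eq_zero_AE) (use e s in \<open>auto elim!: eventually_mono simp: indicator_def\<close>)
  finally show ?thesis by simp
 qed
 then have "osc_decay (Rop p3 ?d) 0 de" unfolding osc_decay_def by blast
 from osc_decay_combine[OF g i p3 _ d this, of 1] show ?thesis by simp
qed

end

context lame_pair
begin

text \<open>Of the two parts of \<open>f\<close>, the first has a Hoelder representative, hence an
  edge value after reduction, and the second has one by assumption. The resulting value for
  \<open>f\<close> vanishes by \<open>edge_average_zero\<close>, and adding back \<open>F\<close>,
  whose value is 0 by decay, gives \<open>V w\<close>.\<close>

lemma potential_osc_decay:
 assumes p3: "test_fun {-M<..<M} p3" "(LINT t|lborel. p3 t) ~= 0" and \<omega>: "\<omega> ~= 0"
  and P: "holder_on \<alpha> Kcl P" "AE x in lebesgue. x \<in> interior Kcl \<longrightarrow> P x = (1 + V x) *\<^sub>R w x"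
  and v: "osc_decay (Rop p3 v) kav de" and de: "de > 0"
 shows "\<exists>de>0. osc_decay (Rop p3 (\<lambda>x. V x *\<^sub>R w x)) 0 de"
proof -
 let ?q = "\<lambda>x. (1 + V x) *\<^sub>R w x"
 \<comment> \<open>A common exponent for all the fields that are combined; a slower decay follows
   from a faster one.\<close>
 define de' where "de' = min de \<alpha>"
 have de': "de' > 0" "de' <= de" "de' <= \<alpha>" "de' <= 1 + \<alpha>" using de \<alpha> by (auto simp: de'_def)
 obtain B where B: "B > 0" "!!t. \<bar>p3 t\<bar> <= B" by (rule test_fun_bounded[OF p3(1)]) blast
 have iv: "Sintegrable v" by (rule set_integrable_Sol[OF L2_integrable[OF H1_D(1)[OF H1(1)]]])
 have iw: "Sintegrable w" by (rule set_integrable_Sol[OF L2_integrable[OF H1_D(1)[OF H1(2)]]])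
 have iq: "Sintegrable ?q" by (rule set_integrable_Sol[OF L2_integrable[OF L2_qw]])
 have fi: "Sintegrable f" by (rule set_integrable_Sol[OF L2_integrable[OF L2_f]])
 have qP: "AE x in lebesgue. x \<in> Sol h \<longrightarrow> ?q x = P x" using P(2) by eventually_elim (use Sol_subset_interior in auto)
 have cP: "continuous_on Kcl P" by (rule holder_continuous[OF P(1) \<alpha>])
 have iP: "Sintegrable P"
 proof -
  have "(\<lambda>x. indicator (Sol h) x *\<^sub>R P x) \<in> borel_measurable borel"
   using open_Sol by (intro borel_measurable_continuous_on_indicator continuous_on_subset[OF cP Sol_subset_Kcl]) auto
  then have "(\<lambda>x. indicator (Sol h) x *\<^sub>R P x) \<in> borel_measurable lebesgue" by (simp add: measurable_completion)
  moreover have "AE x in lebesgue. indicator (Sol h) x *\<^sub>R ?q x = indicator (Sol h) x *\<^sub>R P x"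
   using qP by eventually_elim (simp add: indicator_def)
  ultimately show ?thesis unfolding set_integrable_def by (rule integrable_cong_AE_imp[OF iq[unfolded set_integrable_def]])
 qed
 have axis_Kcl: "join3 0 t \<in> Kcl" if "\<bar>t\<bar> < M" for t using that h by (intro in_Kcl) (auto simp: in_Cyl)
 have sect_Sol: "join3 y t \<in> Sol h" if "y \<in> Sect h" "\<bar>t\<bar> < M" for y t using that by (auto simp: Sect_def in_Sol)
 obtain C where C: "!!x y. x \<in> Kcl ==> y \<in> Kcl ==> norm (P x - P y) <= C * norm (x - y) powr \<alpha>"
  using P(1) unfolding holder_on_def by blast
 define kaP where "kaP = (LINT t|lebesgue. p3 t *\<^sub>R P (join3 0 t))"
 have "osc (Rop p3 P) kaP rh <= ennreal (2 * M * B * pi * \<bar>C\<bar> * rh powr (2 + \<alpha>))" if rh: "0 < rh \<and> rh <= h" for rh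
  unfolding kaP_def
 proof (rule osc_Rop_pointwise[OF iP p3(1) B(2)])
  show "continuous_on {-M<..<M} (\<lambda>t. P (join3 0 t))" by (rule continuous_on_compose2[OF cP]) (auto intro!: continuous_intros axis_Kcl)
  fix y t assume y: "y \<in> Sect h" "\<bar>t\<bar> < M"
  have "join3 y t - join3 0 t = join3 y 0" by (simp add: vec_eq_iff forall_3)
  moreover have "norm (join3 y 0) = norm y" using norm_join3[of y 0] by simp
  ultimately have "norm (P (join3 y t) - P (join3 0 t)) <= C * norm y powr \<alpha>"
   using C[of "join3 y t" "join3 0 t"] sect_Sol[OF y] axis_Kcl[OF y(2)] Sol_subset_Kcl by auto
  also have "\<dots> <= \<bar>C\<bar> * norm y powr \<alpha>" by (intro mult_right_mono) auto
  finally show "norm (P (join3 y t) - P (join3 0 t)) <= \<bar>C\<bar> * norm y powr \<alpha>" .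
 qed (use rh \<alpha> in auto)
 then have "osc_decay (Rop p3 P) kaP \<alpha>" unfolding osc_decay_def using M B(1) by (intro exI[of _ "2 * M * B * pi * \<bar>C\<bar>"]) auto
 then have q: "osc_decay (Rop p3 ?q) kaP de'" by (intro osc_decay_mono[OF osc_decay_cong[OF iq iP p3(1) qP] de'(3)])
 have ef: "(\<lambda>x. ?q x + (- 1) *\<^sub>R v x) = f" by (simp add: f_def[abs_def])
 have f0: "osc_decay (Rop p3 f) (kaP + (- 1) *\<^sub>R kav) de'"
  unfolding ef[symmetric] by (rule osc_decay_combine[OF iq iv p3(1) _ q osc_decay_mono[OF v de'(2)]]) simp
 obtain CF where CF: "CF >= 0" "!!x. x \<in> Sol h ==> norm (F x) <= CF * norm (proj2 x) powr (1 + \<alpha>)" using F_powr by blast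
 \<comment> \<open>So the edge values of the reduced fields (1 + V) w and v coincide.\<close>
 have "kaP + (- 1) *\<^sub>R kav = 0"
 proof (rule edge_average_zero[OF CF(2) \<alpha> h1 \<omega> fi _ p3 f0 de'(1)])
  fix \<phi> i assume "smooth \<phi>" "test_fun (Cyl h1) (\<lambda>x. Re (\<phi> x))" "test_fun (Cyl h1) (\<lambda>x. Im (\<phi> x))"
  from lame_identity[OF this]
  show "Sintegrable (lame_row lam \<mu> \<phi> F i) \<and>
   (SINT x. lame_row lam \<mu> \<phi> F i x) = of_real (\<omega>\<^sup>2) * (SINT x. \<phi> x * f x $ i)" by blast
 qed
 with f0 have f0: "osc_decay (Rop p3 f) 0 de'" by simp
 \<comment> \<open>Here the edge values are 0, so the constant is 0 and the exponent is the full 1 +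
   \<alpha>.\<close>
 have "osc (Rop p3 F) (LINT t|lebesgue. p3 t *\<^sub>R 0) rh <= ennreal (2 * M * B * pi * CF * rh powr (2 + (1 + \<alpha>)))" if rh: "0 < rh \<and> rh <= h" for rh
 proof (rule osc_Rop_pointwise[OF F_set_integrable p3(1) B(2) CF(1)])
  show "norm (F (join3 y t) - 0) <= CF * norm y powr (1 + \<alpha>)" if "y \<in> Sect h" "\<bar>t\<bar> < M" for y t
   using CF(2)[OF sect_Sol[OF that]] by simp
 qed (use rh \<alpha> in auto)
 then have "osc_decay (Rop p3 F) 0 (1 + \<alpha>)" unfolding osc_decay_def using M B(1) CF(1) by (intro exI[of _ "2 * M * B * pi * CF"]) auto
 from osc_decay_combine[OF fi F_set_integrable p3(1) _ f0 osc_decay_mono[OF this de'(4)], of 1]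
 have s: "osc_decay (Rop p3 (\<lambda>x. f x + F x)) 0 de'" by simp
 have iV: "Sintegrable (\<lambda>x. V x *\<^sub>R w x)" using set_integral_diff(1)[OF iq iw] by (simp add: algebra_simps)
 have "AE x in lebesgue. x \<in> Sol h \<longrightarrow> V x *\<^sub>R w x = f x + F x" using F_eq by eventually_elim (simp add: f_def algebra_simps)
 from osc_decay_cong[OF iV set_integral_add(1)[OF fi F_set_integrable] p3(1) this s]
 show ?thesis using de'(1) by blast
qed

text \<open>The projection of the domain may contain points of the small disk outside the sector,
  but for |t| < M the domain lies above the sector only, so there the extension by zero makes the
  reduced field vanish. The sector is contained in the projection, so the denominator is at least of
  order rh^2, while the numerator is O(rh^(2+de)).\<close>

lemma dim_reduction_average_tendsto_0:
 assumes \<phi>: "test_fun {c - L<..<c + L} \<phi>" "{c - L<..<c + L} \<subseteq> {-M<..<M}"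
  and d: "osc_decay (Rop \<phi> p) 0 de" "de > 0"
 shows "((\<lambda>rh. (1 / measure lebesgue (ball 0 rh \<inter> proj2 ` Om)) *\<^sub>R
  (LINT x':ball 0 rh \<inter> proj2 ` Om|lebesgue. dim_reduction c L \<phi> (zero_ext Om p) x')) \<longlongrightarrow> 0) (at_right 0)"
proof -
 obtain C where C: "C >= 0" "!!rh. 0 < rh \<and> rh <= h ==> osc (Rop \<phi> p) 0 rh <= ennreal (C * rh powr (2 + de))"
  using d(1) unfolding osc_decay_def by blast
 have \<phi>M: "test_fun {-M<..<M} \<phi>" by (rule test_fun_mono[OF \<phi>])
 let ?D = "dim_reduction c L \<phi> (zero_ext Om p)"
 have D: "?D y = Rop \<phi> (zero_ext Om p) y" for y unfolding dim_reduction_def Rop_def set_lebesgue_integral_def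
  using test_funD(5)[OF \<phi>(1)] by (intro Bochner_Integration.integral_cong) (auto simp: indicator_def)
 have Dy: "?D y = indicator (Sect h) y *\<^sub>R Rop \<phi> p y" if y: "norm y < h" for y
 proof -
  have "\<phi> t *\<^sub>R zero_ext Om p (join3 y t) = indicator (Sect h) y *\<^sub>R (\<phi> t *\<^sub>R p (join3 y t))" for t
  proof (cases "\<phi> t = 0")
   case False
   then have "\<bar>t\<bar> < M" by (rule test_fun_axis(2)[OF \<phi>M])
   then have "join3 y t \<in> Cyl h" "join3 y t \<in> Sol h \<longleftrightarrow> y \<in> Sect h" using y by (auto simp: in_Cyl in_Sol Sect_def)
   then have "join3 y t \<in> Om \<longleftrightarrow> y \<in> Sect h" using Cyl_Int by blast
   then show ?thesis by (simp add: zero_ext_def indicator_def)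
  qed simp
  then show ?thesis unfolding D Rop_def by (simp only: integral_scaleR_right)
 qed
 \<comment> \<open>A surjective linear map is open, so the projection of the domain is open and in
   particular measurable.\<close>
 have "surj proj2" by (rule surjI[of _ "\<lambda>y. join3 y 0"]) simp
 then have oP: "open (proj2 ` Om)" by (rule open_surjective_linear_image[OF Om(1) linear_proj2])
 define a where "a = pi * (sin be / 4)\<^sup>2"
 have a: "a > 0" using sin_be by (simp add: a_def)
 have bound: "norm ((1 / measure lebesgue (ball 0 rh \<inter> proj2 ` Om)) *\<^sub>R (LINT x':ball 0 rh \<inter> proj2 ` Om|lebesgue. ?D x')) <= C / a * rh powr de"
  if rh: "0 < rh" "rh < h" for rh
 proof -
  let ?B = "ball 0 rh \<inter> proj2 ` Om"
  have sub: "Sect rh \<subseteq> ?B"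
  proof
   fix y assume y: "y \<in> Sect rh"
   then have "join3 y 0 \<in> Sol h" using rh M by (auto simp: in_Sol Sect_def)
   then have "proj2 (join3 y 0) \<in> proj2 ` Om" using Sol_subset_Om by blast
   then show "y \<in> ?B" using y by (simp add: Sect_def)
  qed
  have oB: "open ?B" using oP by (intro open_Int open_ball)
  have "emeasure lborel ?B < top" using emeasure_bounded_finite[of ?B] bounded_subset[OF bounded_ball, of ?B 0 rh] by (simp add: less_top)
  then have fB: "emeasure lebesgue ?B < top" using oB by simp
  have "ennreal (a * rh\<^sup>2) <= emeasure lebesgue ?B"
   unfolding a_def using oB by (intro order_trans[OF emeasure_Sect(2)[OF rh(1)] emeasure_mono[OF sub]]) auto
  also have "\<dots> = ennreal (measure lebesgue ?B)" using fB by (intro emeasure_eq_ennreal_measure) auto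
  finally have m: "a * rh\<^sup>2 <= measure lebesgue ?B" by simp
  have "norm (LINT y:?B|lebesgue. ?D y) <= C * rh powr (2 + de)"
  proof (cases "integrable lebesgue (\<lambda>y. indicator ?B y *\<^sub>R ?D y)")
   case True
   have "ennreal (norm (LINT y:?B|lebesgue. ?D y)) <= (\<integral>\<^sup>+y. norm (indicator ?B y *\<^sub>R ?D y) \<partial>lebesgue)"
    unfolding set_lebesgue_integral_def by (rule integral_norm_bound_ennreal[OF True])
   also have "\<dots> = osc (Rop \<phi> p) 0 rh" unfolding osc_def
   proof (intro nn_integral_cong)
    fix y
    show "ennreal (norm (indicator ?B y *\<^sub>R ?D y)) = ennreal (norm (Rop \<phi> p y - 0)) * indicator (Sect rh) y"
    proof (cases "norm y < rh")
     case True
     then have "y \<in> Sect h \<longleftrightarrow> y \<in> Sect rh" "norm y < h" using rh by (auto simp: Sect_def)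
     then show ?thesis using Dy sub by (auto simp: indicator_def)
    next
     case False then show ?thesis by (simp add: Sect_def)
    qed
   qed
   also have "\<dots> <= ennreal (C * rh powr (2 + de))" using rh by (intro C(2)) auto
   finally show ?thesis using C(1) by simp
  next
   \<comment> \<open>The integral of a non-integrable function is 0 by convention, so the bound
     holds in this case as well.\<close>
   case False
   then show ?thesis using C(1) by (simp add: set_lebesgue_integral_def not_integrable_integral_eq)
  qed
  moreover have p: "0 < a * rh\<^sup>2" using a rh by simp
  ultimately have "norm (LINT y:?B|lebesgue. ?D y) / measure lebesgue ?B <= C * rh powr (2 + de) / (a * rh\<^sup>2)"
   using m C(1) by (intro frac_le) auto
  also have "\<dots> = C / a * rh powr de" using rh by (simp add: powr_add)
  finally show ?thesis by (simp add: divide_inverse mult.commute)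
 qed
 show ?thesis
 proof (rule Lim_null_comparison)
  show "\<forall>\<^sub>F rh in at_right 0. norm ((1 / measure lebesgue (ball 0 rh \<inter> proj2 ` Om)) *\<^sub>R (LINT x':ball 0 rh \<inter> proj2 ` Om|lebesgue. ?D x')) <= C / a * rh powr de"
   using eventually_at_right_real[OF h] by eventually_elim (rule bound, auto)
  have "((\<lambda>rh. rh powr de) \<longlongrightarrow> 0) (at_right (0::real))"
   using d(2) by (intro tendsto_zero_powrI[of _ _ _ de] tendsto_ident_at tendsto_const) (auto simp: eventually_at_right_less eventually_mono[OF eventually_at_right_less])
  then show "((\<lambda>rh. C / a * rh powr de) \<longlongrightarrow> 0) (at_right 0)" by (rule tendsto_mult_right_zero)
 qed
qed

end

text \<open>The set where the function does not vanish is open and nonempty, hence not negligible,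
  and a nonnegative function with integral 0 would vanish almost everywhere.\<close>

lemma test_fun_integral_pos:
 fixes \<phi> :: "real => real"
 assumes \<phi>: "test_fun S \<phi>" "!!t. \<phi> t >= 0" "\<phi> a ~= 0" shows "(LINT t|lborel. \<phi> t) ~= 0"
proof
 assume z: "(LINT t|lborel. \<phi> t) = 0"
 have c: "continuous_on UNIV \<phi>" by (rule smooth_continuous[OF test_funD(1)[OF \<phi>(1)]])
 obtain R where R: "!!t. t \<in> closure {t. \<phi> t ~= 0} ==> norm t <= R"
  using compact_imp_bounded[OF test_funD(2)[OF \<phi>(1)]] unfolding bounded_iff by blast
 have "\<phi> t = 0" if "norm t > R" for t
 proof (rule ccontr)
  assume "\<phi> t ~= 0"
  then have "t \<in> closure {t. \<phi> t ~= 0}" using closure_subset[of "{t. \<phi> t ~= 0}"] by blast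
  then show False using R that by fastforce
 qed
 then have "integrable lborel \<phi>" by (rule integrable_continuous_bounded_support[OF c])
 then have "AE t in lborel. \<phi> t = 0" using z \<phi>(2) by (simp add: integral_nonneg_eq_0_iff_AE)
 then have ae: "AE t in lebesgue. t \<notin> {t. \<phi> t ~= 0}" by (simp add: AE_completion)
 have o: "open {t. \<phi> t ~= 0}" using c by (intro open_Collect_neq continuous_on_const) auto
 then have "{t. \<phi> t ~= 0} \<in> sets lebesgue" by simp
 from AE_iff_null_sets[OF this] ae have "negligible {t. \<phi> t ~= 0}" unfolding negligible_iff_null_sets by blast
 then show False using open_not_negligible[OF o] \<phi>(3) by blast
qed

theorem corollary3p2:
  fixes lam \<mu> \<omega> h M \<theta>m \<theta>M \<alpha> \<gamma> \<beta>1 \<beta>2 :: real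
    and \<Omega> \<Gamma> :: "(real^3) set"
    and V :: "real^3 \<Rightarrow> real"
    and v w :: "real^3 \<Rightarrow> complex^3"
    and gp gs :: "nat \<Rightarrow> real^3 \<Rightarrow> complex^3"
  assumes lame_constants: "\<mu> > 0" "3 * lam + 2 * \<mu> > 0" "lam \<noteq> 0"
    and domain: "bounded_lipschitz_domain \<Omega>" "connected (- closure \<Omega>)" "0 \<in> frontier \<Omega>"
    and edge: "h > 0" "M > 0"
      "cyl (ball 0 h) {-M<..<M} \<inter> \<Omega> = cyl (sector \<theta>m \<theta>M h) {-M<..<M}"
    and angles: "- pi < \<theta>m" "\<theta>m < \<theta>M" "\<theta>M < pi" "\<theta>M - \<theta>m \<noteq> pi"
    and potential: "Linfty_on \<Omega> V" "\<not> (AE x in lebesgue. x \<in> \<Omega> \<longrightarrow> V x = 0)"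
    and frequency: "\<omega> > 0"
    and sobolev: "H1_on \<Omega> v" "H1_on \<Omega> w"
    and eq_v: "has_lame lam \<mu> \<Omega> v (\<lambda>x. - (\<omega>^2 *\<^sub>R v x))"
    and eq_w: "has_lame lam \<mu> \<Omega> w (\<lambda>x. - ((\<omega>^2 * (1 + V x)) *\<^sub>R w x))"
    and Gamma: "openin (top_of_set (frontier \<Omega>)) \<Gamma>"
      "cyl (ray \<theta>m \<inter> ball 0 h) {-M<..<M} \<subseteq> \<Gamma>"
      "cyl (ray \<theta>M \<inter> ball 0 h) {-M<..<M} \<subseteq> \<Gamma>"
    and cauchy_data: "trace_eq_on \<Omega> \<Gamma> w v" "traction_eq_on lam \<mu> \<Omega> \<Gamma> v w"
    and regularity: "0 < \<alpha>" "\<alpha> < 1"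
      "C0_holder \<alpha> (cyl (closure (sector \<theta>m \<theta>M h)) {-M..M}) (\<lambda>x. (1 + V x) *\<^sub>R w x)"
      "C1_holder \<alpha> (cyl (closure (sector \<theta>m \<theta>M h)) {-M..M}) (\<lambda>x. v x - w x)"
    and exponents: "\<gamma> > max \<beta>1 \<beta>2" "max \<beta>1 \<beta>2 > 0"
    and kernels: "\<And>j. j \<ge> 1 \<Longrightarrow> L2_on surface_measure (sphere 0 1) (gp j)"
      "\<And>j. j \<ge> 1 \<Longrightarrow> L2_on surface_measure (sphere 0 1) (gs j)"
    and approximation:
      "\<And>j. j \<ge> 1 \<Longrightarrow>
        H1_norm (cyl (sector \<theta>m \<theta>M h) {-M<..<M})
          (\<lambda>x. v x - herglotz lam \<mu> \<omega> (gp j) (gs j) x) \<le> real j powr (- \<gamma>)"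
      "\<And>j. j \<ge> 1 \<Longrightarrow> L2_norm surface_measure (sphere 0 1) (gp j) \<le> real j powr \<beta>1"
      "\<And>j. j \<ge> 1 \<Longrightarrow> L2_norm surface_measure (sphere 0 1) (gs j) \<le> real j powr \<beta>2"
  shows "\<forall>c L \<phi>. c \<in> {-M<..<M} \<and> L > 0 \<and> {c - L<..<c + L} \<subseteq> {-M<..<M} \<and>
      test_fun {c - L<..<c + L} \<phi> \<and> (\<forall>t. \<phi> t \<ge> 0) \<and> (\<exists>t. \<phi> t \<noteq> 0) \<longrightarrow>
    ((\<lambda>\<rho>. (1 / measure lebesgue (ball 0 \<rho> \<inter> proj2 ` \<Omega>)) *\<^sub>R
        (LINT x':ball 0 \<rho> \<inter> proj2 ` \<Omega>|lebesgue.
          dim_reduction c L \<phi> (zero_ext \<Omega> (\<lambda>x. V x *\<^sub>R w x)) x')) \<longlongrightarrow> 0) (at_right 0)"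
proof -
 \<comment> \<open>Bisector angle and half the opening; an opening different from pi means that cos
   be is nonzero.\<close>
 define th be where "th = (\<theta>m + \<theta>M) / 2" and "be = (\<theta>M - \<theta>m) / 2"
 have be: "0 < be" "be < pi" using angles by (auto simp: be_def)
 have "cos be ~= 0"
 proof
  assume "cos be = 0"
  then have "be = pi / 2" using be cos_inj_pi[of be "pi / 2"] by simp
  then show False using angles(4) by (simp add: be_def)
 qed
 then interpret E: edge th be h M using be edge(1,2) by unfold_locales auto
 have sect: "sector \<theta>m \<theta>M h = E.Sect h"
  unfolding sector_def wedge_eq_ell[OF angles(1-3), folded th_def be_def] E.Sect_def by auto
 have Sol: "cyl (sector \<theta>m \<theta>M h) {-M<..<M} = E.Sol h" and Kcl: "cyl (closure (sector \<theta>m \<theta>M h)) {-M..M} = E.Kcl"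
  by (simp_all add: sect E.Sol_def E.Kcl_def)
 \<comment> \<open>Representatives on the closed solid sector; from here on they stand for v - w and
   its classical gradient.\<close>
 obtain F G where FG: "continuous_on E.Kcl F" "holder_on \<alpha> E.Kcl G"
  "!!x. x \<in> interior E.Kcl ==> (F has_derivative (\<lambda>y. G x *v complexify y)) (at x)"
  "AE x in lebesgue. x \<in> interior E.Kcl \<longrightarrow> F x = v x - w x" using regularity(4) unfolding C1_holder_def Kcl by blast
 obtain P where P: "holder_on \<alpha> E.Kcl P" "AE x in lebesgue. x \<in> interior E.Kcl \<longrightarrow> P x = (1 + V x) *\<^sub>R w x"
  using regularity(3) unfolding C0_holder_def Kcl by blast
 interpret lame_pair th be h M \<Omega> \<Gamma> v w F G \<alpha> lam \<mu> \<omega> V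
 proof
  show "E.Cyl h \<inter> \<Omega> = E.Sol h" using edge(3) unfolding Sol E.Cyl_def .
  show "x \<in> \<Gamma>" if "x \<in> E.Cyl h" "ell th be (proj2 x) = 0" "proj2 x ~= 0" for x
   using ell_0_imp_ray[OF angles(1-3) that(3) that(2)[unfolded th_def be_def]] that(1) Gamma(2,3) by (auto simp: E.Cyl_def cyl_def)
  show "\<Gamma> \<subseteq> frontier \<Omega>" using openin_imp_subset[OF Gamma(1)] .
  show "(F has_derivative (\<lambda>y. G x *v complexify y)) (at x)" if "x \<in> E.Sol h" for x using FG(3) that E.Sol_subset_interior by blast
  show "AE x in lebesgue. x \<in> E.Sol h \<longrightarrow> F x = v x - w x" using FG(4) by eventually_elim (use E.Sol_subset_interior in auto)
 qed (fact domain(1) sobolev cauchy_data regularity(1) FG(1,2) potential(1) eq_v eq_w)+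
 \<comment> \<open>One exponent bounds both kernels, since j >= 1; the strict inequality between it
   and \<open>\<gamma>\<close> makes the decay exponent (\<gamma> - b) / (\<gamma> + b)
   positive.\<close>
 define b where "b = max \<beta>1 \<beta>2"
 define K where "K = (\<bar>\<omega> / sqrt (lam + 2 * \<mu>)\<bar> + \<bar>\<omega> / sqrt \<mu>\<bar>) * sqrt (measure surface_measure (sphere (0::real^3) 1))"
 let ?v = "\<lambda>j. herglotz lam \<mu> \<omega> (gp j) (gs j)"
 have lip: "norm (?v j x - ?v j y) <= K * real j powr b * norm (x - y)" if j: "j >= 1" for j x y
 proof -
  have "real j powr \<beta>1 <= real j powr b" "real j powr \<beta>2 <= real j powr b" using j by (auto simp: b_def intro: powr_mono)
  then show ?thesis unfolding K_def using approximation(2,3)[OF j] by (intro herglotz_lipschitz kernels j) auto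
 qed
 have E: "L2_norm lebesgue (E.Sol h) (\<lambda>x. v x - ?v j x) <= real j powr (- \<gamma>)" if "j >= 1" for j
  using order_trans[OF L2_norm_le_H1_norm(1) approximation(1)[OF that]] unfolding Sol .
 have v2: "L2_on lebesgue (E.Sol h) v" using L2_on_subset(1)[OF H1_D(1)[OF sobolev(1)] Sol_subset_Om] E.open_Sol sets_Om by simp
 have b: "0 < b" "b < \<gamma>" "(\<gamma> - b) / (\<gamma> + b) > 0" using exponents by (auto simp: b_def)
 have K: "K >= 0" by (simp add: K_def)
 show ?thesis
 proof (intro allI impI, elim conjE exE)
  fix c L \<phi> t
  assume \<phi>: "{c - L<..<c + L} \<subseteq> {-M<..<M}" "test_fun {c - L<..<c + L} \<phi>" "\<forall>t. \<phi> t >= 0" "\<phi> t ~= 0"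
  have \<phi>M: "test_fun {-M<..<M} \<phi>" by (rule test_fun_mono[OF \<phi>(2,1)])
  obtain ka where "E.osc_decay (E.Rop \<phi> v) ka ((\<gamma> - b) / (\<gamma> + b))" using E.osc_decay_approx[OF v2 \<phi>M b(1,2) K lip E] by blast
  then obtain de where "de > 0" "E.osc_decay (E.Rop \<phi> (\<lambda>x. V x *\<^sub>R w x)) 0 de"
   using potential_osc_decay[OF \<phi>M test_fun_integral_pos[OF \<phi>M] _ P _ b(3)] \<phi>(3,4) frequency by blast
  then show "((\<lambda>rh. (1 / measure lebesgue (ball 0 rh \<inter> proj2 ` \<Omega>)) *\<^sub>R
    (LINT x':ball 0 rh \<inter> proj2 ` \<Omega>|lebesgue.
     dim_reduction c L \<phi> (zero_ext \<Omega> (\<lambda>x. V x *\<^sub>R w x)) x')) \<longlongrightarrow> 0) (at_right 0)"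
   by (intro dim_reduction_average_tendsto_0[OF \<phi>(2,1)])
 qed
qed

end
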